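(* Let $M$ be a non-compact Hermitian manifold of complex dimension $m$, and let $(x_0,u)$ be a $\lambda$-leaf function element subordinate to an irreducible algebraic equation $$A_\nu(x)w^\nu+A_{\nu-1}(x)w^{\nu-1}+\cdots+A_0(x)=0,\qquad A_\nu\not\equiv0,$$ defining a $\nu$-valued algebroid function on $M$. If $x_0$ is not a singular branch point of $u$, then $u$ can be expanded locally into a convergent Puiseux series $$u(z)=B_0(\hat z_m)+B_\tau(\hat z_m)z_m^{\frac\tau\lambda}+B_{\tau+1}(\hat z_m)z_m^{\frac{\tau+1}\lambda}+\cdots$$ at $x_0$, for some integer $\tau$, in a local holomorphic coordinate $z=(\hat z_m,z_m)$, $\hat z_m=(z_1,\dots,z_{m-1})$, such that $z(x_0)=\mathbf 0$ and $z(x)=(\hat z_m(x),0)$ for all $x\in\mathscr B_u$, where $\mathscr B_u$ is the branch set of $u$ and $B_0,B_\tau,B_{\tau+1},\dots$ are meromorphic functions.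
   Context: The coefficients $A_0,\dots,A_\nu$ are holomorphic functions locally defined on $M$ (for an open covering $\{U_i\}$, $A_k=\{A_{ki}\}$ with $A_{ki}$ holomorphic on $U_i$ and $A_{0i}/A_{0j}=\cdots=A_{\nu i}/A_{\nu j}$ on $U_i\cap U_j$) such that $[A_0:\cdots:A_\nu]:M\to\mathbb P^\nu(\mathbb C)$ is a well-defined meromorphic mapping. A pair $(x_0,u)$ is subordinate to the equation if $u$ is a local (possibly multi-valued) solution near $x_0$. The $\nu$ local branches of the solution near $x_0$ are grouped into orbits under analytic continuation along closed curves close to $x_0$; an orbit with $\lambda$ members defines a $\lambda$-valued function $u$ on a small neighborhood $U(x_0)$, and $(x_0,u)$ is then called a $\lambda$-leaf function element; $x_0$ is a branch point of $u$ (of order $\lambda-1$) if $\lambda>1$. $\mathscr B_u$ is the set of branch points of $u$ in $U(x_0)$. A branch point $x_0$ of $u$ is non-singular if it does not lie in any crossing of components of $\mathscr B_u$ (in which case $\mathscr B_u$ is smooth for $U(x_0)$ small), and singular otherwise.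
   Formalization: "Not a singular branch point" is read as: the branch set is smooth at x_0 if x_0 lies in it (a cusp is not a crossing, yet fails). "Convergent" means near the points of z_m=0 where all B_j are holomorphic, off z_m=0; sqrt(z_2)/(z_1-z_2) has no full neighbourhood of convergence. *)

theory Defs
  imports "HOL-Analysis.Analysis" "HOL-Computational_Algebra.Polynomial"
begin

text \<open>Only meant for open \<open>S\<close>: the Frechet derivative exists and is complex linear.\<close>

definition holomorphic_Cn :: "(complex ^ 'm::finite \<Rightarrow> complex) \<Rightarrow> (complex ^ 'm) set \<Rightarrow> bool" where
  "holomorphic_Cn f S \<longleftrightarrow>
     (\<forall>z\<in>S. \<exists>L. (f has_derivative L) (at z) \<and> (\<forall>c v. L (c *s v) = c * L v))"

definition polydisc :: "real \<Rightarrow> (complex ^ 'm::finite) set" where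
  "polydisc r = {z. \<forall>i. norm (z $ i) < r}"

primrec Ck_on :: "nat \<Rightarrow> ('v::real_normed_vector \<Rightarrow> 'w::real_normed_vector) \<Rightarrow> 'v set \<Rightarrow> bool" where
  "Ck_on 0 f S \<longleftrightarrow> continuous_on S f"
| "Ck_on (Suc k) f S \<longleftrightarrow>
     (\<exists>f'. (\<forall>x\<in>S. (f has_derivative f' x) (at x)) \<and> (\<forall>v. Ck_on k (\<lambda>x. f' x v) S))"

text \<open>The manifold is the whole type \<open>'a\<close>; a chart is a pair of its domain and its coordinate map
  (whose values outside the domain are irrelevant). The complex dimension is \<open>CARD('m)\<close>.\<close>

type_synonym ('a, 'm) chart = "'a set \<times> ('a \<Rightarrow> complex ^ 'm)"

definition chart_inv :: "('a, 'm) chart \<Rightarrow> complex ^ 'm \<Rightarrow> 'a" where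
  "chart_inv c = inv_into (fst c) (snd c)"

definition topological_chart :: "('a::topological_space, 'm::finite) chart \<Rightarrow> bool" where
  "topological_chart c \<longleftrightarrow> open (fst c) \<and> open (snd c ` fst c) \<and>
     homeomorphism (fst c) (snd c ` fst c) (snd c) (chart_inv c)"

definition holomorphic_transition :: "('a, 'm::finite) chart \<Rightarrow> ('a, 'm) chart \<Rightarrow> bool" where
  "holomorphic_transition c d \<longleftrightarrow>
     (\<forall>i. holomorphic_Cn (\<lambda>z. snd d (chart_inv c z) $ i) (snd c ` (fst c \<inter> fst d)))"

definition complex_manifold :: "('a::{t2_space,second_countable_topology}, 'm::finite) chart set \<Rightarrow> bool" where
  "complex_manifold \<A> \<longleftrightarrow> connected (UNIV :: 'a set) \<and> (\<Union>c\<in>\<A>. fst c) = UNIV \<and>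
     (\<forall>c\<in>\<A>. topological_chart c) \<and> (\<forall>c\<in>\<A>. \<forall>d\<in>\<A>. holomorphic_transition c d)"

text \<open>The local holomorphic coordinates are the members of the maximal atlas containing \<open>\<A>\<close>.\<close>

definition holomorphic_coordinate :: "('a::topological_space, 'm::finite) chart set \<Rightarrow> ('a, 'm) chart \<Rightarrow> bool" where
  "holomorphic_coordinate \<A> c \<longleftrightarrow> topological_chart c \<and>
     (\<forall>d\<in>\<A>. holomorphic_transition c d \<and> holomorphic_transition d c)"

text \<open>A Hermitian metric is given chart by chart: \<open>h c x v w\<close> is the product of the tangent vectors
  at \<open>x\<close> with components \<open>v\<close> and \<open>w\<close> with respect to the chart \<open>c\<close>.\<close>

definition hermitian_metric ::
  "('a::topological_space, 'm::finite) chart set \<Rightarrow>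
   (('a, 'm) chart \<Rightarrow> 'a \<Rightarrow> complex ^ 'm \<Rightarrow> complex ^ 'm \<Rightarrow> complex) \<Rightarrow> bool" where
  "hermitian_metric \<A> h \<longleftrightarrow>
     (\<forall>c\<in>\<A>. \<forall>x\<in>fst c.
        (\<forall>v v' w. h c x (v + v') w = h c x v w + h c x v' w) \<and>
        (\<forall>a v w. h c x (a *s v) w = a * h c x v w) \<and>
        (\<forall>v w. h c x w v = cnj (h c x v w)) \<and>
        (\<forall>v. v \<noteq> 0 \<longrightarrow> 0 < Re (h c x v v))) \<and>
     (\<forall>c\<in>\<A>. \<forall>v w k. Ck_on k (\<lambda>z. h c (chart_inv c z) v w) (snd c ` fst c)) \<and>
     (\<forall>c\<in>\<A>. \<forall>d\<in>\<A>. \<forall>x\<in>fst c \<inter> fst d. \<forall>v w.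
        (let J = frechet_derivative (\<lambda>z. snd d (chart_inv c z)) (at (snd c x))
         in h d x (J v) (J w) = h c x v w))"

definition hermitian_manifold ::
  "('a::{t2_space,second_countable_topology}, 'm::finite) chart set \<Rightarrow>
   (('a, 'm) chart \<Rightarrow> 'a \<Rightarrow> complex ^ 'm \<Rightarrow> complex ^ 'm \<Rightarrow> complex) \<Rightarrow> bool" where
  "hermitian_manifold \<A> h \<longleftrightarrow> complex_manifold \<A> \<and> hermitian_metric \<A> h"

definition holomorphic_mfd ::
  "('a::topological_space, 'm::finite) chart set \<Rightarrow> ('a \<Rightarrow> complex) \<Rightarrow> 'a set \<Rightarrow> bool" where
  "holomorphic_mfd \<A> f S \<longleftrightarrow>
     (\<forall>c\<in>\<A>. holomorphic_Cn (\<lambda>z. f (chart_inv c z)) (snd c ` (fst c \<inter> S)))"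

text \<open>Meromorphic functions on an open set \<open>S\<close>: locally quotients \<open>g/h\<close> with \<open>h\<close> not identically
  zero. They are represented by total functions. The last clause normalises the representative by
  removing removable singularities; where no holomorphic extension exists the value is arbitrary.\<close>

definition meromorphic_mfd ::
  "('a::topological_space, 'm::finite) chart set \<Rightarrow> ('a \<Rightarrow> complex) \<Rightarrow> 'a set \<Rightarrow> bool" where
  "meromorphic_mfd \<A> f S \<longleftrightarrow>
     (\<forall>p\<in>S. \<exists>T g h. open T \<and> connected T \<and> p \<in> T \<and> T \<subseteq> S \<and>
        holomorphic_mfd \<A> g T \<and> holomorphic_mfd \<A> h T \<and> (\<exists>x\<in>T. h x \<noteq> 0) \<and>
        (\<forall>x\<in>T. h x \<noteq> 0 \<longrightarrow> f x = g x / h x)) \<and>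
     (\<forall>p\<in>S. \<forall>T g. open T \<and> p \<in> T \<and> T \<subseteq> S \<and> holomorphic_mfd \<A> g T \<and>
        T \<subseteq> closure {x\<in>T. f x = g x} \<longrightarrow> f p = g p)"

abbreviation meromorphic_Cn :: "(complex ^ 'm::finite \<Rightarrow> complex) \<Rightarrow> (complex ^ 'm) set \<Rightarrow> bool" where
  "meromorphic_Cn \<equiv> meromorphic_mfd {(UNIV, \<lambda>z. z)}"

text \<open>Smoothness of a set at \<open>p\<close>: near \<open>p\<close> it is a complex submanifold (of any dimension).\<close>

definition smooth_at :: "('a::topological_space, 'm::finite) chart set \<Rightarrow> 'a set \<Rightarrow> 'a \<Rightarrow> bool" where
  "smooth_at \<A> S p \<longleftrightarrow>
     (\<exists>c L. holomorphic_coordinate \<A> c \<and> p \<in> fst c \<and> snd c p = 0 \<and> vec.subspace L \<and>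
        snd c ` (S \<inter> fst c) = L \<inter> snd c ` fst c)"

text \<open>\<open>A k i\<close> is the local coefficient of \<open>w ^ k\<close> on the member \<open>U i\<close> of the covering. The equality
  of the ratios \<open>A k i / A k j\<close> is stated by cross multiplication, since individual coefficients may
  vanish identically. That the local coefficients do not vanish simultaneously on a nonempty open
  set means that they are homogeneous coordinates of a meromorphic mapping into projective space.\<close>

definition coefficient_system ::
  "('a::topological_space, 'm::finite) chart set \<Rightarrow> ('i \<Rightarrow> 'a set) \<Rightarrow>
   (nat \<Rightarrow> 'i \<Rightarrow> 'a \<Rightarrow> complex) \<Rightarrow> nat \<Rightarrow> bool" where
  "coefficient_system \<A> U A \<nu> \<longleftrightarrow>
     (\<forall>i. open (U i)) \<and> (\<Union>i. U i) = UNIV \<and>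
     (\<forall>k\<le>\<nu>. \<forall>i. holomorphic_mfd \<A> (A k i) (U i)) \<and>
     (\<forall>i j. \<forall>x\<in>U i \<inter> U j. \<forall>k\<le>\<nu>. \<forall>l\<le>\<nu>. A k i x * A l j x = A k j x * A l i x) \<and>
     (\<forall>i. U i \<subseteq> closure {x\<in>U i. \<exists>k\<le>\<nu>. A k i x \<noteq> 0})"

definition local_poly :: "(nat \<Rightarrow> 'i \<Rightarrow> 'a \<Rightarrow> complex) \<Rightarrow> nat \<Rightarrow> 'i \<Rightarrow> 'a \<Rightarrow> complex poly" where
  "local_poly A \<nu> i x = (\<Sum>k\<le>\<nu>. monom (A k i x) k)"

text \<open>Irreducibility over the field of meromorphic functions on the (connected) manifold: the monic
  polynomial with coefficients \<open>A k / A \<nu>\<close>, which are globally defined, is not a product of two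
  polynomials of positive degree with meromorphic coefficients. Such polynomials are given by
  their specialisations \<open>Q x\<close>, \<open>R x\<close>; meromorphic functions are equal iff they agree on a dense set.\<close>

definition irreducible_equation ::
  "('a::topological_space, 'm::finite) chart set \<Rightarrow> ('i \<Rightarrow> 'a set) \<Rightarrow>
   (nat \<Rightarrow> 'i \<Rightarrow> 'a \<Rightarrow> complex) \<Rightarrow> nat \<Rightarrow> bool" where
  "irreducible_equation \<A> U A \<nu> \<longleftrightarrow> 0 < \<nu> \<and>
     \<not> (\<exists>Q R :: 'a \<Rightarrow> complex poly.
          (\<forall>k. meromorphic_mfd \<A> (\<lambda>x. coeff (Q x) k) UNIV) \<and>
          (\<forall>k. meromorphic_mfd \<A> (\<lambda>x. coeff (R x) k) UNIV) \<and>
          closure {x. 0 < degree (Q x) \<and> 0 < degree (R x) \<and>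
            (\<forall>i. x \<in> U i \<longrightarrow> local_poly A \<nu> i x = smult (A \<nu> i x) (Q x * R x))} = UNIV)"

definition solutions ::
  "('i \<Rightarrow> 'a set) \<Rightarrow> (nat \<Rightarrow> 'i \<Rightarrow> 'a \<Rightarrow> complex) \<Rightarrow> nat \<Rightarrow> 'a \<Rightarrow> complex set" where
  "solutions U A \<nu> x = {w. \<forall>i. x \<in> U i \<longrightarrow> poly (local_poly A \<nu> i x) w = 0}"

text \<open>The points with \<open>\<nu>\<close> distinct finite solutions. Near such a point there are exactly \<open>\<nu>\<close>
  local branches, they are holomorphic and determined by their values at the point.\<close>

definition regular_points :: "('i \<Rightarrow> 'a set) \<Rightarrow> (nat \<Rightarrow> 'i \<Rightarrow> 'a \<Rightarrow> complex) \<Rightarrow> nat \<Rightarrow> 'a set" where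
  "regular_points U A \<nu> = {x. card (solutions U A \<nu> x) = \<nu>}"

text \<open>\<open>F t\<close> is a function element at \<open>\<gamma> t\<close>.\<close>

definition analytic_continuation ::
  "('a::topological_space, 'm::finite) chart set \<Rightarrow> (real \<Rightarrow> 'a) \<Rightarrow> (real \<Rightarrow> 'a \<Rightarrow> complex) \<Rightarrow> bool" where
  "analytic_continuation \<A> \<gamma> F \<longleftrightarrow> path \<gamma> \<and>
     (\<forall>t\<in>{0..1}. \<exists>N. open N \<and> \<gamma> t \<in> N \<and> holomorphic_mfd \<A> (F t) N \<and>
        (\<forall>\<^sub>F s in at t within {0..1}. \<gamma> s \<in> N \<and> (\<forall>\<^sub>F y in nhds (\<gamma> s). F s y = F t y)))"

text \<open>The local branch with value \<open>w\<close> at the regular point \<open>x\<close> is continued, along a curve of regular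
  points in \<open>V\<close>, to the local branch with value \<open>w'\<close> at \<open>y\<close>.\<close>

definition continues_to ::
  "('a::topological_space, 'm::finite) chart set \<Rightarrow> ('i \<Rightarrow> 'a set) \<Rightarrow>
   (nat \<Rightarrow> 'i \<Rightarrow> 'a \<Rightarrow> complex) \<Rightarrow> nat \<Rightarrow> 'a set \<Rightarrow> 'a \<Rightarrow> complex \<Rightarrow> 'a \<Rightarrow> complex \<Rightarrow> bool" where
  "continues_to \<A> U A \<nu> V x w y w' \<longleftrightarrow>
     (\<exists>\<gamma> F. analytic_continuation \<A> \<gamma> F \<and>
        path_image \<gamma> \<subseteq> V \<inter> regular_points U A \<nu> \<and> pathstart \<gamma> = x \<and> pathfinish \<gamma> = y \<and>
        (\<forall>t\<in>{0..1}. \<forall>\<^sub>F p in nhds (\<gamma> t). F t p \<in> solutions U A \<nu> p) \<and>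
        F 0 x = w \<and> F 1 y = w')"

definition orbit ::
  "('a::topological_space, 'm::finite) chart set \<Rightarrow> ('i \<Rightarrow> 'a set) \<Rightarrow>
   (nat \<Rightarrow> 'i \<Rightarrow> 'a \<Rightarrow> complex) \<Rightarrow> nat \<Rightarrow> 'a set \<Rightarrow> 'a \<Rightarrow> complex \<Rightarrow> complex set" where
  "orbit \<A> U A \<nu> V x w = {w'. continues_to \<A> U A \<nu> V x w x w'}"

text \<open>A multi-valued function on the neighbourhood \<open>Ux\<close> of \<open>x0\<close> is given by its value sets \<open>u x\<close>.
  At regular points these are \<open>\<lambda>\<close> of the \<open>\<nu>\<close> solutions; at the other points of \<open>Ux\<close> they are the
  finite limits of the values at regular points (so the value infinity at poles is omitted).
  The branches of \<open>u\<close> are continued to branches of \<open>u\<close>, and they form a single orbit in arbitrarily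
  small neighbourhoods of \<open>x0\<close>.\<close>

definition leaf_function_element ::
  "('a::topological_space, 'm::finite) chart set \<Rightarrow> ('i \<Rightarrow> 'a set) \<Rightarrow>
   (nat \<Rightarrow> 'i \<Rightarrow> 'a \<Rightarrow> complex) \<Rightarrow> nat \<Rightarrow> nat \<Rightarrow> 'a set \<Rightarrow> 'a \<Rightarrow> ('a \<Rightarrow> complex set) \<Rightarrow> bool" where
  "leaf_function_element \<A> U A \<nu> l Ux x0 u \<longleftrightarrow>
     0 < l \<and> open Ux \<and> x0 \<in> Ux \<and>
     (\<forall>x\<in>Ux \<inter> regular_points U A \<nu>. u x \<subseteq> solutions U A \<nu> x \<and> card (u x) = l) \<and>
     (\<forall>x\<in>Ux. u x = {w. (x, w) \<in> closure {(y, v). y \<in> Ux \<inter> regular_points U A \<nu> \<and> v \<in> u y}}) \<and>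
     (\<forall>x y w w'. continues_to \<A> U A \<nu> Ux x w y w' \<and> w \<in> u x \<longrightarrow> w' \<in> u y) \<and>
     (\<forall>V. open V \<and> x0 \<in> V \<longrightarrow>
        (\<exists>V'. open V' \<and> x0 \<in> V' \<and> V' \<subseteq> V \<inter> Ux \<and>
           (\<forall>x\<in>V' \<inter> regular_points U A \<nu>. \<forall>w\<in>u x. orbit \<A> U A \<nu> V' x w = u x)))"

text \<open>The points of \<open>Ux\<close> at which, along closed curves arbitrarily close to the point, some local
  branch of \<open>u\<close> has an orbit with more than one member.\<close>

definition branch_set ::
  "('a::topological_space, 'm::finite) chart set \<Rightarrow> ('i \<Rightarrow> 'a set) \<Rightarrow>
   (nat \<Rightarrow> 'i \<Rightarrow> 'a \<Rightarrow> complex) \<Rightarrow> nat \<Rightarrow> 'a set \<Rightarrow> ('a \<Rightarrow> complex set) \<Rightarrow> 'a set" where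
  "branch_set \<A> U A \<nu> Ux u =
     {y\<in>Ux. \<forall>V. open V \<and> y \<in> V \<and> V \<subseteq> Ux \<longrightarrow>
        (\<exists>x\<in>V \<inter> regular_points U A \<nu>. \<exists>w\<in>u x. orbit \<A> U A \<nu> V x w \<noteq> {w})}"

text \<open>Non-singularity of a branch point is smoothness of the branch set at that point. It excludes
  crossings of components, and also singular points of a single component, such as the cusp of the
  branch set of \<open>w\<^sup>2 = z\<^sub>1\<^sup>2 - z\<^sub>2\<^sup>3\<close> at the origin.\<close>

definition singular_branch_point ::
  "('a::topological_space, 'm::finite) chart set \<Rightarrow> ('i \<Rightarrow> 'a set) \<Rightarrow>
   (nat \<Rightarrow> 'i \<Rightarrow> 'a \<Rightarrow> complex) \<Rightarrow> nat \<Rightarrow> 'a set \<Rightarrow> ('a \<Rightarrow> complex set) \<Rightarrow> 'a \<Rightarrow> bool" where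
  "singular_branch_point \<A> U A \<nu> Ux u y \<longleftrightarrow>
     y \<in> branch_set \<A> U A \<nu> Ux u \<and> \<not> smooth_at \<A> (branch_set \<A> U A \<nu> Ux u) y"

text \<open>\<open>drop_coord m z\<close> is the vector of the coordinates other than \<open>z $ m\<close>, embedded as the point of
  the hyperplane \<open>z $ m = 0\<close>. A function on the space of these coordinates is thus a function
  on \<open>complex ^ 'm\<close> composed with \<open>drop_coord m\<close>; this covers dimension one, where it is a constant.\<close>

definition drop_coord :: "'m::finite \<Rightarrow> complex ^ 'm \<Rightarrow> complex ^ 'm" where
  "drop_coord m z = (\<chi> i. if i = m then 0 else z $ i)"

text \<open>The exponents (times \<open>\<lambda>\<close>) in \<open>B\<^sub>0 + B\<^sub>\<tau> \<zeta> ^ \<tau> + B\<^sub>\<tau>\<^sub>+\<^sub>1 \<zeta> ^ (\<tau> + 1) + \<dots>\<close>; if \<open>\<tau> \<le> 0\<close>,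
  the term \<open>B\<^sub>0\<close> occurs once.\<close>

definition puiseux_indices :: "int \<Rightarrow> int set" where
  "puiseux_indices \<tau> = insert 0 {\<tau>..}"

definition puiseux_term ::
  "'m::finite \<Rightarrow> (int \<Rightarrow> complex ^ 'm \<Rightarrow> complex) \<Rightarrow> complex ^ 'm \<Rightarrow> complex \<Rightarrow> int \<Rightarrow> complex" where
  "puiseux_term m B z \<zeta> j = B j (drop_coord m z) * \<zeta> powi j"

text \<open>The points of \<open>S\<close> near which all coefficients are holomorphic.\<close>

definition coefficient_domain ::
  "'m::finite \<Rightarrow> (int \<Rightarrow> complex ^ 'm \<Rightarrow> complex) \<Rightarrow> int set \<Rightarrow> (complex ^ 'm) set \<Rightarrow> (complex ^ 'm) set" where
  "coefficient_domain m B J S =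
     {z\<in>S. \<exists>T. open T \<and> z \<in> T \<and> (\<forall>j\<in>J. holomorphic_Cn (\<lambda>v. B j (drop_coord m v)) T)}"

text \<open>The \<open>\<lambda>\<close>-valued function \<open>u\<close> is the sum of the Puiseux series with coefficients \<open>B\<close> in the
  coordinate \<open>z\<close>: its values at \<open>x\<close> are the sums for the \<open>\<lambda>\<close> choices \<open>\<zeta>\<close> of the root of \<open>z\<^sub>m\<close>.
  The coefficients may have poles through the origin, and since the poles of \<open>u\<close> may meet the
  hyperplane \<open>z\<^sub>m = 0\<close> at the origin (e.g. \<open>u = sqrt z\<^sub>2 / (z\<^sub>1 - z\<^sub>2)\<close>), there is no uniform radius of convergence
  in \<open>z\<^sub>m\<close>. The series converges to \<open>u\<close> on an open set \<open>W\<close> (off \<open>z\<^sub>m = 0\<close>) containing every point of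
  the hyperplane near which all coefficients are holomorphic, and the remaining points of the
  hyperplane form a thin set. If all coefficients are holomorphic near the origin,
  \<open>W\<close> contains the origin, so the series converges in a full neighbourhood of it.\<close>

definition has_puiseux_expansion ::
  "'m::finite \<Rightarrow> nat \<Rightarrow> ('a, 'm) chart \<Rightarrow> real \<Rightarrow> int \<Rightarrow> (int \<Rightarrow> complex ^ 'm \<Rightarrow> complex) \<Rightarrow>
   ('a \<Rightarrow> complex set) \<Rightarrow> bool" where
  "has_puiseux_expansion m l c r \<tau> B u \<longleftrightarrow>
     (let J = puiseux_indices \<tau>; G = coefficient_domain m B J (polydisc r) in
      (\<forall>j\<in>J. meromorphic_Cn (\<lambda>v. B j (drop_coord m v)) (polydisc r)) \<and>
      (\<exists>D. holomorphic_Cn D (polydisc r) \<and> (\<exists>v\<in>polydisc r. D v \<noteq> 0) \<and>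
         {v\<in>polydisc r. D v \<noteq> 0} \<subseteq> G) \<and>
      (\<exists>W. open W \<and> {v\<in>G. v $ m = 0} \<subseteq> W \<and>
         (\<forall>x\<in>fst c. snd c x \<in> W \<and> snd c x $ m \<noteq> 0 \<longrightarrow>
            (\<forall>\<zeta>. \<zeta> ^ l = snd c x $ m \<longrightarrow> puiseux_term m B (snd c x) \<zeta> summable_on J) \<and>
            u x = (\<lambda>\<zeta>. infsum (puiseux_term m B (snd c x) \<zeta>) J) ` {\<zeta>. \<zeta> ^ l = snd c x $ m})))"

end

theory Submission
  imports Defs "HOL-Complex_Analysis.Complex_Analysis" "HOL-Computational_Algebra.Fundamental_Theorem_Algebra"
begin

no_notation fps_nth (infixl \<open>$\<close> 75)

text \<open>Irreducibility makes the discriminant a nonzero meromorphic function, so near \<open>x0\<close> all points off the zero set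
  of some holomorphic \<open>D\<close> are regular. If \<open>x0\<close> is not a singular branch point, coordinates can be chosen in which the
  branch set lies in the hyperplane \<open>z\<^sub>m = 0\<close>. Off this hyperplane \<open>u\<close> splits locally into branches
  on the connected complement of the zeros of \<open>D\<close>, so its pullback under \<open>z\<^sub>m = exp s\<close>, whose domain is convex, splits
  globally. As the branches of \<open>u\<close> form a single orbit, a branch of the pullback has exact period \<open>2 \<pi> i \<lambda>\<close> in \<open>s\<close>,
  hence \<open>u\<close> becomes single-valued under \<open>z\<^sub>m = \<zeta> ^ \<lambda>\<close>. Multiplied by the leading coefficient it is
  locally bounded, and Riemann's extension theorem presents it as a quotient \<open>g / a\<close> of holomorphic functions. The
  coefficients of the Laurent series of \<open>g / a\<close> in \<open>\<zeta>\<close> are meromorphic in the other coordinates;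
  convergence near every point where they are holomorphic follows from the maximum principle on
  circles avoiding the zeros of the lowest coefficient of \<open>a\<close>.\<close>

section \<open>Holomorphic functions of several variables\<close>

text \<open>The obstacle is that poles of \<open>u\<close> and points where solutions coincide may
  pass through \<open>x0\<close> without being branch points. Over the complement of the zeros of
  \<open>D\<close> the solutions are unramified, but nothing is known about the fundamental group of
  this set. The hypothesis on the branch set says that the monodromy around zeros of
  \<open>D\<close> off the hyperplane is trivial; it is used in the form that the value sets split
  into continuous sections over balls minus these zeros. Removing the zeros of a holomorphic
  function from a convex open set leaves it connected, so over a convex domain the sections continue
  past the zeros without any homotopy argument. The leading coefficient is the right multiplier
  because its product with a root satisfies a monic equation with holomorphic coefficients. Dividing
  by it again costs finitely many negative exponents. The quotient has a power series over points
  where the lowest coefficient of \<open>a\<close> is nonzero; near the other points only the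
  coefficients of the quotient are available, and they may be holomorphic although that coefficient
  vanishes.\<close>

lemma norm_vector_smult: "norm (c *s v) = norm c * norm v" for v :: "complex ^ 'm::finite"
  by (simp add: norm_vec_def norm_mult L2_set_right_distrib)

lemma bounded_linear_smult_left: "bounded_linear (\<lambda>t::complex. t *s (v :: complex ^ 'm::finite))"
  by (rule bounded_linear_intro[where K="norm v"])
     (simp_all add: vec_eq_iff norm_vector_smult algebra_simps)

lemma continuous_on_smult [continuous_intros]:
  assumes "continuous_on S f" "continuous_on S g"
  shows "continuous_on S (\<lambda>x. f x *s (g x :: complex ^ 'm::finite))"
  unfolding vector_scalar_mult_def by (intro continuous_intros assms)

lemma holomorphic_CnI:
  assumes "\<And>z. z \<in> S \<Longrightarrow> (f has_derivative L z) (at z)"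
    and "\<And>z c v. z \<in> S \<Longrightarrow> L z (c *s v) = c * L z v"
  shows "holomorphic_Cn f S"
  using assms unfolding holomorphic_Cn_def by blast

lemma holomorphic_Cn_subset: "holomorphic_Cn f S \<Longrightarrow> T \<subseteq> S \<Longrightarrow> holomorphic_Cn f T"
  unfolding holomorphic_Cn_def by blast

lemma holomorphic_Cn_const [simp, intro]: "holomorphic_Cn (\<lambda>z. c) S"
  by (rule holomorphic_CnI[where L="\<lambda>z v. 0"]) auto

lemma holomorphic_Cn_coord: "holomorphic_Cn (\<lambda>z. z $ i) S"
  by (rule holomorphic_CnI[where L="\<lambda>z v. v $ i"])
     (auto intro: bounded_linear_imp_has_derivative bounded_linear_vec_nth)

lemma holomorphic_Cn_add:
  assumes "holomorphic_Cn f S" "holomorphic_Cn g S"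
  shows "holomorphic_Cn (\<lambda>z. f z + g z) S"
  unfolding holomorphic_Cn_def
proof
  fix z assume "z \<in> S"
  then obtain L1 L2 where "(f has_derivative L1) (at z)" "\<forall>c v. L1 (c *s v) = c * L1 v"
    "(g has_derivative L2) (at z)" "\<forall>c v. L2 (c *s v) = c * L2 v"
    using assms unfolding holomorphic_Cn_def by meson
  then show "\<exists>L. ((\<lambda>z. f z + g z) has_derivative L) (at z) \<and> (\<forall>c v. L (c *s v) = c * L v)"
    by (intro exI[of _ "\<lambda>v. L1 v + L2 v"]) (auto intro: has_derivative_add simp: algebra_simps)
qed

lemma holomorphic_Cn_mult:
  assumes "holomorphic_Cn f S" "holomorphic_Cn g S"
  shows "holomorphic_Cn (\<lambda>z. f z * g z) S"
  unfolding holomorphic_Cn_def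
proof
  fix z assume "z \<in> S"
  then obtain L1 L2 where "(f has_derivative L1) (at z)" "\<forall>c v. L1 (c *s v) = c * L1 v"
    "(g has_derivative L2) (at z)" "\<forall>c v. L2 (c *s v) = c * L2 v"
    using assms unfolding holomorphic_Cn_def by meson
  then show "\<exists>L. ((\<lambda>z. f z * g z) has_derivative L) (at z) \<and> (\<forall>c v. L (c *s v) = c * L v)"
    by (intro exI[of _ "\<lambda>v. f z * L2 v + L1 v * g z"] conjI has_derivative_mult)
       (simp_all add: algebra_simps)
qed

lemma holomorphic_Cn_continuous_on: "holomorphic_Cn f S \<Longrightarrow> continuous_on S f"
  unfolding holomorphic_Cn_def
  by (meson continuous_at_imp_continuous_on has_derivative_continuous)

lemma holomorphic_Cn_compose_field:
  assumes g: "holomorphic_Cn g S" and f: "f holomorphic_on A" "open A" and sub: "g ` S \<subseteq> A"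
  shows "holomorphic_Cn (\<lambda>z. f (g z)) S"
  unfolding holomorphic_Cn_def
proof
  fix z assume z: "z \<in> S"
  then obtain L where L: "(g has_derivative L) (at z)" "\<forall>c v. L (c *s v) = c * L v"
    using g unfolding holomorphic_Cn_def by meson
  have "(f has_field_derivative deriv f (g z)) (at (g z))"
    using f sub z by (auto intro: holomorphic_derivI)
  from has_derivative_compose[OF L(1) this[unfolded has_field_derivative_def]]
  show "\<exists>L. ((\<lambda>z. f (g z)) has_derivative L) (at z) \<and> (\<forall>c v. L (c *s v) = c * L v)"
    using L(2) by (intro exI[of _ "\<lambda>v. deriv f (g z) * L v"]) auto
qed

lemma holomorphic_Cn_inverse:
  assumes "holomorphic_Cn f S" "\<And>z. z \<in> S \<Longrightarrow> f z \<noteq> 0"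
  shows "holomorphic_Cn (\<lambda>z. inverse (f z)) S"
  by (rule holomorphic_Cn_compose_field[OF assms(1), where A="-{0}"])
     (use assms(2) in \<open>auto intro!: holomorphic_intros\<close>)

lemma holomorphic_Cn_divide:
  assumes "holomorphic_Cn f S" "holomorphic_Cn g S" "\<And>z. z \<in> S \<Longrightarrow> g z \<noteq> 0"
  shows "holomorphic_Cn (\<lambda>z. f z / g z) S"
  using holomorphic_Cn_mult[OF assms(1) holomorphic_Cn_inverse[OF assms(2,3)]]
  by (simp add: divide_inverse)

lemma holomorphic_Cn_minus: "holomorphic_Cn f S \<Longrightarrow> holomorphic_Cn (\<lambda>z. - f z) S"
  using holomorphic_Cn_mult[of "\<lambda>_. -1" S f] by simp

lemma holomorphic_Cn_diff:
  "holomorphic_Cn f S \<Longrightarrow> holomorphic_Cn g S \<Longrightarrow> holomorphic_Cn (\<lambda>z. f z - g z) S"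
  using holomorphic_Cn_add[of f S "\<lambda>z. - g z"] holomorphic_Cn_minus[of g S] by simp

lemma holomorphic_Cn_sum:
  "(\<And>k. k \<in> I \<Longrightarrow> holomorphic_Cn (f k) S) \<Longrightarrow> holomorphic_Cn (\<lambda>z. \<Sum>k\<in>I. f k z) S"
  by (induction I rule: infinite_finite_induct) (auto intro: holomorphic_Cn_add)

lemma holomorphic_Cn_power: "holomorphic_Cn f S \<Longrightarrow> holomorphic_Cn (\<lambda>z. f z ^ n) S"
  by (induction n) (auto intro: holomorphic_Cn_mult)

lemma holomorphic_Cn_transform:
  assumes "holomorphic_Cn f S" "open S" "\<And>z. z \<in> S \<Longrightarrow> f z = g z"
  shows "holomorphic_Cn g S"
  using assms unfolding holomorphic_Cn_def
  by (meson has_derivative_transform_within_open)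

lemma holomorphic_Cn_local:
  assumes "\<And>p. p \<in> S \<Longrightarrow> \<exists>T. p \<in> T \<and> holomorphic_Cn f T"
  shows "holomorphic_Cn f S"
  using assms unfolding holomorphic_Cn_def by meson

lemma has_derivative_vec:
  fixes f :: "'a::real_normed_vector \<Rightarrow> complex ^ 'm::finite"
  assumes "\<And>i. ((\<lambda>x. f x $ i) has_derivative (\<lambda>v. L v $ i)) (at x)"
  shows "(f has_derivative L) (at x)"
proof (subst has_derivative_componentwise_within, rule ballI)
  fix b :: "complex ^ 'm" assume "b \<in> Basis"
  then obtain i u where b: "b = axis i u" unfolding Basis_vec_def by auto
  have "((\<lambda>x. f x $ i \<bullet> u) has_derivative (\<lambda>v. L v $ i \<bullet> u)) (at x)"
    by (intro has_derivative_inner_left assms)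
  then show "((\<lambda>x. f x \<bullet> b) has_derivative (\<lambda>v. L v \<bullet> b)) (at x)"
    by (simp add: b inner_axis)
qed

lemma holomorphic_Cn_compose:
  fixes g :: "complex ^ 'n::finite \<Rightarrow> complex ^ 'm::finite"
  assumes f: "holomorphic_Cn f T" and g: "\<And>i. holomorphic_Cn (\<lambda>z. g z $ i) S" and sub: "g ` S \<subseteq> T"
  shows "holomorphic_Cn (\<lambda>z. f (g z)) S"
  unfolding holomorphic_Cn_def
proof
  fix z assume z: "z \<in> S"
  have "\<forall>i. \<exists>L. ((\<lambda>z. g z $ i) has_derivative L) (at z) \<and> (\<forall>c v. L (c *s v) = c * L v)"
    using g z unfolding holomorphic_Cn_def by blast
  then obtain L where L: "\<And>i. ((\<lambda>z. g z $ i) has_derivative L i) (at z)"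
    "\<And>i c v. L i (c *s v) = c * L i v" by metis
  obtain K where K: "(f has_derivative K) (at (g z))" "\<And>c v. K (c *s v) = c * K v"
    using f z sub unfolding holomorphic_Cn_def by blast
  have "(g has_derivative (\<lambda>v. \<chi> i. L i v)) (at z)"
    by (rule has_derivative_vec) (simp add: L)
  from has_derivative_compose[OF this K(1)]
  have "((\<lambda>z. f (g z)) has_derivative (\<lambda>v. K (\<chi> i. L i v))) (at z)" by simp
  moreover have "K (\<chi> i. L i (c *s v)) = c * K (\<chi> i. L i v)" for c v
  proof -
    have "(\<chi> i. L i (c *s v)) = c *s (\<chi> i. L i v)" by (simp add: vec_eq_iff L(2))
    then show ?thesis by (simp add: K(2))
  qed
  ultimately show "\<exists>L. ((\<lambda>z. f (g z)) has_derivative L) (at z) \<and> (\<forall>c v. L (c *s v) = c * L v)"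
    by blast
qed

text \<open>Restriction to curves makes one-variable function theory available. Complex linearity of
  the Frechet derivative turns the derivative of the composition into multiplication by the number
  \<open>K d\<close>.\<close>

lemma holomorphic_Cn_curve:
  fixes \<gamma> :: "complex \<Rightarrow> complex ^ 'm::finite"
  assumes f: "holomorphic_Cn f T" and g: "\<And>i. (\<lambda>t. \<gamma> t $ i) holomorphic_on A" and A: "open A"
    and sub: "\<gamma> ` A \<subseteq> T"
  shows "(\<lambda>t. f (\<gamma> t)) holomorphic_on A"
  unfolding holomorphic_on_open[OF A]
proof
  fix t assume t: "t \<in> A"
  define d where "d = (\<chi> i. deriv (\<lambda>t. \<gamma> t $ i) t)"
  have "((\<lambda>t. \<gamma> t $ i) has_field_derivative d $ i) (at t)" for i
    using g A t unfolding d_def by (auto intro: holomorphic_derivI)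
  then have "(\<gamma> has_derivative (\<lambda>v. v *s d)) (at t)"
    by (intro has_derivative_vec) (simp add: has_field_derivative_def mult_commute_abs)
  moreover obtain K where K: "(f has_derivative K) (at (\<gamma> t))" "\<And>c v. K (c *s v) = c * K v"
    using f t sub unfolding holomorphic_Cn_def by blast
  ultimately have "((\<lambda>t. f (\<gamma> t)) has_derivative (\<lambda>v. K (v *s d))) (at t)"
    by (auto dest: has_derivative_compose)
  then have "((\<lambda>t. f (\<gamma> t)) has_field_derivative K d) (at t)"
    by (simp add: K(2) has_field_derivative_def mult_commute_abs)
  then show "\<exists>f'. ((\<lambda>t. f (\<gamma> t)) has_field_derivative f') (at t)" by blast
qed

section \<open>Restriction to complex lines and Osgood's lemma\<close>

lemma open_line_preimage:
  fixes z v :: "complex ^ 'm::finite"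
  assumes "open S" shows "open {t. z + t *s v \<in> S}"
proof -
  have "open ((\<lambda>t. z + t *s v) -` S)"
    by (intro continuous_open_vimage assms continuous_at_imp_continuous_on)
      (auto intro!: continuous_intros bounded_linear.continuous[OF bounded_linear_smult_left])
  then show ?thesis by (simp add: vimage_def)
qed

lemma holomorphic_Cn_line:
  fixes z v :: "complex ^ 'm::finite"
  assumes "holomorphic_Cn f S" "open A" "\<And>t. t \<in> A \<Longrightarrow> z + t *s v \<in> S"
  shows "(\<lambda>t. f (z + t *s v)) holomorphic_on A"
  by (rule holomorphic_Cn_curve[OF assms(1)]) (use assms in \<open>auto intro!: holomorphic_intros\<close>)

lemma convex_line_preimage:
  fixes z v :: "complex ^ 'm::finite"
  assumes "convex S" shows "convex {t. z + t *s v \<in> S}"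
proof (rule convexI)
  fix s t :: complex and a b :: real
  assume *: "s \<in> {t. z + t *s v \<in> S}" "t \<in> {t. z + t *s v \<in> S}" "0 \<le> a" "0 \<le> b" "a + b = 1"
  have "z + (a *\<^sub>R s + b *\<^sub>R t) *s v = a *\<^sub>R (z + s *s v) + b *\<^sub>R (z + t *s v)"
    using * by (simp add: vec_eq_iff algebra_simps flip: scaleR_add_left)
  then show "a *\<^sub>R s + b *\<^sub>R t \<in> {t. z + t *s v \<in> S}"
    using * convexD[OF assms, of "z + s *s v" "z + t *s v" a b] by simp
qed

text \<open>The difference of \<open>f\<close> along two parallel lines is holomorphic in the
  parameter. Uniform continuity on a compact ball makes it small on a circle, and Cauchy's
  inequality passes this on to the difference of the derivatives.\<close>

lemma coord_deriv_continuous: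
  fixes f :: "complex ^ 'm::finite \<Rightarrow> complex"
  assumes S: "open S" and cont: "continuous_on S f" and z: "z \<in> S"
    and sep: "\<And>z i. z \<in> S \<Longrightarrow> (\<lambda>t. f (z + t *s axis i 1)) holomorphic_on {t. z + t *s axis i 1 \<in> S}"
  shows "continuous (at z) (\<lambda>z. deriv (\<lambda>t. f (z + t *s axis i 1)) 0)"
proof -
  \<comment> \<open>Twice the radius leaves room for a base point within \<open>r\<close> of
    \<open>z\<close> and a circle of radius \<open>r\<close> around it.\<close>
  obtain r where r: "r > 0" "cball z (2 * r) \<subseteq> S"
  proof -
    obtain e where "e > 0" "cball z e \<subseteq> S" using S z open_contains_cball by blast
    then show ?thesis using that[of "e / 2"] by auto
  qed
  have uc: "uniformly_continuous_on (cball z (2 * r)) f"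
    using cont r(2) by (intro compact_uniformly_continuous) (auto intro: continuous_on_subset)
  have in_cball: "z' + t *s axis i 1 \<in> cball z (2 * r)" if "dist z' z \<le> r" "norm t \<le> r" for z' t
  proof -
    have "dist (z' + t *s axis i 1) z \<le> dist (z' + t *s axis i 1) z' + dist z' z" by (rule dist_triangle)
    also have "\<dots> \<le> 2 * r" using that by (simp add: dist_norm norm_vector_smult)
    finally show ?thesis by (simp add: dist_commute)
  qed
  have diff: "(\<lambda>t. f (z' + t *s axis i 1)) field_differentiable at t" if "dist z' z \<le> r" "norm t \<le> r" for z' t
  proof -
    have "z' \<in> S" using in_cball[of z' 0] that r by auto
    then show ?thesis
      using sep[of z' i] in_cball[OF that] r(2) open_line_preimage[OF S, of z' "axis i 1"]
      by (auto simp: holomorphic_on_open field_differentiable_def)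
  qed
  show ?thesis unfolding continuous_at_eps_delta
  proof safe
    fix e :: real assume e: "e > 0"
    \<comment> \<open>The bound \<open>e * r / 2\<close> on a circle of radius \<open>r\<close>
      gives \<open>e / 2\<close> for the derivative, strictly below \<open>e\<close>.\<close>
    then have "0 < e * r / 2" using r by simp
    with uc obtain d where d: "d > 0" "\<And>x y. \<lbrakk>x \<in> cball z (2 * r); y \<in> cball z (2 * r); dist y x < d\<rbrakk> \<Longrightarrow> dist (f y) (f x) < e * r / 2"
      unfolding uniformly_continuous_on_def by metis
    show "\<exists>d>0. \<forall>x'. dist x' z < d \<longrightarrow>
       dist (deriv (\<lambda>t. f (x' + t *s axis i 1)) 0) (deriv (\<lambda>t. f (z + t *s axis i 1)) 0) < e"
    proof (intro exI[of _ "min d r"] conjI allI impI)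
      fix z' assume z': "dist z' z < min d r"
      define g where "g = (\<lambda>t. f (z' + t *s axis i 1) - f (z + t *s axis i 1))"
      have gd: "g field_differentiable at t" if "norm t \<le> r" for t
        unfolding g_def by (intro derivative_intros diff) (use z' that r in auto)
      have "norm ((deriv ^^ 1) g 0) \<le> fact 1 * (e * r / 2) / r ^ 1"
      proof (rule Cauchy_inequality)
        show "g holomorphic_on ball 0 r"
          using gd by (auto simp: holomorphic_on_def intro: field_differentiable_at_within)
        show "continuous_on (cball 0 r) g"
          using gd by (intro continuous_at_imp_continuous_on) (auto intro: field_differentiable_imp_continuous_at)
        show "norm (g t) \<le> e * r / 2" if "norm (0 - t) = r" for t
          using d(2)[OF in_cball[of z t] in_cball[of z' t]] z' that r
          by (auto simp: g_def dist_norm)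
      qed (use r in auto)
      also have "\<dots> < e" using e r by simp
      also have "(deriv ^^ 1) g 0 = deriv (\<lambda>t. f (z' + t *s axis i 1)) 0 - deriv (\<lambda>t. f (z + t *s axis i 1)) 0"
        unfolding g_def using z' r by (simp add: deriv_diff diff)
      finally show "dist (deriv (\<lambda>t. f (z' + t *s axis i 1)) 0) (deriv (\<lambda>t. f (z + t *s axis i 1)) 0) < e"
        by (simp add: dist_norm)
    qed (use d r in auto)
  qed
qed

text \<open>A factor between 0 and 1 moves one coordinate along a segment from 0, and
  \<open>c = 0\<close> removes it; in both cases the point stays in the same ball.\<close>

lemma norm_zero_coord_le:
  fixes v :: "complex ^ 'm::finite"
  assumes "norm c \<le> 1"
  shows "norm (\<chi> k. if k = j then c * v $ j else v $ k) \<le> norm v"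
  unfolding norm_vec_def using assms
  by (intro L2_set_mono) (auto simp: norm_mult intro: mult_left_le_one_le)

text \<open>Osgood's lemma: the partial derivatives are continuous by Cauchy's inequality, hence the function
  is Frechet differentiable.\<close>

lemma osgood:
  fixes f :: "complex ^ 'm::finite \<Rightarrow> complex"
  assumes S: "open S" and cont: "continuous_on S f"
    and sep: "\<And>z i. z \<in> S \<Longrightarrow> (\<lambda>t. f (z + t *s axis i 1)) holomorphic_on {t. z + t *s axis i 1 \<in> S}"
  shows "holomorphic_Cn f S"
proof -
  define pd where "pd i z = deriv (\<lambda>t. f (z + t *s axis i 1)) 0" for i z
  have deriv: "((\<lambda>t. f (z + t *s axis i 1)) has_field_derivative pd i (z + t *s axis i 1)) (at t)"
    if "z + t *s axis i 1 \<in> S" for z t i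
  proof -
    have "((\<lambda>s. f ((z + t *s axis i 1) + s *s axis i 1)) has_field_derivative pd i (z + t *s axis i 1)) (at 0)"
      unfolding pd_def
      by (rule holomorphic_derivI[OF sep[OF that]]) (use open_line_preimage[OF S] that in auto)
    moreover have "(\<lambda>s. f ((z + t *s axis i 1) + s *s axis i 1)) = (\<lambda>s. f (z + (s + t) *s axis i 1))"
      by (simp add: add_ac vector_sadd_rdistrib)
    ultimately show ?thesis
      using DERIV_shift[of "\<lambda>t. f (z + t *s axis i 1)" "pd i (z + t *s axis i 1)" 0 t] by (simp only: add_0)
  qed
  show ?thesis
  proof (rule holomorphic_CnI[where L="\<lambda>z v. \<Sum>i\<in>UNIV. pd i z * v $ i"])
    fix z assume z: "z \<in> S"
    show "(f has_derivative (\<lambda>v. \<Sum>i\<in>UNIV. pd i z * v $ i)) (at z)"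
      unfolding has_derivative_at_alt
    proof safe
      show "bounded_linear (\<lambda>v. \<Sum>i\<in>UNIV. pd i z * v $ i)"
        by (intro bounded_linear_sum bounded_linear_const_mult bounded_linear_vec_nth)
      fix e :: real assume e: "e > 0"
      \<comment> \<open>The increment is split into one step per coordinate; each contributes an
        error of at most \<epsilon> times its norm, so the total is at most
        \<open>e * norm (y - z)\<close>.\<close>
      define \<epsilon> where "\<epsilon> = e / real CARD('m)"
      have \<epsilon>: "\<epsilon> > 0" using e by (simp add: \<epsilon>_def)
      have "\<forall>i. \<exists>d>0. \<forall>z'. dist z' z < d \<longrightarrow> dist (pd i z') (pd i z) < \<epsilon>"
        using coord_deriv_continuous[OF S cont z sep] \<epsilon>
        unfolding continuous_at_eps_delta pd_def by blast
      then obtain d where d: "\<And>i. d i > 0" "\<And>i z'. dist z' z < d i \<Longrightarrow> dist (pd i z') (pd i z) < \<epsilon>"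
        by metis
      obtain r0 where r0: "r0 > 0" "ball z r0 \<subseteq> S" using S z open_contains_ball by blast
      define r where "r = min r0 (Min (range d))"
      have r: "r > 0" "ball z r \<subseteq> S" "\<And>i. r \<le> d i"
        using r0 d(1) by (auto simp: r_def min.coboundedI2)
      \<comment> \<open>Only coordinates in \<open>I\<close> are moved. The induction takes off one
        of them at a time, so each partial increment runs along a single coordinate line, where the
        mean value bound applies.\<close>
      have main: "norm (f (z + v) - f z - (\<Sum>i\<in>I. pd i z * v $ i)) \<le> (\<Sum>i\<in>I. \<epsilon> * norm (v $ i))"
        if "finite I" "norm v < r" "\<And>i. i \<notin> I \<Longrightarrow> v $ i = 0" for I v
        using that
      proof (induction I arbitrary: v rule: finite_induct)
        case empty
        then have "v = 0" by (simp add: vec_eq_iff)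
        then show ?case by simp
      next
        case (insert j I)
        define w where "w = (\<chi> k. if k = j then 0 else v $ k)"
        have wle: "norm (w + (c * v $ j) *s axis j 1) \<le> norm v" if "norm c \<le> 1" for c
        proof -
          have "w + (c * v $ j) *s axis j 1 = (\<chi> k. if k = j then c * v $ j else v $ k)"
            by (auto simp: vec_eq_iff w_def axis_def)
          then show ?thesis using norm_zero_coord_le[OF that, of j v] by simp
        qed
        have seg: "z + w + s *s axis j 1 \<in> ball z r" if s: "s \<in> closed_segment 0 (v $ j)" for s
        proof -
          obtain c :: real where "0 \<le> c" "c \<le> 1" "s = c *\<^sub>R (v $ j)"
            using s by (auto simp: in_segment)
          then have "norm (w + s *s axis j 1) < r" using wle[of "of_real c"] insert.prems
            by (simp add: scaleR_conv_of_real)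
          moreover have "dist z (z + w + s *s axis j 1) = norm (w + s *s axis j 1)"
            by (metis add.assoc add_diff_cancel_left' dist_commute dist_norm)
          ultimately show ?thesis by simp
        qed
        have "norm ((f (z + w + (v $ j) *s axis j 1) - pd j z * v $ j) - (f (z + w + 0 *s axis j 1) - pd j z * 0))
            \<le> \<epsilon> * norm (v $ j - 0)"
        proof (rule field_differentiable_bound[where S="closed_segment 0 (v $ j)" and f'="\<lambda>s. pd j (z + w + s *s axis j 1) - pd j z"])
          fix s assume "s \<in> closed_segment 0 (v $ j)"
          note sb = seg[OF this]
          show "((\<lambda>s. f (z + w + s *s axis j 1) - pd j z * s) has_field_derivative
              pd j (z + w + s *s axis j 1) - pd j z) (at s within closed_segment 0 (v $ j))"
            by (rule has_field_derivative_at_within, rule DERIV_diff[OF deriv])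
              (use sb r in \<open>auto intro!: derivative_eq_intros\<close>)
          show "norm (pd j (z + w + s *s axis j 1) - pd j z) \<le> \<epsilon>"
          proof -
            have "dist (z + w + s *s axis j 1) z < d j" using sb r(3)[of j] by (simp add: dist_commute)
            from d(2)[OF this] show ?thesis by (simp add: dist_norm)
          qed
        qed auto
        moreover have "z + w + (v $ j) *s axis j 1 = z + v"
          by (auto simp: vec_eq_iff w_def axis_def)
        ultimately have "norm ((f (z + v) - pd j z * v $ j) - (f (z + w) - pd j z * 0)) \<le> \<epsilon> * norm (v $ j - 0)"
          by (simp only: vector_smult_lzero add_0_right)
        then have 1: "norm (f (z + v) - f (z + w) - pd j z * v $ j) \<le> \<epsilon> * norm (v $ j)"
          by (simp add: diff_diff_eq add.commute)
        have "norm w < r" using wle[of 0] insert.prems by simp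
        then have 2: "norm (f (z + w) - f z - (\<Sum>i\<in>I. pd i z * w $ i)) \<le> (\<Sum>i\<in>I. \<epsilon> * norm (w $ i))"
          using insert.prems by (intro insert.IH) (auto simp: w_def)
        have 3: "(\<Sum>i\<in>I. pd i z * w $ i) = (\<Sum>i\<in>I. pd i z * v $ i)" "(\<Sum>i\<in>I. \<epsilon> * norm (w $ i)) = (\<Sum>i\<in>I. \<epsilon> * norm (v $ i))"
          using insert.hyps by (auto intro!: sum.cong simp: w_def)
        have eq: "f (z + v) - f z - (\<Sum>i\<in>insert j I. pd i z * v $ i)
          = (f (z + v) - f (z + w) - pd j z * v $ j) + (f (z + w) - f z - (\<Sum>i\<in>I. pd i z * v $ i))"
          using insert.hyps by simp
        show ?case unfolding eq using insert.hyps norm_triangle_mono[OF 1 2[unfolded 3]] by simp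
      qed
      show "\<exists>d>0. \<forall>y. norm (y - z) < d \<longrightarrow>
          norm (f y - f z - (\<Sum>i\<in>UNIV. pd i z * (y - z) $ i)) \<le> e * norm (y - z)"
      proof (intro exI[of _ r] conjI allI impI r)
        fix y assume "norm (y - z) < r"
        from main[of UNIV, OF _ this]
        have "norm (f y - f z - (\<Sum>i\<in>UNIV. pd i z * (y - z) $ i)) \<le> (\<Sum>i\<in>UNIV. \<epsilon> * norm ((y - z) $ i))" by simp
        also have "\<dots> \<le> (\<Sum>i\<in>(UNIV::'m set). \<epsilon> * norm (y - z))"
          using \<epsilon> by (intro sum_mono mult_left_mono Finite_Cartesian_Product.norm_nth_le) auto
        also have "\<dots> = e * norm (y - z)" by (simp add: \<epsilon>_def)
        finally show "norm (f y - f z - (\<Sum>i\<in>UNIV. pd i z * (y - z) $ i)) \<le> e * norm (y - z)" .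
      qed
    qed
  qed (simp add: sum_distrib_left mult.left_commute)
qed

section \<open>Identity theorem and complements of zero sets\<close>

lemma eq_on_dense:
  fixes f g :: "'a::topological_space \<Rightarrow> 'b::t2_space"
  assumes "continuous_on T f" "continuous_on T g" "open T" "T \<subseteq> closure X"
    and "\<And>z. z \<in> X \<Longrightarrow> z \<in> T \<Longrightarrow> f z = g z" and "z \<in> T"
  shows "f z = g z"
proof (rule ccontr)
  assume ne: "f z \<noteq> g z"
  then obtain A B where AB: "open A" "open B" "f z \<in> A" "g z \<in> B" "A \<inter> B = {}"
    using hausdorff by meson
  have "open ((f -` A \<inter> T) \<inter> (g -` B \<inter> T))"
    using assms AB by (auto simp: continuous_on_open_vimage)
  moreover have "z \<in> (f -` A \<inter> T) \<inter> (g -` B \<inter> T)" using AB assms by auto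
  moreover have "z \<in> closure X" using assms by auto
  ultimately obtain y where "y \<in> X" "y \<in> (f -` A \<inter> T) \<inter> (g -` B \<inter> T)"
    by (meson closure_iff_nhds_not_empty disjoint_iff order_refl)
  then show False using assms(5)[of y] AB by auto
qed

text \<open>The complex line through \<open>z\<close> and a point of \<open>T\<close> meets the
  convex set \<open>S\<close> in a convex, hence connected, set; the one-variable identity theorem
  applies there.\<close>

lemma holomorphic_Cn_identity_convex:
  fixes f :: "complex ^ 'm::finite \<Rightarrow> complex"
  assumes f: "holomorphic_Cn f S" "open S" "convex S" and T: "open T" "T \<noteq> {}" "T \<subseteq> S"
    and z: "\<And>z. z \<in> T \<Longrightarrow> f z = 0" "z \<in> S"
  shows "f z = 0"
proof -
  obtain p where p: "p \<in> T" using T by auto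
  define v where "v = z - p"
  let ?l = "\<lambda>t. p + t *s v"
  let ?A = "{t. ?l t \<in> S}"
  have 1: "?l 1 = z" by (simp add: v_def)
  have "f (?l 1) = 0"
  proof (rule analytic_continuation_open[where s="{t. ?l t \<in> T}" and s'="?A" and f="\<lambda>t. f (?l t)" and g="\<lambda>_. 0" and z=1])
    show "{t. ?l t \<in> T} \<noteq> {}" using p by (auto intro!: exI[of _ 0])
    show "(\<lambda>t. f (?l t)) holomorphic_on ?A"
      by (rule holomorphic_Cn_line[OF f(1) open_line_preimage[OF f(2)]]) simp
    show "1 \<in> ?A" using 1 z by simp
  qed (use assms in \<open>auto intro!: convex_connected open_line_preimage convex_line_preimage\<close>)
  then show ?thesis using 1 by simp
qed

lemma holomorphic_Cn_nonzero_dense: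
  fixes f :: "complex ^ 'm::finite \<Rightarrow> complex"
  assumes f: "holomorphic_Cn f S" "open S" "convex S" and p: "p \<in> S" "f p \<noteq> 0"
  shows "S \<subseteq> closure {z\<in>S. f z \<noteq> 0}"
proof
  fix z assume z: "z \<in> S"
  show "z \<in> closure {z\<in>S. f z \<noteq> 0}"
    unfolding closure_iff_nhds_not_empty
  proof (intro allI impI)
    fix A V assume *: "V \<subseteq> A" "open V" "z \<in> V"
    have "\<exists>y\<in>V \<inter> S. f y \<noteq> 0"
      using holomorphic_Cn_identity_convex[OF f, of "V \<inter> S" p] * z p f(2) by (auto intro!: open_Int)
    then show "{z \<in> S. f z \<noteq> 0} \<inter> A \<noteq> {}" using * by auto
  qed
qed

text \<open>Two points outside the zero set are joined inside the complex line through them: the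
  zeros on that line are countable, and a connected open planar set stays connected after removal of
  a countable set.\<close>

lemma holomorphic_Cn_nonzero_connected:
  fixes f :: "complex ^ 'm::finite \<Rightarrow> complex"
  assumes f: "holomorphic_Cn f S" "open S" "convex S"
  shows "connected {z\<in>S. f z \<noteq> 0}"
  unfolding connected_iff_connected_component
proof safe
  fix p q assume pq: "p \<in> S" "f p \<noteq> 0" "q \<in> S" "f q \<noteq> 0"
  define v where "v = q - p"
  let ?l = "\<lambda>t. p + t *s v"
  let ?A = "{t. ?l t \<in> S}"
  have A: "open ?A" "convex ?A" using f open_line_preimage convex_line_preimage by auto
  have hol: "(\<lambda>t. f (?l t)) holomorphic_on ?A"
    by (rule holomorphic_Cn_line[OF f(1) A(1)]) simp
  have 1: "?l 1 = q" by (simp add: v_def)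
  have A01: "0 \<in> ?A" "1 \<in> ?A" using pq 1 by auto
  have fs: "fsigma ?A"
  proof -
    obtain C :: "nat \<Rightarrow> complex set" where "\<And>n. compact (C n)" "\<Union>(range C) = ?A"
      using open_Union_compact_subsets[OF A(1)] by metis
    then show ?thesis using fsigma_Union_compact[of ?A] by (metis image_subset_iff mem_Collect_eq)
  qed
  have cnt: "countable {t\<in>?A. f (?l t) = 0}"
  proof (cases "(\<lambda>t. f (?l t)) constant_on ?A")
    case True
    then have "f (?l t) = f (?l 0)" if "t \<in> ?A" for t
      using that A01(1) unfolding constant_on_def by metis
    then have "{t\<in>?A. f (?l t) = 0} = {}" using pq by auto
    then show ?thesis by (metis countable_empty)
  next
    case False
    then show ?thesis
      using A fs by (intro holomorphic_countable_zeros[OF hol]) (auto intro: convex_connected)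
  qed
  have "connected (?A - {t\<in>?A. f (?l t) = 0})"
    using A by (intro connected_open_diff_countable[OF _ A(1) _ cnt]) (auto intro: convex_connected)
  then have "connected (?l ` (?A - {t\<in>?A. f (?l t) = 0}))"
    by (rule connected_continuous_image[rotated]) (intro continuous_intros)
  moreover have "p \<in> ?l ` (?A - {t\<in>?A. f (?l t) = 0})" using pq A01 by (intro image_eqI[of _ _ 0]) auto
  moreover have "q \<in> ?l ` (?A - {t\<in>?A. f (?l t) = 0})" using pq A01 1 by (intro image_eqI[of _ _ 1]) auto
  ultimately show "connected_component {z\<in>S. f z \<noteq> 0} p q"
    unfolding connected_component_def by (intro exI[of _ "?l ` (?A - {t\<in>?A. f (?l t) = 0})"]) auto
qed

section \<open>Cauchy integrals depending on parameters\<close>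

lemma holomorphic_Cn_coord_deriv:
  assumes f: "holomorphic_Cn f S" "open S" and z: "z + t *s axis i 1 \<in> S"
  shows "((\<lambda>t. f (z + t *s axis i 1)) has_field_derivative
    deriv (\<lambda>s. f ((z + t *s axis i 1) + s *s axis i 1)) 0) (at t)"
proof -
  have "(\<lambda>s. f ((z + t *s axis i 1) + s *s axis i 1)) holomorphic_on {s. (z + t *s axis i 1) + s *s axis i 1 \<in> S}"
    by (rule holomorphic_Cn_line[OF f(1) open_line_preimage[OF f(2)]]) auto
  then have "((\<lambda>s. f ((z + t *s axis i 1) + s *s axis i 1)) has_field_derivative
      deriv (\<lambda>s. f ((z + t *s axis i 1) + s *s axis i 1)) 0) (at 0)"
    by (rule holomorphic_derivI) (use open_line_preimage[OF f(2)] z in auto)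
  moreover have "(\<lambda>s. f ((z + t *s axis i 1) + s *s axis i 1)) = (\<lambda>s. f (z + (s + t) *s axis i 1))"
    by (simp add: add_ac vector_sadd_rdistrib)
  ultimately show ?thesis
    using DERIV_shift[of "\<lambda>t. f (z + t *s axis i 1)" _ 0 t] by (simp only: add_0)
qed

text \<open>By \<open>osgood\<close>, differentiation under the integral sign is needed in one
  coordinate at a time only. The argument \<open>z + \<gamma> x\<close> describes a curve that is
  moved along with its centre.\<close>

lemma holomorphic_Cn_integral:
  fixes f :: "complex ^ 'm::finite \<Rightarrow> complex" and \<gamma> :: "real \<Rightarrow> complex ^ 'm"
  assumes f: "holomorphic_Cn f T" "open T" and S: "open S"
    and \<gamma>: "continuous_on {0..1} \<gamma>" and k: "continuous_on {0..1} k"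
    and sub: "\<And>z x. z \<in> S \<Longrightarrow> x \<in> {0..1} \<Longrightarrow> z + \<gamma> x \<in> T"
  shows "holomorphic_Cn (\<lambda>z. integral {0..1} (\<lambda>x. f (z + \<gamma> x) * k x)) S"
proof (rule osgood[OF S])
  have contf: "continuous_on T f" by (rule holomorphic_Cn_continuous_on[OF f(1)])
  have cont: "continuous_on (S \<times> cbox 0 1) (\<lambda>(z, x). f (z + \<gamma> x) * k x)"
    unfolding case_prod_beta
    by (intro continuous_intros continuous_on_compose2[OF contf] continuous_on_compose2[OF \<gamma>] continuous_on_compose2[OF k])
       (use sub in auto)
  show "continuous_on S (\<lambda>z. integral {0..1} (\<lambda>x. f (z + \<gamma> x) * k x))"
    using integral_continuous_on_param[OF cont] by simp
  fix z i assume z: "z \<in> S"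
  define A where "A = {t. z + t *s axis i 1 \<in> S}"
  have A: "open A" unfolding A_def by (rule open_line_preimage[OF S])
  define pd where "pd z = deriv (\<lambda>s. f (z + s *s axis i 1)) 0" for z
  have contpd: "continuous_on T pd"
    unfolding pd_def
    by (intro continuous_at_imp_continuous_on ballI coord_deriv_continuous[OF f(2) contf])
       (auto intro!: holomorphic_Cn_line[OF f(1) open_line_preimage[OF f(2)]])
  have "(\<lambda>t. integral (cbox 0 1) (\<lambda>x. f (z + t *s axis i 1 + \<gamma> x) * k x)) field_differentiable at t" if t: "t \<in> A" for t
  proof -
    obtain e where e: "e > 0" "ball t e \<subseteq> A" using A t open_contains_ball by blast
    have "(\<lambda>t. integral (cbox 0 1) (\<lambda>x. f (z + t *s axis i 1 + \<gamma> x) * k x)) holomorphic_on ball t e"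
    proof (rule leibniz_rule_holomorphic[where fx="\<lambda>t x. pd (z + t *s axis i 1 + \<gamma> x) * k x"])
      have inT: "z + s *s axis i 1 + \<gamma> x \<in> T" if "s \<in> ball t e" "x \<in> cbox 0 1" for s x
        using that e(2) sub[of "z + s *s axis i 1" x] by (auto simp: A_def)
      show "((\<lambda>t. f (z + t *s axis i 1 + \<gamma> x) * k x) has_field_derivative
          pd (z + s *s axis i 1 + \<gamma> x) * k x) (at s within ball t e)" if "s \<in> ball t e" "x \<in> cbox 0 1" for s x
      proof (rule has_field_derivative_at_within, rule DERIV_cmult_right)
        have "z + \<gamma> x + s *s axis i 1 \<in> T" using inT[OF that] by (simp add: add_ac)
        from holomorphic_Cn_coord_deriv[OF f this]
        show "((\<lambda>t. f (z + t *s axis i 1 + \<gamma> x)) has_field_derivative pd (z + s *s axis i 1 + \<gamma> x)) (at s)"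
          unfolding pd_def by (simp add: add_ac)
      qed
      show "(\<lambda>x. f (z + s *s axis i 1 + \<gamma> x) * k x) integrable_on cbox 0 1" if "s \<in> ball t e" for s
        using inT[OF that] \<gamma> k
        by (intro integrable_continuous continuous_intros continuous_on_compose2[OF contf]) auto
      show "continuous_on (ball t e \<times> cbox 0 1) (\<lambda>(s, x). pd (z + s *s axis i 1 + \<gamma> x) * k x)"
        unfolding case_prod_beta
        by (intro continuous_intros continuous_on_compose2[OF contpd] continuous_on_compose2[OF \<gamma>] continuous_on_compose2[OF k])
           (use inT in auto)
    qed auto
    then show ?thesis using e holomorphic_on_imp_differentiable_at by auto
  qed
  then show "(\<lambda>t. integral {0..1} (\<lambda>x. f (z + t *s axis i 1 + \<gamma> x) * k x)) holomorphic_on {t. z + t *s axis i 1 \<in> S}"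
    unfolding A_def by (auto simp: holomorphic_on_def intro: field_differentiable_at_within)
qed

text \<open>The contour integral is parametrised over the unit interval so that
  \<open>holomorphic_Cn_integral\<close> applies to it.\<close>

lemma mean_value_integral:
  assumes "g holomorphic_on S" "open S" "cball 0 r \<subseteq> S" "r > 0"
  shows "integral {0..1} (\<lambda>x. g (of_real r * exp (2 * of_real pi * \<i> * of_real x))) = g 0"
proof -
  have "((\<lambda>u. g u / (u - 0)) has_contour_integral (2 * of_real pi * \<i> * g 0)) (circlepath 0 r)"
    by (rule Cauchy_integral_circlepath_simple) (use assms in \<open>auto intro: holomorphic_on_subset\<close>)
  then have "((\<lambda>x. 2 * of_real pi * \<i> * g (of_real r * exp (2 * of_real pi * \<i> * of_real x))) has_integral
      (2 * of_real pi * \<i> * g 0)) {0..1}"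
    unfolding has_contour_integral_def
    by (rule has_integral_eq[rotated])
       (use assms(4) in \<open>simp add: vector_derivative_circlepath01, simp add: circlepath mult_ac\<close>)
  from has_integral_mult_right[OF this, of "1 / (2 * of_real pi * \<i>)"]
  show ?thesis by (auto intro: integral_unique)
qed

lemma deriv_integral:
  assumes "g holomorphic_on S" "open S" "cball 0 r \<subseteq> S" "r > 0"
  shows "integral {0..1} (\<lambda>x. g (of_real r * exp (2 * of_real pi * \<i> * of_real x)) *
    (exp (- 2 * of_real pi * \<i> * of_real x) / of_real r)) = deriv g 0"
proof -
  have g: "continuous_on (cball 0 r) g" "g holomorphic_on ball 0 r"
    using holomorphic_on_subset[OF assms(1), of "ball 0 r"] holomorphic_on_subset[OF assms(1,3)] assms
    by (auto intro!: holomorphic_on_imp_continuous_on)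
  have 0: "(0::complex) \<in> ball 0 r" using assms by auto
  let ?I = "contour_integral (circlepath 0 r) (\<lambda>u. g u / (u - 0)^2)"
  have "((\<lambda>u. g u / (u - 0)^2) has_contour_integral ?I) (circlepath 0 r)"
    using Cauchy_derivative_integral_circlepath(1)[OF g 0] has_contour_integral_integral by blast
  then have "((\<lambda>x. 2 * of_real pi * \<i> * (g (of_real r * exp (2 * of_real pi * \<i> * of_real x)) *
      (exp (- 2 * of_real pi * \<i> * of_real x) / of_real r))) has_integral ?I) {0..1}"
    unfolding has_contour_integral_def
    by (rule has_integral_eq[rotated])
       (use assms(4) in \<open>simp add: vector_derivative_circlepath01,
          simp add: circlepath field_simps power2_eq_square exp_minus\<close>)
  from integral_unique[OF has_integral_mult_right[OF this, of "1 / (2 * of_real pi * \<i>)"]]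
  have "integral {0..1} (\<lambda>x. g (of_real r * exp (2 * of_real pi * \<i> * of_real x)) *
      (exp (- 2 * of_real pi * \<i> * of_real x) / of_real r)) = 1 / (2 * of_real pi * \<i>) * ?I"
    by simp
  also have "\<dots> = deriv g 0"
    using Cauchy_derivative_integral_circlepath(2)[OF g 0] by (simp add: DERIV_imp_deriv)
  finally show ?thesis .
qed

text \<open>The derivative is a Cauchy integral over a circle of fixed radius, whose kernel depends
  on \<open>x\<close> alone and not on \<open>z\<close>.\<close>

lemma holomorphic_Cn_deriv:
  assumes f: "holomorphic_Cn f S" "open S"
  shows "holomorphic_Cn (\<lambda>z. deriv (\<lambda>t. f (z + t *s axis i 1)) 0) S"
proof (rule holomorphic_Cn_local)
  fix p assume "p \<in> S"
  then obtain e where e: "e > 0" "ball p e \<subseteq> S" using f(2) open_contains_ball by blast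
  \<comment> \<open>A centre within \<open>e / 3\<close> of \<open>p\<close> and a circle of the
    same radius around it remain in \<open>ball p e\<close>.\<close>
  define r where "r = e / 3"
  have r: "r > 0" using e by (simp add: r_def)
  have inS: "z + t *s axis i 1 \<in> S" if "z \<in> ball p r" "norm t \<le> r" for z t
  proof -
    have "dist p (z + t *s axis i 1) \<le> dist p z + dist z (z + t *s axis i 1)" by (rule dist_triangle)
    also have "\<dots> < e" using that e(1) by (simp add: dist_norm norm_vector_smult r_def)
    finally show ?thesis using e(2) by auto
  qed
  define \<gamma> :: "real \<Rightarrow> complex ^ 'a" where
    "\<gamma> x = (of_real r * exp (2 * of_real pi * \<i> * of_real x)) *s axis i 1" for x
  have "holomorphic_Cn (\<lambda>z. integral {0..1} (\<lambda>x. f (z + \<gamma> x) * (exp (- 2 * of_real pi * \<i> * of_real x) / of_real r))) (ball p r)"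
    by (rule holomorphic_Cn_integral[OF f])
       (use r in \<open>auto simp: \<gamma>_def norm_mult intro!: continuous_intros inS\<close>)
  moreover have "integral {0..1} (\<lambda>x. f (z + \<gamma> x) * (exp (- 2 * of_real pi * \<i> * of_real x) / of_real r))
      = deriv (\<lambda>t. f (z + t *s axis i 1)) 0" if "z \<in> ball p r" for z
    unfolding \<gamma>_def
    by (rule deriv_integral[OF holomorphic_Cn_line[OF f(1) open_line_preimage[OF f(2)]] open_line_preimage[OF f(2)]])
       (use inS[OF that] r in auto)
  ultimately have "holomorphic_Cn (\<lambda>z. deriv (\<lambda>t. f (z + t *s axis i 1)) 0) (ball p r)"
    by (auto intro: holomorphic_Cn_transform)
  then show "\<exists>T. p \<in> T \<and> holomorphic_Cn (\<lambda>z. deriv (\<lambda>t. f (z + t *s axis i 1)) 0) T"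
    using r by (intro exI[of _ "ball p r"]) auto
qed

section \<open>Riemann's extension theorem\<close>

lemma compact_in_open_uniform:
  fixes K :: "'a::metric_space set"
  assumes "compact K" "open S" "K \<subseteq> S"
  obtains e where "e > 0" "\<And>x. x \<in> K \<Longrightarrow> ball x e \<subseteq> S"
  using Heine_Borel_lemma[OF assms(1), of "{S}"] assms by auto

text \<open>In a direction in which \<open>D\<close> does not vanish identically, the mean value over a small circle
  avoiding the zeros of \<open>D\<close> gives the extension.\<close>

lemma riemann_extension_local:
  fixes f :: "complex ^ 'm::finite \<Rightarrow> complex"
  assumes S: "open S" and D: "holomorphic_Cn D S" and dense: "S \<subseteq> closure {z\<in>S. D z \<noteq> 0}"
    and f: "holomorphic_Cn f {z\<in>S. D z \<noteq> 0}" and p: "p \<in> S"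
    and T: "open T" "p \<in> T" and bd: "\<And>z. \<lbrakk>z \<in> T; z \<in> S; D z \<noteq> 0\<rbrakk> \<Longrightarrow> norm (f z) \<le> K"
  obtains \<delta> F where "\<delta> > 0" "ball p \<delta> \<subseteq> S" "holomorphic_Cn F (ball p \<delta>)"
    "\<And>z. \<lbrakk>z \<in> ball p \<delta>; D z \<noteq> 0\<rbrakk> \<Longrightarrow> F z = f z"
proof -
  define X where "X = {z\<in>S. D z \<noteq> 0}"
  have openX: "open X"
  proof -
    have "open (D -` (-{0}) \<inter> S)"
      using holomorphic_Cn_continuous_on[OF D] S by (auto simp: continuous_on_open_vimage)
    moreover have "D -` (-{0}) \<inter> S = X" by (auto simp: X_def)
    ultimately show ?thesis by simp
  qed
  obtain R where R: "R > 0" "ball p R \<subseteq> S \<inter> T"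
    using S T p by (meson IntI open_Int open_contains_ball)
  have "p \<in> closure X" using dense p by (auto simp: X_def)
  \<comment> \<open>Density gives a point near \<open>p\<close> where \<open>D\<close> is nonzero.
    On the line from \<open>p\<close> towards it, the only possible zero of \<open>D\<close> close
    to \<open>p\<close> is \<open>p\<close> itself.\<close>
  then obtain q where q: "q \<in> X" "q \<in> ball p R"
    using R(1) by (auto simp: closure_approachable dist_commute)
  define v where "v = q - p"
  let ?l = "\<lambda>z t. z + t *s v"
  define A where "A z = {t. ?l z t \<in> ball p R}" for z
  have A: "open (A z)" "convex (A z)" for z
    unfolding A_def by (intro open_line_preimage convex_line_preimage open_ball convex_ball)+
  have DR: "holomorphic_Cn D (ball p R)" using D R by (auto intro: holomorphic_Cn_subset)
  have holD: "(\<lambda>t. D (?l z t)) holomorphic_on A z" for z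
    by (rule holomorphic_Cn_line[OF DR A(1)]) (simp add: A_def)
  have "?l p 1 = q" by (simp add: v_def)
  then have "\<forall>\<^sub>F t in at 0. D (?l p t) \<noteq> 0 \<and> t \<in> A p"
    using q R A[of p]
    by (intro non_zero_neighbour_alt[OF holD[of p], where \<beta>=1]) (auto simp: A_def X_def convex_connected)
  then obtain r0 where r0: "r0 > 0" "\<And>t. t \<noteq> 0 \<Longrightarrow> norm t < r0 \<Longrightarrow> D (?l p t) \<noteq> 0 \<and> t \<in> A p"
    unfolding eventually_at by (auto simp: dist_norm)
  define r where "r = r0 / 2"
  have r: "r > 0" "r < r0" using r0 by (auto simp: r_def)
  have "compact (?l p ` sphere 0 r)"
    by (intro compact_continuous_image continuous_intros) auto
  moreover have "?l p ` sphere 0 r \<subseteq> X"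
  proof
    fix x assume "x \<in> ?l p ` sphere 0 r"
    then obtain t where "x = ?l p t" "t \<in> sphere 0 r" by blast
    then have t: "x = ?l p t" "norm t = r" by auto
    then have "D x \<noteq> 0" "x \<in> ball p R" using r0(2)[of t] r by (auto simp: A_def)
    then show "x \<in> X" using R(2) by (auto simp: X_def)
  qed
  ultimately obtain d1 where d1: "d1 > 0" "\<And>x. x \<in> ?l p ` sphere 0 r \<Longrightarrow> ball x d1 \<subseteq> X"
    using compact_in_open_uniform openX by blast
  have "compact (?l p ` cball 0 r)"
    by (intro compact_continuous_image continuous_intros) auto
  moreover have "?l p ` cball 0 r \<subseteq> ball p R"
  proof
    fix x assume "x \<in> ?l p ` cball 0 r"
    then obtain t where "x = ?l p t" "t \<in> cball 0 r" by blast
    then have t: "x = ?l p t" "norm t \<le> r" by auto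
    show "x \<in> ball p R" using t r0(2)[of t] r R by (cases "t = 0") (auto simp: A_def)
  qed
  ultimately obtain d2 where d2: "d2 > 0" "\<And>x. x \<in> ?l p ` cball 0 r \<Longrightarrow> ball x d2 \<subseteq> ball p R"
    using compact_in_open_uniform open_ball by blast
  define \<delta> where "\<delta> = min (min d1 d2) R"
  have \<delta>: "\<delta> > 0" using d1 d2 R by (simp add: \<delta>_def)
  have inX: "?l z t \<in> X" if "z \<in> ball p \<delta>" "norm t = r" for z t
  proof -
    have "?l p t \<in> ?l p ` sphere 0 r" by (rule imageI) (use that in simp)
    moreover have "?l z t \<in> ball (?l p t) d1" using that(1) by (simp add: \<delta>_def)
    ultimately show ?thesis using d1(2) by blast
  qed
  have inA: "t \<in> A z" if "z \<in> ball p \<delta>" "norm t \<le> r" for z t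
  proof -
    have "?l p t \<in> ?l p ` cball 0 r" by (rule imageI) (use that in simp)
    moreover have "?l z t \<in> ball (?l p t) d2" using that(1) by (simp add: \<delta>_def)
    ultimately show ?thesis using d2(2) unfolding A_def by blast
  qed
  \<comment> \<open>One circle, moved parallel to itself, serves all centres near \<open>p\<close>:
    by compactness its translates still avoid the zeros of \<open>D\<close>.\<close>
  define \<gamma> :: "real \<Rightarrow> complex ^ 'm" where
    "\<gamma> x = (of_real r * exp (2 * of_real pi * \<i> * of_real x)) *s v" for x
  define F where "F z = integral {0..1} (\<lambda>x. f (z + \<gamma> x) * 1)" for z
  have f': "holomorphic_Cn f X" using f by (simp add: X_def)
  have "holomorphic_Cn F (ball p \<delta>)"
    unfolding F_def
    by (rule holomorphic_Cn_integral[OF f' openX])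
       (use r inX in \<open>auto simp: \<gamma>_def norm_mult intro!: continuous_intros\<close>)
  moreover have "F z = f z" if z: "z \<in> ball p \<delta>" "D z \<noteq> 0" for z
  proof -
    define Z where "Z = {t \<in> cball 0 r. D (?l z t) = 0}"
    have A0: "0 \<in> A z" using inA[OF z(1), of 0] r by simp
    \<comment> \<open>If \<open>D\<close> is constant along the line through \<open>z\<close>, the
      constant is the nonzero number \<open>D z\<close>; otherwise the zeros in the compact disc are
      finite in number.\<close>
    have "\<not> (\<lambda>t. D (?l z t)) constant_on A z \<or> Z = {}"
    proof (rule ccontr)
      assume "\<not> ?thesis"
      then obtain c t where c: "\<And>s. s \<in> A z \<Longrightarrow> D (?l z s) = c" and t: "t \<in> Z"
        unfolding constant_on_def by auto
      have "t \<in> A z" using t inA[OF z(1)] by (auto simp: Z_def)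
      then show False using c[OF A0] c[of t] t z(2) by (simp add: Z_def)
    qed
    then have finZ: "finite Z"
    proof
      assume nc: "\<not> (\<lambda>t. D (?l z t)) constant_on A z"
      have "cball 0 r \<subseteq> A z" using inA[OF z(1)] by auto
      then show ?thesis unfolding Z_def
        using holomorphic_compact_finite_zeros[OF holD A(1) convex_connected[OF A(2)] compact_cball _ nc] by blast
    qed auto
    have Zball: "norm t < r" if "t \<in> Z" for t
    proof (rule ccontr)
      assume "\<not> norm t < r"
      then have "norm t = r" using that by (auto simp: Z_def)
      from inX[OF z(1) this] show False using that by (auto simp: Z_def X_def)
    qed
    define P where "P = {t\<in>A z. D (?l z t) \<noteq> 0}"
    define S0 where "S0 = P \<union> ball 0 r"
    have openP: "open P"
    proof -
      have "open ((\<lambda>t. D (?l z t)) -` (-{0}) \<inter> A z)"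
        using holomorphic_on_imp_continuous_on[OF holD[of z]] A(1)[of z] by (auto simp: continuous_on_open_vimage)
      moreover have "(\<lambda>t. D (?l z t)) -` (-{0}) \<inter> A z = P" by (auto simp: P_def)
      ultimately show ?thesis by simp
    qed
    have S0: "open S0" unfolding S0_def by (intro open_Un openP open_ball)
    have cb: "cball 0 r \<subseteq> S0"
    proof
      fix t :: complex assume "t \<in> cball 0 r"
      then show "t \<in> S0"
        using inX[OF z(1), of t] inA[OF z(1), of t] by (cases "norm t = r") (auto simp: S0_def P_def X_def)
    qed
    have S0Z: "S0 - Z \<subseteq> P"
      using inA[OF z(1)] by (auto simp: S0_def P_def Z_def)
    have PX: "?l z t \<in> X" if "t \<in> P" for t using that R(2) by (auto simp: P_def A_def X_def)
    have "\<exists>g. g holomorphic_on S0 \<and> (\<forall>t\<in>S0 - Z. g t = f (?l z t))"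
    proof (rule removable_singularities[OF finZ])
      show "Z \<subseteq> interior S0" using cb S0 by (auto simp: Z_def interior_open)
      show "(\<lambda>t. f (?l z t)) holomorphic_on S0 - Z"
        by (rule holomorphic_on_subset[OF holomorphic_Cn_line[OF f' openP] S0Z]) (use PX in auto)
      fix t assume t: "t \<in> Z"
      have "\<forall>\<^sub>F s in at t. s \<in> S0 - (Z - {t}) - {t}"
        using t cb finZ S0 by (intro eventually_at_in_open) (auto simp: Z_def intro!: open_Diff finite_imp_closed)
      then have "\<forall>\<^sub>F s in at t. norm (f (?l z s)) \<le> K * norm (1::complex)"
      proof eventually_elim
        case (elim s)
        then have "s \<in> P" using S0Z by auto
        then show ?case using PX[of s] bd[of "?l z s"] R(2) by (auto simp: P_def A_def X_def)
      qed
      then show "(\<lambda>t. f (?l z t)) \<in> O[at t](\<lambda>_. 1)" by (rule bigoI)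
    qed
    then obtain g where g: "g holomorphic_on S0" "\<And>t. t \<in> S0 - Z \<Longrightarrow> g t = f (?l z t)" by blast
    have onc: "of_real r * exp (2 * of_real pi * \<i> * of_real x) \<in> S0 - Z" for x :: real
      using Zball[of "of_real r * exp (2 * of_real pi * \<i> * of_real x)"] cb r by (auto simp: norm_mult)
    have "F z = integral {0..1} (\<lambda>x. g (of_real r * exp (2 * of_real pi * \<i> * of_real x)))"
      unfolding F_def \<gamma>_def using g(2)[OF onc] by simp
    also have "\<dots> = g 0" by (rule mean_value_integral[OF g(1) S0 cb r(1)])
    also have "\<dots> = f z"
    proof -
      have "0 \<in> S0" using r by (simp add: S0_def)
      then show ?thesis using g(2)[of 0] z by (auto simp: Z_def)
    qed
    finally show ?thesis .
  qed
  moreover have "ball p \<delta> \<subseteq> S" using R(2) by (auto simp: \<delta>_def)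
  ultimately show ?thesis using that[of \<delta> F] \<delta> by blast
qed

text \<open>Local extensions agree where \<open>D\<close> is nonzero, hence by density and
  continuity on every overlap. So the extension chosen at a point may be evaluated at that point
  itself.\<close>

lemma riemann_extension:
  fixes f :: "complex ^ 'm::finite \<Rightarrow> complex"
  assumes S: "open S" and D: "holomorphic_Cn D S" and dense: "S \<subseteq> closure {z\<in>S. D z \<noteq> 0}"
    and f: "holomorphic_Cn f {z\<in>S. D z \<noteq> 0}"
    and bd: "\<And>p. p \<in> S \<Longrightarrow> \<exists>T K. open T \<and> p \<in> T \<and> (\<forall>z\<in>T \<inter> S. D z \<noteq> 0 \<longrightarrow> norm (f z) \<le> K)"
  obtains F where "holomorphic_Cn F S" "\<And>z. \<lbrakk>z \<in> S; D z \<noteq> 0\<rbrakk> \<Longrightarrow> F z = f z"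
proof -
  have "\<exists>\<delta> G. p \<in> S \<longrightarrow> \<delta> > 0 \<and> ball p \<delta> \<subseteq> S \<and> holomorphic_Cn G (ball p \<delta>) \<and>
      (\<forall>z\<in>ball p \<delta>. D z \<noteq> 0 \<longrightarrow> G z = f z)" for p
  proof (cases "p \<in> S")
    case True
    obtain T K where T: "open T" "p \<in> T" "\<forall>z\<in>T \<inter> S. D z \<noteq> 0 \<longrightarrow> norm (f z) \<le> K" using bd[OF True] by blast
    obtain \<delta> G where "\<delta> > 0" "ball p \<delta> \<subseteq> S" "holomorphic_Cn G (ball p \<delta>)"
        "\<And>z. \<lbrakk>z \<in> ball p \<delta>; D z \<noteq> 0\<rbrakk> \<Longrightarrow> G z = f z"
      by (rule riemann_extension_local[OF S D dense f True T(1,2), of K]) (use T(3) in auto)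
    then show ?thesis by blast
  qed auto
  then obtain \<delta> G where G: "\<And>p. p \<in> S \<Longrightarrow> \<delta> p > 0 \<and> ball p (\<delta> p) \<subseteq> S \<and> holomorphic_Cn (G p) (ball p (\<delta> p)) \<and>
      (\<forall>z\<in>ball p (\<delta> p). D z \<noteq> 0 \<longrightarrow> G p z = f z)" by metis
  define F where "F z = G z z" for z
  have FG: "F z = G p z" if p: "p \<in> S" and z: "z \<in> ball p (\<delta> p)" for p z
  proof -
    have zS: "z \<in> S" using G[OF p] z by blast
    show ?thesis unfolding F_def
    proof (rule eq_on_dense[where f="G z" and g="G p" and z=z and T="ball p (\<delta> p) \<inter> ball z (\<delta> z)" and X="{z\<in>S. D z \<noteq> 0}"])
      show "continuous_on (ball p (\<delta> p) \<inter> ball z (\<delta> z)) (G z)"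
        "continuous_on (ball p (\<delta> p) \<inter> ball z (\<delta> z)) (G p)"
        using G[OF p] G[OF zS] by (auto intro: continuous_on_subset holomorphic_Cn_continuous_on)
      show "G z y = G p y" if "y \<in> {z \<in> S. D z \<noteq> 0}" "y \<in> ball p (\<delta> p) \<inter> ball z (\<delta> z)" for y
        using that G[OF p] G[OF zS] by auto
      show "ball p (\<delta> p) \<inter> ball z (\<delta> z) \<subseteq> closure {z \<in> S. D z \<noteq> 0}"
        using dense G[OF p] by blast
      show "z \<in> ball p (\<delta> p) \<inter> ball z (\<delta> z)" using z G[OF zS] by auto
    qed auto
  qed
  have "holomorphic_Cn F S"
  proof (rule holomorphic_Cn_local)
    fix p assume p: "p \<in> S"
    have "holomorphic_Cn F (ball p (\<delta> p))"
      by (rule holomorphic_Cn_transform[where f="G p"]) (use G[OF p] FG[OF p] in auto)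
    then show "\<exists>T. p \<in> T \<and> holomorphic_Cn F T" using G[OF p] by (intro exI[of _ "ball p (\<delta> p)"]) auto
  qed
  moreover have "F z = f z" if "z \<in> S" "D z \<noteq> 0" for z
    using G[OF that(1)] that by (auto simp: F_def)
  ultimately show ?thesis using that by blast
qed

section \<open>Sections of multi-valued functions\<close>

definition is_section ::
  "'a::topological_space set \<Rightarrow> ('a \<Rightarrow> 'b::topological_space set) \<Rightarrow> ('a \<Rightarrow> 'b) \<Rightarrow> bool" where
  "is_section Y V f \<longleftrightarrow> continuous_on Y f \<and> (\<forall>y\<in>Y. f y \<in> V y)"

text \<open>The set-valued substitute for a trivial covering; that sections through different values
  do not meet is left to \<open>separated_on\<close>.\<close>

definition has_sections :: "'a::topological_space set \<Rightarrow> ('a \<Rightarrow> 'b::topological_space set) \<Rightarrow> bool" where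
  "has_sections Y V \<longleftrightarrow> (\<forall>q\<in>Y. \<forall>w\<in>V q. \<exists>f. is_section Y V f \<and> f q = w)"

text \<open>A locally uniform gap between values replaces discreteness of the fibres of a covering:
  two sections that are close near a point must agree there.\<close>

definition separated_on :: "'a::metric_space set \<Rightarrow> ('a \<Rightarrow> 'b::metric_space set) \<Rightarrow> bool" where
  "separated_on X V \<longleftrightarrow> (\<forall>q\<in>X. \<exists>\<epsilon>>0. \<exists>\<delta>>0. \<forall>y\<in>X \<inter> ball q \<epsilon>. \<forall>w\<in>V y. \<forall>w'\<in>V y. w \<noteq> w' \<longrightarrow> \<delta> \<le> dist w w')"

lemma is_section_subset: "is_section Y V f \<Longrightarrow> Z \<subseteq> Y \<Longrightarrow> is_section Z V f"
  unfolding is_section_def by (auto intro: continuous_on_subset)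

lemma has_sectionsE:
  assumes "has_sections Y V" "q \<in> Y" "w \<in> V q"
  obtains f where "is_section Y V f" "f q = w"
  using assms unfolding has_sections_def by blast

lemma has_sections_imp_subset: "has_sections Y V \<Longrightarrow> Z \<subseteq> Y \<Longrightarrow> has_sections Z V"
  unfolding has_sections_def by (meson is_section_subset subsetD)

lemma separated_onI:
  assumes "\<And>q. q \<in> X \<Longrightarrow> \<exists>\<epsilon> \<delta>. \<epsilon> > 0 \<and> \<delta> > 0 \<and>
    (\<forall>y w w'. y \<in> X \<longrightarrow> dist q y < \<epsilon> \<longrightarrow> w \<in> V y \<longrightarrow> w' \<in> V y \<longrightarrow> w \<noteq> w' \<longrightarrow> \<delta> \<le> dist w w')"
  shows "separated_on X V"
  unfolding separated_on_def
proof
  fix q assume "q \<in> X"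
  from assms[OF this] obtain \<epsilon> \<delta> where *: "\<epsilon> > 0" "\<delta> > 0"
    "\<forall>y w w'. y \<in> X \<longrightarrow> dist q y < \<epsilon> \<longrightarrow> w \<in> V y \<longrightarrow> w' \<in> V y \<longrightarrow> w \<noteq> w' \<longrightarrow> \<delta> \<le> dist w w'"
    by (elim exE conjE)
  show "\<exists>\<epsilon>>0. \<exists>\<delta>>0. \<forall>y\<in>X \<inter> ball q \<epsilon>. \<forall>w\<in>V y. \<forall>w'\<in>V y. w \<noteq> w' \<longrightarrow> \<delta> \<le> dist w w'"
    by (rule exI[of _ \<epsilon>], rule conjI[OF *(1)], rule exI[of _ \<delta>], rule conjI[OF *(2)]) (use *(3) in auto)
qed

lemma separated_onE:
  assumes "separated_on X V" "q \<in> X"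
  obtains \<epsilon> \<delta> where "\<epsilon> > 0" "\<delta> > 0"
    "\<forall>y w w'. y \<in> X \<longrightarrow> dist q y < \<epsilon> \<longrightarrow> w \<in> V y \<longrightarrow> w' \<in> V y \<longrightarrow> w \<noteq> w' \<longrightarrow> \<delta> \<le> dist w w'"
proof -
  from assms have "\<exists>\<epsilon>>0. \<exists>\<delta>>0. \<forall>y\<in>X \<inter> ball q \<epsilon>. \<forall>w\<in>V y. \<forall>w'\<in>V y. w \<noteq> w' \<longrightarrow> \<delta> \<le> dist w w'"
    unfolding separated_on_def by (rule bspec)
  then obtain \<epsilon> \<delta> where *: "\<epsilon> > 0" "\<delta> > 0"
    "\<forall>y\<in>X \<inter> ball q \<epsilon>. \<forall>w\<in>V y. \<forall>w'\<in>V y. w \<noteq> w' \<longrightarrow> \<delta> \<le> dist w w'"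
    by (elim exE conjE)
  show ?thesis by (rule that[OF *(1,2)]) (use *(3) in simp)
qed

lemma separated_on_subset:
  assumes "separated_on X V" "Y \<subseteq> X" "\<And>y. y \<in> Y \<Longrightarrow> V' y \<subseteq> V y"
  shows "separated_on Y V'"
proof (rule separated_onI)
  fix q assume "q \<in> Y"
  then have "q \<in> X" using assms(2) by auto
  then obtain \<epsilon> \<delta> where "\<epsilon> > 0" "\<delta> > 0"
    "\<forall>y w w'. y \<in> X \<longrightarrow> dist q y < \<epsilon> \<longrightarrow> w \<in> V y \<longrightarrow> w' \<in> V y \<longrightarrow> w \<noteq> w' \<longrightarrow> \<delta> \<le> dist w w'"
    by (rule separated_onE[OF assms(1)])
  then show "\<exists>\<epsilon> \<delta>. \<epsilon> > 0 \<and> \<delta> > 0 \<and>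
    (\<forall>y w w'. y \<in> Y \<longrightarrow> dist q y < \<epsilon> \<longrightarrow> w \<in> V' y \<longrightarrow> w' \<in> V' y \<longrightarrow> w \<noteq> w' \<longrightarrow> \<delta> \<le> dist w w')"
    using assms(2,3) by (intro exI[of _ \<epsilon>] exI[of _ \<delta>]) (auto simp: subset_iff)
qed

text \<open>The distance between the two sections is continuous and, because of the local gap, takes
  no small positive values; so the sections agree on a set that is open and closed in
  \<open>Y\<close>.\<close>

lemma section_unique:
  assumes sep: "separated_on X V" and Y: "connected Y" "Y \<subseteq> X"
    and f: "is_section Y V f" and g: "is_section Y V g" and q: "q \<in> Y" "f q = g q" and y: "y \<in> Y"
  shows "f y = g y"
proof -
  have cont: "continuous_on Y (\<lambda>y. dist (f y) (g y))"
    using f g unfolding is_section_def by (intro continuous_intros) auto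
  let ?E = "{y \<in> Y. dist (f y) (g y) = 0}"
  have "closedin (top_of_set Y) ?E"
    by (rule continuous_closedin_preimage_constant[OF cont])
  moreover have "openin (top_of_set Y) ?E"
    unfolding openin_euclidean_subtopology_iff
  proof (intro conjI ballI)
    fix p assume p: "p \<in> ?E"
    then have "p \<in> X" using Y by auto
    then obtain \<epsilon> \<delta> where e: "\<epsilon> > 0" "\<delta> > 0"
      "\<forall>y w w'. y \<in> X \<longrightarrow> dist p y < \<epsilon> \<longrightarrow> w \<in> V y \<longrightarrow> w' \<in> V y \<longrightarrow> w \<noteq> w' \<longrightarrow> \<delta> \<le> dist w w'"
      by (rule separated_onE[OF sep])
    have pY: "p \<in> Y" using p by auto
    from cont pY e(2) have "\<exists>d>0. \<forall>y\<in>Y. dist y p < d \<longrightarrow> dist (dist (f y) (g y)) (dist (f p) (g p)) < \<delta>"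
      unfolding continuous_on_iff by simp
    then obtain d where d: "d > 0" "\<And>y. y \<in> Y \<Longrightarrow> dist y p < d \<Longrightarrow> dist (dist (f y) (g y)) (dist (f p) (g p)) < \<delta>"
      by auto
    show "\<exists>e>0. \<forall>y\<in>Y. dist y p < e \<longrightarrow> y \<in> ?E"
    proof (intro exI[of _ "min d \<epsilon>"] conjI ballI impI)
      fix y assume y: "y \<in> Y" "dist y p < min d \<epsilon>"
      have "dist (f y) (g y) < \<delta>" using d(2)[of y] y p by (simp add: dist_real_def)
      moreover have "f y \<in> V y" "g y \<in> V y" using f g y unfolding is_section_def by auto
      ultimately have "f y = g y" using e(3)[rule_format, of y "f y" "g y"] y Y(2) by (force simp: dist_commute)
      then show "y \<in> ?E" using y by simp
    qed (use d e in auto)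
  qed auto
  ultimately have "?E = {} \<or> ?E = Y" using Y(1) unfolding connected_clopen by blast
  then show ?thesis using q y by auto
qed

lemma continuous_on_local:
  assumes "open S" "\<And>z. z \<in> S \<Longrightarrow> \<exists>T g. open T \<and> z \<in> T \<and> continuous_on (T \<inter> S) g \<and> (\<forall>y\<in>T \<inter> S. f y = g y)"
  shows "continuous_on S f"
proof -
  obtain T g where T: "\<And>z. z \<in> S \<Longrightarrow> open (T z) \<and> z \<in> T z \<and> continuous_on (T z \<inter> S) (g z) \<and> (\<forall>y\<in>T z \<inter> S. f y = g z y)"
    using assms(2) by metis
  have "continuous_on (\<Union>z\<in>S. T z \<inter> S) f"
  proof (rule continuous_on_open_UN)
    fix z assume "z \<in> S"
    then show "open (T z \<inter> S)" "continuous_on (T z \<inter> S) f"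
      using T[of z] assms(1) by (auto intro: continuous_on_eq[where f="g z"])
  qed
  moreover have "(\<Union>z\<in>S. T z \<inter> S) = S" using T by auto
  ultimately show ?thesis by simp
qed

section \<open>Monodromy over convex sets minus a thin set\<close>

context
  fixes C X :: "'a::euclidean_space set" and V :: "'a \<Rightarrow> 'b::metric_space set"
  assumes openC: "open C" and convC: "convex C" and openX: "open X" and XC: "X \<subseteq> C"
    and conn: "\<And>Q. \<lbrakk>open Q; convex Q; Q \<noteq> {}; Q \<subseteq> C\<rbrakk> \<Longrightarrow> connected (Q \<inter> X) \<and> Q \<inter> X \<noteq> {}"
    and sep: "separated_on X V"
begin

lemma section_unique_convex:
  assumes "open Q" "convex Q" "Q \<subseteq> C" "is_section (Q \<inter> X) V f" "is_section (Q \<inter> X) V g"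
    "q \<in> Q \<inter> X" "f q = g q" "y \<in> Q \<inter> X"
  shows "f y = g y"
  using section_unique[OF sep, of "Q \<inter> X" f g q y] conn[of Q] assms by auto

text \<open>The convex set is exhausted by copies shrunk towards \<open>q\<close>. The smallest copy
  lies in one ball over which sections exist, and each enlargement is small compared with
  \<epsilon>, so the section grows by local continuation in balls centred in the previous
  copy.\<close>

lemma section_extend_scaled:
  assumes C': "open C'" "convex C'" "C' \<subseteq> C" "q \<in> C'" "C' \<subseteq> ball q R" and e: "\<epsilon> > 0"
    and loc: "\<And>p. p \<in> C' \<Longrightarrow> ball p \<epsilon> \<subseteq> C \<and> has_sections (ball p \<epsilon> \<inter> X) V"
    and qX: "q \<in> X" and w: "w \<in> V q"
  obtains f where "is_section (C' \<inter> X) V f" "f q = w"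
proof -
  have R: "R > 0" using C'(4,5) by force
  define D where "D t = {z. q + (1 / t) *\<^sub>R (z - q) \<in> C'}" for t :: real
  \<comment> \<open>Enlarging the scale by \<delta> moves a point by at most
    \<open>\<delta> * R = \<epsilon> / 3\<close>, safely below the bound
    \<open>\<epsilon> / 2\<close> in \<open>\<pi>dist\<close>.\<close>
  define \<delta> where "\<delta> = \<epsilon> / (3 * R)"
  define s where "s n = min 1 (real (Suc n) * \<delta>)" for n
  have \<delta>: "\<delta> > 0" using e R by (simp add: \<delta>_def)
  have s: "s n > 0" "s n \<le> 1" "s n \<le> s (Suc n)" "s (Suc n) - s n \<le> \<delta>" for n
    using \<delta> by (auto simp: s_def algebra_simps intro!: add_pos_nonneg)
  have openD: "open (D t)" for t
  proof -
    have "open ((\<lambda>z. q + (1 / t) *\<^sub>R (z - q)) -` C')"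
      by (intro continuous_open_vimage C' continuous_intros) 
    then show ?thesis by (simp add: D_def vimage_def)
  qed
  have convD: "convex (D t)" for t
  proof (rule convexI)
    fix x y u v assume *: "x \<in> D t" "y \<in> D t" "0 \<le> u" "0 \<le> v" "u + v = (1::real)"
    have v: "v = 1 - u" using * by simp
    have "q + (1 / t) *\<^sub>R ((u *\<^sub>R x + v *\<^sub>R y) - q) = u *\<^sub>R (q + (1 / t) *\<^sub>R (x - q)) + v *\<^sub>R (q + (1 / t) *\<^sub>R (y - q))"
      unfolding v by (simp only: algebra_simps scaleR_one scaleR_scaleR) (simp add: diff_divide_distrib algebra_simps)
    then show "u *\<^sub>R x + v *\<^sub>R y \<in> D t"
      using * convexD[OF C'(2), of "q + (1 / t) *\<^sub>R (x - q)" "q + (1 / t) *\<^sub>R (y - q)" u v] by (simp add: D_def)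
  qed
  have qD: "q \<in> D t" for t using C' by (simp add: D_def)
  have DR: "dist z q < t * R" if "z \<in> D t" "t > 0" for z t
  proof -
    have "q + (1 / t) *\<^sub>R (z - q) \<in> ball q R" using that C' unfolding D_def by blast
    moreover have "dist q (q + (1 / t) *\<^sub>R (z - q)) = norm ((1 / t) *\<^sub>R (z - q))"
      by (metis add_diff_cancel_left' dist_commute dist_norm)
    moreover have "\<dots> = dist z q / t" unfolding norm_scaleR dist_norm using that by simp
    ultimately have "dist z q / t < R" by (simp only: mem_ball)
    then show ?thesis using that by (simp add: field_simps)
  qed
  have D1: "D 1 = C'" by (simp add: D_def)
  have Dmono: "D t \<subseteq> D t'" if "0 < t" "t \<le> t'" for t t'
  proof
    fix z assume z: "z \<in> D t"
    have eq: "q + (1 / t') *\<^sub>R (z - q) = (1 - t / t') *\<^sub>R q + (t / t') *\<^sub>R (q + (1 / t) *\<^sub>R (z - q))"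
      using that by (simp add: algebra_simps)
    show "z \<in> D t'"
      using z that C'(2,4) unfolding D_def mem_Collect_eq eq
      by (intro convexD) (auto simp: field_simps)
  qed
  have DC: "D t \<subseteq> C'" if "0 < t" "t \<le> 1" for t using Dmono[OF that] D1 by simp
  have main: "\<exists>f. is_section (D (s n) \<inter> X) V f \<and> f q = w" for n
  proof (induction n)
    case 0
    have "D (s 0) \<subseteq> ball q \<epsilon>"
    proof
      fix z assume "z \<in> D (s 0)"
      then have "dist z q < s 0 * R" using DR s(1) by blast
      also have "\<dots> \<le> \<delta> * R" using R by (intro mult_right_mono) (auto simp: s_def)
      also have "\<dots> < \<epsilon>" using e R by (simp add: \<delta>_def)
      finally show "z \<in> ball q \<epsilon>" by (simp add: dist_commute)
    qed
    moreover obtain f where "is_section (ball q \<epsilon> \<inter> X) V f" "f q = w"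
      using has_sectionsE[OF conjunct2[OF loc[OF C'(4)]], of q w] qX w e by auto
    ultimately show ?case by (intro exI[of _ f]) (auto intro: is_section_subset)
  next
    case (Suc n)
    define t t' where "t = s n" "t' = s (Suc n)"
    have t: "0 < t" "t \<le> t'" "0 < t'" "t' \<le> 1" "t' - t \<le> \<delta>" "t \<le> 1"
      using s[of n] s[of "Suc n"] unfolding t_t'_def by auto
    obtain f where f: "is_section (D t \<inter> X) V f" "f q = w" using Suc unfolding t_t'_def by auto
    \<comment> \<open>A common point of \<open>X\<close>, the ball and \<open>D t\<close> selects
      the section over the ball; as the overlap is convex, this section agrees with \<open>f\<close>
      on all of it.\<close>
    have "\<exists>b. is_section (ball y \<epsilon> \<inter> X) V b \<and> (\<forall>x\<in>ball y \<epsilon> \<inter> D t \<inter> X. b x = f x)" if y: "y \<in> D t" for y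
    proof -
      have yC: "y \<in> C'" using y DC[of t] t by auto
      let ?Q = "ball y \<epsilon> \<inter> D t"
      have Q: "open ?Q" "convex ?Q" "?Q \<noteq> {}" "?Q \<subseteq> C"
      proof -
        have "y \<in> ?Q" using y e by simp
        then show "?Q \<noteq> {}" by blast
      qed (use openD[of t] convD[of t] loc[OF yC] in \<open>auto intro: convex_Int\<close>)
      then obtain x where x: "x \<in> ?Q \<inter> X" using conn by blast
      then have "f x \<in> V x" using f unfolding is_section_def by auto
      then obtain b where b: "is_section (ball y \<epsilon> \<inter> X) V b" "b x = f x"
        using has_sectionsE[OF conjunct2[OF loc[OF yC]], of x "f x"] x by auto
      have "b z = f z" if "z \<in> ?Q \<inter> X" for z
        by (rule section_unique_convex[OF Q(1,2,4) is_section_subset[OF b(1)] is_section_subset[OF f(1)] x b(2) that]) auto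
      then show ?thesis using b by auto
    qed
    then obtain b where b: "\<And>y. y \<in> D t \<Longrightarrow> is_section (ball y \<epsilon> \<inter> X) V (b y)"
      "\<And>y x. y \<in> D t \<Longrightarrow> x \<in> ball y \<epsilon> \<inter> D t \<inter> X \<Longrightarrow> b y x = f x" by metis
    \<comment> \<open>Shrinking maps the larger copy into the smaller one; \<open>\<pi> z\<close>
      selects the ball in which the value at \<open>z\<close> is computed.\<close>
    define \<pi> where "\<pi> z = q + (t / t') *\<^sub>R (z - q)" for z
    have \<pi>D: "\<pi> z \<in> D t" if "z \<in> D t'" for z
      using that t by (simp add: \<pi>_def D_def)
    have \<pi>dist: "dist z (\<pi> z) < \<epsilon> / 2" if "z \<in> D t'" for z
    proof -
      have "z - \<pi> z = (1 - t / t') *\<^sub>R (z - q)" by (simp add: \<pi>_def algebra_simps)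
      then have "dist z (\<pi> z) = (1 - t / t') * dist z q"
        using t by (simp add: dist_norm)
      also have "\<dots> \<le> (1 - t / t') * (t' * R)"
        using DR[OF that] t by (intro mult_left_mono) auto
      also have "\<dots> = (t' - t) * R" using t by (simp add: field_simps)
      also have "\<dots> \<le> \<delta> * R" using t R by (intro mult_right_mono) auto
      also have "\<dots> < \<epsilon> / 2" using e R by (simp add: \<delta>_def)
      finally show ?thesis .
    qed
    have \<pi>lip: "dist (\<pi> z) (\<pi> z') \<le> dist z z'" for z z'
    proof -
      have "\<pi> z - \<pi> z' = (t / t') *\<^sub>R (z - z')" by (simp add: \<pi>_def algebra_simps)
      then have "dist (\<pi> z) (\<pi> z') = (t / t') * dist z z'" using t by (simp add: dist_norm)
      also have "\<dots> \<le> 1 * dist z z'" using t by (intro mult_right_mono) auto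
      finally show ?thesis by simp
    qed
    \<comment> \<open>The overlap of the two balls may leave \<open>D t\<close>, where
      \<open>f\<close> is not defined. But the centres are so close that a point of
      \<open>D t\<close> lies in both balls, and there both sections equal \<open>f\<close>.\<close>
    have agree: "b y z = b y' z"
      if y: "y \<in> D t" "y' \<in> D t" "dist y y' < \<epsilon>" and z: "z \<in> ball y \<epsilon> \<inter> ball y' \<epsilon> \<inter> X" for y y' z
    proof -
      let ?B = "ball y \<epsilon> \<inter> ball y' \<epsilon>"
      have yC: "y \<in> C'" using y DC[of t] t by auto
      have B: "open ?B" "convex ?B" "?B \<subseteq> C" using loc[OF yC] by (auto intro: convex_Int)
      let ?Q = "?B \<inter> D t"
      have "open ?Q" "convex ?Q" "?Q \<noteq> {}" "?Q \<subseteq> C"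
      proof -
        have "y \<in> ?Q" using y e by (simp add: dist_commute)
        then show "?Q \<noteq> {}" by blast
      qed (use openD[of t] convD[of t] B in \<open>auto intro: convex_Int\<close>)
      then obtain x where x: "x \<in> ?Q \<inter> X" using conn by blast
      then have eq: "b y x = b y' x" using b(2)[OF y(1), of x] b(2)[OF y(2), of x] by auto
      show ?thesis
        by (rule section_unique_convex[OF B is_section_subset[OF b(1)[OF y(1)]] is_section_subset[OF b(1)[OF y(2)]] _ eq z])
           (use x in auto)
    qed
    define f' where "f' z = b (\<pi> z) z" for z
    have near: "f' z = b (\<pi> z1) z" if "z \<in> D t' \<inter> X" "z1 \<in> D t'" "dist z z1 < \<epsilon> / 2" for z z1
      unfolding f'_def
    proof (rule agree)
      show "dist (\<pi> z) (\<pi> z1) < \<epsilon>" using \<pi>lip[of z z1] that e by linarith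
      show "z \<in> ball (\<pi> z) \<epsilon> \<inter> ball (\<pi> z1) \<epsilon> \<inter> X"
        using \<pi>dist[of z] \<pi>dist[of z1] that e dist_triangle[of "\<pi> z1" z z1] by (auto simp: dist_commute)
    qed (use \<pi>D that in auto)
    have "is_section (D t' \<inter> X) V f'"
      unfolding is_section_def
    proof
      show "continuous_on (D t' \<inter> X) f'"
      proof (rule continuous_on_local)
        fix z1 assume z1: "z1 \<in> D t' \<inter> X"
        have "continuous_on (ball z1 (\<epsilon> / 2) \<inter> (D t' \<inter> X)) (b (\<pi> z1))"
        proof (rule continuous_on_subset)
          show "continuous_on (ball (\<pi> z1) \<epsilon> \<inter> X) (b (\<pi> z1))"
            using b(1)[OF \<pi>D] z1 unfolding is_section_def by auto
          show "ball z1 (\<epsilon> / 2) \<inter> (D t' \<inter> X) \<subseteq> ball (\<pi> z1) \<epsilon> \<inter> X"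
          proof
            fix z assume z: "z \<in> ball z1 (\<epsilon> / 2) \<inter> (D t' \<inter> X)"
            show "z \<in> ball (\<pi> z1) \<epsilon> \<inter> X"
              using z z1 \<pi>dist[of z1] dist_triangle[of "\<pi> z1" z z1] by (auto simp: dist_commute)
          qed
        qed
        then show "\<exists>T g. open T \<and> z1 \<in> T \<and> continuous_on (T \<inter> (D t' \<inter> X)) g \<and> (\<forall>y\<in>T \<inter> (D t' \<inter> X). f' y = g y)"
          using near z1 e by (intro exI[of _ "ball z1 (\<epsilon> / 2)"] exI[of _ "b (\<pi> z1)"]) (auto simp: dist_commute)
      qed (use openD openX in auto)
      show "\<forall>y\<in>D t' \<inter> X. f' y \<in> V y"
      proof
        fix z assume z: "z \<in> D t' \<inter> X"
        then have "z \<in> ball (\<pi> z) \<epsilon> \<inter> X" using \<pi>dist[of z] e by (auto simp: dist_commute)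
        then show "f' z \<in> V z" using b(1)[OF \<pi>D, of z] z unfolding is_section_def f'_def by auto
      qed
    qed
    moreover have "f' q = w"
      using b(2)[of q q] qD[of t] qX e f(2) by (simp add: f'_def \<pi>_def)
    ultimately show ?case unfolding t_t'_def by blast
  qed
  obtain n where "1 / \<delta> < real n" using reals_Archimedean2 by blast
  then have "1 < real (Suc n) * \<delta>" using \<delta> by (simp add: field_simps)
  then have "s n = 1" by (simp add: s_def)
  with main[of n] D1 show ?thesis using that by auto
qed

text \<open>Locally split multi-valued functions on a convex set split globally: sections are extended to
  neighbourhoods of segments from a base point, and these neighbourhoods have convex intersections.\<close>

theorem global_sections:
  assumes loc: "\<And>p. p \<in> C \<Longrightarrow> \<exists>\<epsilon>>0. ball p \<epsilon> \<subseteq> C \<and> has_sections (ball p \<epsilon> \<inter> X) V"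
  shows "has_sections X V"
  unfolding has_sections_def
proof (intro ballI)
  fix q w assume q: "q \<in> X" and w: "w \<in> V q"
  have "\<exists>Q f. open Q \<and> convex Q \<and> Q \<subseteq> C \<and> q \<in> Q \<and> z \<in> Q \<and> is_section (Q \<inter> X) V f \<and> f q = w" if z: "z \<in> C" for z
  proof -
    let ?K = "closed_segment q z"
    have KC: "?K \<subseteq> C" using convC q XC z by (intro closed_segment_subset) auto
    obtain e where e: "\<And>p. p \<in> C \<Longrightarrow> e p > 0 \<and> ball p (e p) \<subseteq> C \<and> has_sections (ball p (e p) \<inter> X) V"
      using loc by metis
    \<comment> \<open>A Lebesgue number of the segment turns the pointwise radii into a uniform
      one.\<close>
    obtain \<epsilon> where \<epsilon>: "\<epsilon> > 0" "\<And>p. p \<in> ?K \<Longrightarrow> \<exists>G\<in>(\<lambda>p. ball p (e p)) ` ?K. ball p \<epsilon> \<subseteq> G"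
      by (rule Heine_Borel_lemma[of ?K "(\<lambda>p. ball p (e p)) ` ?K"]) (use e KC in \<open>auto 4 4\<close>)
    have good: "ball p \<epsilon> \<subseteq> C \<and> has_sections (ball p \<epsilon> \<inter> X) V" if pK: "p \<in> ?K" for p
    proof -
      obtain p' where p': "p' \<in> ?K" "ball p \<epsilon> \<subseteq> ball p' (e p')" using \<epsilon>(2)[OF pK] by auto
      then show ?thesis using e[of p'] KC
        by (meson Int_mono has_sections_imp_subset order_refl subset_trans subsetD)
    qed
    \<comment> \<open>A Minkowski sum of convex sets, so this neighbourhood of the segment is
      convex. The half radius keeps a ball of radius \<open>\<epsilon> / 2\<close> around each of
      its points inside a good ball.\<close>
    define Q where "Q = (\<Union>x\<in>?K. \<Union>y\<in>ball 0 (\<epsilon> / 2). {x + y})"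
    have Q: "open Q" "convex Q"
      unfolding Q_def by (auto intro!: open_sums convex_sums)
    have Qin: "\<exists>p\<in>?K. y \<in> ball p (\<epsilon> / 2)" if y: "y \<in> Q" for y
    proof -
      obtain p x where "p \<in> ?K" "x \<in> ball 0 (\<epsilon> / 2)" "y = p + x" using y unfolding Q_def by blast
      then show ?thesis by (intro bexI[of _ p]) (auto simp: dist_norm)
    qed
    have good': "ball y (\<epsilon> / 2) \<subseteq> C \<and> has_sections (ball y (\<epsilon> / 2) \<inter> X) V" if y: "y \<in> Q" for y
    proof -
      obtain p where p: "p \<in> ?K" "y \<in> ball p (\<epsilon> / 2)" using Qin[OF y] by blast
      have "ball y (\<epsilon> / 2) \<subseteq> ball p \<epsilon>"
      proof
        fix x assume "x \<in> ball y (\<epsilon> / 2)"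
        then show "x \<in> ball p \<epsilon>" using p(2) dist_triangle[of p x y] by simp
      qed
      then show ?thesis using good[OF p(1)] by (meson Int_mono has_sections_imp_subset order_refl subset_trans)
    qed
    have KQ: "?K \<subseteq> Q" using \<epsilon>(1) by (auto simp: Q_def intro!: bexI[of _ 0])
    have QC: "Q \<subseteq> C" using good' \<epsilon>(1) by (meson centre_in_ball half_gt_zero subset_iff)
    have "Q \<subseteq> ball q (dist q z + \<epsilon>)"
    proof
      fix y assume "y \<in> Q"
      then obtain p where p: "p \<in> ?K" "dist p y < \<epsilon> / 2" using Qin by auto
      have "dist q p \<le> dist q z" using p(1) by (metis dist_commute dist_in_closed_segment)
      then show "y \<in> ball q (dist q z + \<epsilon>)" using p(2) dist_triangle[of q y p] \<epsilon>(1) by simp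
    qed
    moreover have "q \<in> Q" "z \<in> Q" using KQ by auto
    moreover obtain f where "is_section (Q \<inter> X) V f" "f q = w"
      by (rule section_extend_scaled[OF Q QC \<open>q \<in> Q\<close> calculation(1) _ good' q w]) (use \<epsilon> in auto)
    ultimately show ?thesis using Q QC by blast
  qed
  then obtain Q f where Q: "\<And>z. z \<in> C \<Longrightarrow> open (Q z) \<and> convex (Q z) \<and> Q z \<subseteq> C \<and> q \<in> Q z \<and> z \<in> Q z \<and> is_section (Q z \<inter> X) V (f z) \<and> f z q = w"
    by metis
  define F where "F z = f z z" for z
  have Fz: "F z = f z1 z" if "z1 \<in> C" "z \<in> Q z1 \<inter> X" for z z1
  proof -
    have zC: "z \<in> C" using that Q[of z1] by auto
    \<comment> \<open>The two neighbourhoods meet in a convex set that contains \<open>q\<close>,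
      where both sections take the value \<open>w\<close>.\<close>
    show ?thesis unfolding F_def
      by (rule section_unique_convex[of "Q z \<inter> Q z1" "f z" "f z1" q])
         (use Q[OF zC] Q[OF that(1)] that q in \<open>auto intro: convex_Int is_section_subset\<close>)
  qed
  have "is_section X V F"
    unfolding is_section_def
  proof
    show "continuous_on X F"
    proof (rule continuous_on_local[OF openX])
      fix z1 assume "z1 \<in> X"
      then have z1: "z1 \<in> C" using XC by auto
      show "\<exists>T g. open T \<and> z1 \<in> T \<and> continuous_on (T \<inter> X) g \<and> (\<forall>y\<in>T \<inter> X. F y = g y)"
        using Q[OF z1] Fz[OF z1] unfolding is_section_def by (intro exI[of _ "Q z1"] exI[of _ "f z1"]) auto
    qed
    show "\<forall>z\<in>X. F z \<in> V z"
      using Q XC unfolding F_def is_section_def by (meson IntI subsetD)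
  qed
  moreover have "F q = w" using Q[of q] q XC by (auto simp: F_def)
  ultimately show "\<exists>f. is_section X V f \<and> f q = w" by blast
qed

end

section \<open>Roots of polynomials with holomorphic coefficients\<close>

text \<open>The modulus of \<open>poly p w\<close> is that of the leading coefficient times the
  product of the distances from \<open>w\<close> to the roots; if all distances were at least
  \<open>e\<close>, the product would be too large.\<close>

lemma poly_root_near:
  fixes p :: "complex poly"
  assumes n: "degree p = n" "n > 0" and e: "e > 0" and less: "norm (poly p w) < norm (lead_coeff p) * e ^ n"
  obtains r where "poly p r = 0" "dist w r < e"
proof -
  obtain root where "smult (lead_coeff p) (\<Prod>i<degree p. [:-root i, 1:]) = p"
    by (rule complex_poly_decompose')
  then have p: "p = smult (lead_coeff p) (\<Prod>i<n. [:-root i, 1:])" using n by simp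
  have eval: "poly p x = lead_coeff p * (\<Prod>i<n. x - root i)" for x
    by (subst p) (simp add: poly_prod)
  have "\<exists>i<n. dist w (root i) < e"
  proof (rule ccontr)
    assume "\<not> (\<exists>i<n. dist w (root i) < e)"
    then have "(\<Prod>i<n. e) \<le> (\<Prod>i<n. norm (w - root i))"
    proof (intro prod_mono conjI)
      fix i assume "i \<in> {..<n}"
      then have "\<not> dist w (root i) < e" using \<open>\<not> (\<exists>i<n. dist w (root i) < e)\<close> by blast
      then show "e \<le> norm (w - root i)" by (simp add: dist_norm)
    qed (use e in simp)
    then have "norm (lead_coeff p) * e ^ n \<le> norm (poly p w)"
      unfolding eval by (simp add: norm_mult prod_norm mult_left_mono)
    with less show False by simp
  qed
  then obtain i where "i < n" "dist w (root i) < e" by blast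
  then show ?thesis using that[of "root i"] by (auto simp: eval)
qed

lemma finite_separated:
  fixes R :: "'a::metric_space set"
  assumes "finite R"
  obtains d where "d > 0" "\<And>x y. \<lbrakk>x \<in> R; y \<in> R; x \<noteq> y\<rbrakk> \<Longrightarrow> d \<le> dist x y"
proof -
  have "\<exists>d>0. \<forall>x\<in>R. x \<noteq> a \<longrightarrow> d \<le> dist a x" for a
    using finite_set_avoid[OF assms] by blast
  then obtain d where d: "\<And>a. d a > 0" "\<And>a x. x \<in> R \<Longrightarrow> x \<noteq> a \<Longrightarrow> d a \<le> dist a x" by metis
  show ?thesis
  proof (rule that[of "Min (insert 1 (d ` R))"])
    show "0 < Min (insert 1 (d ` R))" using assms d(1) by auto
    show "Min (insert 1 (d ` R)) \<le> dist x y" if "x \<in> R" "y \<in> R" "x \<noteq> y" for x y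
      using d(2)[of y x] that assms by (auto simp: Min_le_iff)
  qed
qed

text \<open>At a multiple root the cofactor of the linear factor would have the same set of roots as
  \<open>p\<close>, but its degree is too small for so many.\<close>

lemma simple_root_pderiv:
  fixes p :: "complex poly"
  assumes "card {w. poly p w = 0} = degree p" "degree p > 0" "poly p w = 0"
  shows "poly (pderiv p) w \<noteq> 0"
proof
  assume d: "poly (pderiv p) w = 0"
  obtain q where q: "p = [:-w, 1:] * q" using assms(3) by (auto simp: poly_eq_0_iff_dvd dvd_def)
  have "q \<noteq> 0" using q assms(2) by auto
  have "poly (pderiv p) w = poly q w" unfolding q pderiv_mult by (simp add: pderiv_pCons)
  then have qw: "poly q w = 0" using d by simp
  have "{w. poly p w = 0} = {w. poly q w = 0}" using qw by (auto simp: q)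
  then have "card {w. poly p w = 0} \<le> degree q" using card_poly_roots_bound[OF \<open>q \<noteq> 0\<close>] by simp
  moreover have "degree p = Suc (degree q)" using \<open>q \<noteq> 0\<close> unfolding q by (subst degree_mult_eq) auto
  ultimately show False using assms(1) by simp
qed

text \<open>Where the first factor vanishes, the product rule needs only continuity of the second.
  The second factor will be the inverse of an expression containing a root that is so far known to
  be continuous only.\<close>

lemma has_derivative_mult_continuous:
  fixes n k :: "'a::real_normed_vector \<Rightarrow> complex"
  assumes n: "(n has_derivative L) (at x)" "n x = 0" and k: "isCont k x"
  shows "((\<lambda>y. n y * k y) has_derivative (\<lambda>v. L v * k x)) (at x)"
proof -
  interpret L: bounded_linear L using n(1) by (rule has_derivative_bounded_linear)
  obtain C where C: "\<And>v. norm (L v) \<le> norm v * C" using L.bounded by blast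
  let ?g = "\<lambda>y. norm (n y - n x - L (y - x)) / norm (y - x) * norm (k y) + C * norm (k y - k x)"
  have "((\<lambda>y. norm (n y - n x - L (y - x)) / norm (y - x)) \<longlongrightarrow> 0) (at x)"
    using n(1) by (simp add: has_derivative_iff_norm)
  then have "(?g \<longlongrightarrow> 0 * norm (k x) + C * norm (k x - k x)) (at x)"
    using k unfolding isCont_def by (intro tendsto_intros)
  then have g0: "(?g \<longlongrightarrow> 0) (at x)" by simp
  show ?thesis
    unfolding has_derivative_iff_norm
  proof
    show "bounded_linear (\<lambda>v. L v * k x)" by (intro bounded_linear_mult_const L.bounded_linear_axioms)
    show "((\<lambda>y. norm (n y * k y - n x * k x - L (y - x) * k x) / norm (y - x)) \<longlongrightarrow> 0) (at x)"
    proof (rule Lim_null_comparison[OF _ g0])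
      show "\<forall>\<^sub>F y in at x. norm (norm (n y * k y - n x * k x - L (y - x) * k x) / norm (y - x)) \<le> ?g y"
        unfolding eventually_at_filter
      proof (intro always_eventually allI impI)
        fix y assume y: "y \<noteq> x"
        have "n y * k y - n x * k x - L (y - x) * k x = (n y - n x - L (y - x)) * k y + L (y - x) * (k y - k x)"
          using n(2) by (simp add: algebra_simps)
        then have "norm (n y * k y - n x * k x - L (y - x) * k x)
            \<le> norm (n y - n x - L (y - x)) * norm (k y) + (norm (y - x) * C) * norm (k y - k x)"
          using C[of "y - x"] by (auto simp: norm_mult intro!: norm_triangle_le add_mono mult_right_mono)
        then have "norm (n y * k y - n x * k x - L (y - x) * k x) / norm (y - x)
            \<le> (norm (n y - n x - L (y - x)) * norm (k y) + (norm (y - x) * C) * norm (k y - k x)) / norm (y - x)"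
          by (rule divide_right_mono) simp
        then show "norm (norm (n y * k y - n x * k x - L (y - x) * k x) / norm (y - x)) \<le> ?g y"
          using y by (simp add: add_divide_distrib)
      qed
    qed
  qed
qed

definition coeff_poly :: "(nat \<Rightarrow> complex) \<Rightarrow> nat \<Rightarrow> complex poly" where
  "coeff_poly a \<nu> = (\<Sum>k\<le>\<nu>. monom (a k) k)"

lemma coeff_coeff_poly: "coeff (coeff_poly a \<nu>) k = (if k \<le> \<nu> then a k else 0)"
  by (auto simp: coeff_poly_def coeff_sum)

lemma poly_coeff_poly: "poly (coeff_poly a \<nu>) w = (\<Sum>k\<le>\<nu>. a k * w ^ k)"
  by (simp add: coeff_poly_def poly_sum poly_monom)

lemma degree_coeff_poly: "a \<nu> \<noteq> 0 \<Longrightarrow> degree (coeff_poly a \<nu>) = \<nu>"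
  by (intro antisym degree_le le_degree) (auto simp: coeff_coeff_poly)

text \<open>By the estimate \<open>poly_root_near\<close>, near a point with \<open>\<nu>\<close> distinct roots
  there is exactly one root close to each of them.\<close>

lemma regular_roots_local:
  fixes a :: "nat \<Rightarrow> complex ^ 'm::finite \<Rightarrow> complex" and \<nu> :: nat
  defines "rt \<equiv> \<lambda>y. {w. poly (coeff_poly (\<lambda>k. a k y) \<nu>) w = 0}"
  assumes S: "open S" and a: "\<And>k. k \<le> \<nu> \<Longrightarrow> holomorphic_Cn (a k) S" and v: "v \<in> S" "a \<nu> v \<noteq> 0"
    and card: "card (rt v) = \<nu>" and \<nu>: "\<nu> > 0"
  shows "\<exists>\<epsilon> \<delta>. \<epsilon> > 0 \<and> \<delta> > 0 \<and> ball v \<epsilon> \<subseteq> S \<and>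
    (\<forall>y\<in>ball v \<epsilon>. a \<nu> y \<noteq> 0 \<and> card (rt y) = \<nu> \<and>
      (\<forall>w\<in>rt y. \<forall>w'\<in>rt y. w \<noteq> w' \<longrightarrow> \<delta> \<le> dist w w') \<and>
      (\<forall>w\<in>rt y. \<exists>b. holomorphic_Cn b (ball v \<epsilon>) \<and> b y = w \<and> (\<forall>y'\<in>ball v \<epsilon>. b y' \<in> rt y')))"
proof -
  define P where "P y w = (\<Sum>k\<le>\<nu>. a k y * w ^ k)" for y w
  have rt: "w \<in> rt y \<longleftrightarrow> P y w = 0" for w y by (simp add: rt_def P_def poly_coeff_poly)
  have holP: "holomorphic_Cn (\<lambda>y. P y w) S" for w
    unfolding P_def by (intro holomorphic_Cn_sum holomorphic_Cn_mult a) auto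
  have conta: "continuous_on S (a k)" if "k \<le> \<nu>" for k
    using a[OF that] by (rule holomorphic_Cn_continuous_on)
  have near: "\<exists>r. r \<in> rt y \<and> dist w r < e" if h: "a \<nu> y \<noteq> 0" "e > 0" "norm (P y w) < norm (a \<nu> y) * e ^ \<nu>" for y w e
  proof -
    obtain r where "poly (coeff_poly (\<lambda>k. a k y) \<nu>) r = 0" "dist w r < e"
    proof (rule poly_root_near[of "coeff_poly (\<lambda>k. a k y) \<nu>" \<nu> e w])
      show "norm (poly (coeff_poly (\<lambda>k. a k y) \<nu>) w) < norm (lead_coeff (coeff_poly (\<lambda>k. a k y) \<nu>)) * e ^ \<nu>"
        using h degree_coeff_poly[of "\<lambda>k. a k y" \<nu>] by (simp add: poly_coeff_poly coeff_coeff_poly P_def)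
    qed (use h \<nu> degree_coeff_poly[of "\<lambda>k. a k y" \<nu>] in auto)
    then show ?thesis by (auto simp: rt_def)
  qed
  have fin_rt: "finite (rt y)" and card_rt: "card (rt y) \<le> \<nu>" if "a \<nu> y \<noteq> 0" for y
  proof -
    have "coeff_poly (\<lambda>k. a k y) \<nu> \<noteq> 0" using degree_coeff_poly[of "\<lambda>k. a k y" \<nu>] that \<nu> by auto
    then show "finite (rt y)" "card (rt y) \<le> \<nu>"
      using card_poly_roots_bound[of "coeff_poly (\<lambda>k. a k y) \<nu>"] degree_coeff_poly[of "\<lambda>k. a k y" \<nu>] that
      by (auto simp: rt_def poly_roots_finite)
  qed
  obtain d where d: "d > 0" "\<And>x y. \<lbrakk>x \<in> rt v; y \<in> rt v; x \<noteq> y\<rbrakk> \<Longrightarrow> d \<le> dist x y"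
    using finite_separated[OF fin_rt[OF v(2)]] by blast
  \<comment> \<open>Points within \<eta> of different roots are at least
    \<open>d - 2 * \<eta> = 2 * \<eta>\<close> apart; this is also the separation constant in the
    end.\<close>
  define \<eta> where "\<eta> = d / 4"
  have \<eta>: "\<eta> > 0" using d by (simp add: \<eta>_def)
  \<comment> \<open>The inequality demanded by \<open>near\<close> holds at \<open>y0\<close>, where
    its left side vanishes, and it is an open condition.\<close>
  have small: "\<exists>e>0. \<forall>y\<in>ball y0 e. y \<in> S \<and> norm (P y w) < norm (a \<nu> y) * c ^ \<nu>"
    if "y0 \<in> S" "a \<nu> y0 \<noteq> 0" "P y0 w = 0" "c > 0" for y0 w c
  proof -
    have "continuous_on S (\<lambda>y. norm (P y w) - norm (a \<nu> y) * c ^ \<nu>)"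
      using holomorphic_Cn_continuous_on[OF holP] conta by (intro continuous_intros) auto
    then have "open ((\<lambda>y. norm (P y w) - norm (a \<nu> y) * c ^ \<nu>) -` {..<0} \<inter> S)"
      using S by (auto simp: continuous_on_open_vimage)
    moreover have "y0 \<in> (\<lambda>y. norm (P y w) - norm (a \<nu> y) * c ^ \<nu>) -` {..<0} \<inter> S" using that by simp
    ultimately obtain e where "e > 0" "ball y0 e \<subseteq> (\<lambda>y. norm (P y w) - norm (a \<nu> y) * c ^ \<nu>) -` {..<0} \<inter> S"
      by (meson open_contains_ball)
    then show ?thesis by (intro exI[of _ e] conjI ballI) (auto dest: subsetD)
  qed
  have "\<exists>e. \<forall>w\<in>rt v. e w > 0 \<and> (\<forall>y\<in>ball v (e w). y \<in> S \<and> norm (P y w) < norm (a \<nu> y) * \<eta> ^ \<nu>)"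
  proof (rule bchoice, rule ballI)
    fix w assume "w \<in> rt v"
    then show "\<exists>e>0. \<forall>y\<in>ball v e. y \<in> S \<and> norm (P y w) < norm (a \<nu> y) * \<eta> ^ \<nu>"
      using small[OF v _ \<eta>, of w] rt[of w v] by simp
  qed
  then obtain e where e: "\<And>w. w \<in> rt v \<Longrightarrow> e w > 0"
    "\<And>w y. w \<in> rt v \<Longrightarrow> y \<in> ball v (e w) \<Longrightarrow> y \<in> S \<and> norm (P y w) < norm (a \<nu> y) * \<eta> ^ \<nu>" by blast
  have ne: "rt v \<noteq> {}" using card \<nu> by auto
  define \<epsilon> where "\<epsilon> = Min (e ` rt v)"
  have \<epsilon>: "\<epsilon> > 0" "\<And>w. w \<in> rt v \<Longrightarrow> \<epsilon> \<le> e w"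
    using e fin_rt[OF v(2)] ne by (auto simp: \<epsilon>_def)
  have yS: "y \<in> S" "a \<nu> y \<noteq> 0" if "y \<in> ball v \<epsilon>" for y
  proof -
    obtain w where w: "w \<in> rt v" using ne by auto
    have *: "y \<in> S \<and> norm (P y w) < norm (a \<nu> y) * \<eta> ^ \<nu>" using e(2)[OF w, of y] \<epsilon>(2)[OF w] that by auto
    then show "y \<in> S" by blast
    show "a \<nu> y \<noteq> 0" using * by auto
  qed
  define r where "r w y = (SOME r. r \<in> rt y \<and> dist w r < \<eta>)" for w y
  have r: "r w y \<in> rt y \<and> dist w (r w y) < \<eta>" if yw: "y \<in> ball v \<epsilon>" "w \<in> rt v" for w y
  proof -
    have "norm (P y w) < norm (a \<nu> y) * \<eta> ^ \<nu>" using e(2)[of w y] \<epsilon>(2)[of w] yw by simp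
    then have "\<exists>r. r \<in> rt y \<and> dist w r < \<eta>" by (rule near[OF yS(2)[OF yw(1)] \<eta>])
    then show ?thesis unfolding r_def by (rule someI_ex)
  qed
  have far: "2 * \<eta> \<le> dist x x'" if "w \<in> rt v" "w' \<in> rt v" "w \<noteq> w'" "dist w x < \<eta>" "dist w' x' < \<eta>" for w w' x x'
  proof -
    have "dist w w' \<le> dist w x + dist x x' + dist x' w'"
      by (meson add_right_mono dist_triangle dist_triangle_le order_trans)
    then show ?thesis using d(2)[OF that(1-3)] that(4,5) by (simp add: \<eta>_def dist_commute)
  qed
  have image: "(\<lambda>w. r w y) ` rt v = rt y" "card (rt y) = \<nu>" if y: "y \<in> ball v \<epsilon>" for y
  proof -
    have inj: "inj_on (\<lambda>w. r w y) (rt v)"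
    proof (rule inj_onI, rule ccontr)
      fix w w' assume *: "w \<in> rt v" "w' \<in> rt v" "r w y = r w' y" "w \<noteq> w'"
      show False using far[OF *(1,2,4), of "r w y" "r w' y"] r[OF y *(1)] r[OF y *(2)] * \<eta> by simp
    qed
    have sub: "(\<lambda>w. r w y) ` rt v \<subseteq> rt y" using r[OF y] by auto
    have "card ((\<lambda>w. r w y) ` rt v) = \<nu>" using inj card by (simp add: card_image)
    \<comment> \<open>Injectivity already produces \<nu> roots, and a polynomial of degree \<nu> has
      no more; so every root is close to a root over \<open>v\<close>.\<close>
    then show "(\<lambda>w. r w y) ` rt v = rt y" "card (rt y) = \<nu>"
      using sub card_rt[OF yS(2)[OF y]] fin_rt[OF yS(2)[OF y]] card_mono[OF fin_rt[OF yS(2)[OF y]] sub]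
        card_subset_eq[OF fin_rt[OF yS(2)[OF y]] sub] by auto
  qed
  have uniq: "x = r w y" if y: "y \<in> ball v \<epsilon>" and w: "w \<in> rt v" and x: "x \<in> rt y" "dist w x < \<eta>" for x w y
  proof -
    obtain w' where w': "w' \<in> rt v" "x = r w' y" using x image(1)[OF y] by auto
    have "w' = w" using far[OF w w'(1) _ x(2), of x] r[OF y w'(1)] w'(2) \<eta> by auto
    then show ?thesis using w' by simp
  qed
  have cont: "isCont (r w) y0" if y0: "y0 \<in> ball v \<epsilon>" and w: "w \<in> rt v" for w y0
    unfolding continuous_at_eps_delta
  proof safe
    fix c :: real assume c: "c > 0"
    \<comment> \<open>Being within \<open>c'\<close> of the root at \<open>y0\<close> keeps the new
      root within \<eta> of \<open>w\<close>, so by uniqueness it is \<open>r w y\<close>.\<close>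
    define c' where "c' = min c (\<eta> - dist w (r w y0))"
    have c': "c' > 0" using c r[OF y0 w] by (simp add: c'_def)
    have "P y0 (r w y0) = 0" using r[OF y0 w] rt by auto
    from small[OF yS[OF y0] this c'] obtain e1 where e1: "e1 > 0"
      "\<And>y. y \<in> ball y0 e1 \<Longrightarrow> norm (P y (r w y0)) < norm (a \<nu> y) * c' ^ \<nu>" by blast
    obtain e2 where e2: "e2 > 0" "ball y0 e2 \<subseteq> ball v \<epsilon>" using y0 open_contains_ball open_ball by metis
    show "\<exists>e>0. \<forall>y. dist y y0 < e \<longrightarrow> dist (r w y) (r w y0) < c"
    proof (intro exI[of _ "min e1 e2"] conjI allI impI)
      fix y assume "dist y y0 < min e1 e2"
      then have y: "y \<in> ball y0 e1" "y \<in> ball v \<epsilon>" using e2 by (auto simp: dist_commute)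
      obtain x where x: "x \<in> rt y" "dist (r w y0) x < c'"
        using near[OF yS(2)[OF y(2)] c' e1(2)[OF y(1)]] by blast
      have "dist w x < \<eta>" using x(2) dist_triangle[of w x "r w y0"] by (simp add: c'_def)
      then have "x = r w y" using uniq[OF y(2) w x(1)] by simp
      then show "dist (r w y) (r w y0) < c" using x(2) by (simp add: c'_def dist_commute)
    qed (use e1 e2 in auto)
  qed
  have hol: "holomorphic_Cn (r w) (ball v \<epsilon>)" if w: "w \<in> rt v" for w
    unfolding holomorphic_Cn_def
  proof
    fix y0 assume y0: "y0 \<in> ball v \<epsilon>"
    define w0 where "w0 = r w y0"
    \<comment> \<open>The divided difference of the polynomial between \<open>w0\<close> and
      \<open>r w y\<close>. At \<open>y0\<close> the two arguments coincide and it becomes the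
      derivative, which is nonzero at a simple root.\<close>
    define G where "G y = (\<Sum>k\<le>\<nu>. a k y * (\<Sum>i<k. w0 ^ (k - Suc i) * (r w y) ^ i))" for y
    have rr: "r w y0 \<in> rt y0" using r[OF y0 w] by blast
    have "G y0 = poly (pderiv (coeff_poly (\<lambda>k. a k y0) \<nu>)) w0"
    proof -
      have "(\<Sum>i<k. w0 ^ (k - Suc i) * w0 ^ i) = of_nat k * w0 ^ (k - 1)" for k
      proof -
        have "(\<Sum>i<k. w0 ^ (k - Suc i) * w0 ^ i) = (\<Sum>i<k. w0 ^ (k - 1))"
          by (intro sum.cong) (auto simp flip: power_add)
        then show ?thesis by simp
      qed
      moreover have "pderiv (\<Sum>k\<le>\<nu>. monom (a k y0) k) = (\<Sum>k\<le>\<nu>. pderiv (monom (a k y0) k))"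
        using higher_pderiv_sum[of 1 "\<lambda>k. monom (a k y0) k" "{..\<nu>}"] by simp
      ultimately show ?thesis
        by (simp add: G_def w0_def[symmetric] coeff_poly_def pderiv_monom poly_sum poly_monom mult_ac)
    qed
    also have "\<dots> \<noteq> 0"
      using image(2)[OF y0] rr yS(2)[OF y0] \<nu> unfolding w0_def
      by (intro simple_root_pderiv) (auto simp: rt_def degree_coeff_poly[of "\<lambda>k. a k y0" \<nu>])
    finally have G0: "G y0 \<noteq> 0" .
    have contG: "isCont G y0"
      unfolding G_def using conta yS(1)[OF y0] S cont[OF y0 w]
      by (intro continuous_intros) (auto simp: continuous_on_eq_continuous_at)
    have eq: "P y w0 = (w0 - r w y) * G y" if "y \<in> ball v \<epsilon>" for y
    proof -
      have "P y (r w y) = 0" using r[OF that w] rt by auto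
      then have "P y w0 = (\<Sum>k\<le>\<nu>. a k y * (w0 ^ k - r w y ^ k))"
        by (simp add: P_def right_diff_distrib sum_subtractf)
      also have "\<dots> = (\<Sum>k\<le>\<nu>. a k y * ((w0 - r w y) * (\<Sum>i<k. w0 ^ (k - Suc i) * r w y ^ i)))"
      proof -
        have "w0 ^ k - r w y ^ k = (w0 - r w y) * (\<Sum>i<k. w0 ^ (k - Suc i) * r w y ^ i)" for k
          using power_diff_sumr2[of "r w y" k w0] by (metis minus_diff_eq mult_minus_left)
        then show ?thesis by simp
      qed
      finally show ?thesis by (simp add: G_def sum_distrib_left mult_ac)
    qed
    obtain L where L: "((\<lambda>y. P y w0) has_derivative L) (at y0)" "\<And>c v. L (c *s v) = c * L v"
      using holP[of w0] yS(1)[OF y0] unfolding holomorphic_Cn_def by blast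
    have "((\<lambda>y. P y w0 * inverse (G y)) has_derivative (\<lambda>v. L v * inverse (G y0))) (at y0)"
    proof (rule has_derivative_mult_continuous[OF L(1)])
      show "P y0 w0 = 0" using rr rt by (simp add: w0_def)
      show "isCont (\<lambda>y. inverse (G y)) y0" using contG G0 by (rule continuous_at_within_inverse)
    qed
    from has_derivative_diff[OF has_derivative_const[of w0] this]
    have der: "((\<lambda>y. w0 - P y w0 * inverse (G y)) has_derivative (\<lambda>v. - (L v * inverse (G y0)))) (at y0)"
      by simp
    obtain e where e: "e > 0" "\<And>y. dist y0 y < e \<Longrightarrow> G y \<noteq> 0"
      using continuous_at_avoid[OF contG G0] by blast
    have "(r w has_derivative (\<lambda>v. - (L v * inverse (G y0)))) (at y0)"
    proof (rule has_derivative_transform_within_open[OF der])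
      show "open (ball y0 e \<inter> ball v \<epsilon>)" "y0 \<in> ball y0 e \<inter> ball v \<epsilon>" using y0 e by auto
      show "w0 - P y w0 * inverse (G y) = r w y" if "y \<in> ball y0 e \<inter> ball v \<epsilon>" for y
        using that eq[of y] e(2)[of y] by (simp add: mult.assoc)
    qed
    then show "\<exists>L. (r w has_derivative L) (at y0) \<and> (\<forall>c v. L (c *s v) = c * L v)"
      using L(2) by (intro exI[of _ "\<lambda>v. - (L v * inverse (G y0))"]) simp
  qed
  show ?thesis
  proof (rule exI[of _ \<epsilon>], rule exI[of _ "2 * \<eta>"], intro conjI ballI impI)
    show "ball v \<epsilon> \<subseteq> S" using yS by blast
    show "a \<nu> y \<noteq> 0" "card (rt y) = \<nu>" if "y \<in> ball v \<epsilon>" for y using yS(2)[OF that] image(2)[OF that] by simp_all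
    show "2 * \<eta> \<le> dist w w'" if y: "y \<in> ball v \<epsilon>" and w: "w \<in> rt y" "w' \<in> rt y" "w \<noteq> w'" for y w w'
    proof -
      obtain u u' where "u \<in> rt v" "u' \<in> rt v" "w = r u y" "w' = r u' y" using image(1)[OF y] w by (metis imageE)
      then show ?thesis using far[of u u' w w'] r[OF y] w by auto
    qed
    show "\<exists>b. holomorphic_Cn b (ball v \<epsilon>) \<and> b y = w \<and> (\<forall>y'\<in>ball v \<epsilon>. b y' \<in> rt y')"
      if y: "y \<in> ball v \<epsilon>" and w: "w \<in> rt y" for y w
    proof -
      obtain u where u: "u \<in> rt v" "w = r u y" using image(1)[OF y] w by (metis imageE)
      then show ?thesis using hol[OF u(1)] r by (intro exI[of _ "r u"]) auto
    qed
  qed (use \<epsilon> \<eta> in auto)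
qed

section \<open>Charts of complex manifolds\<close>

lemma open_polydisc: "open (polydisc r :: (complex ^ 'm::finite) set)"
proof -
  have "open (\<Inter>i\<in>UNIV. {z :: complex ^ 'm. norm (z $ i) < r})"
    by (intro open_INT ballI finite open_Collect_less continuous_intros)
  then show ?thesis by (simp add: polydisc_def Collect_all_eq)
qed

lemma convex_polydisc: "convex (polydisc r :: (complex ^ 'm::finite) set)"
proof (rule convexI)
  fix x y :: "complex ^ 'm" and u v :: real
  assume *: "x \<in> polydisc r" "y \<in> polydisc r" "0 \<le> u" "0 \<le> v" "u + v = 1"
  have "norm ((u *\<^sub>R x + v *\<^sub>R y) $ i) < r" for i
  proof -
    have "x $ i \<in> ball 0 r" "y $ i \<in> ball 0 r" using * by (auto simp: polydisc_def)
    then have "u *\<^sub>R x $ i + v *\<^sub>R y $ i \<in> ball 0 r"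
      using * convex_ball[of "0::complex" r] by (intro convexD)
    then show ?thesis by simp
  qed
  then show "u *\<^sub>R x + v *\<^sub>R y \<in> polydisc r" by (simp add: polydisc_def)
qed

lemma zero_in_polydisc: "r > 0 \<Longrightarrow> 0 \<in> polydisc r"
  by (simp add: polydisc_def)

lemma polydisc_subset_ball:
  assumes "e > 0"
  obtains r where "r > 0" "polydisc r \<subseteq> ball (0 :: complex ^ 'm::finite) e"
proof (rule that)
  show "polydisc (e / real CARD('m)) \<subseteq> ball (0 :: complex ^ 'm) e"
  proof
    fix z :: "complex ^ 'm" assume z: "z \<in> polydisc (e / real CARD('m))"
    have "norm z \<le> (\<Sum>i\<in>UNIV. norm (z $ i))" unfolding norm_vec_def by (rule L2_set_le_sum) simp
    also have "\<dots> < (\<Sum>i\<in>(UNIV::'m set). e / real CARD('m))"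
      using z by (intro sum_strict_mono) (auto simp: polydisc_def)
    finally show "z \<in> ball 0 e" by simp
  qed
qed (use assms in simp)

lemma chart_inv_snd: "topological_chart c \<Longrightarrow> x \<in> fst c \<Longrightarrow> chart_inv c (snd c x) = x"
  unfolding topological_chart_def homeomorphism_def by auto

lemma snd_chart_inv: "topological_chart c \<Longrightarrow> z \<in> snd c ` fst c \<Longrightarrow> snd c (chart_inv c z) = z"
  unfolding topological_chart_def homeomorphism_def by auto

lemma chart_inv_in: "topological_chart c \<Longrightarrow> z \<in> snd c ` fst c \<Longrightarrow> chart_inv c z \<in> fst c"
  unfolding topological_chart_def homeomorphism_def by auto

lemma chart_continuous: "topological_chart c \<Longrightarrow> continuous_on (fst c) (snd c)"
  unfolding topological_chart_def homeomorphism_def by auto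

lemma chart_inv_continuous: "topological_chart c \<Longrightarrow> continuous_on (snd c ` fst c) (chart_inv c)"
  unfolding topological_chart_def homeomorphism_def by auto

lemma chart_open: "topological_chart c \<Longrightarrow> open (fst c)" "topological_chart c \<Longrightarrow> open (snd c ` fst c)"
  unfolding topological_chart_def by auto

lemma chart_preimage_open:
  assumes "topological_chart c" "open B"
  shows "open {x \<in> fst c. snd c x \<in> B}"
proof -
  have "open (snd c -` B \<inter> fst c)"
    using chart_continuous[OF assms(1)] chart_open(1)[OF assms(1)] assms(2)
    by (auto simp: continuous_on_open_vimage)
  moreover have "snd c -` B \<inter> fst c = {x \<in> fst c. snd c x \<in> B}" by auto
  ultimately show ?thesis by simp
qed

lemma chart_image_open:
  assumes c: "topological_chart c" and S: "open S"
  shows "open (snd c ` (fst c \<inter> S))"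
proof -
  have "open (chart_inv c -` S \<inter> snd c ` fst c)"
    using chart_inv_continuous[OF c] chart_open(2)[OF c] S by (auto simp: continuous_on_open_vimage)
  moreover have "chart_inv c -` S \<inter> snd c ` fst c = snd c ` (fst c \<inter> S)"
    using chart_inv_snd[OF c] by auto
  ultimately show ?thesis by simp
qed

lemma chart_inv_image:
  assumes c: "topological_chart c" and B: "B \<subseteq> snd c ` fst c"
  shows "chart_inv c ` B = {x \<in> fst c. snd c x \<in> B}"
proof
  show "chart_inv c ` B \<subseteq> {x \<in> fst c. snd c x \<in> B}"
    using snd_chart_inv[OF c] chart_inv_in[OF c] B by (auto simp: subset_iff)
  show "{x \<in> fst c. snd c x \<in> B} \<subseteq> chart_inv c ` B"
    using chart_inv_snd[OF c] by (metis (no_types, lifting) image_eqI mem_Collect_eq subsetI)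
qed

lemma holomorphic_coordinate_topological: "holomorphic_coordinate \<A> c \<Longrightarrow> topological_chart c"
  unfolding holomorphic_coordinate_def by auto

lemma atlas_holomorphic_coordinate:
  "complex_manifold \<A> \<Longrightarrow> c \<in> \<A> \<Longrightarrow> holomorphic_coordinate \<A> c"
  unfolding complex_manifold_def holomorphic_coordinate_def by blast

lemma atlas_covers:
  assumes "complex_manifold \<A>" obtains c where "c \<in> \<A>" "x \<in> fst c"
  using assms unfolding complex_manifold_def by blast

text \<open>\<open>holomorphic_mfd\<close> tests the charts of the atlas only; transition maps carry
  the property to every member of the maximal atlas.\<close>

lemma holomorphic_mfd_Cn:
  fixes \<A> :: "('a::{t2_space,second_countable_topology}, 'm::finite) chart set"
  assumes M: "complex_manifold \<A>" and c: "holomorphic_coordinate \<A> c"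
    and f: "holomorphic_mfd \<A> f S" and S: "open S"
  shows "holomorphic_Cn (\<lambda>z. f (chart_inv c z)) (snd c ` (fst c \<inter> S))"
proof (rule holomorphic_Cn_local)
  fix p assume "p \<in> snd c ` (fst c \<inter> S)"
  then obtain x where x: "x \<in> fst c" "x \<in> S" "p = snd c x" by auto
  obtain d where d: "d \<in> \<A>" "x \<in> fst d" by (rule atlas_covers[OF M])
  note ct = holomorphic_coordinate_topological[OF c]
  have dt: "topological_chart d" using M d unfolding complex_manifold_def by blast
  let ?T = "snd c ` (fst c \<inter> (S \<inter> fst d))"
  have T: "open ?T" using chart_image_open[OF ct, of "S \<inter> fst d"] S chart_open(1)[OF dt] by blast
  have "holomorphic_Cn (\<lambda>z. f (chart_inv d (snd d (chart_inv c z)))) ?T"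
  proof (rule holomorphic_Cn_compose)
    show "holomorphic_Cn (\<lambda>z. f (chart_inv d z)) (snd d ` (fst d \<inter> S))"
      using f d unfolding holomorphic_mfd_def by blast
    show "holomorphic_Cn (\<lambda>z. snd d (chart_inv c z) $ i) ?T" for i
      using c d unfolding holomorphic_coordinate_def holomorphic_transition_def
      by (auto intro: holomorphic_Cn_subset)
    show "(\<lambda>z. snd d (chart_inv c z)) ` ?T \<subseteq> snd d ` (fst d \<inter> S)"
      using chart_inv_snd[OF ct] by auto
  qed
  then have "holomorphic_Cn (\<lambda>z. f (chart_inv c z)) ?T"
    by (rule holomorphic_Cn_transform[OF _ T]) (use chart_inv_snd[OF ct] chart_inv_snd[OF dt] in auto)
  then show "\<exists>T. p \<in> T \<and> holomorphic_Cn (\<lambda>z. f (chart_inv c z)) T"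
    using x d by (intro exI[of _ ?T]) auto
qed

lemma holomorphic_Cn_mfd:
  fixes \<A> :: "('a::{t2_space,second_countable_topology}, 'm::finite) chart set"
  assumes M: "complex_manifold \<A>" and c: "holomorphic_coordinate \<A> c" and g: "holomorphic_Cn g B"
  shows "holomorphic_mfd \<A> (\<lambda>x. g (snd c x)) {x \<in> fst c. snd c x \<in> B}"
  unfolding holomorphic_mfd_def
proof
  fix d assume d: "d \<in> \<A>"
  have dt: "topological_chart d" using M d unfolding complex_manifold_def by blast
  let ?S = "snd d ` (fst d \<inter> {x \<in> fst c. snd c x \<in> B})"
  show "holomorphic_Cn (\<lambda>z. g (snd c (chart_inv d z))) ?S"
  proof (rule holomorphic_Cn_compose[OF g])
    show "holomorphic_Cn (\<lambda>z. snd c (chart_inv d z) $ i) ?S" for i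
      using c d unfolding holomorphic_coordinate_def holomorphic_transition_def
      by (auto intro: holomorphic_Cn_subset)
    show "(\<lambda>z. snd c (chart_inv d z)) ` ?S \<subseteq> B"
      using chart_inv_snd[OF dt] by auto
  qed
qed

lemma holomorphic_mfd_subset: "holomorphic_mfd \<A> f S \<Longrightarrow> T \<subseteq> S \<Longrightarrow> holomorphic_mfd \<A> f T"
  unfolding holomorphic_mfd_def by (meson holomorphic_Cn_subset image_mono Int_mono order_refl)

lemma holomorphic_mfd_const [simp]: "holomorphic_mfd \<A> (\<lambda>x. c) S"
  unfolding holomorphic_mfd_def by simp

lemma holomorphic_mfd_add: "holomorphic_mfd \<A> f S \<Longrightarrow> holomorphic_mfd \<A> g S \<Longrightarrow> holomorphic_mfd \<A> (\<lambda>x. f x + g x) S"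
  unfolding holomorphic_mfd_def by (auto intro: holomorphic_Cn_add)

lemma holomorphic_mfd_mult: "holomorphic_mfd \<A> f S \<Longrightarrow> holomorphic_mfd \<A> g S \<Longrightarrow> holomorphic_mfd \<A> (\<lambda>x. f x * g x) S"
  unfolding holomorphic_mfd_def by (auto intro: holomorphic_Cn_mult)

lemma holomorphic_mfd_divide:
  fixes \<A> :: "('a::{t2_space,second_countable_topology}, 'm::finite) chart set"
  assumes M: "complex_manifold \<A>" and fg: "holomorphic_mfd \<A> f S" "holomorphic_mfd \<A> g S"
    and nz: "\<And>x. x \<in> S \<Longrightarrow> g x \<noteq> 0"
  shows "holomorphic_mfd \<A> (\<lambda>x. f x / g x) S"
  unfolding holomorphic_mfd_def
proof
  fix c assume c: "c \<in> \<A>"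
  then have ct: "topological_chart c" using M unfolding complex_manifold_def by blast
  show "holomorphic_Cn (\<lambda>z. f (chart_inv c z) / g (chart_inv c z)) (snd c ` (fst c \<inter> S))"
    using fg c chart_inv_snd[OF ct] nz unfolding holomorphic_mfd_def
    by (intro holomorphic_Cn_divide) auto
qed

lemma holomorphic_mfd_continuous_on:
  fixes \<A> :: "('a::{t2_space,second_countable_topology}, 'm::finite) chart set"
  assumes M: "complex_manifold \<A>" and f: "holomorphic_mfd \<A> f S" and S: "open S"
  shows "continuous_on S f"
proof (rule continuous_on_local[OF S])
  fix x assume x: "x \<in> S"
  obtain c where c: "c \<in> \<A>" "x \<in> fst c" by (rule atlas_covers[OF M])
  then have ct: "topological_chart c" using M unfolding complex_manifold_def by blast
  have 1: "continuous_on (snd c ` (fst c \<inter> S)) (\<lambda>z. f (chart_inv c z))"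
    using f c unfolding holomorphic_mfd_def by (blast intro: holomorphic_Cn_continuous_on)
  have 2: "continuous_on (fst c \<inter> S) (snd c)"
    using chart_continuous[OF ct] by (rule continuous_on_subset) auto
  have "continuous_on (fst c \<inter> S) (\<lambda>y. f (chart_inv c (snd c y)))"
    by (rule continuous_on_compose2[OF 1 2]) auto
  then show "\<exists>T g. open T \<and> x \<in> T \<and> continuous_on (T \<inter> S) g \<and> (\<forall>y\<in>T \<inter> S. f y = g y)"
    using chart_open(1)[OF ct] c(2) chart_inv_snd[OF ct]
    by (intro exI[of _ "fst c"] exI[of _ "\<lambda>y. f (chart_inv c (snd c y))"]) auto
qed

text \<open>Composing a chart with a biholomorphic map of the model space stays in the maximal
  atlas. It is applied to translations and to a linear map that moves the branch set into a
  coordinate hyperplane; shrinking to a polydisc makes the image convex.\<close>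

lemma holomorphic_coordinate_polydisc:
  fixes \<A> :: "('a::{t2_space,second_countable_topology}, 'm::finite) chart set"
    and T T' :: "complex ^ 'm \<Rightarrow> complex ^ 'm"
  assumes M: "complex_manifold \<A>" and c: "holomorphic_coordinate \<A> c" and x0: "x0 \<in> fst c" "x0 \<in> S" "open S"
    and T: "\<And>i. holomorphic_Cn (\<lambda>z. T z $ i) UNIV" "\<And>i. holomorphic_Cn (\<lambda>z. T' z $ i) UNIV"
    and inv: "\<And>z. T' (T z) = z" "\<And>z. T (T' z) = z" and T0: "T (snd c x0) = 0"
  obtains N r where "r > 0" "N \<subseteq> fst c \<inter> S" "x0 \<in> N" "holomorphic_coordinate \<A> (N, \<lambda>x. T (snd c x))"
    "(\<lambda>x. T (snd c x)) ` N = polydisc r"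
proof -
  note ct = holomorphic_coordinate_topological[OF c]
  have "continuous_on UNIV (\<lambda>z. \<chi> i. T z $ i)" "continuous_on UNIV (\<lambda>z. \<chi> i. T' z $ i)"
    by (intro continuous_on_vec_lambda holomorphic_Cn_continuous_on T)+
  then have contT: "continuous_on UNIV T" "continuous_on UNIV T'" by simp_all
  let ?\<phi> = "\<lambda>x. T (snd c x)"
  let ?E = "T' -` snd c ` (fst c \<inter> S)"
  have "open ?E" using contT(2) chart_image_open[OF ct x0(3)] by (simp add: continuous_on_open_vimage)
  moreover have "0 \<in> ?E" using x0 T0 inv(1)[of "snd c x0"] by auto
  ultimately obtain e where e: "e > 0" "ball 0 e \<subseteq> ?E" using open_contains_ball by blast
  obtain r where r: "r > 0" "polydisc r \<subseteq> ball (0 :: complex ^ 'm) e" using polydisc_subset_ball[OF e(1)] .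
  let ?P = "polydisc r :: (complex ^ 'm) set"
  define N where "N = chart_inv c ` T' ` ?P"
  have sub: "T' ` ?P \<subseteq> snd c ` (fst c \<inter> S)" using e r by auto
  have NS: "N \<subseteq> fst c \<inter> S"
  proof
    fix x assume "x \<in> N"
    then obtain z where z: "z \<in> ?P" "x = chart_inv c (T' z)" unfolding N_def by blast
    then obtain y where "y \<in> fst c \<inter> S" "T' z = snd c y" using sub by blast
    then show "x \<in> fst c \<inter> S" using z chart_inv_snd[OF ct] by simp
  qed
  have \<phi>N: "?\<phi> (chart_inv c (T' z)) = z" if "z \<in> ?P" for z
  proof -
    have "T' z \<in> snd c ` fst c" using sub that by blast
    then show ?thesis using snd_chart_inv[OF ct] inv(2) by simp
  qed
  have N\<phi>: "chart_inv c (T' (?\<phi> x)) = x" if "x \<in> fst c" for x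
    using inv(1) chart_inv_snd[OF ct that] by simp
  have img: "?\<phi> ` N = ?P" unfolding N_def image_image using \<phi>N by simp
  have Neq: "N = {x \<in> fst c. snd c x \<in> T -` ?P}"
  proof
    show "N \<subseteq> {x \<in> fst c. snd c x \<in> T -` ?P}" using NS img by auto
    show "{x \<in> fst c. snd c x \<in> T -` ?P} \<subseteq> N"
    proof
      fix x assume x: "x \<in> {x \<in> fst c. snd c x \<in> T -` ?P}"
      then have "chart_inv c (T' (?\<phi> x)) \<in> N" unfolding N_def by (intro imageI) auto
      then show "x \<in> N" using N\<phi> x by simp
    qed
  qed
  have openN: "open N"
    unfolding Neq using contT(1) open_polydisc by (intro chart_preimage_open[OF ct]) (auto simp: continuous_on_open_vimage)
  have inj: "inj_on ?\<phi> N"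
  proof (rule inj_on_inverseI)
    fix x assume "x \<in> N"
    then show "chart_inv c (T' (?\<phi> x)) = x" using N\<phi> NS by blast
  qed
  have cinv: "chart_inv (N, ?\<phi>) z = chart_inv c (T' z)" if "z \<in> ?P" for z
  proof -
    have "chart_inv c (T' z) \<in> N" using that by (auto simp: N_def)
    then have "inv_into N ?\<phi> (?\<phi> (chart_inv c (T' z))) = chart_inv c (T' z)" using inj by (intro inv_into_f_f)
    then show ?thesis using \<phi>N[OF that] by (simp add: chart_inv_def)
  qed
  have tc: "topological_chart (N, ?\<phi>)"
    unfolding topological_chart_def
  proof (intro conjI)
    show "open (fst (N, ?\<phi>))" using openN by simp
    show "open (snd (N, ?\<phi>) ` fst (N, ?\<phi>))" using img open_polydisc by simp
    have "continuous_on N ?\<phi>"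
      using continuous_on_compose2[OF contT(1)] continuous_on_subset[OF chart_continuous[OF ct], of N] NS by blast
    moreover have "continuous_on ?P (\<lambda>z. chart_inv c (T' z))"
      by (rule continuous_on_compose2[OF chart_inv_continuous[OF ct] continuous_on_subset[OF contT(2)]]) (use sub in auto)
    then have "continuous_on ?P (chart_inv (N, ?\<phi>))"
      by (rule continuous_on_eq) (simp add: cinv)
    moreover have "chart_inv (N, ?\<phi>) (?\<phi> x) = x" if "x \<in> N" for x
    proof -
      have "?\<phi> x \<in> ?P" using img that by blast
      from cinv[OF this] show ?thesis using N\<phi>[of x] that NS by auto
    qed
    moreover have "?\<phi> (chart_inv (N, ?\<phi>) z) = z" if "z \<in> ?P" for z
      using cinv[OF that] \<phi>N[OF that] by simp
    moreover have "chart_inv (N, ?\<phi>) ` ?P = N"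
      using cinv unfolding N_def image_image by simp
    ultimately show "homeomorphism (fst (N, ?\<phi>)) (snd (N, ?\<phi>) ` fst (N, ?\<phi>)) (snd (N, ?\<phi>)) (chart_inv (N, ?\<phi>))"
      using img unfolding homeomorphism_def by simp
  qed
  have "holomorphic_coordinate \<A> (N, ?\<phi>)"
    unfolding holomorphic_coordinate_def
  proof (intro conjI ballI tc)
    fix d assume d: "d \<in> \<A>"
    then have cd: "holomorphic_transition c d" "holomorphic_transition d c"
      using c unfolding holomorphic_coordinate_def by auto
    have dt: "topological_chart d" using M d unfolding complex_manifold_def by blast
    show "holomorphic_transition (N, ?\<phi>) d"
      unfolding holomorphic_transition_def
    proof
      fix i
      let ?S = "snd (N, ?\<phi>) ` (fst (N, ?\<phi>) \<inter> fst d)"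
      have hol: "holomorphic_Cn (\<lambda>z. snd d (chart_inv c (T' z)) $ i) ?S"
        using cd(1)[unfolded holomorphic_transition_def, rule_format, of i]
      proof (rule holomorphic_Cn_compose)
        show "holomorphic_Cn (\<lambda>z. T' z $ i) ?S" for i by (rule holomorphic_Cn_subset[OF T(2)]) simp
        show "T' ` ?S \<subseteq> snd c ` (fst c \<inter> fst d)" using inv(1) NS by auto
      qed
      have openS: "open ?S" by (rule chart_image_open[OF tc chart_open(1)[OF dt]])
      have "?S \<subseteq> ?P" using img by auto
      then have "snd d (chart_inv c (T' z)) $ i = snd d (chart_inv (N, ?\<phi>) z) $ i" if "z \<in> ?S" for z
        using cinv[of z] that by (simp only: subset_iff)
      then show "holomorphic_Cn (\<lambda>z. snd d (chart_inv (N, ?\<phi>) z) $ i) ?S"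
        by (rule holomorphic_Cn_transform[OF hol openS])
    qed
    show "holomorphic_transition d (N, ?\<phi>)"
      unfolding holomorphic_transition_def
    proof
      fix i
      have "holomorphic_Cn (\<lambda>z. T (snd c (chart_inv d z)) $ i) (snd d ` (fst d \<inter> N))"
      proof (rule holomorphic_Cn_compose[OF T(1)[of i]])
        show "holomorphic_Cn (\<lambda>z. snd c (chart_inv d z) $ j) (snd d ` (fst d \<inter> N))" for j
          using cd(2) NS unfolding holomorphic_transition_def by (auto intro: holomorphic_Cn_subset)
      qed simp
      then show "holomorphic_Cn (\<lambda>z. snd (N, ?\<phi>) (chart_inv d z) $ i) (snd d ` (fst d \<inter> fst (N, ?\<phi>)))" by simp
    qed
  qed
  moreover have "x0 \<in> N" using T0 x0 r(1) unfolding Neq by (simp add: zero_in_polydisc)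
  ultimately show ?thesis using that[of r N] r(1) NS img by blast
qed

section \<open>Meromorphic functions\<close>

lemma dense_iff:
  "T \<subseteq> closure {x\<in>T. P x} \<longleftrightarrow> (\<forall>W. open W \<longrightarrow> W \<inter> T \<noteq> {} \<longrightarrow> (\<exists>x\<in>W \<inter> T. P x))"
  (is "?L \<longleftrightarrow> ?R")
proof
  assume L: ?L
  show ?R
  proof (intro allI impI)
    fix W assume W: "open W" "W \<inter> T \<noteq> {}"
    then obtain p where "p \<in> W" "p \<in> T" by blast
    then have "p \<in> closure {x\<in>T. P x}" using L by blast
    with W(1) \<open>p \<in> W\<close> have "{x\<in>T. P x} \<inter> W \<noteq> {}"
      using open_Int_closure_eq_empty[OF W(1), of "{x\<in>T. P x}"] by blast
    then show "\<exists>x\<in>W \<inter> T. P x" by blast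
  qed
next
  assume R: ?R
  show ?L
  proof
    fix p assume p: "p \<in> T"
    show "p \<in> closure {x\<in>T. P x}"
    proof (rule ccontr)
      assume "p \<notin> closure {x\<in>T. P x}"
      then obtain x where "x \<in> (- closure {x\<in>T. P x}) \<inter> T" "P x"
        using R[rule_format, of "- closure {x\<in>T. P x}"] p by blast
      then show False using closure_subset[of "{x\<in>T. P x}"] by blast
    qed
  qed
qed

lemma dense_restrict:
  assumes "T \<subseteq> closure {x\<in>T. P x}" "open W" "W \<subseteq> T"
  shows "W \<subseteq> closure {x\<in>W. P x}"
  unfolding dense_iff
proof (intro allI impI)
  fix V assume V: "open V" "V \<inter> W \<noteq> {}"
  then have "open (V \<inter> W)" "(V \<inter> W) \<inter> T \<noteq> {}" using assms(2,3) by auto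
  then obtain x where "x \<in> (V \<inter> W) \<inter> T" "P x" using assms(1)[unfolded dense_iff] by blast
  then show "\<exists>x\<in>V \<inter> W. P x" by blast
qed

lemma open_nonzero:
  assumes "continuous_on T f" "open T"
  shows "open {x\<in>T. f x \<noteq> (0::complex)}"
proof -
  have "open (f -` (-{0}) \<inter> T)" using assms by (auto simp: continuous_on_open_vimage)
  moreover have "f -` (-{0}) \<inter> T = {x\<in>T. f x \<noteq> 0}" by auto
  ultimately show ?thesis by simp
qed

text \<open>Dense sets may be disjoint, but here one of them is the nonzero set of a continuous
  function and therefore open.\<close>

lemma dense_conj:
  assumes f: "continuous_on T f" "open T" "T \<subseteq> closure {x\<in>T. f x \<noteq> (0::complex)}"
    and P: "T \<subseteq> closure {x\<in>T. P x}"
  shows "T \<subseteq> closure {x\<in>T. f x \<noteq> 0 \<and> P x}"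
  unfolding dense_iff
proof (intro allI impI)
  fix W assume W: "open W" "W \<inter> T \<noteq> {}"
  then obtain x where x: "x \<in> W \<inter> T" "f x \<noteq> 0" using f(3)[unfolded dense_iff] by blast
  have "open (W \<inter> {x\<in>T. f x \<noteq> 0})" using W open_nonzero[OF f(1,2)] by blast
  moreover have "(W \<inter> {x\<in>T. f x \<noteq> 0}) \<inter> T \<noteq> {}" using x by blast
  ultimately obtain y where "y \<in> (W \<inter> {x\<in>T. f x \<noteq> 0}) \<inter> T" "P y" using P[unfolded dense_iff] by blast
  then show "\<exists>x\<in>W \<inter> T. f x \<noteq> 0 \<and> P x" by blast
qed

text \<open>The complement of \<open>X\<close> in \<open>S\<close> is contained in a thin analytic set.\<close>

definition generically ::
  "('a::topological_space, 'm::finite) chart set \<Rightarrow> 'a set \<Rightarrow> ('a \<Rightarrow> bool) \<Rightarrow> bool" where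
  "generically \<A> S P \<longleftrightarrow> (\<forall>p\<in>S. \<exists>T h. open T \<and> p \<in> T \<and> T \<subseteq> S \<and> holomorphic_mfd \<A> h T \<and>
     T \<subseteq> closure {x\<in>T. h x \<noteq> 0} \<and> (\<forall>x\<in>T. h x \<noteq> 0 \<longrightarrow> P x))"

text \<open>Meromorphy without normalisation of the values. Unlike \<open>meromorphic_mfd\<close> it
  is preserved by pointwise sums and products, so the algebra is done with it and normalisation
  comes last.\<close>

definition locally_quotient ::
  "('a::topological_space, 'm::finite) chart set \<Rightarrow> 'a set \<Rightarrow> ('a \<Rightarrow> complex) \<Rightarrow> bool" where
  "locally_quotient \<A> S f \<longleftrightarrow> (\<forall>p\<in>S. \<exists>T g h. open T \<and> p \<in> T \<and> T \<subseteq> S \<and> holomorphic_mfd \<A> g T \<and>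
     holomorphic_mfd \<A> h T \<and> T \<subseteq> closure {x\<in>T. h x \<noteq> 0} \<and> (\<forall>x\<in>T. h x \<noteq> 0 \<longrightarrow> f x = g x / h x))"

lemma generically_elim:
  assumes "generically \<A> S P" "p \<in> S"
  obtains T h where "open T" "p \<in> T" "T \<subseteq> S" "holomorphic_mfd \<A> h T"
    "T \<subseteq> closure {x\<in>T. h x \<noteq> 0}" "\<forall>x\<in>T. h x \<noteq> 0 \<longrightarrow> P x"
  using bspec[OF assms(1)[unfolded generically_def] assms(2)]
  by (elim exE conjE) (rule that)

lemma generically_mono: "generically \<A> S P \<Longrightarrow> (\<And>x. x \<in> S \<Longrightarrow> P x \<Longrightarrow> Q x) \<Longrightarrow> generically \<A> S Q"
  unfolding generically_def by (meson subsetD)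

lemma generically_UNIV_I: "(\<And>x. x \<in> S \<Longrightarrow> P x) \<Longrightarrow> open S \<Longrightarrow> generically \<A> S P"
  unfolding generically_def
  by (intro ballI exI[of _ S] exI[of _ "\<lambda>x. 1"]) (auto simp: closure_subset)

lemma generically_dense:
  assumes "generically \<A> S P"
  shows "S \<subseteq> closure {x\<in>S. P x}"
proof
  fix p assume "p \<in> S"
  then obtain T h where "open T" "p \<in> T" "T \<subseteq> S" "holomorphic_mfd \<A> h T"
    "T \<subseteq> closure {x\<in>T. h x \<noteq> 0}" "\<forall>x\<in>T. h x \<noteq> 0 \<longrightarrow> P x"
    by (rule generically_elim[OF assms])
  moreover from this have "{x\<in>T. h x \<noteq> 0} \<subseteq> {x\<in>S. P x}" by blast
  ultimately show "p \<in> closure {x\<in>S. P x}" using closure_mono by blast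
qed

context
  fixes \<A> :: "('a::{t2_space,second_countable_topology}, 'm::finite) chart set"
  assumes M: "complex_manifold \<A>"
begin

lemma generically_conj:
  assumes "generically \<A> S P" "generically \<A> S Q"
  shows "generically \<A> S (\<lambda>x. P x \<and> Q x)"
  unfolding generically_def
proof
  fix p assume p: "p \<in> S"
  obtain T1 h1 where 1: "open T1" "p \<in> T1" "T1 \<subseteq> S" "holomorphic_mfd \<A> h1 T1"
    "T1 \<subseteq> closure {x\<in>T1. h1 x \<noteq> 0}" "\<forall>x\<in>T1. h1 x \<noteq> 0 \<longrightarrow> P x"
    by (rule generically_elim[OF assms(1) p])
  obtain T2 h2 where 2: "open T2" "p \<in> T2" "T2 \<subseteq> S" "holomorphic_mfd \<A> h2 T2"
    "T2 \<subseteq> closure {x\<in>T2. h2 x \<noteq> 0}" "\<forall>x\<in>T2. h2 x \<noteq> 0 \<longrightarrow> Q x"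
    by (rule generically_elim[OF assms(2) p])
  let ?T = "T1 \<inter> T2"
  have T: "open ?T" using 1 2 by blast
  have h: "holomorphic_mfd \<A> h1 ?T" "holomorphic_mfd \<A> h2 ?T"
    by (rule holomorphic_mfd_subset[OF 1(4)], simp, rule holomorphic_mfd_subset[OF 2(4)], simp)
  have "?T \<subseteq> closure {x\<in>?T. h1 x \<noteq> 0 \<and> h2 x \<noteq> 0}"
    by (rule dense_conj[OF holomorphic_mfd_continuous_on[OF M h(1) T] T dense_restrict[OF 1(5) T] dense_restrict[OF 2(5) T]]) auto
  then have "?T \<subseteq> closure {x\<in>?T. h1 x * h2 x \<noteq> 0}" by simp
  then show "\<exists>T h. open T \<and> p \<in> T \<and> T \<subseteq> S \<and> holomorphic_mfd \<A> h T \<and>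
      T \<subseteq> closure {x\<in>T. h x \<noteq> 0} \<and> (\<forall>x\<in>T. h x \<noteq> 0 \<longrightarrow> P x \<and> Q x)"
    using 1 2 T holomorphic_mfd_mult[OF h] by (intro exI[of _ ?T] exI[of _ "\<lambda>x. h1 x * h2 x"]) auto
qed

lemma generically_finite_ball:
  assumes "finite I" "\<And>i. i \<in> I \<Longrightarrow> generically \<A> S (P i)" "open S"
  shows "generically \<A> S (\<lambda>x. \<forall>i\<in>I. P i x)"
  using assms
proof (induction I rule: finite_induct)
  case empty
  then show ?case by (intro generically_UNIV_I) auto
next
  case (insert i I)
  then show ?case using generically_conj[of S "P i" "\<lambda>x. \<forall>i\<in>I. P i x"] by simp
qed

text \<open>A ball in a chart is convex, so the identity theorem decides between the alternatives on
  it.\<close>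

lemma holomorphic_mfd_dichotomy:
  assumes f: "holomorphic_mfd \<A> f T" "open T" "p \<in> T"
  obtains W where "open W" "connected W" "p \<in> W" "W \<subseteq> T" "(\<forall>x\<in>W. f x = 0) \<or> W \<subseteq> closure {x\<in>W. f x \<noteq> 0}"
proof -
  obtain c where c: "c \<in> \<A>" "p \<in> fst c" by (rule atlas_covers[OF M])
  note hc = atlas_holomorphic_coordinate[OF M c(1)]
  note ct = holomorphic_coordinate_topological[OF hc]
  have "open (snd c ` (fst c \<inter> T))" by (rule chart_image_open[OF ct f(2)])
  moreover have "snd c p \<in> snd c ` (fst c \<inter> T)" using c f by blast
  ultimately obtain e where e: "e > 0" "ball (snd c p) e \<subseteq> snd c ` (fst c \<inter> T)" by (meson open_contains_ball)
  let ?B = "ball (snd c p) e"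
  let ?f = "\<lambda>z. f (chart_inv c z)"
  have Bsub: "?B \<subseteq> snd c ` fst c" using e(2) by blast
  define W where "W = {x \<in> fst c. snd c x \<in> ?B}"
  have Weq: "W = chart_inv c ` ?B" unfolding W_def using chart_inv_image[OF ct Bsub] by simp
  have openW: "open W" unfolding W_def by (rule chart_preimage_open[OF ct open_ball])
  have conW: "connected W"
    unfolding Weq using chart_inv_continuous[OF ct] Bsub
    by (intro connected_continuous_image convex_connected convex_ball) (rule continuous_on_subset)
  have WT: "W \<subseteq> T"
  proof
    fix x assume x: "x \<in> W"
    then obtain y where y: "y \<in> fst c \<inter> T" "snd c x = snd c y" using e(2) unfolding W_def by blast
    then have "x = y" using chart_inv_snd[OF ct, of x] chart_inv_snd[OF ct, of y] x unfolding W_def by auto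
    then show "x \<in> T" using y by blast
  qed
  have pW: "p \<in> W" using c e by (simp add: W_def)
  have holf: "holomorphic_Cn ?f ?B"
    using f(1) c(1) e(2) unfolding holomorphic_mfd_def by (blast intro: holomorphic_Cn_subset)
  have "(\<forall>x\<in>W. f x = 0) \<or> W \<subseteq> closure {x\<in>W. f x \<noteq> 0}"
  proof (cases "\<forall>z\<in>?B. ?f z = 0")
    case True
    then show ?thesis unfolding Weq by auto
  next
    case False
    then obtain q where "q \<in> ?B" "?f q \<noteq> 0" by blast
    then have dB: "?B \<subseteq> closure {z\<in>?B. ?f z \<noteq> 0}"
      by (rule holomorphic_Cn_nonzero_dense[OF holf open_ball convex_ball])
    have "W \<subseteq> closure {x\<in>W. f x \<noteq> 0}"
      unfolding dense_iff
    proof (intro allI impI)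
      fix V assume V: "open V" "V \<inter> W \<noteq> {}"
      have "open (snd c ` (fst c \<inter> V))" by (rule chart_image_open[OF ct V(1)])
      moreover have "snd c ` (fst c \<inter> V) \<inter> ?B \<noteq> {}" using V(2) unfolding W_def by blast
      ultimately obtain z where z: "z \<in> snd c ` (fst c \<inter> V) \<inter> ?B" "?f z \<noteq> 0" using dB[unfolded dense_iff] by blast
      then obtain x where x: "x \<in> fst c \<inter> V" "z = snd c x" by blast
      then have "x \<in> V \<inter> W" "f x \<noteq> 0" using z chart_inv_snd[OF ct, of x] unfolding W_def by auto
      then show "\<exists>x\<in>V \<inter> W. f x \<noteq> 0" by blast
    qed
    then show ?thesis ..
  qed
  then show ?thesis using that openW conW pW WT by blast
qed

section \<open>The field of meromorphic functions\<close>

lemma locally_quotientI: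
  assumes "\<And>p. p \<in> S \<Longrightarrow> \<exists>T g h. open T \<and> p \<in> T \<and> T \<subseteq> S \<and> holomorphic_mfd \<A> g T \<and>
     holomorphic_mfd \<A> h T \<and> T \<subseteq> closure {x\<in>T. h x \<noteq> 0} \<and> (\<forall>x\<in>T. h x \<noteq> 0 \<longrightarrow> f x = g x / h x)"
  shows "locally_quotient \<A> S f"
  using assms unfolding locally_quotient_def by blast

lemma locally_quotientE:
  assumes "locally_quotient \<A> S f" "p \<in> S"
  obtains T g h where "open T" "p \<in> T" "T \<subseteq> S" "holomorphic_mfd \<A> g T" "holomorphic_mfd \<A> h T"
    "T \<subseteq> closure {x\<in>T. h x \<noteq> 0}" "\<forall>x\<in>T. h x \<noteq> 0 \<longrightarrow> f x = g x / h x"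
  using bspec[OF assms(1)[unfolded locally_quotient_def] assms(2)]
  by (elim exE conjE) (rule that)

lemma holomorphic_locally_quotient:
  assumes "holomorphic_mfd \<A> f S" "open S" shows "locally_quotient \<A> S f"
  using assms by (intro locally_quotientI exI[of _ S] exI[of _ f] exI[of _ "\<lambda>x. 1"]) (auto simp: closure_subset)

lemma locally_quotient_const: "open S \<Longrightarrow> locally_quotient \<A> S (\<lambda>x. c)"
  by (intro holomorphic_locally_quotient) auto

lemma locally_quotient_pair:
  assumes f1: "locally_quotient \<A> S f1" and f2: "locally_quotient \<A> S f2" and p: "p \<in> S"
  obtains T g1 h1 g2 h2 where "open T" "p \<in> T" "T \<subseteq> S"
    "holomorphic_mfd \<A> g1 T" "holomorphic_mfd \<A> h1 T" "holomorphic_mfd \<A> g2 T" "holomorphic_mfd \<A> h2 T"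
    "T \<subseteq> closure {x\<in>T. h1 x * h2 x \<noteq> 0}" "\<forall>x\<in>T. h1 x \<noteq> 0 \<longrightarrow> f1 x = g1 x / h1 x"
    "\<forall>x\<in>T. h2 x \<noteq> 0 \<longrightarrow> f2 x = g2 x / h2 x"
proof -
  obtain T1 g1 h1 where 1: "open T1" "p \<in> T1" "T1 \<subseteq> S" "holomorphic_mfd \<A> g1 T1" "holomorphic_mfd \<A> h1 T1"
    "T1 \<subseteq> closure {x\<in>T1. h1 x \<noteq> 0}" "\<forall>x\<in>T1. h1 x \<noteq> 0 \<longrightarrow> f1 x = g1 x / h1 x"
    by (rule locally_quotientE[OF f1 p])
  obtain T2 g2 h2 where 2: "open T2" "p \<in> T2" "T2 \<subseteq> S" "holomorphic_mfd \<A> g2 T2" "holomorphic_mfd \<A> h2 T2"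
    "T2 \<subseteq> closure {x\<in>T2. h2 x \<noteq> 0}" "\<forall>x\<in>T2. h2 x \<noteq> 0 \<longrightarrow> f2 x = g2 x / h2 x"
    by (rule locally_quotientE[OF f2 p])
  let ?T = "T1 \<inter> T2"
  have T: "open ?T" "?T \<subseteq> T1" "?T \<subseteq> T2" using 1 2 by blast+
  note hol = holomorphic_mfd_subset[OF 1(4) T(2)] holomorphic_mfd_subset[OF 1(5) T(2)]
    holomorphic_mfd_subset[OF 2(4) T(3)] holomorphic_mfd_subset[OF 2(5) T(3)]
  have "?T \<subseteq> closure {x\<in>?T. h1 x \<noteq> 0 \<and> h2 x \<noteq> 0}"
    by (rule dense_conj[OF holomorphic_mfd_continuous_on[OF M hol(2) T(1)] T(1) dense_restrict[OF 1(6) T(1,2)] dense_restrict[OF 2(6) T(1,3)]])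
  then have "?T \<subseteq> closure {x\<in>?T. h1 x * h2 x \<noteq> 0}" by simp
  then show ?thesis
    by (intro that[of ?T g1 h1 g2 h2] hol T(1)) (use 1 2 in auto)
qed

lemma locally_quotient_add:
  assumes "locally_quotient \<A> S f1" "locally_quotient \<A> S f2"
  shows "locally_quotient \<A> S (\<lambda>x. f1 x + f2 x)"
proof (rule locally_quotientI)
  fix p assume "p \<in> S"
  then obtain T g1 h1 g2 h2 where *: "open T" "p \<in> T" "T \<subseteq> S"
    "holomorphic_mfd \<A> g1 T" "holomorphic_mfd \<A> h1 T" "holomorphic_mfd \<A> g2 T" "holomorphic_mfd \<A> h2 T"
    "T \<subseteq> closure {x\<in>T. h1 x * h2 x \<noteq> 0}" "\<forall>x\<in>T. h1 x \<noteq> 0 \<longrightarrow> f1 x = g1 x / h1 x"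
    "\<forall>x\<in>T. h2 x \<noteq> 0 \<longrightarrow> f2 x = g2 x / h2 x"
    by (rule locally_quotient_pair[OF assms])
  then show "\<exists>T g h. open T \<and> p \<in> T \<and> T \<subseteq> S \<and> holomorphic_mfd \<A> g T \<and>
     holomorphic_mfd \<A> h T \<and> T \<subseteq> closure {x\<in>T. h x \<noteq> 0} \<and> (\<forall>x\<in>T. h x \<noteq> 0 \<longrightarrow> f1 x + f2 x = g x / h x)"
    by (intro exI[of _ T] exI[of _ "\<lambda>x. g1 x * h2 x + g2 x * h1 x"] exI[of _ "\<lambda>x. h1 x * h2 x"])
       (auto intro!: holomorphic_mfd_add holomorphic_mfd_mult simp: add_frac_eq)
qed

lemma locally_quotient_mult:
  assumes "locally_quotient \<A> S f1" "locally_quotient \<A> S f2"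
  shows "locally_quotient \<A> S (\<lambda>x. f1 x * f2 x)"
proof (rule locally_quotientI)
  fix p assume "p \<in> S"
  then obtain T g1 h1 g2 h2 where *: "open T" "p \<in> T" "T \<subseteq> S"
    "holomorphic_mfd \<A> g1 T" "holomorphic_mfd \<A> h1 T" "holomorphic_mfd \<A> g2 T" "holomorphic_mfd \<A> h2 T"
    "T \<subseteq> closure {x\<in>T. h1 x * h2 x \<noteq> 0}" "\<forall>x\<in>T. h1 x \<noteq> 0 \<longrightarrow> f1 x = g1 x / h1 x"
    "\<forall>x\<in>T. h2 x \<noteq> 0 \<longrightarrow> f2 x = g2 x / h2 x"
    by (rule locally_quotient_pair[OF assms])
  then show "\<exists>T g h. open T \<and> p \<in> T \<and> T \<subseteq> S \<and> holomorphic_mfd \<A> g T \<and>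
     holomorphic_mfd \<A> h T \<and> T \<subseteq> closure {x\<in>T. h x \<noteq> 0} \<and> (\<forall>x\<in>T. h x \<noteq> 0 \<longrightarrow> f1 x * f2 x = g x / h x)"
    by (intro exI[of _ T] exI[of _ "\<lambda>x. g1 x * g2 x"] exI[of _ "\<lambda>x. h1 x * h2 x"])
       (auto intro!: holomorphic_mfd_add holomorphic_mfd_mult)
qed

lemma locally_quotient_sum:
  "open S \<Longrightarrow> (\<And>i. i \<in> I \<Longrightarrow> locally_quotient \<A> S (f i)) \<Longrightarrow> locally_quotient \<A> S (\<lambda>x. \<Sum>i\<in>I. f i x)"
  by (induction I rule: infinite_finite_induct) (auto intro: locally_quotient_const locally_quotient_add)

lemma locally_quotient_inverse:
  assumes f: "locally_quotient \<A> S f" and nz: "generically \<A> S (\<lambda>x. f x \<noteq> 0)"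
  shows "locally_quotient \<A> S (\<lambda>x. inverse (f x))"
proof (rule locally_quotientI)
  fix p assume p: "p \<in> S"
  obtain T1 g h where 1: "open T1" "p \<in> T1" "T1 \<subseteq> S" "holomorphic_mfd \<A> g T1" "holomorphic_mfd \<A> h T1"
    "T1 \<subseteq> closure {x\<in>T1. h x \<noteq> 0}" "\<forall>x\<in>T1. h x \<noteq> 0 \<longrightarrow> f x = g x / h x"
    by (rule locally_quotientE[OF f p])
  obtain T2 k where 2: "open T2" "p \<in> T2" "T2 \<subseteq> S" "holomorphic_mfd \<A> k T2"
    "T2 \<subseteq> closure {x\<in>T2. k x \<noteq> 0}" "\<forall>x\<in>T2. k x \<noteq> 0 \<longrightarrow> f x \<noteq> 0"
    by (rule generically_elim[OF nz p])
  let ?T = "T1 \<inter> T2"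
  have T: "open ?T" "?T \<subseteq> T1" "?T \<subseteq> T2" using 1 2 by blast+
  note hol = holomorphic_mfd_subset[OF 1(4) T(2)] holomorphic_mfd_subset[OF 1(5) T(2)]
    holomorphic_mfd_subset[OF 2(4) T(3)]
  have "?T \<subseteq> closure {x\<in>?T. h x \<noteq> 0 \<and> k x \<noteq> 0}"
    by (rule dense_conj[OF holomorphic_mfd_continuous_on[OF M hol(2) T(1)] T(1) dense_restrict[OF 1(6) T(1,2)] dense_restrict[OF 2(5) T(1,3)]])
  moreover have "{x\<in>?T. h x \<noteq> 0 \<and> k x \<noteq> 0} \<subseteq> {x\<in>?T. g x * h x \<noteq> 0}"
    using 1(7) 2(6) by auto
  ultimately have "?T \<subseteq> closure {x\<in>?T. g x * h x \<noteq> 0}"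
    by (meson closure_mono subset_trans)
  \<comment> \<open>The fraction \<open>h / g\<close> is expanded by \<open>h\<close>, because
    \<open>f = g / h\<close> is known only where \<open>h\<close> is nonzero.\<close>
  then show "\<exists>T g h. open T \<and> p \<in> T \<and> T \<subseteq> S \<and> holomorphic_mfd \<A> g T \<and>
     holomorphic_mfd \<A> h T \<and> T \<subseteq> closure {x\<in>T. h x \<noteq> 0} \<and> (\<forall>x\<in>T. h x \<noteq> 0 \<longrightarrow> inverse (f x) = g x / h x)"
    using 1 2 T
    by (intro exI[of _ ?T] exI[of _ "\<lambda>x. h x * h x"] exI[of _ "\<lambda>x. g x * h x"])
       (auto intro!: holomorphic_mfd_mult hol)
qed

text \<open>The points near which \<open>f\<close> vanishes generically and those near which it is
  generically nonzero form disjoint open sets that cover the connected set \<open>S\<close>.\<close>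

lemma locally_quotient_dichotomy:
  assumes f: "locally_quotient \<A> S f" and S: "open S" "connected S"
  shows "generically \<A> S (\<lambda>x. f x = 0) \<or> generically \<A> S (\<lambda>x. f x \<noteq> 0)"
proof -
  define G where "G P = (\<Union>{T. open T \<and> T \<subseteq> S \<and> (\<exists>h. holomorphic_mfd \<A> h T \<and>
     T \<subseteq> closure {x\<in>T. h x \<noteq> 0} \<and> (\<forall>x\<in>T. h x \<noteq> 0 \<longrightarrow> P x))})" for P
  have openG: "open (G P)" for P unfolding G_def by (rule open_Union) blast
  have GI: "p \<in> G P" if "open T" "p \<in> T" "T \<subseteq> S" "holomorphic_mfd \<A> h T"
     "T \<subseteq> closure {x\<in>T. h x \<noteq> 0}" "\<forall>x\<in>T. h x \<noteq> 0 \<longrightarrow> P x" for T h p P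
    unfolding G_def using that by blast
  have gen: "generically \<A> S P" if "S \<subseteq> G P" for P
    unfolding generically_def
  proof
    fix p assume "p \<in> S"
    then have "p \<in> G P" using that by blast
    then show "\<exists>T h. open T \<and> p \<in> T \<and> T \<subseteq> S \<and> holomorphic_mfd \<A> h T \<and>
       T \<subseteq> closure {x\<in>T. h x \<noteq> 0} \<and> (\<forall>x\<in>T. h x \<noteq> 0 \<longrightarrow> P x)"
      unfolding G_def by blast
  qed
  have cover: "S \<subseteq> G (\<lambda>x. f x = 0) \<union> G (\<lambda>x. f x \<noteq> 0)"
  proof
    fix p assume p: "p \<in> S"
    obtain T g h where 1: "open T" "p \<in> T" "T \<subseteq> S" "holomorphic_mfd \<A> g T" "holomorphic_mfd \<A> h T"
      "T \<subseteq> closure {x\<in>T. h x \<noteq> 0}" "\<forall>x\<in>T. h x \<noteq> 0 \<longrightarrow> f x = g x / h x"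
      by (rule locally_quotientE[OF f p])
    obtain W where W: "open W" "p \<in> W" "W \<subseteq> T" "(\<forall>x\<in>W. g x = 0) \<or> W \<subseteq> closure {x\<in>W. g x \<noteq> 0}"
      by (rule holomorphic_mfd_dichotomy[OF 1(4,1,2)])
    have hol: "holomorphic_mfd \<A> g W" "holomorphic_mfd \<A> h W"
      by (rule holomorphic_mfd_subset[OF 1(4) W(3)], rule holomorphic_mfd_subset[OF 1(5) W(3)])
    have WS: "W \<subseteq> S" using W 1 by blast
    note dh = dense_restrict[OF 1(6) W(1,3)]
    from W(4) show "p \<in> G (\<lambda>x. f x = 0) \<union> G (\<lambda>x. f x \<noteq> 0)"
    proof
      assume g0: "\<forall>x\<in>W. g x = 0"
      have "p \<in> G (\<lambda>x. f x = 0)" by (rule GI[OF W(1,2) WS hol(2) dh]) (use g0 1(7) W(3) in auto)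
      then show ?thesis ..
    next
      assume dg: "W \<subseteq> closure {x\<in>W. g x \<noteq> 0}"
      have "W \<subseteq> closure {x\<in>W. g x \<noteq> 0 \<and> h x \<noteq> 0}"
        by (rule dense_conj[OF holomorphic_mfd_continuous_on[OF M hol(1) W(1)] W(1) dg dh])
      then have "W \<subseteq> closure {x\<in>W. g x * h x \<noteq> 0}" by simp
      then have "p \<in> G (\<lambda>x. f x \<noteq> 0)"
        by (rule GI[OF W(1,2) WS holomorphic_mfd_mult[OF hol]]) (use 1(7) W(3) in auto)
      then show ?thesis ..
    qed
  qed
  have disj: "G (\<lambda>x. f x = 0) \<inter> G (\<lambda>x. f x \<noteq> 0) = {}"
  proof (rule ccontr)
    assume "G (\<lambda>x. f x = 0) \<inter> G (\<lambda>x. f x \<noteq> 0) \<noteq> {}"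
    then obtain p where p: "p \<in> G (\<lambda>x. f x = 0)" "p \<in> G (\<lambda>x. f x \<noteq> 0)" by blast
    obtain T1 h1 where 1: "p \<in> T1" "open T1" "holomorphic_mfd \<A> h1 T1"
      "T1 \<subseteq> closure {x\<in>T1. h1 x \<noteq> 0}" "\<forall>x\<in>T1. h1 x \<noteq> 0 \<longrightarrow> f x = 0"
      using p(1) unfolding G_def mem_Collect_eq Union_iff bex_simps by (elim bexE exE conjE CollectE)
    obtain T2 h2 where 2: "p \<in> T2" "open T2" "holomorphic_mfd \<A> h2 T2"
      "T2 \<subseteq> closure {x\<in>T2. h2 x \<noteq> 0}" "\<forall>x\<in>T2. h2 x \<noteq> 0 \<longrightarrow> f x \<noteq> 0"
      using p(2) unfolding G_def mem_Collect_eq Union_iff bex_simps by (elim bexE exE conjE CollectE)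
    let ?T = "T1 \<inter> T2"
    have T: "open ?T" "?T \<subseteq> T1" "?T \<subseteq> T2" using 1 2 by blast+
    have "?T \<subseteq> closure {x\<in>?T. h1 x \<noteq> 0 \<and> h2 x \<noteq> 0}"
      by (rule dense_conj[OF holomorphic_mfd_continuous_on[OF M holomorphic_mfd_subset[OF 1(3) T(2)] T(1)] T(1)
          dense_restrict[OF 1(4) T(1,2)] dense_restrict[OF 2(4) T(1,3)]])
    then have "\<exists>x\<in>T1 \<inter> ?T. h1 x \<noteq> 0 \<and> h2 x \<noteq> 0" unfolding dense_iff using 1(1,2) 2(1) by blast
    then show False using 1(5) 2(5) by blast
  qed
  have "G (\<lambda>x. f x = 0) \<inter> S = {} \<or> G (\<lambda>x. f x \<noteq> 0) \<inter> S = {}"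
    using connectedD[OF S(2) openG openG] cover disj by blast
  then have "S \<subseteq> G (\<lambda>x. f x \<noteq> 0) \<or> S \<subseteq> G (\<lambda>x. f x = 0)" using cover by blast
  then show ?thesis using gen by blast
qed

section \<open>Normalisation of meromorphic functions\<close>

definition local_extension :: "'a set \<Rightarrow> ('a \<Rightarrow> complex) \<Rightarrow> 'a \<Rightarrow> 'a set \<Rightarrow> ('a \<Rightarrow> complex) \<Rightarrow> bool" where
  "local_extension S f p T g \<longleftrightarrow> open T \<and> p \<in> T \<and> T \<subseteq> S \<and> holomorphic_mfd \<A> g T \<and> T \<subseteq> closure {x\<in>T. f x = g x}"

text \<open>Removes the removable singularities; the value at the others is set to 0.\<close>

definition normalized :: "'a set \<Rightarrow> ('a \<Rightarrow> complex) \<Rightarrow> 'a \<Rightarrow> complex" where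
  "normalized S f p = (if \<exists>T g. local_extension S f p T g then (SOME w. \<exists>T g. local_extension S f p T g \<and> w = g p) else 0)"

text \<open>Where the denominator of a representation \<open>g / h\<close> is nonzero, density
  forces every extension to equal this continuous quotient; such points are dense in turn.\<close>

lemma local_extension_unique:
  assumes f: "locally_quotient \<A> S f" and 1: "local_extension S f p T1 g1" and 2: "local_extension S f p T2 g2"
  shows "g1 p = g2 p"
proof -
  have p: "p \<in> S" using 1 unfolding local_extension_def by blast
  obtain T0 g h where 0: "open T0" "p \<in> T0" "T0 \<subseteq> S" "holomorphic_mfd \<A> g T0" "holomorphic_mfd \<A> h T0"
    "T0 \<subseteq> closure {x\<in>T0. h x \<noteq> 0}" "\<forall>x\<in>T0. h x \<noteq> 0 \<longrightarrow> f x = g x / h x"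
    by (rule locally_quotientE[OF f p])
  define O0 where "O0 = {x\<in>T0. h x \<noteq> 0}"
  have O0: "open O0" unfolding O0_def by (rule open_nonzero[OF holomorphic_mfd_continuous_on[OF M 0(5,1)] 0(1)])
  have eq: "gi x = g x / h x" if gi: "local_extension S f p Ti gi" and x: "x \<in> O0 \<inter> Ti" for gi Ti x
  proof (rule eq_on_dense[where T="O0 \<inter> Ti" and X="{x\<in>Ti. f x = gi x}"])
    show "continuous_on (O0 \<inter> Ti) gi"
      using gi holomorphic_mfd_continuous_on[OF M] unfolding local_extension_def by (blast intro: continuous_on_subset)
    have "continuous_on (O0 \<inter> Ti) g" "continuous_on (O0 \<inter> Ti) h"
      using holomorphic_mfd_continuous_on[OF M 0(4,1)] holomorphic_mfd_continuous_on[OF M 0(5,1)]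
      unfolding O0_def by (auto intro: continuous_on_subset)
    then show "continuous_on (O0 \<inter> Ti) (\<lambda>x. g x / h x)"
      by (intro continuous_on_divide) (auto simp: O0_def)
    show "open (O0 \<inter> Ti)" using O0 gi unfolding local_extension_def by blast
    show "O0 \<inter> Ti \<subseteq> closure {x \<in> Ti. f x = gi x}" using gi unfolding local_extension_def by blast
    show "gi z = g z / h z" if "z \<in> {x \<in> Ti. f x = gi x}" "z \<in> O0 \<inter> Ti" for z
      using that 0(7) unfolding O0_def by simp
  qed (rule x)
  show ?thesis
  proof (rule eq_on_dense[where T="T0 \<inter> T1 \<inter> T2" and X="O0"])
    show "continuous_on (T0 \<inter> T1 \<inter> T2) g1" "continuous_on (T0 \<inter> T1 \<inter> T2) g2"
      using 1 2 holomorphic_mfd_continuous_on[OF M] unfolding local_extension_def by (blast intro: continuous_on_subset)+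
    show "open (T0 \<inter> T1 \<inter> T2)" "p \<in> T0 \<inter> T1 \<inter> T2" using 0 1 2 unfolding local_extension_def by blast+
    show "T0 \<inter> T1 \<inter> T2 \<subseteq> closure O0" using 0(6) unfolding O0_def by blast
    show "g1 z = g2 z" if "z \<in> O0" "z \<in> T0 \<inter> T1 \<inter> T2" for z
      using eq[OF 1, of z] eq[OF 2, of z] that by simp
  qed
qed

lemma normalized_eq:
  assumes "locally_quotient \<A> S f" "local_extension S f p T g"
  shows "normalized S f p = g p"
proof -
  have "\<exists>T' g'. local_extension S f p T' g' \<and> (SOME w. \<exists>T g. local_extension S f p T g \<and> w = g p) = g' p"
    by (rule someI[where x="g p" and P="\<lambda>w. \<exists>T' g'. local_extension S f p T' g' \<and> w = g' p"]) (use assms in blast)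
  then obtain T' g' where "local_extension S f p T' g'" "(SOME w. \<exists>T g. local_extension S f p T g \<and> w = g p) = g' p" by blast
  then show ?thesis using assms local_extension_unique unfolding normalized_def by metis
qed

text \<open>Near such a point \<open>g / h\<close> itself is a holomorphic extension, so
  normalisation leaves the value unchanged.\<close>

lemma normalized_eq_local:
  assumes f: "locally_quotient \<A> S f" and T: "open T" "T \<subseteq> S" "holomorphic_mfd \<A> g T" "holomorphic_mfd \<A> h T"
    "\<forall>x\<in>T. h x \<noteq> 0 \<longrightarrow> f x = g x / h x" and x: "x \<in> T" "h x \<noteq> 0"
  shows "normalized S f x = f x"
proof -
  let ?W = "{x\<in>T. h x \<noteq> 0}"
  have W: "open ?W" by (rule open_nonzero[OF holomorphic_mfd_continuous_on[OF M T(4,1)] T(1)])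
  have "holomorphic_mfd \<A> (\<lambda>x. g x / h x) ?W"
    by (intro holomorphic_mfd_divide[OF M] holomorphic_mfd_subset[OF T(3)] holomorphic_mfd_subset[OF T(4)]) auto
  moreover have "{x\<in>?W. f x = g x / h x} = ?W" using T(5) by blast
  ultimately have "local_extension S f x ?W (\<lambda>x. g x / h x)"
    using W T x unfolding local_extension_def by (auto simp: closure_subset)
  from normalized_eq[OF f this] show ?thesis using T(5) x by simp
qed

lemma normalized_generically:
  assumes f: "locally_quotient \<A> S f"
  shows "generically \<A> S (\<lambda>x. normalized S f x = f x)"
  unfolding generically_def
proof
  fix p assume p: "p \<in> S"
  obtain T g h where 0: "open T" "p \<in> T" "T \<subseteq> S" "holomorphic_mfd \<A> g T" "holomorphic_mfd \<A> h T"
    "T \<subseteq> closure {x\<in>T. h x \<noteq> 0}" "\<forall>x\<in>T. h x \<noteq> 0 \<longrightarrow> f x = g x / h x"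
    by (rule locally_quotientE[OF f p])
  then show "\<exists>T h. open T \<and> p \<in> T \<and> T \<subseteq> S \<and> holomorphic_mfd \<A> h T \<and>
     T \<subseteq> closure {x\<in>T. h x \<noteq> 0} \<and> (\<forall>x\<in>T. h x \<noteq> 0 \<longrightarrow> normalized S f x = f x)"
    using normalized_eq_local[OF f 0(1,3,4,5,7)] by blast
qed

lemma normalized_meromorphic:
  assumes f: "locally_quotient \<A> S f"
  shows "meromorphic_mfd \<A> (normalized S f) S"
  unfolding meromorphic_mfd_def
proof (intro conjI ballI allI impI)
  fix p assume p: "p \<in> S"
  obtain T g h where 0: "open T" "p \<in> T" "T \<subseteq> S" "holomorphic_mfd \<A> g T" "holomorphic_mfd \<A> h T"
    "T \<subseteq> closure {x\<in>T. h x \<noteq> 0}" "\<forall>x\<in>T. h x \<noteq> 0 \<longrightarrow> f x = g x / h x"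
    by (rule locally_quotientE[OF f p])
  obtain W where W: "open W" "connected W" "p \<in> W" "W \<subseteq> T"
    by (rule holomorphic_mfd_dichotomy[OF 0(4,1,2)])
  have "\<exists>x\<in>W. h x \<noteq> 0" using 0(6)[unfolded dense_iff] W by blast
  moreover have "normalized S f x = g x / h x" if "x \<in> W" "h x \<noteq> 0" for x
    using normalized_eq_local[OF f 0(1,3,4,5,7), of x] 0(7) that W(4) by auto
  ultimately show "\<exists>T g h. open T \<and> connected T \<and> p \<in> T \<and> T \<subseteq> S \<and> holomorphic_mfd \<A> g T \<and>
      holomorphic_mfd \<A> h T \<and> (\<exists>x\<in>T. h x \<noteq> 0) \<and> (\<forall>x\<in>T. h x \<noteq> 0 \<longrightarrow> normalized S f x = g x / h x)"
    using W 0 holomorphic_mfd_subset[OF 0(4) W(4)] holomorphic_mfd_subset[OF 0(5) W(4)]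
    by (intro exI[of _ W] exI[of _ g] exI[of _ h]) auto
next
  fix p T g assume p: "p \<in> S" and T: "open T \<and> p \<in> T \<and> T \<subseteq> S \<and> holomorphic_mfd \<A> g T \<and> T \<subseteq> closure {x\<in>T. normalized S f x = g x}"
  \<comment> \<open>Normalisation alters \<open>f\<close> only outside an open dense set, so
    agreement with \<open>g\<close> on a dense set passes from the normalised function to
    \<open>f\<close>.\<close>
  have "T \<subseteq> closure {x\<in>T. f x = g x}"
    unfolding dense_iff
  proof (intro allI impI)
    fix W assume W: "open W" "W \<inter> T \<noteq> {}"
    then obtain q where q: "q \<in> W" "q \<in> T" by blast
    then have "q \<in> S" using T by blast
    then obtain T0 g0 h where 0: "open T0" "q \<in> T0" "T0 \<subseteq> S" "holomorphic_mfd \<A> g0 T0" "holomorphic_mfd \<A> h T0"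
      "T0 \<subseteq> closure {x\<in>T0. h x \<noteq> 0}" "\<forall>x\<in>T0. h x \<noteq> 0 \<longrightarrow> f x = g0 x / h x"
      by (rule locally_quotientE[OF f])
    let ?O = "{x\<in>T0. h x \<noteq> 0} \<inter> W"
    have "open ?O" using open_nonzero[OF holomorphic_mfd_continuous_on[OF M 0(5,1)] 0(1)] W by blast
    moreover have "?O \<inter> T \<noteq> {}"
    proof -
      have "\<exists>x\<in>(W \<inter> T) \<inter> T0. h x \<noteq> 0" using 0(6)[unfolded dense_iff, rule_format, of "W \<inter> T"] W T q 0(2) by blast
      then show ?thesis by blast
    qed
    ultimately obtain x where x: "x \<in> ?O \<inter> T" "normalized S f x = g x"
      using T[unfolded dense_iff] by blast
    then have "f x = g x" using normalized_eq_local[OF f 0(1,3,4,5,7), of x] by simp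
    then show "\<exists>x\<in>W \<inter> T. f x = g x" using x by blast
  qed
  then show "normalized S f p = g p" using normalized_eq[OF f] T unfolding local_extension_def by blast
qed

end

section \<open>Regular points\<close>

lemma rsquarefree_card_roots:
  fixes p :: "complex poly"
  assumes "rsquarefree p"
  shows "card {z. poly p z = 0} = degree p"
proof -
  have p0: "p \<noteq> 0" using assms by (auto simp: rsquarefree_def)
  have "degree p = degree (smult (lead_coeff p) (\<Prod>z|poly p z = 0. [:-z, 1:]))"
    using complex_poly_decompose_rsquarefree[OF assms] by simp
  also have "\<dots> = (\<Sum>z|poly p z = 0. degree [:-z, 1:])"
    using p0 by (simp add: degree_prod_sum_eq)
  finally show ?thesis by simp
qed

section \<open>Polynomials over the field of meromorphic functions\<close>

context
  fixes \<A> :: "('a::{t2_space,second_countable_topology}, 'm::finite) chart set"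
  assumes M: "complex_manifold \<A>"
begin

text \<open>A polynomial over the meromorphic functions, given by its specialisations; the uniform
  bound on the degree leaves finitely many coefficients to control.\<close>

definition poly_family :: "('a \<Rightarrow> complex poly) \<Rightarrow> bool" where
  "poly_family Q \<longleftrightarrow> (\<exists>n. \<forall>x. degree (Q x) \<le> n) \<and> (\<forall>k. locally_quotient \<A> UNIV (\<lambda>x. coeff (Q x) k))"

abbreviation gen :: "('a \<Rightarrow> bool) \<Rightarrow> bool" where "gen \<equiv> generically \<A> UNIV"

lemma poly_family_bound: assumes "poly_family Q" obtains n where "\<And>x. degree (Q x) \<le> n"
  using assms unfolding poly_family_def by blast

lemma poly_family_coeff: "poly_family Q \<Longrightarrow> locally_quotient \<A> UNIV (\<lambda>x. coeff (Q x) k)"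
  unfolding poly_family_def by blast

lemma poly_family_add:
  assumes "poly_family P" "poly_family Q" shows "poly_family (\<lambda>x. P x + Q x)"
proof -
  obtain n m where "\<And>x. degree (P x) \<le> n" "\<And>x. degree (Q x) \<le> m"
    using assms poly_family_bound by metis
  then have "degree (P x + Q x) \<le> max n m" for x
    by (meson degree_add_le max.coboundedI1 max.coboundedI2)
  then show ?thesis
    unfolding poly_family_def
    using locally_quotient_add[OF M poly_family_coeff[OF assms(1)] poly_family_coeff[OF assms(2)]] by auto
qed

lemma poly_family_mult:
  assumes "poly_family P" "poly_family Q" shows "poly_family (\<lambda>x. P x * Q x)"
proof -
  obtain n m where "\<And>x. degree (P x) \<le> n" "\<And>x. degree (Q x) \<le> m"
    using assms poly_family_bound by metis
  then have "degree (P x * Q x) \<le> n + m" for x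
    by (meson add_mono degree_mult_le order_trans)
  then show ?thesis
    unfolding poly_family_def coeff_mult
    by (auto intro!: locally_quotient_sum[OF M] locally_quotient_mult[OF M] poly_family_coeff[OF assms(1)] poly_family_coeff[OF assms(2)])
qed

lemma poly_family_monom:
  assumes "locally_quotient \<A> UNIV c" shows "poly_family (\<lambda>x. monom (c x) n)"
proof -
  have "locally_quotient \<A> UNIV (\<lambda>x. coeff (monom (c x) n) k)" for k
    using assms locally_quotient_const[OF M open_UNIV, of 0] by (cases "n = k") auto
  then show ?thesis unfolding poly_family_def using degree_monom_le by blast
qed

lemma poly_family_smult:
  assumes "locally_quotient \<A> UNIV c" "poly_family Q" shows "poly_family (\<lambda>x. smult (c x) (Q x))"
proof -
  have "poly_family (\<lambda>x. monom (c x) 0 * Q x)" by (intro poly_family_mult poly_family_monom assms)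
  then show ?thesis by (simp add: monom_0)
qed

lemma poly_family_const: "poly_family (\<lambda>x. [:c:])"
  using poly_family_monom[OF locally_quotient_const[OF M open_UNIV, of c], of 0] by (simp add: monom_0)

lemma poly_family_diff:
  assumes "poly_family P" "poly_family Q" shows "poly_family (\<lambda>x. P x - Q x)"
  using poly_family_add[OF assms(1) poly_family_smult[OF locally_quotient_const[OF M open_UNIV, of "-1"] assms(2)]] by simp

lemma poly_family_sum: "(\<And>i. i \<in> I \<Longrightarrow> poly_family (f i)) \<Longrightarrow> poly_family (\<lambda>x. \<Sum>i\<in>I. f i x)"
  by (induction I rule: infinite_finite_induct) (auto intro: poly_family_add poly_family_const[of 0, simplified])

lemma poly_family_pderiv:
  assumes "poly_family Q" shows "poly_family (\<lambda>x. pderiv (Q x))"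
proof -
  obtain n where "\<And>x. degree (Q x) \<le> n" using poly_family_bound[OF assms] by blast
  then have "degree (pderiv (Q x)) \<le> n" for x by (metis degree_pderiv diff_le_self le_trans)
  then show ?thesis
    unfolding poly_family_def coeff_pderiv
    by (auto intro!: locally_quotient_mult[OF M] locally_quotient_const[OF M] poly_family_coeff[OF assms])
qed

lemma gen_conj: "gen P \<Longrightarrow> gen Q \<Longrightarrow> gen (\<lambda>x. P x \<and> Q x)"
  by (rule generically_conj[OF M])

lemma gen_everywhere: "(\<And>x. P x) \<Longrightarrow> gen P"
  by (rule generically_UNIV_I) auto

text \<open>The induction is on a bound for the coefficients of \<open>F\<close> that may be
  nonzero; each step cancels the highest one. Since \<open>Q\<close> is generically monic no
  coefficient has to be inverted.\<close>

lemma poly_family_division: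
  assumes Q: "poly_family Q" "gen (\<lambda>x. degree (Q x) = d \<and> coeff (Q x) d = 1)"
  shows "poly_family F \<Longrightarrow> gen (\<lambda>x. \<forall>k\<ge>n. coeff (F x) k = 0) \<Longrightarrow>
    \<exists>H. poly_family H \<and> gen (\<lambda>x. \<forall>k\<ge>d. coeff (F x - H x * Q x) k = 0)"
proof (induction n arbitrary: F)
  case 0
  then show ?case
    by (intro exI[of _ "\<lambda>x. 0"] conjI poly_family_const[of 0, simplified]) (auto elim: generically_mono)
next
  case (Suc n)
  show ?case
  proof (cases "Suc n \<le> d")
    case True
    then show ?thesis
      using Suc.prems by (intro exI[of _ "\<lambda>x. 0"] conjI poly_family_const[of 0, simplified]) (auto elim: generically_mono)
  next
    case False
    define G where "G x = monom (coeff (F x) n) (n - d)" for x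
    have G: "poly_family G" unfolding G_def by (intro poly_family_monom poly_family_coeff Suc.prems)
    have F': "poly_family (\<lambda>x. F x - G x * Q x)"
      by (intro poly_family_diff poly_family_mult G Q Suc.prems)
    have "gen (\<lambda>x. \<forall>k\<ge>n. coeff (F x - G x * Q x) k = 0)"
    proof (rule generically_mono[OF gen_conj[OF Suc.prems(2) Q(2)]])
      fix x assume *: "(\<forall>k\<ge>Suc n. coeff (F x) k = 0) \<and> degree (Q x) = d \<and> coeff (Q x) d = 1"
      show "\<forall>k\<ge>n. coeff (F x - G x * Q x) k = 0"
      proof (intro allI impI)
        fix k assume k: "k \<ge> n"
        show "coeff (F x - G x * Q x) k = 0"
        proof (cases "k = n")
          case True
          then show ?thesis using * False by (simp add: G_def coeff_monom_mult)
        next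
          case neq: False
          then have "coeff (Q x) (k - (n - d)) = 0" using * k False by (intro coeff_eq_0) auto
          then show ?thesis using * k neq by (simp add: G_def coeff_monom_mult)
        qed
      qed
    qed
    from Suc.IH[OF F' this] obtain H where H: "poly_family H"
      "gen (\<lambda>x. \<forall>k\<ge>d. coeff (F x - G x * Q x - H x * Q x) k = 0)" by blast
    then show ?thesis
      by (intro exI[of _ "\<lambda>x. G x + H x"] conjI poly_family_add G) (simp_all add: algebra_simps)
  qed
qed

text \<open>Euclid's algorithm for \<open>P\<close> and \<open>pderiv P\<close> over the field of meromorphic functions: a nonzero
  combination of minimal degree divides both.\<close>

lemma generic_gcd:
  assumes P: "poly_family P" "\<And>x. degree (P x) = \<nu>" "\<And>x. coeff (P x) \<nu> = 1" and \<nu>: "\<nu> > 0"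
  shows "gen (\<lambda>x. card {w. poly (P x) w = 0} = \<nu>) \<or>
    (\<exists>H Q. poly_family H \<and> poly_family Q \<and> gen (\<lambda>x. P x = H x * Q x \<and> 0 < degree (H x) \<and> 0 < degree (Q x)))"
proof -
  define comb where "comb Q \<longleftrightarrow> (\<exists>S T. poly_family S \<and> poly_family T \<and> (\<forall>x. Q x = S x * P x + T x * pderiv (P x)))" for Q
  define has_deg where "has_deg d \<longleftrightarrow> (\<exists>Q. comb Q \<and> gen (\<lambda>x. Q x \<noteq> 0 \<and> degree (Q x) = d))" for d
  define d where "d = (LEAST d. has_deg d)"
  have comb_family: "poly_family Q" if "comb Q" for Q
  proof -
    obtain S T where "poly_family S" "poly_family T" "\<And>x. Q x = S x * P x + T x * pderiv (P x)"
      using \<open>comb Q\<close> unfolding comb_def by blast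
    moreover from this have "Q = (\<lambda>x. S x * P x + T x * pderiv (P x))" by blast
    ultimately show ?thesis by (auto intro!: poly_family_add poly_family_mult poly_family_pderiv P)
  qed
  have comb_P: "comb P" unfolding comb_def
    by (intro exI[of _ "\<lambda>x. 1"] exI[of _ "\<lambda>x. 0"] conjI)
       (use poly_family_const[of 1] poly_family_const[of 0] in \<open>auto simp: one_pCons\<close>)
  have comb_P': "comb (\<lambda>x. pderiv (P x))" unfolding comb_def
    by (intro exI[of _ "\<lambda>x. 0"] exI[of _ "\<lambda>x. 1"] conjI)
       (use poly_family_const[of 1] poly_family_const[of 0] in \<open>auto simp: one_pCons\<close>)
  have comb_sub: "comb (\<lambda>x. F x - H x * Q x)" if FQ: "comb F" "comb Q" "poly_family H" for F Q H
  proof -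
    obtain S T where 1: "poly_family S" "poly_family T" "\<And>x. F x = S x * P x + T x * pderiv (P x)"
      using FQ(1) unfolding comb_def by blast
    obtain S' T' where 2: "poly_family S'" "poly_family T'" "\<And>x. Q x = S' x * P x + T' x * pderiv (P x)"
      using FQ(2) unfolding comb_def by blast
    show ?thesis unfolding comb_def
      by (intro exI[of _ "\<lambda>x. S x - H x * S' x"] exI[of _ "\<lambda>x. T x - H x * T' x"] conjI
           poly_family_diff poly_family_mult 1 2 FQ allI) (simp add: 1 2 algebra_simps)
  qed
  have P'0: "pderiv (P x) \<noteq> 0" for x using P(2)[of x] \<nu> by (simp add: pderiv_eq_0_iff)
  have start: "has_deg (\<nu> - 1)"
    unfolding has_deg_def
    by (intro exI[of _ "\<lambda>x. pderiv (P x)"] conjI comb_P' gen_everywhere) (auto simp: P'0 degree_pderiv P(2))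
  have d_le: "d \<le> \<nu> - 1" unfolding d_def using start by (rule Least_le)
  have "has_deg d" unfolding d_def using start by (rule LeastI)
  then obtain Q0 where Q0: "comb Q0" "gen (\<lambda>x. Q0 x \<noteq> 0 \<and> degree (Q0 x) = d)" unfolding has_deg_def by blast
  define c where "c x = coeff (Q0 x) d" for x
  have c: "locally_quotient \<A> UNIV c" unfolding c_def by (rule poly_family_coeff[OF comb_family[OF Q0(1)]])
  have c0: "gen (\<lambda>x. c x \<noteq> 0)" unfolding c_def by (rule generically_mono[OF Q0(2)]) (auto simp: leading_coeff_0_iff)
  have ic: "locally_quotient \<A> UNIV (\<lambda>x. inverse (c x))" by (rule locally_quotient_inverse[OF M c c0])
  define Q where "Q x = smult (inverse (c x)) (Q0 x)" for x
  have Qf: "poly_family Q" unfolding Q_def by (rule poly_family_smult[OF ic comb_family[OF Q0(1)]])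
  have Qc: "comb Q"
  proof -
    obtain S T where 1: "poly_family S" "poly_family T" "\<And>x. Q0 x = S x * P x + T x * pderiv (P x)"
      using Q0(1) unfolding comb_def by blast
    show ?thesis unfolding comb_def
      by (intro exI[of _ "\<lambda>x. smult (inverse (c x)) (S x)"] exI[of _ "\<lambda>x. smult (inverse (c x)) (T x)"] conjI
           poly_family_smult ic 1 allI) (simp add: 1 Q_def smult_add_right)
  qed
  have Qmonic: "gen (\<lambda>x. degree (Q x) = d \<and> coeff (Q x) d = 1)"
    by (rule generically_mono[OF gen_conj[OF Q0(2) c0]]) (auto simp: Q_def c_def)
  have rem0: "gen (\<lambda>x. R x = 0)" if R: "comb R" "gen (\<lambda>x. \<forall>k\<ge>d. coeff (R x) k = 0)" for R
  proof -
    \<comment> \<open>By the dichotomy the highest coefficient that is not generically zero is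
      generically nonzero; so a nonvanishing remainder would be a combination of degree less than
      the minimum \<open>d\<close>.\<close>
    define K where "K = {k. k < d \<and> \<not> gen (\<lambda>x. coeff (R x) k = 0)}"
    have finK: "finite K" unfolding K_def by simp
    show ?thesis
    proof (cases "K = {}")
      case True
      then have "gen (\<lambda>x. \<forall>k\<in>{..<d}. coeff (R x) k = 0)"
        by (intro generically_finite_ball[OF M]) (auto simp: K_def)
      from gen_conj[OF this R(2)] show ?thesis
      proof (rule generically_mono)
        fix x assume *: "(\<forall>k\<in>{..<d}. coeff (R x) k = 0) \<and> (\<forall>k\<ge>d. coeff (R x) k = 0)"
        have "coeff (R x) k = 0" for k using * by (cases "k < d") auto
        then show "R x = 0" by (intro poly_eqI) simp
      qed
    next
      case False
      define k where "k = Max K"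
      have k: "k \<in> K" unfolding k_def using finK False by (rule Max_in)
      have "gen (\<lambda>x. coeff (R x) k = 0) \<or> gen (\<lambda>x. coeff (R x) k \<noteq> 0)"
        using M unfolding complex_manifold_def
        by (intro locally_quotient_dichotomy[OF M poly_family_coeff[OF comb_family[OF R(1)]]]) auto
      then have 1: "gen (\<lambda>x. coeff (R x) k \<noteq> 0)" using k by (auto simp: K_def)
      have "gen (\<lambda>x. \<forall>j\<in>{k<..<d}. coeff (R x) j = 0)"
      proof (intro generically_finite_ball[OF M])
        fix j assume j: "j \<in> {k<..<d}"
        then have "j \<notin> K" using Max_ge[OF finK, of j] by (auto simp: k_def)
        then show "gen (\<lambda>x. coeff (R x) j = 0)" using j by (auto simp: K_def)
      qed auto
      from gen_conj[OF 1 gen_conj[OF this R(2)]]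
      have "gen (\<lambda>x. R x \<noteq> 0 \<and> degree (R x) = k)"
      proof (rule generically_mono)
        fix x assume *: "coeff (R x) k \<noteq> 0 \<and> (\<forall>j\<in>{k<..<d}. coeff (R x) j = 0) \<and> (\<forall>k\<ge>d. coeff (R x) k = 0)"
        have "degree (R x) \<le> k" by (rule degree_le) (use * in \<open>metis greaterThanLessThan_iff not_less\<close>)
        moreover have "k \<le> degree (R x)" using * by (intro le_degree) auto
        ultimately show "R x \<noteq> 0 \<and> degree (R x) = k" using * by auto
      qed
      then have "has_deg k" unfolding has_deg_def using R(1) by blast
      then have "d \<le> k" unfolding d_def by (rule Least_le)
      then show ?thesis using k by (auto simp: K_def)
    qed
  qed
  have divides: "\<exists>H. poly_family H \<and> gen (\<lambda>x. F x = H x * Q x)" if F: "comb F" for F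
  proof -
    obtain n where n: "\<And>x. degree (F x) \<le> n" using poly_family_bound[OF comb_family[OF F]] by blast
    have "gen (\<lambda>x. \<forall>k\<ge>Suc n. coeff (F x) k = 0)"
    proof (rule gen_everywhere, intro allI impI)
      fix x k assume "k \<ge> Suc n"
      then show "coeff (F x) k = 0" using n[of x] by (intro coeff_eq_0) auto
    qed
    from poly_family_division[OF Qf Qmonic comb_family[OF F] this]
    obtain H where H: "poly_family H" "gen (\<lambda>x. \<forall>k\<ge>d. coeff (F x - H x * Q x) k = 0)" by blast
    have "gen (\<lambda>x. F x - H x * Q x = 0)" by (rule rem0[OF comb_sub[OF F Qc H(1)] H(2)])
    then show ?thesis using H(1) by auto
  qed
  obtain H where H: "poly_family H" "gen (\<lambda>x. P x = H x * Q x)" using divides[OF comb_P] by blast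
  show ?thesis
  proof (cases "d = 0")
    case True
    \<comment> \<open>A monic gcd of degree 0 is 1, so there is a Bezout identity: generically
      \<open>P\<close> and its derivative have no common root and all roots are simple.\<close>
    obtain S T where ST: "\<And>x. Q x = S x * P x + T x * pderiv (P x)" using Qc unfolding comb_def by blast
    have "gen (\<lambda>x. card {w. poly (P x) w = 0} = \<nu>)"
    proof (rule generically_mono[OF Qmonic])
      fix x assume "degree (Q x) = d \<and> coeff (Q x) d = 1"
      then have "poly (Q x) w = 1" for w using True by (auto elim!: degree_eq_zeroE)
      then have "poly (S x) w * poly (P x) w + poly (T x) w * poly (pderiv (P x)) w = 1" for w
        using arg_cong[OF ST[of x], of "\<lambda>p. poly p w"] by simp
      then have "\<not> (poly (P x) w = 0 \<and> poly (pderiv (P x)) w = 0)" for w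
        by (metis add_0 mult_zero_right zero_neq_one)
      then have "rsquarefree (P x)" unfolding rsquarefree_roots by blast
      then show "card {w. poly (P x) w = 0} = \<nu>" using rsquarefree_card_roots P(2) by simp
    qed
    then show ?thesis ..
  next
    case False
    have "gen (\<lambda>x. P x = H x * Q x \<and> 0 < degree (H x) \<and> 0 < degree (Q x))"
    proof (rule generically_mono[OF gen_conj[OF H(2) Qmonic]])
      fix x assume *: "P x = H x * Q x \<and> degree (Q x) = d \<and> coeff (Q x) d = 1"
      have "P x \<noteq> 0" using P(3)[of x] by auto
      \<comment> \<open>Since \<open>d\<close> is at most \<nu> - 1, the degree of the derivative,
        the cofactor \<open>H x\<close> has positive degree too.\<close>
      then have "\<nu> = degree (H x) + d" using * P(2)[of x] by (metis degree_mult_eq mult_zero_left mult_zero_right)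
      then show "P x = H x * Q x \<and> 0 < degree (H x) \<and> 0 < degree (Q x)" using * False d_le \<nu> by auto
    qed
    then show ?thesis using H(1) Qf by blast
  qed
qed

text \<open>\<open>irreducible_equation\<close> quantifies over normalised meromorphic coefficients;
  a factorisation of families becomes admissible after a change on a thin set.\<close>

lemma poly_family_normalize:
  assumes "poly_family Q"
  obtains Q' where "\<forall>k. meromorphic_mfd \<A> (\<lambda>x. coeff (Q' x) k) UNIV" "gen (\<lambda>x. Q' x = Q x)"
proof -
  obtain n where n: "\<And>x. degree (Q x) \<le> n" using poly_family_bound[OF assms] by blast
  define q where "q k = normalized \<A> UNIV (\<lambda>x. coeff (Q x) k)" for k
  have coeff': "coeff (\<Sum>k\<le>n. monom (q k x) k) k = (if k \<le> n then q k x else 0)" for x k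
    by (auto simp: coeff_sum)
  have zero: "meromorphic_mfd \<A> (\<lambda>x. 0) UNIV"
  proof -
    have lq: "locally_quotient \<A> UNIV (\<lambda>x. 0)" by (rule locally_quotient_const[OF M open_UNIV])
    have "normalized \<A> UNIV (\<lambda>x. 0) x = 0" for x
      by (rule normalized_eq_local[OF M lq open_UNIV, of "\<lambda>x. 0" "\<lambda>x. 1"]) auto
    then have "normalized \<A> UNIV (\<lambda>x. 0) = (\<lambda>x. 0)" by blast
    then show ?thesis using normalized_meromorphic[OF M lq] by simp
  qed
  show ?thesis
  proof (rule that[of "\<lambda>x. \<Sum>k\<le>n. monom (q k x) k"])
    show "\<forall>k. meromorphic_mfd \<A> (\<lambda>x. coeff (\<Sum>k\<le>n. monom (q k x) k) k) UNIV"
    proof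
      fix k
      show "meromorphic_mfd \<A> (\<lambda>x. coeff (\<Sum>k\<le>n. monom (q k x) k) k) UNIV"
      unfolding coeff' using normalized_meromorphic[OF M poly_family_coeff[OF assms, of k]] zero
      by (cases "k \<le> n") (auto simp: q_def)
    qed
    have "gen (\<lambda>x. \<forall>k\<in>{..n}. q k x = coeff (Q x) k)"
      unfolding q_def
      by (intro generically_finite_ball[OF M] normalized_generically[OF M] poly_family_coeff[OF assms]) auto
    then show "gen (\<lambda>x. (\<Sum>k\<le>n. monom (q k x) k) = Q x)"
    proof (rule generically_mono)
      fix x assume *: "\<forall>k\<in>{..n}. q k x = coeff (Q x) k"
      show "(\<Sum>k\<le>n. monom (q k x) k) = Q x"
      proof (rule poly_eqI)
        fix k
        have "coeff (Q x) k = 0" if "\<not> k \<le> n" using n[of x] that by (intro coeff_eq_0) auto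
        then show "coeff (\<Sum>k\<le>n. monom (q k x) k) k = coeff (Q x) k" unfolding coeff' using * by auto
      qed
    qed
  qed
qed

section \<open>Generic distinctness of the solutions of an irreducible equation\<close>

context
  fixes U :: "'i \<Rightarrow> 'a set" and A :: "nat \<Rightarrow> 'i \<Rightarrow> 'a \<Rightarrow> complex" and \<nu> :: nat
  assumes cs: "coefficient_system \<A> U A \<nu>"
begin

lemma U_open: "open (U i)"
  using cs unfolding coefficient_system_def by blast

lemma U_cover: obtains i where "x \<in> U i"
proof -
  have "(\<Union>i. U i) = UNIV" using cs unfolding coefficient_system_def by (elim conjE)
  then show ?thesis using that by (metis UNIV_I UN_E)
qed

lemma A_holomorphic: "k \<le> \<nu> \<Longrightarrow> holomorphic_mfd \<A> (A k i) (U i)"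
  using cs unfolding coefficient_system_def by blast

lemma A_cross: "x \<in> U i \<Longrightarrow> x \<in> U j \<Longrightarrow> k \<le> \<nu> \<Longrightarrow> l \<le> \<nu> \<Longrightarrow> A k i x * A l j x = A k j x * A l i x"
  using cs unfolding coefficient_system_def by blast

lemma A_dense: "U i \<subseteq> closure {x\<in>U i. \<exists>k\<le>\<nu>. A k i x \<noteq> 0}"
  using cs unfolding coefficient_system_def by blast

text \<open>Vanishing of the leading coefficient on an open set does not depend on the index: by
  cross multiplication it passes to any other index, as the local coefficients have no common zero
  on a dense set. Connectedness of the manifold then spreads generic nonvanishing.\<close>

lemma leading_dense:
  assumes nz: "\<exists>i. \<exists>x\<in>U i. A \<nu> i x \<noteq> 0"
  shows "U i \<subseteq> closure {x\<in>U i. A \<nu> i x \<noteq> 0}"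
proof -
  define X where "X = \<Union>{T. open T \<and> (\<exists>i. T \<subseteq> U i \<and> (\<forall>x\<in>T. A \<nu> i x = 0))}"
  define Y where "Y = \<Union>{T. open T \<and> (\<exists>i. T \<subseteq> U i \<and> T \<subseteq> closure {x\<in>T. A \<nu> i x \<noteq> 0})}"
  have XI: "p \<in> X" if "open T" "p \<in> T" "T \<subseteq> U i" "\<forall>x\<in>T. A \<nu> i x = 0" for T p i
    unfolding X_def using that by blast
  have YI: "p \<in> Y" if "open T" "p \<in> T" "T \<subseteq> U i" "T \<subseteq> closure {x\<in>T. A \<nu> i x \<noteq> 0}" for T p i
    unfolding Y_def using that by blast
  have op: "open X" "open Y" unfolding X_def Y_def by (rule open_Union, blast)+
  have cover: "UNIV \<subseteq> X \<union> Y"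
  proof
    fix p
    obtain i where i: "p \<in> U i" by (rule U_cover)
    obtain W where W: "open W" "p \<in> W" "W \<subseteq> U i" "(\<forall>x\<in>W. A \<nu> i x = 0) \<or> W \<subseteq> closure {x\<in>W. A \<nu> i x \<noteq> 0}"
      by (rule holomorphic_mfd_dichotomy[OF M A_holomorphic[OF order_refl] U_open i])
    from W(4) show "p \<in> X \<union> Y"
    proof
      assume "\<forall>x\<in>W. A \<nu> i x = 0"
      from XI[OF W(1-3) this] show ?thesis ..
    next
      assume "W \<subseteq> closure {x\<in>W. A \<nu> i x \<noteq> 0}"
      from YI[OF W(1-3) this] show ?thesis ..
    qed
  qed
  have disj: "X \<inter> Y = {}"
  proof (rule ccontr)
    assume "X \<inter> Y \<noteq> {}"
    then obtain p where p: "p \<in> X" "p \<in> Y" by blast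
    obtain T1 where "p \<in> T1" "open T1" "\<exists>i. T1 \<subseteq> U i \<and> (\<forall>x\<in>T1. A \<nu> i x = 0)"
      using p(1) unfolding X_def Union_iff mem_Collect_eq by (elim bexE CollectE conjE)
    then obtain i where 1: "p \<in> T1" "open T1" "T1 \<subseteq> U i" "\<forall>x\<in>T1. A \<nu> i x = 0" by blast
    obtain T2 where "p \<in> T2" "open T2" "\<exists>i. T2 \<subseteq> U i \<and> T2 \<subseteq> closure {x\<in>T2. A \<nu> i x \<noteq> 0}"
      using p(2) unfolding Y_def Union_iff mem_Collect_eq by (elim bexE CollectE conjE)
    then obtain j where 2: "p \<in> T2" "open T2" "T2 \<subseteq> U j" "T2 \<subseteq> closure {x\<in>T2. A \<nu> j x \<noteq> 0}" by blast
    have hol: "holomorphic_mfd \<A> (A \<nu> j) T2" by (rule holomorphic_mfd_subset[OF A_holomorphic[OF order_refl] 2(3)])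
    define O2 where "O2 = {x\<in>T2. A \<nu> j x \<noteq> 0}"
    have O2: "open O2" unfolding O2_def by (rule open_nonzero[OF holomorphic_mfd_continuous_on[OF M hol 2(2)] 2(2)])
    have "\<exists>x\<in>T1 \<inter> T2. A \<nu> j x \<noteq> 0" using 2(4)[unfolded dense_iff, rule_format, of T1] 1 2(1) by blast
    then have "(O2 \<inter> T1) \<inter> U i \<noteq> {}" using 1(3) unfolding O2_def by blast
    then obtain x where "x \<in> (O2 \<inter> T1) \<inter> U i" "\<exists>k\<le>\<nu>. A k i x \<noteq> 0"
      using A_dense[of i, unfolded dense_iff, rule_format, of "O2 \<inter> T1"] O2 1(2) by blast
    then obtain k where x: "x \<in> O2" "x \<in> T1" "x \<in> U i" "k \<le> \<nu>" "A k i x \<noteq> 0" by blast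
    have "A k i x * A \<nu> j x = A k j x * A \<nu> i x" using A_cross[of x i j k \<nu>] x 2(3) unfolding O2_def by blast
    then show False using x 1(4) unfolding O2_def by auto
  qed
  have "Y \<noteq> {}"
  proof -
    obtain j x where x: "x \<in> U j" "A \<nu> j x \<noteq> 0" using nz by blast
    let ?T = "{x\<in>U j. A \<nu> j x \<noteq> 0}"
    have "open ?T" by (rule open_nonzero[OF holomorphic_mfd_continuous_on[OF M A_holomorphic[OF order_refl] U_open] U_open])
    moreover have "?T \<subseteq> closure {x\<in>?T. A \<nu> j x \<noteq> 0}" by (simp add: closure_subset)
    ultimately have "x \<in> Y" using x by (intro YI[of ?T x j]) auto
    then show ?thesis by blast
  qed
  moreover have "connected (UNIV :: 'a set)" using M unfolding complex_manifold_def by blast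
  ultimately have X: "X = {}" using connectedD[OF _ op] cover disj by blast
  show ?thesis
    unfolding dense_iff
  proof (intro allI impI)
    fix W assume W: "open W" "W \<inter> U i \<noteq> {}"
    then obtain p where p: "p \<in> W" "p \<in> U i" by blast
    obtain V where V: "open V" "p \<in> V" "V \<subseteq> U i" "(\<forall>x\<in>V. A \<nu> i x = 0) \<or> V \<subseteq> closure {x\<in>V. A \<nu> i x \<noteq> 0}"
      by (rule holomorphic_mfd_dichotomy[OF M A_holomorphic[OF order_refl] U_open p(2)])
    have "\<not> (\<forall>x\<in>V. A \<nu> i x = 0)" using XI[OF V(1-3)] X by blast
    then have "V \<subseteq> closure {x\<in>V. A \<nu> i x \<noteq> 0}" using V(4) by blast
    then have "\<exists>x\<in>W \<inter> V. A \<nu> i x \<noteq> 0" using W(1) p V(2) unfolding dense_iff by blast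
    then show "\<exists>x\<in>W \<inter> U i. A \<nu> i x \<noteq> 0" using V(3) by blast
  qed
qed

lemma local_poly_proportional:
  assumes "x \<in> U i" "x \<in> U j"
  shows "smult (A \<nu> i x) (local_poly A \<nu> j x) = smult (A \<nu> j x) (local_poly A \<nu> i x)"
proof (rule poly_eqI)
  fix k
  have "coeff (local_poly A \<nu> i x) k = (if k \<le> \<nu> then A k i x else 0)" for i
    using coeff_coeff_poly[of "\<lambda>k. A k i x" \<nu> k] by (simp add: local_poly_def coeff_poly_def)
  then show "coeff (smult (A \<nu> i x) (local_poly A \<nu> j x)) k = coeff (smult (A \<nu> j x) (local_poly A \<nu> i x)) k"
    using A_cross[OF assms, of k \<nu>] by (simp add: mult.commute)
qed

lemma solutions_eq_roots:
  assumes "x \<in> U i" "A \<nu> i x \<noteq> 0"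
  shows "solutions U A \<nu> x = {w. poly (local_poly A \<nu> i x) w = 0}"
proof -
  have "poly (local_poly A \<nu> j x) w = 0" if "x \<in> U j" "poly (local_poly A \<nu> i x) w = 0" for j w
  proof -
    have "A \<nu> i x * poly (local_poly A \<nu> j x) w = A \<nu> j x * poly (local_poly A \<nu> i x) w"
      using arg_cong[OF local_poly_proportional[OF assms(1) that(1)], of "\<lambda>p. poly p w"] by simp
    then show ?thesis using that assms(2) by simp
  qed
  then show ?thesis using assms(1) unfolding solutions_def by blast
qed

text \<open>Division by the leading coefficient gives a monic polynomial over the meromorphic
  functions. \<open>generic_gcd\<close> makes its roots generically distinct, unless it factors,
  which irreducibility forbids.\<close>

lemma regular_points_generic:
  assumes nz: "\<exists>i. \<exists>x\<in>U i. A \<nu> i x \<noteq> 0" and irr: "irreducible_equation \<A> U A \<nu>"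
  shows "gen (\<lambda>x. x \<in> regular_points U A \<nu>)"
proof -
  have \<nu>: "\<nu> > 0" using irr unfolding irreducible_equation_def by blast
  \<comment> \<open>All indices with nonzero leading coefficient give the same ratios. Where there
    is none, the ratio is arbitrary, which is harmless because such points form a thin set.\<close>
  define ix where "ix x = (SOME i. x \<in> U i \<and> A \<nu> i x \<noteq> 0)" for x
  define a where "a k x = A k (ix x) x / A \<nu> (ix x) x" for k x
  have ix: "x \<in> U (ix x)" "A \<nu> (ix x) x \<noteq> 0" if "x \<in> U i" "A \<nu> i x \<noteq> 0" for x i
  proof -
    have "x \<in> U (ix x) \<and> A \<nu> (ix x) x \<noteq> 0" unfolding ix_def by (rule someI[of _ i]) (use that in blast)
    then show "x \<in> U (ix x)" "A \<nu> (ix x) x \<noteq> 0" by blast+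
  qed
  have a_eq: "a k x = A k i x / A \<nu> i x" if "x \<in> U i" "A \<nu> i x \<noteq> 0" "k \<le> \<nu>" for k x i
    using A_cross[OF ix(1)[OF that(1,2)] that(1) that(3) order_refl] ix(2)[OF that(1,2)] that(2)
    by (simp add: a_def frac_eq_eq)
  have lq: "locally_quotient \<A> UNIV (a k)" if k: "k \<le> \<nu>" for k
  proof (rule locally_quotientI[OF M])
    fix p
    obtain i where i: "p \<in> U i" by (rule U_cover)
    show "\<exists>T g h. open T \<and> p \<in> T \<and> T \<subseteq> UNIV \<and> holomorphic_mfd \<A> g T \<and> holomorphic_mfd \<A> h T \<and>
        T \<subseteq> closure {x\<in>T. h x \<noteq> 0} \<and> (\<forall>x\<in>T. h x \<noteq> 0 \<longrightarrow> a k x = g x / h x)"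
      using i U_open A_holomorphic[OF k] A_holomorphic[OF order_refl] leading_dense[OF nz] a_eq[OF _ _ k]
      by (intro exI[of _ "U i"] exI[of _ "A k i"] exI[of _ "A \<nu> i"]) auto
  qed
  \<comment> \<open>The leading term is \<open>monom 1 \<nu>\<close> and does not come from
    \<open>a \<nu>\<close>, so that the polynomial is monic at every point, as
    \<open>generic_gcd\<close> demands.\<close>
  define P where "P x = monom 1 \<nu> + (\<Sum>k<\<nu>. monom (a k x) k)" for x
  have coeffP: "coeff (P x) k = (if k = \<nu> then 1 else if k < \<nu> then a k x else 0)" for x k
    by (auto simp: P_def coeff_sum)
  have degP: "degree (P x) = \<nu>" for x
    by (intro antisym degree_le le_degree) (auto simp: coeffP)
  have Pf: "poly_family P"
    unfolding P_def
    by (intro poly_family_add poly_family_sum poly_family_monom locally_quotient_const[OF M open_UNIV] lq) auto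
  have lpP: "local_poly A \<nu> j x = smult (A \<nu> j x) (P x)" if x: "x \<in> U i" "A \<nu> i x \<noteq> 0" "x \<in> U j" for x i j
  proof (rule poly_eqI)
    fix k
    have "coeff (local_poly A \<nu> j x) k = (if k \<le> \<nu> then A k j x else 0)"
      using coeff_coeff_poly[of "\<lambda>k. A k j x" \<nu> k] by (simp add: local_poly_def coeff_poly_def)
    then show "coeff (local_poly A \<nu> j x) k = coeff (smult (A \<nu> j x) (P x)) k"
    proof (cases "k < \<nu>")
      case True
      have "A \<nu> i x * A k j x = A k i x * A \<nu> j x"
        using A_cross[OF x(1,3), of k \<nu>] True by (simp add: mult.commute)
      also have "A k i x = a k x * A \<nu> i x" using a_eq[OF x(1,2), of k] x(2) True by simp
      also have "a k x * A \<nu> i x * A \<nu> j x = A \<nu> i x * (a k x * A \<nu> j x)" by (simp only: mult_ac)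
      finally have "A \<nu> i x * A k j x = A \<nu> i x * (a k x * A \<nu> j x)" .
      then show ?thesis using x(2) True \<open>coeff (local_poly A \<nu> j x) k = _\<close> by (simp add: coeffP mult.commute)
    qed (auto simp: coeffP)
  qed
  have gi: "gen (\<lambda>x. \<exists>i. x \<in> U i \<and> A \<nu> i x \<noteq> 0)"
    unfolding generically_def
  proof
    fix p
    obtain i where i: "p \<in> U i" by (rule U_cover)
    show "\<exists>T h. open T \<and> p \<in> T \<and> T \<subseteq> UNIV \<and> holomorphic_mfd \<A> h T \<and> T \<subseteq> closure {x\<in>T. h x \<noteq> 0} \<and>
        (\<forall>x\<in>T. h x \<noteq> 0 \<longrightarrow> (\<exists>i. x \<in> U i \<and> A \<nu> i x \<noteq> 0))"
      using i U_open A_holomorphic[OF order_refl] leading_dense[OF nz]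
      by (intro exI[of _ "U i"] exI[of _ "A \<nu> i"]) auto
  qed
  have "\<not> (\<exists>H Q. poly_family H \<and> poly_family Q \<and> gen (\<lambda>x. P x = H x * Q x \<and> 0 < degree (H x) \<and> 0 < degree (Q x)))"
  proof
    assume "\<exists>H Q. poly_family H \<and> poly_family Q \<and> gen (\<lambda>x. P x = H x * Q x \<and> 0 < degree (H x) \<and> 0 < degree (Q x))"
    then obtain H Q where HQ: "poly_family H" "poly_family Q"
      "gen (\<lambda>x. P x = H x * Q x \<and> 0 < degree (H x) \<and> 0 < degree (Q x))" by blast
    obtain H' where H': "\<forall>k. meromorphic_mfd \<A> (\<lambda>x. coeff (H' x) k) UNIV" "gen (\<lambda>x. H' x = H x)"
      by (rule poly_family_normalize[OF HQ(1)])
    obtain Q' where Q': "\<forall>k. meromorphic_mfd \<A> (\<lambda>x. coeff (Q' x) k) UNIV" "gen (\<lambda>x. Q' x = Q x)"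
      by (rule poly_family_normalize[OF HQ(2)])
    have "gen (\<lambda>x. 0 < degree (H' x) \<and> 0 < degree (Q' x) \<and>
        (\<forall>i. x \<in> U i \<longrightarrow> local_poly A \<nu> i x = smult (A \<nu> i x) (H' x * Q' x)))"
    proof (rule generically_mono[OF gen_conj[OF HQ(3) gen_conj[OF H'(2) gen_conj[OF Q'(2) gi]]]])
      fix x assume *: "(P x = H x * Q x \<and> 0 < degree (H x) \<and> 0 < degree (Q x)) \<and> H' x = H x \<and> Q' x = Q x \<and>
          (\<exists>i. x \<in> U i \<and> A \<nu> i x \<noteq> 0)"
      then obtain i where "x \<in> U i" "A \<nu> i x \<noteq> 0" by blast
      then show "0 < degree (H' x) \<and> 0 < degree (Q' x) \<and>
          (\<forall>i. x \<in> U i \<longrightarrow> local_poly A \<nu> i x = smult (A \<nu> i x) (H' x * Q' x))"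
        using * lpP by auto
    qed
    from generically_dense[OF this]
    have "closure {x. 0 < degree (H' x) \<and> 0 < degree (Q' x) \<and>
        (\<forall>i. x \<in> U i \<longrightarrow> local_poly A \<nu> i x = smult (A \<nu> i x) (H' x * Q' x))} = UNIV" by auto
    then show False using irr H'(1) Q'(1) unfolding irreducible_equation_def by blast
  qed
  then have "gen (\<lambda>x. card {w. poly (P x) w = 0} = \<nu>)"
    using generic_gcd[OF Pf degP _ \<nu>] by (auto simp: coeffP)
  from gen_conj[OF this gi] show ?thesis
  proof (rule generically_mono)
    fix x assume *: "card {w. poly (P x) w = 0} = \<nu> \<and> (\<exists>i. x \<in> U i \<and> A \<nu> i x \<noteq> 0)"
    then obtain i where i: "x \<in> U i" "A \<nu> i x \<noteq> 0" by blast
    have "{w. poly (local_poly A \<nu> i x) w = 0} = {w. poly (P x) w = 0}"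
      using lpP[OF i i(1)] i(2) by simp
    then show "x \<in> regular_points U A \<nu>"
      using * solutions_eq_roots[OF i] unfolding regular_points_def by simp
  qed
qed

end

end

section \<open>Analytic continuation\<close>

text \<open>In a small ball, a section of \<open>S\<close> through one value of \<open>f\<close>
  coincides with \<open>f\<close>; so membership in \<open>S\<close> at one point of the ball
  implies it at all others, and it spreads over the connected set \<open>Y\<close>.\<close>

lemma section_in_subfamily:
  fixes S V :: "'a::real_normed_vector \<Rightarrow> complex set"
  assumes sep: "separated_on X V" and SV: "\<And>x. x \<in> X \<Longrightarrow> S x \<subseteq> V x"
    and loc: "\<And>v. v \<in> X \<Longrightarrow> \<exists>\<epsilon>>0. ball v \<epsilon> \<subseteq> X \<and> has_sections (ball v \<epsilon>) S"
    and Y: "open Y" "connected Y" "Y \<subseteq> X" and f: "is_section Y V f" and y0: "y0 \<in> Y" "f y0 \<in> S y0"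
    and y: "y \<in> Y"
  shows "f y \<in> S y"
proof -
  let ?E = "{y \<in> Y. f y \<in> S y}"
  have ball: "\<exists>\<epsilon>>0. ball p \<epsilon> \<subseteq> Y \<and> (\<forall>y1\<in>ball p \<epsilon>. \<forall>y2\<in>ball p \<epsilon>. f y1 \<in> S y1 \<longrightarrow> f y2 \<in> S y2)" if p: "p \<in> Y" for p
  proof -
    obtain e1 where e1: "e1 > 0" "ball p e1 \<subseteq> X" "has_sections (ball p e1) S"
      using loc[of p] p Y by blast
    obtain e2 where e2: "e2 > 0" "ball p e2 \<subseteq> Y" using Y(1) p by (meson open_contains_ball)
    let ?B = "ball p (min e1 e2)"
    have sub: "?B \<subseteq> ball p e1" "?B \<subseteq> Y" using e2 by auto
    have pres: "f y2 \<in> S y2" if *: "y1 \<in> ?B" "y2 \<in> ?B" "f y1 \<in> S y1" for y1 y2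
    proof -
      obtain g where g: "is_section ?B S g" "g y1 = f y1"
        using has_sectionsE[OF has_sections_imp_subset[OF e1(3) sub(1)], of y1 "f y1"] * by blast
      have gV: "is_section ?B V g" using g(1) SV sub e1(2) unfolding is_section_def by blast
      have "?B \<subseteq> X" using sub(1) e1(2) by blast
      from section_unique[OF sep connected_ball this gV is_section_subset[OF f sub(2)] *(1) g(2) *(2)]
      have "g y2 = f y2" .
      then show ?thesis using g(1) *(2) unfolding is_section_def by metis
    qed
    have "min e1 e2 > 0" using e1(1) e2(1) by simp
    then show ?thesis using sub(2) pres by blast
  qed
  have "open ?E"
    unfolding open_contains_ball
  proof
    fix p assume p: "p \<in> ?E"
    then obtain \<epsilon> where e: "\<epsilon> > 0" "ball p \<epsilon> \<subseteq> Y" "\<forall>y1\<in>ball p \<epsilon>. \<forall>y2\<in>ball p \<epsilon>. f y1 \<in> S y1 \<longrightarrow> f y2 \<in> S y2"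
      using ball[of p] by blast
    then have "ball p \<epsilon> \<subseteq> ?E" using p by auto
    then show "\<exists>e>0. ball p e \<subseteq> ?E" using e(1) by blast
  qed
  moreover have "open (Y - ?E)"
    unfolding open_contains_ball
  proof
    fix p assume p: "p \<in> Y - ?E"
    then obtain \<epsilon> where e: "\<epsilon> > 0" "ball p \<epsilon> \<subseteq> Y" "\<forall>y1\<in>ball p \<epsilon>. \<forall>y2\<in>ball p \<epsilon>. f y1 \<in> S y1 \<longrightarrow> f y2 \<in> S y2"
      using ball[of p] by blast
    have "f y1 \<notin> S y1" if "y1 \<in> ball p \<epsilon>" for y1
      using e(3)[rule_format, OF that centre_in_ball[THEN iffD2, OF e(1)]] p by blast
    then have "ball p \<epsilon> \<subseteq> Y - ?E" using e(2) by blast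
    then show "\<exists>e>0. ball p e \<subseteq> Y - ?E" using e(1) by blast
  qed
  ultimately have "?E \<inter> Y = {} \<or> (Y - ?E) \<inter> Y = {}"
    using connectedD[OF Y(2), of ?E "Y - ?E"] by blast
  then show ?thesis using y y0 by blast
qed

text \<open>A section of \<open>T\<close> over a small ball that lies in \<open>S\<close> at one
  point lies in \<open>S\<close> throughout, so the inclusion spreads from point to point. It will
  turn transitivity at one base point into a statement about all points.\<close>

lemma sections_exhaust:
  fixes S T V :: "'a::real_normed_vector \<Rightarrow> complex set"
  assumes sep: "separated_on X V" and X: "open X" "connected X" and SV: "\<And>x. x \<in> X \<Longrightarrow> S x \<subseteq> V x" and TV: "\<And>x. x \<in> X \<Longrightarrow> T x \<subseteq> V x"
    and locS: "\<And>v. v \<in> X \<Longrightarrow> \<exists>\<epsilon>>0. ball v \<epsilon> \<subseteq> X \<and> has_sections (ball v \<epsilon>) S"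
    and locT: "\<And>v. v \<in> X \<Longrightarrow> \<exists>\<epsilon>>0. ball v \<epsilon> \<subseteq> X \<and> has_sections (ball v \<epsilon>) T"
    and v0: "v0 \<in> X" "T v0 \<subseteq> S v0" and v: "v \<in> X"
  shows "T v \<subseteq> S v"
proof -
  let ?E = "{y \<in> X. T y \<subseteq> S y}"
  have ball: "\<exists>\<epsilon>>0. ball p \<epsilon> \<subseteq> X \<and> (\<forall>y1\<in>ball p \<epsilon>. \<forall>y2\<in>ball p \<epsilon>. T y1 \<subseteq> S y1 \<longrightarrow> T y2 \<subseteq> S y2)" if p: "p \<in> X" for p
  proof -
    obtain e where e: "e > 0" "ball p e \<subseteq> X" "has_sections (ball p e) T" using locT[OF p] by blast
    have "T y2 \<subseteq> S y2" if *: "y1 \<in> ball p e" "y2 \<in> ball p e" "T y1 \<subseteq> S y1" for y1 y2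
    proof
      fix w assume w: "w \<in> T y2"
      obtain g where g: "is_section (ball p e) T g" "g y2 = w" using has_sectionsE[where Y="ball p e" and V=T and q=y2 and w=w] e(3) *(2) w by blast
      have gV: "is_section (ball p e) V g" using g(1) TV e(2) unfolding is_section_def by blast
      have "g y1 \<in> S y1" using g(1) *(1,3) unfolding is_section_def by blast
      from section_in_subfamily[OF sep SV locS open_ball connected_ball e(2) gV *(1) this *(2)]
      show "w \<in> S y2" using g(2) by simp
    qed
    then show ?thesis using e by blast
  qed
  have "open ?E"
    unfolding open_contains_ball
  proof
    fix p assume p: "p \<in> ?E"
    then obtain \<epsilon> where e: "\<epsilon> > 0" "ball p \<epsilon> \<subseteq> X" "\<forall>y1\<in>ball p \<epsilon>. \<forall>y2\<in>ball p \<epsilon>. T y1 \<subseteq> S y1 \<longrightarrow> T y2 \<subseteq> S y2"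
      using ball[of p] by blast
    then have "ball p \<epsilon> \<subseteq> ?E" using p by auto
    then show "\<exists>e>0. ball p e \<subseteq> ?E" using e(1) by blast
  qed
  moreover have "open (X - ?E)"
    unfolding open_contains_ball
  proof
    fix p assume p: "p \<in> X - ?E"
    then obtain \<epsilon> where e: "\<epsilon> > 0" "ball p \<epsilon> \<subseteq> X" "\<forall>y1\<in>ball p \<epsilon>. \<forall>y2\<in>ball p \<epsilon>. T y1 \<subseteq> S y1 \<longrightarrow> T y2 \<subseteq> S y2"
      using ball[of p] by blast
    have "\<not> T y1 \<subseteq> S y1" if "y1 \<in> ball p \<epsilon>" for y1
      using e(3)[rule_format, OF that centre_in_ball[THEN iffD2, OF e(1)]] p by blast
    then have "ball p \<epsilon> \<subseteq> X - ?E" using e(2) by blast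
    then show "\<exists>e>0. ball p e \<subseteq> X - ?E" using e(1) by blast
  qed
  ultimately have "?E \<inter> X = {} \<or> (X - ?E) \<inter> X = {}"
    using connectedD[OF X(2), of ?E "X - ?E"] by blast
  then show ?thesis using v v0 by blast
qed

lemma analytic_continuationI:
  fixes \<gamma> :: "real \<Rightarrow> 'a::topological_space"
  assumes \<gamma>: "path \<gamma>"
    and loc: "\<And>t. t \<in> {0..1} \<Longrightarrow> \<exists>N. open N \<and> \<gamma> t \<in> N \<and> holomorphic_mfd \<A> (F t) N \<and>
      (\<exists>d>0. \<forall>s\<in>{0..1}. dist s t < d \<longrightarrow> (\<forall>\<^sub>F y in nhds (\<gamma> s). F s y = F t y))"
  shows "analytic_continuation \<A> \<gamma> F"
  unfolding analytic_continuation_def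
proof (intro conjI ballI \<gamma>)
  fix t :: real assume t: "t \<in> {0..1}"
  obtain N d where N: "open N" "\<gamma> t \<in> N" "holomorphic_mfd \<A> (F t) N" "d > 0"
    "\<forall>s\<in>{0..1}. dist s t < d \<longrightarrow> (\<forall>\<^sub>F y in nhds (\<gamma> s). F s y = F t y)"
    using loc[OF t] by (elim exE conjE)
  have "(\<gamma> \<longlongrightarrow> \<gamma> t) (at t within {0..1})" using \<gamma> t unfolding path_def continuous_on_def by blast
  then have "\<forall>\<^sub>F s in at t within {0..1}. \<gamma> s \<in> N" using N(1,2) by (rule topological_tendstoD)
  moreover have "\<forall>\<^sub>F s in at t within {0..1}. (\<forall>\<^sub>F y in nhds (\<gamma> s). F s y = F t y)"
    unfolding eventually_at using N(4,5) by blast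
  ultimately show "\<exists>N. open N \<and> \<gamma> t \<in> N \<and> holomorphic_mfd \<A> (F t) N \<and>
      (\<forall>\<^sub>F s in at t within {0..1}. \<gamma> s \<in> N \<and> (\<forall>\<^sub>F y in nhds (\<gamma> s). F s y = F t y))"
    using N(1-3) by (intro exI[of _ N] conjI eventually_conj)
qed

lemma analytic_continuationE:
  assumes "analytic_continuation \<A> \<gamma> F" "t \<in> {0..1}"
  obtains N d where "open N" "\<gamma> t \<in> N" "holomorphic_mfd \<A> (F t) N" "d > 0"
    "\<forall>s\<in>{0..1}. dist s t < d \<longrightarrow> \<gamma> s \<in> N \<and> (\<forall>\<^sub>F y in nhds (\<gamma> s). F s y = F t y)"
proof -
  obtain N where N: "open N" "\<gamma> t \<in> N" "holomorphic_mfd \<A> (F t) N"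
    "\<forall>\<^sub>F s in at t within {0..1}. \<gamma> s \<in> N \<and> (\<forall>\<^sub>F y in nhds (\<gamma> s). F s y = F t y)"
    using assms unfolding analytic_continuation_def by blast
  obtain d where d: "d > 0" "\<forall>s\<in>{0..1}. s \<noteq> t \<and> dist s t < d \<longrightarrow> \<gamma> s \<in> N \<and> (\<forall>\<^sub>F y in nhds (\<gamma> s). F s y = F t y)"
    using N(4) unfolding eventually_at by blast
  have "\<forall>s\<in>{0..1}. dist s t < d \<longrightarrow> \<gamma> s \<in> N \<and> (\<forall>\<^sub>F y in nhds (\<gamma> s). F s y = F t y)"
  proof (intro ballI impI)
    fix s assume "s \<in> {0..1}" "dist s t < d"
    then show "\<gamma> s \<in> N \<and> (\<forall>\<^sub>F y in nhds (\<gamma> s). F s y = F t y)"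
      using d(2) N(2) by (cases "s = t") auto
  qed
  then show ?thesis by (rule that[OF N(1-3) d(1)])
qed

lemma continues_toE:
  assumes "continues_to \<A> U A \<nu> V x w y w'"
  obtains \<gamma> F where "analytic_continuation \<A> \<gamma> F" "path \<gamma>" "path_image \<gamma> \<subseteq> V \<inter> regular_points U A \<nu>" "\<gamma> 0 = x" "\<gamma> 1 = y"
    "\<forall>t\<in>{0..1}. \<forall>\<^sub>F p in nhds (\<gamma> t). F t p \<in> solutions U A \<nu> p" "F 0 x = w" "F 1 y = w'"
  using assms unfolding continues_to_def analytic_continuation_def pathstart_def pathfinish_def
  by (elim exE conjE) blast

lemma continues_toI:
  assumes "analytic_continuation \<A> \<gamma> F" "path_image \<gamma> \<subseteq> V \<inter> regular_points U A \<nu>" "\<gamma> 0 = x" "\<gamma> 1 = y"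
    "\<And>t. t \<in> {0..1} \<Longrightarrow> \<forall>\<^sub>F p in nhds (\<gamma> t). F t p \<in> solutions U A \<nu> p" "F 0 x = w" "F 1 y = w'"
  shows "continues_to \<A> U A \<nu> V x w y w'"
  using assms unfolding continues_to_def pathstart_def pathfinish_def by blast

lemma continues_to_subset: "continues_to \<A> U A \<nu> V x w y w' \<Longrightarrow> V \<subseteq> V' \<Longrightarrow> continues_to \<A> U A \<nu> V' x w y w'"
  unfolding continues_to_def by blast

lemma continues_to_sym:
  assumes "continues_to \<A> U A \<nu> V x w y w'"
  shows "continues_to \<A> U A \<nu> V y w' x w"
proof -
  obtain \<gamma> F where *: "analytic_continuation \<A> \<gamma> F" "path \<gamma>" "path_image \<gamma> \<subseteq> V \<inter> regular_points U A \<nu>" "\<gamma> 0 = x" "\<gamma> 1 = y"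
    "\<forall>t\<in>{0..1}. \<forall>\<^sub>F p in nhds (\<gamma> t). F t p \<in> solutions U A \<nu> p" "F 0 x = w" "F 1 y = w'"
    by (rule continues_toE[OF assms])
  have rev: "reversepath \<gamma> t = \<gamma> (1 - t)" for t by (simp add: reversepath_def)
  show ?thesis
  proof (rule continues_toI[where \<gamma>="reversepath \<gamma>" and F="\<lambda>t. F (1 - t)"])
    show "analytic_continuation \<A> (reversepath \<gamma>) (\<lambda>t. F (1 - t))"
    proof (rule analytic_continuationI)
      fix t :: real assume t: "t \<in> {0..1}"
      then have t': "1 - t \<in> {0..1}" by auto
      obtain N d where N: "open N" "\<gamma> (1 - t) \<in> N" "holomorphic_mfd \<A> (F (1 - t)) N" "d > 0"
        "\<forall>s\<in>{0..1}. dist s (1 - t) < d \<longrightarrow> \<gamma> s \<in> N \<and> (\<forall>\<^sub>F y in nhds (\<gamma> s). F s y = F (1 - t) y)"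
        by (rule analytic_continuationE[OF *(1) t'])
      have "\<forall>s\<in>{0..1}. dist s t < d \<longrightarrow> (\<forall>\<^sub>F y in nhds (\<gamma> (1 - s)). F (1 - s) y = F (1 - t) y)"
        using N(5) by (auto simp: dist_real_def)
      then show "\<exists>N. open N \<and> reversepath \<gamma> t \<in> N \<and> holomorphic_mfd \<A> (F (1 - t)) N \<and>
          (\<exists>d>0. \<forall>s\<in>{0..1}. dist s t < d \<longrightarrow> (\<forall>\<^sub>F y in nhds (reversepath \<gamma> s). F (1 - s) y = F (1 - t) y))"
        unfolding rev using N(1-4) by blast
    qed (use *(2) in simp)
    show "\<forall>\<^sub>F p in nhds (reversepath \<gamma> t). F (1 - t) p \<in> solutions U A \<nu> p" if "t \<in> {0..1}" for t
      unfolding rev using *(6) that by auto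
  qed (use * in \<open>auto simp: rev\<close>)
qed

section \<open>Continuation of germs of solutions\<close>

context
  fixes \<A> :: "('a::{t2_space,second_countable_topology}, 'm::finite) chart set"
    and U :: "'i \<Rightarrow> 'a set" and A :: "nat \<Rightarrow> 'i \<Rightarrow> 'a \<Rightarrow> complex" and \<nu> :: nat
  assumes M: "complex_manifold \<A>" and cs: "coefficient_system \<A> U A \<nu>" and \<nu>: "\<nu> > 0"
begin

text \<open>If all leading coefficients vanished at \<open>x\<close>, either some nonzero local
  polynomial would have degree below \<nu> and too few roots, or every number would be a
  solution.\<close>

lemma regular_leading_nonzero:
  assumes "x \<in> regular_points U A \<nu>"
  obtains i where "x \<in> U i" "A \<nu> i x \<noteq> 0"
proof -
  have card: "card (solutions U A \<nu> x) = \<nu>" using assms by (simp add: regular_points_def)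
  have coeff: "coeff (local_poly A \<nu> i x) k = (if k \<le> \<nu> then A k i x else 0)" for i k
    using coeff_coeff_poly[of "\<lambda>k. A k i x" \<nu> k] by (simp add: local_poly_def coeff_poly_def)
  have "\<exists>i. x \<in> U i \<and> A \<nu> i x \<noteq> 0"
  proof (rule ccontr)
    assume none: "\<not> (\<exists>i. x \<in> U i \<and> A \<nu> i x \<noteq> 0)"
    show False
    proof (cases "\<exists>i. x \<in> U i \<and> local_poly A \<nu> i x \<noteq> 0")
      case True
      then obtain i where i: "x \<in> U i" "local_poly A \<nu> i x \<noteq> 0" by blast
      have "degree (local_poly A \<nu> i x) \<le> \<nu>" by (rule degree_le) (simp add: coeff)
      moreover have "degree (local_poly A \<nu> i x) \<noteq> \<nu>"
      proof
        assume "degree (local_poly A \<nu> i x) = \<nu>"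
        then have "coeff (local_poly A \<nu> i x) \<nu> \<noteq> 0" using leading_coeff_0_iff[of "local_poly A \<nu> i x"] i(2) by metis
        then show False using none i(1) coeff[of i \<nu>] by auto
      qed
      moreover have "solutions U A \<nu> x \<subseteq> {w. poly (local_poly A \<nu> i x) w = 0}" using i(1) unfolding solutions_def by blast
      then have "card (solutions U A \<nu> x) \<le> card {w. poly (local_poly A \<nu> i x) w = 0}"
        by (rule card_mono[OF poly_roots_finite[OF i(2)]])
      moreover have "\<dots> \<le> degree (local_poly A \<nu> i x)" by (rule card_poly_roots_bound[OF i(2)])
      ultimately show False using card by linarith
    next
      case False
      \<comment> \<open>The \<open>card\<close> of an infinite set is 0, which differs from the
        positive number \<nu>.\<close>
      then have "solutions U A \<nu> x = UNIV" unfolding solutions_def by auto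
      then show False using card \<nu> infinite_UNIV_char_0[where 'a=complex] by simp
    qed
  qed
  then show ?thesis using that by blast
qed

text \<open>Near \<open>x\<close> a single index describes all solutions, because its leading
  coefficient stays nonzero; this transports \<open>regular_roots_local\<close> to an arbitrary
  holomorphic coordinate.\<close>

lemma regular_local:
  assumes c: "holomorphic_coordinate \<A> c" and x: "x \<in> regular_points U A \<nu>" "x \<in> fst c"
  defines "sol \<equiv> \<lambda>y. solutions U A \<nu> (chart_inv c y)"
  obtains \<epsilon> \<delta> where "\<epsilon> > 0" "\<delta> > 0" "ball (snd c x) \<epsilon> \<subseteq> snd c ` fst c"
    "\<forall>y\<in>ball (snd c x) \<epsilon>. chart_inv c y \<in> regular_points U A \<nu>"
    "\<forall>y\<in>ball (snd c x) \<epsilon>. \<forall>w\<in>sol y. \<forall>w'\<in>sol y. w \<noteq> w' \<longrightarrow> \<delta> \<le> dist w w'"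
    "\<forall>y\<in>ball (snd c x) \<epsilon>. \<forall>w\<in>sol y. \<exists>b. holomorphic_Cn b (ball (snd c x) \<epsilon>) \<and> b y = w \<and>
      (\<forall>y'\<in>ball (snd c x) \<epsilon>. b y' \<in> sol y')"
proof -
  note ct = holomorphic_coordinate_topological[OF c]
  obtain i where i: "x \<in> U i" "A \<nu> i x \<noteq> 0" by (rule regular_leading_nonzero[OF x(1)])
  let ?S = "snd c ` (fst c \<inter> U i)"
  let ?a = "\<lambda>k z. A k i (chart_inv c z)"
  have roots: "{w. poly (coeff_poly (\<lambda>k. ?a k y) \<nu>) w = 0} = sol y" if "y \<in> ?S" "?a \<nu> y \<noteq> 0" for y
  proof -
    have "chart_inv c y \<in> U i" using that(1) chart_inv_snd[OF ct] by auto
    from solutions_eq_roots[OF M cs this that(2)] show ?thesis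
      by (simp add: sol_def local_poly_def coeff_poly_def)
  qed
  have xS: "snd c x \<in> ?S" "?a \<nu> (snd c x) \<noteq> 0" using i x chart_inv_snd[OF ct] by auto
  have card: "card {w. poly (coeff_poly (\<lambda>k. ?a k (snd c x)) \<nu>) w = 0} = \<nu>"
    unfolding roots[OF xS] sol_def using x chart_inv_snd[OF ct] by (simp add: regular_points_def)
  let ?rt = "\<lambda>y. {w. poly (coeff_poly (\<lambda>k. ?a k y) \<nu>) w = 0}"
  have "\<exists>\<epsilon> \<delta>. \<epsilon> > 0 \<and> \<delta> > 0 \<and> ball (snd c x) \<epsilon> \<subseteq> ?S \<and>
    (\<forall>y\<in>ball (snd c x) \<epsilon>. ?a \<nu> y \<noteq> 0 \<and> card (?rt y) = \<nu> \<and>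
      (\<forall>w\<in>?rt y. \<forall>w'\<in>?rt y. w \<noteq> w' \<longrightarrow> \<delta> \<le> dist w w') \<and>
      (\<forall>w\<in>?rt y. \<exists>b. holomorphic_Cn b (ball (snd c x) \<epsilon>) \<and> b y = w \<and> (\<forall>y'\<in>ball (snd c x) \<epsilon>. b y' \<in> ?rt y')))"
  proof (rule regular_roots_local[where a="?a" and \<nu>=\<nu> and S="?S" and v="snd c x"])
    show "open ?S" by (rule chart_image_open[OF ct U_open[OF M cs]])
    show "holomorphic_Cn (?a k) ?S" if "k \<le> \<nu>" for k
      by (rule holomorphic_mfd_Cn[OF M c A_holomorphic[OF M cs that] U_open[OF M cs]])
  qed (fact xS card \<nu>)+
  then obtain \<epsilon> \<delta> where e: "\<epsilon> > 0" "ball (snd c x) \<epsilon> \<subseteq> ?S" "\<delta> > 0"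
    and e4: "\<forall>y\<in>ball (snd c x) \<epsilon>. ?a \<nu> y \<noteq> 0 \<and> card (?rt y) = \<nu> \<and>
      (\<forall>w\<in>?rt y. \<forall>w'\<in>?rt y. w \<noteq> w' \<longrightarrow> \<delta> \<le> dist w w') \<and>
      (\<forall>w\<in>?rt y. \<exists>b. holomorphic_Cn b (ball (snd c x) \<epsilon>) \<and> b y = w \<and> (\<forall>y'\<in>ball (snd c x) \<epsilon>. b y' \<in> ?rt y'))"
    by (elim exE conjE)
  have r: "{w. poly (coeff_poly (\<lambda>k. ?a k y) \<nu>) w = 0} = sol y" if "y \<in> ball (snd c x) \<epsilon>" for y
    using roots[of y] e(2) bspec[OF e4 that] that by blast
  show ?thesis
  proof (rule that[OF e(1,3)])
    show "ball (snd c x) \<epsilon> \<subseteq> snd c ` fst c" using e(2) by blast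
    show "\<forall>y\<in>ball (snd c x) \<epsilon>. chart_inv c y \<in> regular_points U A \<nu>"
    proof
      fix y assume y: "y \<in> ball (snd c x) \<epsilon>"
      then show "chart_inv c y \<in> regular_points U A \<nu>"
        using bspec[OF e4 y] r[OF y] unfolding sol_def regular_points_def by simp
    qed
    show "\<forall>y\<in>ball (snd c x) \<epsilon>. \<forall>w\<in>sol y. \<forall>w'\<in>sol y. w \<noteq> w' \<longrightarrow> \<delta> \<le> dist w w'"
    proof (intro ballI impI)
      fix y w w' assume y: "y \<in> ball (snd c x) \<epsilon>" and w: "w \<in> sol y" "w' \<in> sol y" "w \<noteq> w'"
      show "\<delta> \<le> dist w w'" using bspec[OF e4 y] w unfolding r[OF y] by blast
    qed
    show "\<forall>y\<in>ball (snd c x) \<epsilon>. \<forall>w\<in>sol y. \<exists>b. holomorphic_Cn b (ball (snd c x) \<epsilon>) \<and> b y = w \<and>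
      (\<forall>y'\<in>ball (snd c x) \<epsilon>. b y' \<in> sol y')"
    proof (intro ballI)
      fix y w assume y: "y \<in> ball (snd c x) \<epsilon>" "w \<in> sol y"
      then obtain b where b: "holomorphic_Cn b (ball (snd c x) \<epsilon>)" "b y = w"
        "\<forall>y'\<in>ball (snd c x) \<epsilon>. b y' \<in> {w. poly (coeff_poly (\<lambda>k. ?a k y') \<nu>) w = 0}"
        using bspec[OF e4 y(1)] y(2) unfolding r[OF y(1)] by blast
      have "b y' \<in> sol y'" if "y' \<in> ball (snd c x) \<epsilon>" for y' using b(3) r[OF that] that by blast
      then show "\<exists>b. holomorphic_Cn b (ball (snd c x) \<epsilon>) \<and> b y = w \<and> (\<forall>y'\<in>ball (snd c x) \<epsilon>. b y' \<in> sol y')"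
        using b by blast
    qed
  qed
qed

lemma regular_separated:
  assumes x: "x \<in> regular_points U A \<nu>"
  obtains \<delta> where "\<delta> > 0" "\<forall>\<^sub>F p in nhds x. \<forall>w\<in>solutions U A \<nu> p. \<forall>w'\<in>solutions U A \<nu> p. w \<noteq> w' \<longrightarrow> \<delta> \<le> dist w w'"
proof -
  obtain c where c: "c \<in> \<A>" "x \<in> fst c" by (rule atlas_covers[OF M])
  note hc = atlas_holomorphic_coordinate[OF M c(1)]
  note ct = holomorphic_coordinate_topological[OF hc]
  obtain \<epsilon> \<delta> where e: "\<epsilon> > 0" "\<delta> > 0"
    "\<forall>y\<in>ball (snd c x) \<epsilon>. \<forall>w\<in>solutions U A \<nu> (chart_inv c y). \<forall>w'\<in>solutions U A \<nu> (chart_inv c y). w \<noteq> w' \<longrightarrow> \<delta> \<le> dist w w'"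
    by (rule regular_local[OF hc x c(2)])
  have "open {p \<in> fst c. snd c p \<in> ball (snd c x) \<epsilon>}" by (rule chart_preimage_open[OF ct open_ball])
  moreover have "x \<in> {p \<in> fst c. snd c p \<in> ball (snd c x) \<epsilon>}" using c e by simp
  ultimately have "\<forall>\<^sub>F p in nhds x. p \<in> {p \<in> fst c. snd c p \<in> ball (snd c x) \<epsilon>}" by (rule eventually_nhds_in_open)
  then have "\<forall>\<^sub>F p in nhds x. \<forall>w\<in>solutions U A \<nu> p. \<forall>w'\<in>solutions U A \<nu> p. w \<noteq> w' \<longrightarrow> \<delta> \<le> dist w w'"
  proof eventually_elim
    case (elim p)
    then have "chart_inv c (snd c p) = p" using chart_inv_snd[OF ct] by blast
    then show ?case using e(3)[rule_format, of "snd c p"] elim by auto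
  qed
  then show ?thesis by (rule that[OF e(2)])
qed

text \<open>Continuous branches with equal value at \<open>x\<close> stay closer to each other than
  the local gap between solutions.\<close>

lemma solution_germs_unique:
  assumes x: "x \<in> regular_points U A \<nu>"
    and f: "open N1" "x \<in> N1" "holomorphic_mfd \<A> f N1" "\<forall>\<^sub>F p in nhds x. f p \<in> solutions U A \<nu> p"
    and g: "open N2" "x \<in> N2" "holomorphic_mfd \<A> g N2" "\<forall>\<^sub>F p in nhds x. g p \<in> solutions U A \<nu> p"
    and eq: "f x = g x"
  shows "\<forall>\<^sub>F p in nhds x. f p = g p"
proof -
  obtain \<delta> where d: "\<delta> > 0" "\<forall>\<^sub>F p in nhds x. \<forall>w\<in>solutions U A \<nu> p. \<forall>w'\<in>solutions U A \<nu> p. w \<noteq> w' \<longrightarrow> \<delta> \<le> dist w w'"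
    by (rule regular_separated[OF x])
  have "isCont f x" "isCont g x"
    using holomorphic_mfd_continuous_on[OF M f(3,1)] holomorphic_mfd_continuous_on[OF M g(3,1)] f g
    by (simp_all add: continuous_on_eq_continuous_at)
  then have "isCont (\<lambda>p. dist (f p) (g p)) x" by (intro continuous_intros)
  then have "((\<lambda>p. dist (f p) (g p)) \<longlongrightarrow> dist (f x) (g x)) (nhds x)"
    by (simp add: continuous_at tendsto_nhds_iff)
  then have "\<forall>\<^sub>F p in nhds x. dist (f p) (g p) < \<delta>" using d(1) eq by (intro order_tendstoD(2)) auto
  from eventually_conj[OF this eventually_conj[OF d(2) eventually_conj[OF f(4) g(4)]]]
  show ?thesis by (rule eventually_mono) (meson not_le)
qed

text \<open>Only the junction of the curves needs care: there the two function elements are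
  different functions, but their germs at \<open>y\<close> agree by
  \<open>solution_germs_unique\<close>.\<close>

lemma continues_to_trans:
  assumes 1: "continues_to \<A> U A \<nu> V x w y w'" and 2: "continues_to \<A> U A \<nu> V y w' z w''"
  shows "continues_to \<A> U A \<nu> V x w z w''"
proof -
  obtain \<gamma>1 F1 where 1: "analytic_continuation \<A> \<gamma>1 F1" "path \<gamma>1" "path_image \<gamma>1 \<subseteq> V \<inter> regular_points U A \<nu>" "\<gamma>1 0 = x" "\<gamma>1 1 = y"
    "\<forall>t\<in>{0..1}. \<forall>\<^sub>F p in nhds (\<gamma>1 t). F1 t p \<in> solutions U A \<nu> p" "F1 0 x = w" "F1 1 y = w'"
    by (rule continues_toE[OF 1])
  obtain \<gamma>2 F2 where 2: "analytic_continuation \<A> \<gamma>2 F2" "path \<gamma>2" "path_image \<gamma>2 \<subseteq> V \<inter> regular_points U A \<nu>" "\<gamma>2 0 = y" "\<gamma>2 1 = z"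
    "\<forall>t\<in>{0..1}. \<forall>\<^sub>F p in nhds (\<gamma>2 t). F2 t p \<in> solutions U A \<nu> p" "F2 0 y = w'" "F2 1 z = w''"
    by (rule continues_toE[OF 2])
  define \<gamma> where "\<gamma> = \<gamma>1 +++ \<gamma>2"
  define F where "F t = (if t \<le> 1 / 2 then F1 (2 * t) else F2 (2 * t - 1))" for t :: real
  have \<gamma>: "\<gamma> t = (if t \<le> 1 / 2 then \<gamma>1 (2 * t) else \<gamma>2 (2 * t - 1))" for t by (simp add: \<gamma>_def joinpaths_def)
  have path: "path \<gamma>" unfolding \<gamma>_def using 1 2 by (intro path_join_imp) (auto simp: pathfinish_def pathstart_def)
  have img: "path_image \<gamma> \<subseteq> V \<inter> regular_points U A \<nu>"
    unfolding \<gamma>_def by (rule subset_path_image_join[OF 1(3) 2(3)])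
  have yreg: "y \<in> regular_points U A \<nu>" using 1(3,5) by (auto simp: path_image_def)
  show ?thesis
  proof (rule continues_toI[where \<gamma>=\<gamma> and F=F])
    show "\<forall>\<^sub>F p in nhds (\<gamma> t). F t p \<in> solutions U A \<nu> p" if "t \<in> {0..1}" for t
      using 1(6)[rule_format, of "2 * t"] 2(6)[rule_format, of "2 * t - 1"] that by (auto simp: \<gamma> F_def)
    show "analytic_continuation \<A> \<gamma> F"
    proof (rule analytic_continuationI[OF path])
      fix t :: real assume t: "t \<in> {0..1}"
      consider "t < 1 / 2" | "t > 1 / 2" | "t = 1 / 2" by linarith
      then show "\<exists>N. open N \<and> \<gamma> t \<in> N \<and> holomorphic_mfd \<A> (F t) N \<and>
        (\<exists>d>0. \<forall>s\<in>{0..1}. dist s t < d \<longrightarrow> (\<forall>\<^sub>F y in nhds (\<gamma> s). F s y = F t y))"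
      proof cases
        case 1
        then have "2 * t \<in> {0..1}" using t by auto
        then obtain N d where N: "open N" "\<gamma>1 (2 * t) \<in> N" "holomorphic_mfd \<A> (F1 (2 * t)) N" "d > 0"
          "\<forall>s\<in>{0..1}. dist s (2 * t) < d \<longrightarrow> \<gamma>1 s \<in> N \<and> (\<forall>\<^sub>F y in nhds (\<gamma>1 s). F1 s y = F1 (2 * t) y)"
          by (rule analytic_continuationE[OF \<open>analytic_continuation \<A> \<gamma>1 F1\<close>])
        have "\<forall>\<^sub>F y in nhds (\<gamma> s). F s y = F t y" if s: "s \<in> {0..1}" "dist s t < min (d / 2) (1 / 2 - t)" for s
        proof -
          have ds: "\<bar>s - t\<bar> < d / 2" "\<bar>s - t\<bar> < 1 / 2 - t" using s(2) by (simp_all add: dist_real_def)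
          have "s \<le> 1 / 2" using ds(2) by linarith
          moreover have "dist (2 * s) (2 * t) < d" unfolding dist_real_def using ds(1) by linarith
          moreover have "2 * s \<in> {0..1}" using s(1) \<open>s \<le> 1 / 2\<close> by simp
          ultimately have "s \<le> 1 / 2" "2 * s \<in> {0..1}" "dist (2 * s) (2 * t) < d" by blast+
          then show ?thesis using N(5)[rule_format, of "2 * s"] 1 by (simp add: \<gamma> F_def)
        qed
        then show ?thesis using N 1 by (intro exI[of _ N] conjI exI[of _ "min (d / 2) (1 / 2 - t)"]) (auto simp: \<gamma> F_def)
      next
        case 2
        then have "2 * t - 1 \<in> {0..1}" using t by auto
        then obtain N d where N: "open N" "\<gamma>2 (2 * t - 1) \<in> N" "holomorphic_mfd \<A> (F2 (2 * t - 1)) N" "d > 0"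
          "\<forall>s\<in>{0..1}. dist s (2 * t - 1) < d \<longrightarrow> \<gamma>2 s \<in> N \<and> (\<forall>\<^sub>F y in nhds (\<gamma>2 s). F2 s y = F2 (2 * t - 1) y)"
          by (rule analytic_continuationE[OF \<open>analytic_continuation \<A> \<gamma>2 F2\<close>])
        have "\<forall>\<^sub>F y in nhds (\<gamma> s). F s y = F t y" if s: "s \<in> {0..1}" "dist s t < min (d / 2) (t - 1 / 2)" for s
        proof -
          have ds: "\<bar>s - t\<bar> < d / 2" "\<bar>s - t\<bar> < t - 1 / 2" using s(2) by (simp_all add: dist_real_def)
          have "\<not> s \<le> 1 / 2" using ds(2) by linarith
          moreover have "dist (2 * s - 1) (2 * t - 1) < d" unfolding dist_real_def using ds(1) by linarith
          moreover have "2 * s - 1 \<in> {0..1}" using s(1) \<open>\<not> s \<le> 1 / 2\<close> by simp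
          ultimately have "\<not> s \<le> 1 / 2" "2 * s - 1 \<in> {0..1}" "dist (2 * s - 1) (2 * t - 1) < d" by blast+
          then show ?thesis using N(5)[rule_format, of "2 * s - 1"] 2 by (simp add: \<gamma> F_def)
        qed
        then show ?thesis using N 2 by (intro exI[of _ N] conjI exI[of _ "min (d / 2) (t - 1 / 2)"]) (auto simp: \<gamma> F_def)
      next
        case 3
        have m: "1 \<in> {0..1::real}" "0 \<in> {0..1::real}" by auto
        obtain N1 d1 where N1: "open N1" "\<gamma>1 1 \<in> N1" "holomorphic_mfd \<A> (F1 1) N1" "d1 > 0"
          "\<forall>s\<in>{0..1}. dist s 1 < d1 \<longrightarrow> \<gamma>1 s \<in> N1 \<and> (\<forall>\<^sub>F y in nhds (\<gamma>1 s). F1 s y = F1 1 y)"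
          by (rule analytic_continuationE[OF \<open>analytic_continuation \<A> \<gamma>1 F1\<close> m(1)])
        obtain N2 d2 where N2: "open N2" "\<gamma>2 0 \<in> N2" "holomorphic_mfd \<A> (F2 0) N2" "d2 > 0"
          "\<forall>s\<in>{0..1}. dist s 0 < d2 \<longrightarrow> \<gamma>2 s \<in> N2 \<and> (\<forall>\<^sub>F y in nhds (\<gamma>2 s). F2 s y = F2 0 y)"
          by (rule analytic_continuationE[OF \<open>analytic_continuation \<A> \<gamma>2 F2\<close> m(2)])
        have y: "\<gamma>1 1 = y" "\<gamma>2 0 = y" by fact+
        have "\<forall>\<^sub>F p in nhds y. F1 1 p = F2 0 p"
          by (rule solution_germs_unique[OF yreg N1(1) _ N1(3) _ N2(1) _ N2(3)])
            (use N1(2) N2(2) y \<open>F1 1 y = w'\<close> \<open>F2 0 y = w'\<close>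
               \<open>\<forall>t\<in>{0..1}. \<forall>\<^sub>F p in nhds (\<gamma>1 t). F1 t p \<in> solutions U A \<nu> p\<close>[rule_format, OF m(1)]
               \<open>\<forall>t\<in>{0..1}. \<forall>\<^sub>F p in nhds (\<gamma>2 t). F2 t p \<in> solutions U A \<nu> p\<close>[rule_format, OF m(2)] in simp_all)
        then obtain W where W: "open W" "y \<in> W" "\<forall>p\<in>W. F1 1 p = F2 0 p" unfolding eventually_nhds by blast
        \<comment> \<open>At the junction the element of the first curve is used. Beyond it, the
          second element must agree with it near \<open>\<gamma> s\<close> and not just near
          \<open>y\<close>; the neighbourhood \<open>W\<close> ensures this.\<close>
        have FtF: "F t = F1 1" unfolding 3 F_def by simp
        have g12: "\<gamma> (1 / 2) = y" using y by (simp add: \<gamma>)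
        have "(\<gamma> \<longlongrightarrow> \<gamma> (1 / 2)) (at (1 / 2) within {0..1})" using path unfolding path_def continuous_on_def by simp
        then have "\<forall>\<^sub>F s in at (1 / 2) within {0..1}. \<gamma> s \<in> W" using W(1,2) g12 by (intro topological_tendstoD) auto
        then obtain d3 where d3: "d3 > 0" "\<forall>s\<in>{0..1}. s \<noteq> 1 / 2 \<and> dist s (1 / 2) < d3 \<longrightarrow> \<gamma> s \<in> W"
          unfolding eventually_at by blast
        have evd: "\<forall>\<^sub>F y in nhds (\<gamma> s). F s y = F t y" if s: "s \<in> {0..1}" "dist s t < min (min (d1 / 2) (d2 / 2)) d3" for s
        proof (cases "s \<le> 1 / 2")
          case True
          have ds: "\<bar>s - 1 / 2\<bar> < d1 / 2" using s(2) 3 by (simp add: dist_real_def)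
          have "dist (2 * s) 1 < d1" unfolding dist_real_def using ds by linarith
          moreover have "2 * s \<in> {0..1}" using s(1) True by simp
          ultimately have "2 * s \<in> {0..1}" "dist (2 * s) 1 < d1" by blast+
          then show ?thesis using N1(5)[rule_format, of "2 * s"] True unfolding FtF by (simp add: \<gamma> F_def)
        next
          case False
          have ds: "\<bar>s - 1 / 2\<bar> < d2 / 2" using s(2) 3 by (simp add: dist_real_def)
          have "dist (2 * s - 1) 0 < d2" unfolding dist_real_def using ds by linarith
          moreover have "2 * s - 1 \<in> {0..1}" using s(1) False by simp
          ultimately have "\<forall>\<^sub>F y in nhds (\<gamma>2 (2 * s - 1)). F2 (2 * s - 1) y = F2 0 y" using N2(5) by blast
          then have a: "\<forall>\<^sub>F y in nhds (\<gamma> s). F s y = F2 0 y" using False by (simp add: \<gamma> F_def)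
          have "\<gamma> s \<in> W" using d3(2)[rule_format, of s] s 3 False by auto
          then have b: "\<forall>\<^sub>F y in nhds (\<gamma> s). F1 1 y = F2 0 y" using W(1,3) unfolding eventually_nhds by blast
          from a b show ?thesis unfolding FtF by eventually_elim simp
        qed
        have "\<gamma> t \<in> N1" unfolding 3 g12 using N1(2) y by simp
        moreover have "holomorphic_mfd \<A> (F t) N1" unfolding FtF by (rule N1(3))
        moreover have "\<exists>d>0. \<forall>s\<in>{0..1}. dist s t < d \<longrightarrow> (\<forall>\<^sub>F y in nhds (\<gamma> s). F s y = F t y)"
        proof (rule exI[of _ "min (min (d1 / 2) (d2 / 2)) d3"], intro conjI ballI impI)
          show "0 < min (min (d1 / 2) (d2 / 2)) d3" using N1(4) N2(4) d3(1) by simp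
        qed (rule evd)
        ultimately show ?thesis using N1(1) by blast
      qed
    qed
  qed (use img 1(4,7) 2(5,8) in \<open>auto simp: \<gamma> F_def\<close>)
qed

text \<open>A branch defined on the whole ball is its own continuation along a segment, so the
  function elements do not depend on the parameter.\<close>

lemma continues_to_local:
  assumes c: "holomorphic_coordinate \<A> c" and B: "ball v \<epsilon> \<subseteq> snd c ` fst c"
    "\<forall>y\<in>ball v \<epsilon>. chart_inv c y \<in> V \<inter> regular_points U A \<nu>"
    and b: "holomorphic_Cn b (ball v \<epsilon>)" "\<forall>y\<in>ball v \<epsilon>. b y \<in> solutions U A \<nu> (chart_inv c y)"
    and y: "y \<in> ball v \<epsilon>" "y' \<in> ball v \<epsilon>"
  shows "continues_to \<A> U A \<nu> V (chart_inv c y) (b y) (chart_inv c y') (b y')"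
proof -
  note ct = holomorphic_coordinate_topological[OF c]
  define N where "N = {x \<in> fst c. snd c x \<in> ball v \<epsilon>}"
  have N: "open N" unfolding N_def by (rule chart_preimage_open[OF ct open_ball])
  have Neq: "N = chart_inv c ` ball v \<epsilon>" unfolding N_def by (rule chart_inv_image[OF ct B(1), symmetric])
  define \<gamma> where "\<gamma> t = chart_inv c (linepath y y' t)" for t
  have lin: "linepath y y' t \<in> ball v \<epsilon>" if "t \<in> {0..1}" for t
  proof -
    have "linepath y y' t \<in> closed_segment y y'" using that by (rule linepath_in_path)
    then show ?thesis using closed_segment_subset[OF y convex_ball] by blast
  qed
  have \<gamma>N: "\<gamma> t \<in> N" if "t \<in> {0..1}" for t unfolding Neq \<gamma>_def using lin[OF that] by (rule imageI)
  have "continuous_on {0..1} (\<lambda>t. chart_inv c (linepath y y' t))"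
    by (rule continuous_on_compose2[OF chart_inv_continuous[OF ct] continuous_on_linepath]) (use lin B(1) in blast)
  then have path: "path \<gamma>" unfolding path_def \<gamma>_def .
  have bcoord: "b (snd c (chart_inv c p)) = b p" if "p \<in> ball v \<epsilon>" for p
    using snd_chart_inv[OF ct] B(1) that by (metis subsetD)
  have hol: "holomorphic_mfd \<A> (\<lambda>x. b (snd c x)) N" unfolding N_def by (rule holomorphic_Cn_mfd[OF M c b(1)])
  show ?thesis
  proof (rule continues_toI[where \<gamma>=\<gamma> and F="\<lambda>t x. b (snd c x)"])
    show "analytic_continuation \<A> \<gamma> (\<lambda>t x. b (snd c x))"
      using N \<gamma>N hol by (intro analytic_continuationI[OF path]) (auto intro!: exI[of _ N] exI[of _ 1])
    show "path_image \<gamma> \<subseteq> V \<inter> regular_points U A \<nu>"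
    proof
      fix x assume "x \<in> path_image \<gamma>"
      then obtain t where "t \<in> {0..1}" "x = \<gamma> t" by (auto simp: path_image_def)
      then show "x \<in> V \<inter> regular_points U A \<nu>" using lin[of t] B(2) unfolding \<gamma>_def by blast
    qed
    show "\<forall>\<^sub>F p in nhds (\<gamma> t). b (snd c p) \<in> solutions U A \<nu> p" if "t \<in> {0..1}" for t
    proof -
      have "\<forall>\<^sub>F p in nhds (\<gamma> t). p \<in> N" by (rule eventually_nhds_in_open[OF N \<gamma>N[OF that]])
      then show ?thesis
      proof eventually_elim
        case (elim p)
        then have "chart_inv c (snd c p) = p" "snd c p \<in> ball v \<epsilon>" using chart_inv_snd[OF ct] unfolding N_def by blast+
        then show ?case using b(2) by metis
      qed
    qed
    show "b (snd c (chart_inv c y)) = b y" "b (snd c (chart_inv c y')) = b y'"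
      using bcoord y by blast+
  qed (simp_all add: \<gamma>_def linepath_def)
qed

text \<open>A subfamily of the solutions over the dense open set \<open>X\<close> that consists of local sections is
  preserved by continuation, also along curves that leave \<open>X\<close>.\<close>

lemma continues_to_invariant:
  assumes c: "holomorphic_coordinate \<A> c" and V: "V \<subseteq> fst c" and X: "open X" "X \<subseteq> snd c ` fst c"
    and conn: "\<And>v \<epsilon>. \<epsilon> > 0 \<Longrightarrow> ball v \<epsilon> \<subseteq> snd c ` fst c \<Longrightarrow> connected (ball v \<epsilon> \<inter> X) \<and> ball v \<epsilon> \<inter> X \<noteq> {}"
    and sep: "separated_on X (\<lambda>y. solutions U A \<nu> (chart_inv c y))"
    and S: "\<And>y. y \<in> X \<Longrightarrow> S y \<subseteq> solutions U A \<nu> (chart_inv c y)"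
    and loc: "\<And>v. v \<in> X \<Longrightarrow> \<exists>\<epsilon>>0. ball v \<epsilon> \<subseteq> X \<and> has_sections (ball v \<epsilon>) S"
    and cont: "continues_to \<A> U A \<nu> V (chart_inv c v) w (chart_inv c v') w'"
    and v: "v \<in> X" "v' \<in> X" "w \<in> S v"
  shows "w' \<in> S v'"
proof -
  note ct = holomorphic_coordinate_topological[OF c]
  obtain \<gamma> F where *: "analytic_continuation \<A> \<gamma> F" "path \<gamma>" "path_image \<gamma> \<subseteq> V \<inter> regular_points U A \<nu>" "\<gamma> 0 = chart_inv c v" "\<gamma> 1 = chart_inv c v'"
    "\<forall>t\<in>{0..1}. \<forall>\<^sub>F p in nhds (\<gamma> t). F t p \<in> solutions U A \<nu> p" "F 0 (chart_inv c v) = w" "F 1 (chart_inv c v') = w'"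
    by (rule continues_toE[OF cont])
  \<comment> \<open>The curve may pass through points outside \<open>X\<close>, where
    \<open>S\<close> says nothing; so membership is required at the points of \<open>X\<close> near
    \<open>\<gamma> t\<close>.\<close>
  define good where "good t \<longleftrightarrow> (\<forall>\<^sub>F y in nhds (snd c (\<gamma> t)). y \<in> X \<longrightarrow> F t (chart_inv c y) \<in> S y)" for t
  have \<gamma>c: "\<gamma> t \<in> fst c" if "t \<in> {0..1}" for t 
  proof -
    have "\<gamma> t \<in> path_image \<gamma>" unfolding path_image_def using that by (rule imageI)
    then show ?thesis using *(3) V by blast
  qed
  have pull: "\<forall>\<^sub>F y in nhds (snd c p). Q (chart_inv c y)" if p: "p \<in> fst c" and Q: "\<forall>\<^sub>F q in nhds p. Q q" for p Q
  proof -
    obtain W where W: "open W" "p \<in> W" "\<forall>q\<in>W. Q q" using Q unfolding eventually_nhds by blast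
    have "open (snd c ` (fst c \<inter> W))" by (rule chart_image_open[OF ct W(1)])
    moreover have "snd c p \<in> snd c ` (fst c \<inter> W)" using p W by blast
    ultimately have "\<forall>\<^sub>F y in nhds (snd c p). y \<in> snd c ` (fst c \<inter> W)" by (rule eventually_nhds_in_open)
    then show ?thesis by eventually_elim (use W(3) chart_inv_snd[OF ct] in auto)
  qed
  have local: "\<exists>d>0. \<forall>s\<in>{0..1}. dist s t < d \<longrightarrow> good s = good t" if t: "t \<in> {0..1}" for t
  proof -
    obtain N d where N: "open N" "\<gamma> t \<in> N" "holomorphic_mfd \<A> (F t) N" "d > 0"
      "\<forall>s\<in>{0..1}. dist s t < d \<longrightarrow> \<gamma> s \<in> N \<and> (\<forall>\<^sub>F y in nhds (\<gamma> s). F s y = F t y)"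
      by (rule analytic_continuationE[OF *(1) t])
    obtain W where W: "open W" "\<gamma> t \<in> W" "\<forall>p\<in>W. F t p \<in> solutions U A \<nu> p"
      using *(6) t unfolding eventually_nhds by blast
    have "open (snd c ` (fst c \<inter> (N \<inter> W)))" by (rule chart_image_open[OF ct]) (use N W in blast)
    moreover have "snd c (\<gamma> t) \<in> snd c ` (fst c \<inter> (N \<inter> W))" using \<gamma>c[OF t] N W by blast
    ultimately obtain e where e: "e > 0" "ball (snd c (\<gamma> t)) e \<subseteq> snd c ` (fst c \<inter> (N \<inter> W))" by (meson open_contains_ball)
    let ?B = "ball (snd c (\<gamma> t)) e"
    have Binv: "chart_inv c y \<in> N \<inter> W" if yB: "y \<in> ?B" for y
    proof -
      obtain x where "x \<in> fst c \<inter> (N \<inter> W)" "y = snd c x" using e(2) yB by blast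
      then show ?thesis using chart_inv_snd[OF ct] by auto
    qed
    have Bsub: "?B \<subseteq> snd c ` fst c" using e(2) by blast
    have "holomorphic_Cn (\<lambda>y. F t (chart_inv c y)) ?B"
      by (rule holomorphic_Cn_subset[OF holomorphic_mfd_Cn[OF M c N(3,1)]]) (use e(2) in blast)
    then have sec: "is_section ?B (\<lambda>y. solutions U A \<nu> (chart_inv c y)) (\<lambda>y. F t (chart_inv c y))"
      unfolding is_section_def using Binv W(3) by (auto intro: holomorphic_Cn_continuous_on)
    have BX: "connected (?B \<inter> X)" "?B \<inter> X \<noteq> {}" using conn[OF e(1) Bsub] by blast+
    \<comment> \<open>The ball meets \<open>X\<close> in a connected set, so membership at one of
      its points decides for all. This makes \<open>good\<close> locally constant along the
      curve.\<close>
    have uni: "F t (chart_inv c y) \<in> S y" if "y0 \<in> ?B \<inter> X" "F t (chart_inv c y0) \<in> S y0" "y \<in> ?B \<inter> X" for y0 y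
      by (rule section_in_subfamily[OF sep S loc _ BX(1) _ is_section_subset[OF sec] that(1,2,3)]) (use X in auto)
    have goodiff: "good s \<longleftrightarrow> (\<forall>y\<in>?B \<inter> X. F t (chart_inv c y) \<in> S y)"
      if s: "s \<in> {0..1}" "snd c (\<gamma> s) \<in> ?B" "\<forall>\<^sub>F p in nhds (\<gamma> s). F s p = F t p" for s
    proof
      have ev: "\<forall>\<^sub>F y in nhds (snd c (\<gamma> s)). F s (chart_inv c y) = F t (chart_inv c y)"
        by (rule pull[OF \<gamma>c[OF s(1)] s(3)])
      have evB: "\<forall>\<^sub>F y in nhds (snd c (\<gamma> s)). y \<in> ?B" by (rule eventually_nhds_in_open[OF open_ball s(2)])
      show "\<forall>y\<in>?B \<inter> X. F t (chart_inv c y) \<in> S y" if "good s"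
      proof -
        have "\<forall>\<^sub>F y in nhds (snd c (\<gamma> s)). y \<in> ?B \<and> (y \<in> X \<longrightarrow> F t (chart_inv c y) \<in> S y)"
          using \<open>good s\<close>[unfolded good_def] ev evB by eventually_elim simp
        then obtain Y where Y: "open Y" "snd c (\<gamma> s) \<in> Y" "\<forall>y\<in>Y. y \<in> ?B \<and> (y \<in> X \<longrightarrow> F t (chart_inv c y) \<in> S y)"
          unfolding eventually_nhds by blast
        obtain e' where e': "e' > 0" "ball (snd c (\<gamma> s)) e' \<subseteq> Y" using Y(1,2) by (meson open_contains_ball)
        have "ball (snd c (\<gamma> s)) e' \<subseteq> snd c ` fst c" using e'(2) Y(3) Bsub by blast
        then obtain y0 where "y0 \<in> ball (snd c (\<gamma> s)) e' \<inter> X" using conn[OF e'(1)] by blast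
        then have "y0 \<in> ?B \<inter> X" "F t (chart_inv c y0) \<in> S y0" using e'(2) Y(3) by blast+
        then show ?thesis using uni by blast
      qed
      show "good s" if all: "\<forall>y\<in>?B \<inter> X. F t (chart_inv c y) \<in> S y"
        unfolding good_def using ev evB by eventually_elim (use all in auto)
    qed
    have "(\<gamma> \<longlongrightarrow> \<gamma> t) (at t within {0..1})" using *(2) t unfolding path_def continuous_on_def by blast
    then have "\<forall>\<^sub>F s in at t within {0..1}. \<gamma> s \<in> {x \<in> fst c. snd c x \<in> ?B}"
      using chart_preimage_open[OF ct open_ball] \<gamma>c[OF t] e(1) by (intro topological_tendstoD) auto
    then obtain d' where d': "d' > 0" "\<forall>s\<in>{0..1}. s \<noteq> t \<and> dist s t < d' \<longrightarrow> \<gamma> s \<in> {x \<in> fst c. snd c x \<in> ?B}"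
      unfolding eventually_at by blast
    have tB: "snd c (\<gamma> t) \<in> ?B" using e(1) by simp
    have gt: "good t \<longleftrightarrow> (\<forall>y\<in>?B \<inter> X. F t (chart_inv c y) \<in> S y)" by (rule goodiff[OF t tB]) simp
    have "good s = good t" if "s \<in> {0..1}" "dist s t < min d d'" for s
    proof (cases "s = t")
      case False
      then have "snd c (\<gamma> s) \<in> ?B" using d'(2) that by auto
      moreover have "\<forall>\<^sub>F p in nhds (\<gamma> s). F s p = F t p" using N(5) that by auto
      ultimately show ?thesis using goodiff[OF that(1)] gt by blast
    qed simp
    then show ?thesis using N(4) d'(1) by (intro exI[of _ "min d d'"]) auto
  qed
  have const: "good 1 = good 0"
  proof (rule connected_local_const[of "{0..1::real}"])
    show "\<forall>t\<in>{0..1}. \<forall>\<^sub>F s in at t within {0..1}. good t = good s"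
    proof
      fix t :: real assume "t \<in> {0..1}"
      then obtain d where d: "d > 0" "\<forall>s\<in>{0..1}. dist s t < d \<longrightarrow> good s = good t" using local by blast
      show "\<forall>\<^sub>F s in at t within {0..1}. good t = good s"
        unfolding eventually_at by (rule exI[of _ d]) (use d in simp)
    qed
  qed auto
  \<comment> \<open>At points of the curve that lie in \<open>X\<close>, as its end points do,
    membership of the germ is equivalent to membership of its value.\<close>
  have gval: "good t \<longleftrightarrow> F t (chart_inv c y) \<in> S y" if t: "t \<in> {0..1}" and y: "y \<in> X" "\<gamma> t = chart_inv c y" for t y
  proof
    have ycoord: "snd c (\<gamma> t) = y" using snd_chart_inv[OF ct] X(2) y by auto
    show "F t (chart_inv c y) \<in> S y" if "good t"
      using eventually_nhds_x_imp_x[OF \<open>good t\<close>[unfolded good_def]] ycoord y by simp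
    show "good t" if val: "F t (chart_inv c y) \<in> S y"
    proof -
      obtain N d where N: "open N" "\<gamma> t \<in> N" "holomorphic_mfd \<A> (F t) N" by (rule analytic_continuationE[OF *(1) t])
      obtain W where W: "open W" "\<gamma> t \<in> W" "\<forall>p\<in>W. F t p \<in> solutions U A \<nu> p"
        using *(6) t unfolding eventually_nhds by blast
      have "open (snd c ` (fst c \<inter> (N \<inter> W)) \<inter> X)" using chart_image_open[OF ct, of "N \<inter> W"] N W X by blast
      moreover have "y \<in> snd c ` (fst c \<inter> (N \<inter> W)) \<inter> X" using \<gamma>c[OF t] N W y ycoord by blast
      ultimately obtain e where e: "e > 0" "ball y e \<subseteq> snd c ` (fst c \<inter> (N \<inter> W)) \<inter> X" by (meson open_contains_ball)
      have Binv: "chart_inv c q \<in> N \<inter> W" if qB: "q \<in> ball y e" for q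
      proof -
        obtain x where "x \<in> fst c \<inter> (N \<inter> W)" "q = snd c x" using e(2) qB by blast
        then show ?thesis using chart_inv_snd[OF ct] by auto
      qed
      have "holomorphic_Cn (\<lambda>y. F t (chart_inv c y)) (ball y e)"
        by (rule holomorphic_Cn_subset[OF holomorphic_mfd_Cn[OF M c N(3,1)]]) (use e(2) in blast)
      then have sec: "is_section (ball y e) (\<lambda>y. solutions U A \<nu> (chart_inv c y)) (\<lambda>y. F t (chart_inv c y))"
        unfolding is_section_def using Binv W(3) by (auto intro: holomorphic_Cn_continuous_on)
      have "F t (chart_inv c q) \<in> S q" if "q \<in> ball y e" for q
        by (rule section_in_subfamily[OF sep S loc open_ball connected_ball _ sec _ val that]) (use e in auto)
      then show ?thesis
        unfolding good_def ycoord using e(1) eventually_nhds_in_open[OF open_ball, of y y e]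
        by (auto elim: eventually_mono)
    qed
  qed
  have "good 0" using gval[of 0 v] *(4,7) v by simp
  then have "good 1" using const by simp
  then show ?thesis using gval[of 1 v'] *(5,8) v by simp
qed

end

section \<open>Puiseux series with meromorphic coefficients\<close>

lemma drop_coord_nth [simp]: "drop_coord m v $ i = (if i = m then 0 else v $ i)"
  by (simp add: drop_coord_def)

lemma drop_coord_idem [simp]: "drop_coord m (drop_coord m v) = drop_coord m v"
  by (simp add: vec_eq_iff)

lemma drop_coord_add [simp]: "drop_coord m (v + t *s axis m 1) = drop_coord m v"
  by (simp add: vec_eq_iff axis_def)

lemma drop_coord_decomp: "drop_coord m v + v $ m *s axis m 1 = v"
  by (simp add: vec_eq_iff axis_def)

lemma drop_coord_fix: "v $ m = 0 \<Longrightarrow> drop_coord m v = v"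
  by (simp add: vec_eq_iff)

lemma norm_drop_coord_le: "norm (drop_coord m v) \<le> norm v"
  using norm_zero_coord_le[of 0 m v] by (simp add: drop_coord_def cong: if_cong)

lemma drop_coord_diff: "drop_coord m (v - w) = drop_coord m v - drop_coord m w"
  by (simp add: vec_eq_iff)

lemma holomorphic_Cn_drop_coord: "holomorphic_Cn (\<lambda>z. drop_coord m z $ i) S"
  by (cases "i = m") (auto intro: holomorphic_Cn_coord)

lemma continuous_on_drop_coord [continuous_intros]:
  assumes "continuous_on S f" shows "continuous_on S (\<lambda>x. drop_coord m (f x))"
proof -
  have "continuous_on S (\<lambda>x. \<chi> i. if i = m then 0 else f x $ i)"
  proof (rule continuous_on_vec_lambda)
    show "continuous_on S (\<lambda>x. if i = m then 0 else f x $ i)" for i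
      by (cases "i = m") (use assms in \<open>auto intro!: continuous_intros\<close>)
  qed
  then show ?thesis by (simp add: drop_coord_def)
qed

lemma drop_coord_polydisc: "v \<in> polydisc r \<Longrightarrow> r > 0 \<Longrightarrow> drop_coord m v \<in> polydisc r"
  by (auto simp: polydisc_def)

text \<open>Power series division: the Cauchy product with \<open>h\<close> shall be
  \<open>g\<close>, which determines the coefficients recursively when \<open>h 0\<close> is
  nonzero.\<close>

function quot_coeff :: "(nat \<Rightarrow> complex) \<Rightarrow> (nat \<Rightarrow> complex) \<Rightarrow> nat \<Rightarrow> complex" where
  "quot_coeff g h n = (g n - (\<Sum>i<n. quot_coeff g h i * h (n - i))) / h 0"
  by pat_completeness auto
termination by (relation "Wellfounded.measure (\<lambda>(g, h, n). n)") auto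

declare quot_coeff.simps [simp del]

lemma quot_coeff_convolution:
  assumes "h 0 \<noteq> 0" shows "(\<Sum>i\<le>n. quot_coeff g h i * h (n - i)) = g n"
proof -
  have "quot_coeff g h n * h 0 = g n - (\<Sum>i<n. quot_coeff g h i * h (n - i))"
    using assms by (subst quot_coeff.simps) simp
  then show ?thesis by (simp add: lessThan_Suc_atMost[symmetric])
qed

text \<open>With \<open>K = M / c\<close> and after scaling by \<open>\<eta> ^ n\<close>, the
  recursion bounds each coefficient by \<open>K\<close> times one plus the sum of the bounds of the
  earlier ones; the majorant \<open>K * (1 + K) ^ n\<close> reproduces itself under this
  rule.\<close>

lemma quot_coeff_bound:
  assumes c: "c > 0" "c \<le> norm (h 0)" and \<eta>: "\<eta> > 0" and M: "M \<ge> 0"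
    and g: "\<And>n. norm (g n) \<le> M / \<eta> ^ n" and h: "\<And>n. norm (h n) \<le> M / \<eta> ^ n"
  shows "norm (quot_coeff g h n) \<le> (M / c) * ((1 + M / c) / \<eta>) ^ n"
proof -
  define K where "K = M / c"
  have K: "K \<ge> 0" using c M by (simp add: K_def)
  have geo: "1 + (\<Sum>i<n. K * (1 + K) ^ i) = (1 + K) ^ n" for n
    by (induction n) (auto simp: algebra_simps)
  have "norm (quot_coeff g h n) * \<eta> ^ n \<le> K * (1 + K) ^ n"
  proof (induction n rule: less_induct)
    case (less n)
    have "norm (g n - (\<Sum>i<n. quot_coeff g h i * h (n - i)))
        \<le> norm (g n) + (\<Sum>i<n. norm (quot_coeff g h i) * norm (h (n - i)))"
      by (rule order_trans[OF norm_triangle_ineq4]) (auto intro!: sum_norm_le simp: norm_mult)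
    also have "\<dots> \<le> M / \<eta> ^ n + (\<Sum>i<n. norm (quot_coeff g h i) * (M / \<eta> ^ (n - i)))"
      by (intro add_mono g sum_mono mult_left_mono h) auto
    finally have 1: "norm (g n - (\<Sum>i<n. quot_coeff g h i * h (n - i))) * \<eta> ^ n
        \<le> (M / \<eta> ^ n + (\<Sum>i<n. norm (quot_coeff g h i) * (M / \<eta> ^ (n - i)))) * \<eta> ^ n"
      using \<eta> by (intro mult_right_mono) auto
    have "norm (quot_coeff g h i) * (M / \<eta> ^ (n - i)) * \<eta> ^ n = M * (norm (quot_coeff g h i) * \<eta> ^ i)" if "i < n" for i
    proof -
      have "\<eta> ^ n = \<eta> ^ (n - i) * \<eta> ^ i" using that by (simp flip: power_add)
      then show ?thesis using \<eta> by simp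
    qed
    then have "(M / \<eta> ^ n + (\<Sum>i<n. norm (quot_coeff g h i) * (M / \<eta> ^ (n - i)))) * \<eta> ^ n
        = M * (1 + (\<Sum>i<n. norm (quot_coeff g h i) * \<eta> ^ i))"
      using \<eta> by (simp add: distrib_right sum_distrib_right distrib_left sum_distrib_left)
    also have "\<dots> \<le> M * (1 + (\<Sum>i<n. K * (1 + K) ^ i))"
      using M less.IH by (intro mult_left_mono add_left_mono sum_mono) auto
    also have "\<dots> = M * (1 + K) ^ n" by (simp only: geo)
    finally have 2: "norm (g n - (\<Sum>i<n. quot_coeff g h i * h (n - i))) * \<eta> ^ n \<le> M * (1 + K) ^ n"
      using 1 by simp
    have "norm (quot_coeff g h n) * \<eta> ^ n = (norm (g n - (\<Sum>i<n. quot_coeff g h i * h (n - i))) * \<eta> ^ n) / norm (h 0)"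
      by (subst quot_coeff.simps) (simp add: norm_divide)
    also have "\<dots> \<le> (M * (1 + K) ^ n) / norm (h 0)" using 2 by (rule divide_right_mono) simp
    also have "\<dots> \<le> (M * (1 + K) ^ n) / c"
    proof (rule divide_left_mono)
      show "0 < norm (h 0) * c" using c by (intro mult_pos_pos) auto
    qed (use c M K in auto)
    finally show ?case by (simp add: K_def)
  qed
  then have "norm (quot_coeff g h n) \<le> K * (1 + K) ^ n / \<eta> ^ n" using \<eta> by (simp add: pos_le_divide_eq)
  then show ?thesis by (simp add: K_def power_divide)
qed

section \<open>Taylor coefficients in one coordinate and meromorphy of their quotients\<close>

definition taylor_coeff :: "'m::finite \<Rightarrow> (complex ^ 'm \<Rightarrow> complex) \<Rightarrow> nat \<Rightarrow> complex ^ 'm \<Rightarrow> complex" where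
  "taylor_coeff m f n v = (deriv ^^ n) (\<lambda>t. f (drop_coord m v + t *s axis m 1)) 0 / fact n"

lemma taylor_coeff_drop [simp]: "taylor_coeff m f n (drop_coord m v) = taylor_coeff m f n v"
  by (simp add: taylor_coeff_def)

text \<open>The iterated partial derivative is a function of the point, the iterated derivative one
  of the parameter on a line. Both claims go through one induction, because the step differentiates
  their equality near \<open>t\<close> and uses holomorphy of the function on the right.\<close>

lemma higher_deriv_line:
  assumes f: "holomorphic_Cn f S" "open S"
  shows "holomorphic_Cn (((\<lambda>h z. deriv (\<lambda>t. h (z + t *s axis m 1)) 0) ^^ n) f) S \<and>
    (\<forall>z t. z + t *s axis m 1 \<in> S \<longrightarrow>
      (deriv ^^ n) (\<lambda>t. f (z + t *s axis m 1)) t = ((\<lambda>h z. deriv (\<lambda>t. h (z + t *s axis m 1)) 0) ^^ n) f (z + t *s axis m 1))"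
proof (induction n)
  case 0
  then show ?case using f by simp
next
  case (Suc n)
  define h where "h = ((\<lambda>h z. deriv (\<lambda>t. h (z + t *s axis m 1)) 0) ^^ n) f"
  have hol: "holomorphic_Cn h S" using Suc by (simp add: h_def)
  have "(deriv ^^ Suc n) (\<lambda>t. f (z + t *s axis m 1)) t = deriv (\<lambda>s. h (z + t *s axis m 1 + s *s axis m 1)) 0"
    if zt: "z + t *s axis m 1 \<in> S" for z t
  proof -
    have "\<forall>\<^sub>F s in nhds t. s \<in> {s. z + s *s axis m 1 \<in> S}"
      using open_line_preimage[OF f(2)] zt by (intro eventually_nhds_in_open) auto
    then have "\<forall>\<^sub>F s in nhds t. (deriv ^^ n) (\<lambda>t. f (z + t *s axis m 1)) s = h (z + s *s axis m 1)"
      by eventually_elim (use Suc in \<open>simp add: h_def\<close>)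
    then have "deriv ((deriv ^^ n) (\<lambda>t. f (z + t *s axis m 1))) t = deriv (\<lambda>s. h (z + s *s axis m 1)) t"
      by (rule deriv_cong_ev) simp
    also have "\<dots> = deriv (\<lambda>s. h (z + t *s axis m 1 + s *s axis m 1)) 0"
      by (rule DERIV_imp_deriv[OF holomorphic_Cn_coord_deriv[OF hol f(2) zt]])
    finally show ?thesis by simp
  qed
  moreover have "((\<lambda>h z. deriv (\<lambda>t. h (z + t *s axis m 1)) 0) ^^ Suc n) f = (\<lambda>z. deriv (\<lambda>t. h (z + t *s axis m 1)) 0)"
    by (simp add: h_def)
  ultimately show ?case using holomorphic_Cn_deriv[OF hol f(2)] by simp
qed

lemma taylor_coeff_holomorphic:
  assumes f: "holomorphic_Cn f S" "open S" and T: "\<And>v. v \<in> T \<Longrightarrow> drop_coord m v \<in> S" "open T"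
  shows "holomorphic_Cn (taylor_coeff m f n) T"
proof -
  define h where "h = ((\<lambda>h z. deriv (\<lambda>t. h (z + t *s axis m 1)) 0) ^^ n) f"
  have eq: "(deriv ^^ n) (\<lambda>t. f (z + t *s axis m 1)) t = h (z + t *s axis m 1)" if "z + t *s axis m 1 \<in> S" for z t
    using higher_deriv_line[OF f, where m=m and n=n] that unfolding h_def by blast+
  have hol: "holomorphic_Cn h S" using higher_deriv_line[OF f, where m=m and n=n] unfolding h_def by blast
  have "holomorphic_Cn (\<lambda>v. h (drop_coord m v) * (1 / fact n)) T"
    by (intro holomorphic_Cn_mult holomorphic_Cn_const holomorphic_Cn_compose[OF hol] holomorphic_Cn_drop_coord)
       (use T in auto)
  then show ?thesis
    by (rule holomorphic_Cn_transform[OF _ T(2)]) (use eq[of "drop_coord m _" 0] T(1) in \<open>simp add: taylor_coeff_def\<close>)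
qed

lemma taylor_coeff_sums:
  assumes f: "holomorphic_Cn f S" and S: "\<And>t. norm t < \<rho> \<Longrightarrow> drop_coord m v + t *s axis m 1 \<in> S" and t: "norm t < \<rho>"
  shows "(\<lambda>n. taylor_coeff m f n v * t ^ n) sums f (drop_coord m v + t *s axis m 1)"
proof -
  have "(\<lambda>t. f (drop_coord m v + t *s axis m 1)) holomorphic_on ball 0 \<rho>"
    by (rule holomorphic_Cn_line[OF f open_ball]) (use S in auto)
  from holomorphic_power_series[OF this, of t] show ?thesis using t by (simp add: taylor_coeff_def)
qed

lemma taylor_coeff_bound:
  assumes f: "holomorphic_Cn f S" and S: "\<And>t. norm t < \<rho> \<Longrightarrow> drop_coord m v + t *s axis m 1 \<in> S"
    and \<eta>: "0 < \<eta>" "\<eta> < \<rho>" and M: "\<And>t. norm t = \<eta> \<Longrightarrow> norm (f (drop_coord m v + t *s axis m 1)) \<le> M"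
  shows "norm (taylor_coeff m f n v) \<le> M / \<eta> ^ n"
proof -
  have hol: "(\<lambda>t. f (drop_coord m v + t *s axis m 1)) holomorphic_on ball 0 \<rho>"
    by (rule holomorphic_Cn_line[OF f open_ball]) (use S in auto)
  have "norm ((deriv ^^ n) (\<lambda>t. f (drop_coord m v + t *s axis m 1)) 0) \<le> fact n * M / \<eta> ^ n"
  proof (rule Cauchy_inequality)
    show "(\<lambda>t. f (drop_coord m v + t *s axis m 1)) holomorphic_on ball 0 \<eta>"
      by (rule holomorphic_on_subset[OF hol]) (use \<eta> in auto)
    show "continuous_on (cball 0 \<eta>) (\<lambda>t. f (drop_coord m v + t *s axis m 1))"
      by (rule holomorphic_on_imp_continuous_on, rule holomorphic_on_subset[OF hol]) (use \<eta> in auto)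
  qed (use \<eta> M in auto)
  then have "norm ((deriv ^^ n) (\<lambda>t. f (drop_coord m v + t *s axis m 1)) 0) / fact n \<le> (fact n * M / \<eta> ^ n) / fact n"
    by (rule divide_right_mono) simp
  then show ?thesis unfolding taylor_coeff_def by (simp add: norm_divide)
qed

lemma standard_manifold: "complex_manifold {(UNIV :: (complex ^ 'm::finite) set, \<lambda>z. z)}"
proof -
  have [simp]: "chart_inv (UNIV :: (complex ^ 'm) set, \<lambda>z. z) = (\<lambda>z. z)"
    by (rule ext) (simp add: chart_inv_def inv_into_f_f[of "\<lambda>z. z" UNIV, simplified])
  show ?thesis
    unfolding complex_manifold_def topological_chart_def holomorphic_transition_def
    by (auto intro: holomorphic_Cn_coord connected_UNIV simp: homeomorphism_def)
qed

lemma holomorphic_mfd_standard: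
  "holomorphic_mfd {(UNIV :: (complex ^ 'm::finite) set, \<lambda>z. z)} f S \<longleftrightarrow> holomorphic_Cn f S"
proof -
  have [simp]: "chart_inv (UNIV :: (complex ^ 'm) set, \<lambda>z. z) = (\<lambda>z. z)"
    by (rule ext) (simp add: chart_inv_def inv_into_f_f[of "\<lambda>z. z" UNIV, simplified])
  show ?thesis by (simp add: holomorphic_mfd_def)
qed

lemma meromorphic_mfd_cong:
  assumes f: "meromorphic_mfd \<A> f S" and eq: "\<And>x. x \<in> S \<Longrightarrow> f x = g x"
  shows "meromorphic_mfd \<A> g S"
  unfolding meromorphic_mfd_def
proof (intro conjI ballI allI impI)
  fix p assume "p \<in> S"
  from f this have "\<exists>T h k. open T \<and> connected T \<and> p \<in> T \<and> T \<subseteq> S \<and> holomorphic_mfd \<A> h T \<and> holomorphic_mfd \<A> k T \<and>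
      (\<exists>x\<in>T. k x \<noteq> 0) \<and> (\<forall>x\<in>T. k x \<noteq> 0 \<longrightarrow> f x = h x / k x)"
    unfolding meromorphic_mfd_def by (elim conjE) (rule bspec)
  then obtain T h k where *: "open T" "connected T" "p \<in> T" "T \<subseteq> S" "holomorphic_mfd \<A> h T" "holomorphic_mfd \<A> k T"
      "\<exists>x\<in>T. k x \<noteq> 0" "\<forall>x\<in>T. k x \<noteq> 0 \<longrightarrow> f x = h x / k x" by (elim exE conjE)
  have "\<forall>x\<in>T. k x \<noteq> 0 \<longrightarrow> g x = h x / k x" using *(4,8) eq by (metis subsetD)
  then show "\<exists>T h k. open T \<and> connected T \<and> p \<in> T \<and> T \<subseteq> S \<and> holomorphic_mfd \<A> h T \<and> holomorphic_mfd \<A> k T \<and>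
      (\<exists>x\<in>T. k x \<noteq> 0) \<and> (\<forall>x\<in>T. k x \<noteq> 0 \<longrightarrow> g x = h x / k x)"
    by (intro exI[of _ T] exI[of _ h] exI[of _ k] conjI *(1-7))
next
  fix p T h assume p: "p \<in> S" and T: "open T \<and> p \<in> T \<and> T \<subseteq> S \<and> holomorphic_mfd \<A> h T \<and> T \<subseteq> closure {x\<in>T. g x = h x}"
  have "{x\<in>T. f x = h x} = {x\<in>T. g x = h x}" using eq T by auto
  then have "open T \<and> p \<in> T \<and> T \<subseteq> S \<and> holomorphic_mfd \<A> h T \<and> T \<subseteq> closure {x\<in>T. f x = h x}" using T by simp
  then have "f p = h p" using f p unfolding meromorphic_mfd_def by blast
  then show "g p = h p" using eq[OF p] by simp
qed

text \<open>Normalised values are defined by a choice, so their invariance rests on uniqueness of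
  extensions: translation carries extensions at \<open>v\<close> to extensions at
  \<open>v + s\<close> and back. This keeps normalised coefficients independent of the coordinate
  \<open>m\<close>.\<close>

lemma normalized_translate:
  fixes f :: "complex ^ 'm::finite \<Rightarrow> complex"
  defines "A0 \<equiv> {(UNIV :: (complex ^ 'm) set, \<lambda>z. z)}"
  assumes S: "open S" and f: "locally_quotient A0 S f" and inv: "\<And>x. f (x + s) = f x" and v: "v \<in> S" "v + s \<in> S"
  shows "normalized A0 S f (v + s) = normalized A0 S f v"
proof -
  note M = standard_manifold[where 'm='m, folded A0_def]
  have std: "holomorphic_mfd A0 g T \<longleftrightarrow> holomorphic_Cn g T" for g T
    unfolding A0_def by (rule holomorphic_mfd_standard)
  have ext: "\<exists>T' g'. local_extension A0 S f (p + d) T' g' \<and> g' (p + d) = g p"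
    if e: "local_extension A0 S f p T g" and d: "\<And>x. f (x + d) = f x" "p + d \<in> S" for p d T g
  proof -
    have T: "open T" "p \<in> T" "T \<subseteq> S" "holomorphic_Cn g T" "T \<subseteq> closure {x\<in>T. f x = g x}"
      using e unfolding local_extension_def[OF M] std by auto
    define T' where "T' = {x. x - d \<in> T} \<inter> S"
    have vim: "open {x. x - d \<in> W}" if "open W" for W :: "(complex ^ 'm) set"
    proof -
      have "open ((\<lambda>x. x - d) -` W)" using that by (intro continuous_open_vimage) (auto intro: continuous_intros)
      then show ?thesis by (simp add: vimage_def)
    qed
    have T': "open T'" unfolding T'_def using vim[OF T(1)] S by blast
    have hol: "holomorphic_Cn (\<lambda>x. g (x - d)) T'"
      by (rule holomorphic_Cn_compose[OF T(4)]) (auto simp: T'_def intro!: holomorphic_Cn_diff holomorphic_Cn_coord)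
    have "T' \<subseteq> closure {x\<in>T'. f x = g (x - d)}"
      unfolding dense_iff
    proof (intro allI impI)
      fix W assume W: "open W" "W \<inter> T' \<noteq> {}"
      have "open ((\<lambda>x. x + d) -` (W \<inter> T'))"
        using W(1) T' by (intro continuous_open_vimage) (auto intro: continuous_intros)
      moreover obtain y where "y \<in> W" "y \<in> T'" using W(2) by blast
      then have "y - d \<in> ((\<lambda>x. x + d) -` (W \<inter> T')) \<inter> T" by (simp add: T'_def)
      ultimately obtain x where x: "x \<in> ((\<lambda>x. x + d) -` (W \<inter> T')) \<inter> T" "f x = g x"
        using T(5)[unfolded dense_iff] by blast
      then show "\<exists>x\<in>W \<inter> T'. f x = g (x - d)" using d(1)[of x] by (intro bexI[of _ "x + d"]) auto
    qed
    then have "local_extension A0 S f (p + d) T' (\<lambda>x. g (x - d))"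
      unfolding local_extension_def[OF M] std using T' hol T(2) d(2) by (auto simp: T'_def)
    then show ?thesis by (intro exI[of _ T'] exI[of _ "\<lambda>x. g (x - d)"]) simp
  qed
  show ?thesis
  proof (cases "\<exists>T g. local_extension A0 S f v T g")
    case True
    then obtain T g where e: "local_extension A0 S f v T g" by blast
    obtain T' g' where e': "local_extension A0 S f (v + s) T' g'" "g' (v + s) = g v" using ext[OF e inv v(2)] by blast
    show ?thesis using normalized_eq[OF M f e] normalized_eq[OF M f e'(1)] e'(2) by simp
  next
    case False
    have "\<not> (\<exists>T g. local_extension A0 S f (v + s) T g)"
    proof
      assume "\<exists>T g. local_extension A0 S f (v + s) T g"
      then obtain T g where e: "local_extension A0 S f (v + s) T g" by blast
      have "f (x + - s) = f x" for x using inv[of "x + - s"] by simp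
      from ext[OF e this] False v(1) show False by auto
    qed
    moreover have "normalized A0 S f p = 0" if "\<not> (\<exists>T g. local_extension A0 S f p T g)" for p
      unfolding normalized_def[OF M] by (rule if_not_P[OF that])
    ultimately show ?thesis using False by metis
  qed
qed

section \<open>The branched covering given by an \<open>l\<close>-th root of one coordinate\<close>

definition ramify :: "'m::finite \<Rightarrow> nat \<Rightarrow> complex ^ 'm \<Rightarrow> complex ^ 'm" where
  "ramify m l q = drop_coord m q + (q $ m) ^ l *s axis m 1"

lemma ramify_nth: "ramify m l q $ i = (if i = m then (q $ m) ^ l else q $ i)"
  by (simp add: ramify_def axis_def)

lemma drop_coord_ramify [simp]: "drop_coord m (ramify m l q) = drop_coord m q"
  by (simp add: ramify_def)

lemma holomorphic_Cn_ramify: "holomorphic_Cn (\<lambda>q. ramify m l q $ i) S"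
  unfolding ramify_nth by (cases "i = m") (auto intro: holomorphic_Cn_coord holomorphic_Cn_power)

lemma continuous_on_ramify: "continuous_on S (ramify m l)"
  unfolding ramify_def by (intro continuous_intros)

lemma ramify_line: "ramify m l (drop_coord m v + t *s axis m 1) = drop_coord m v + t ^ l *s axis m 1"
  by (simp add: vec_eq_iff ramify_nth axis_def)

lemma ramify_eq_iff: "ramify m l (drop_coord m v + t *s axis m 1) = v \<longleftrightarrow> t ^ l = v $ m"
  unfolding ramify_line by (auto simp: vec_eq_iff axis_def)

lemma ramify_eq_line:
  assumes "ramify m l q = v" shows "q = drop_coord m v + q $ m *s axis m 1" "q $ m ^ l = v $ m"
  using assms drop_coord_decomp[of m q] by (auto simp: ramify_nth)

lemma polydisc_line_iff:
  assumes "r > 0" "drop_coord m v \<in> polydisc r"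
  shows "drop_coord m v + t *s axis m 1 \<in> polydisc r \<longleftrightarrow> norm t < r"
  using assms by (auto simp: polydisc_def axis_def split: if_splits)

lemma holomorphic_Cn_bounded_near:
  assumes f: "holomorphic_Cn f S" "open S" and K: "compact K" "K \<subseteq> S"
  obtains \<delta> M where "\<delta> > 0" "M \<ge> 0" "\<forall>x\<in>K. \<forall>y\<in>ball x \<delta>. y \<in> S \<and> norm (f y) \<le> M"
proof -
  have cont: "continuous_on S f" by (rule holomorphic_Cn_continuous_on[OF f(1)])
  have "compact (f ` K)" by (rule compact_continuous_image[OF continuous_on_subset[OF cont K(2)] K(1)])
  then obtain M0 where M0: "\<forall>x\<in>K. norm (f x) \<le> M0" using compact_imp_bounded bounded_iff by (metis (no_types, lifting) imageI)
  define O1 where "O1 = (\<lambda>x. norm (f x)) -` {..<max M0 0 + 1} \<inter> S"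
  have "continuous_on S (\<lambda>x. norm (f x))" by (intro continuous_intros cont)
  then have "open O1" unfolding O1_def using f(2) by (auto simp: continuous_on_open_vimage)
  moreover have "K \<subseteq> O1" using M0 K(2) unfolding O1_def by fastforce
  ultimately obtain \<delta> where d: "\<delta> > 0" "\<And>x. x \<in> K \<Longrightarrow> ball x \<delta> \<subseteq> O1" using compact_in_open_uniform[OF K(1)] by blast
  show ?thesis
  proof (rule that[OF d(1), of "max M0 0 + 1"])
    show "\<forall>x\<in>K. \<forall>y\<in>ball x \<delta>. y \<in> S \<and> norm (f y) \<le> max M0 0 + 1"
      using d(2) unfolding O1_def by fastforce
  qed simp
qed

lemma summable_int_shift:
  fixes b :: "nat \<Rightarrow> complex" and k :: nat
  assumes "summable (\<lambda>n. norm (b n))"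
  shows "(\<lambda>j. b (nat (j + int k))) summable_on {- int k..}"
    "infsum (\<lambda>j. b (nat (j + int k))) {- int k..} = suminf b"
proof -
  have bij: "bij_betw (\<lambda>n. int n - int k) UNIV {- int k..}"
    by (rule bij_betwI[where g="\<lambda>j. nat (j + int k)"]) auto
  have hs: "(b has_sum suminf b) UNIV"
    using norm_summable_imp_has_sum[OF assms summable_sums[OF summable_norm_cancel[OF assms]]] .
  have "((\<lambda>j. b (nat (j + int k))) has_sum suminf b) {- int k..}"
    using has_sum_reindex_bij_betw[OF bij, of "\<lambda>j. b (nat (j + int k))" "suminf b"] hs by simp
  then show "(\<lambda>j. b (nat (j + int k))) summable_on {- int k..}"
    "infsum (\<lambda>j. b (nat (j + int k))) {- int k..} = suminf b"
    by (auto simp: summable_on_def infsumI)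
qed

context
  fixes m :: "'m::finite" and l :: nat and r :: real
  assumes l: "l > 0" and r: "r > 0"
begin

definition ramified_disc :: "(complex ^ 'm) set" where
  "ramified_disc = {q. ramify m l q \<in> polydisc r}"

lemma ramified_disc_open: "open ramified_disc"
proof -
  have "open (ramify m l -` polydisc r)"
    by (rule open_vimage[OF open_polydisc continuous_on_ramify])
  then show ?thesis by (simp add: ramified_disc_def vimage_def)
qed

lemma norm_power_less_iff: "norm t ^ l < r \<longleftrightarrow> norm t < root l r" for t :: complex
  using l r by (metis norm_ge_zero real_root_less_iff real_root_power_cancel)

text \<open>With the \<open>l\<close>-th root of the radius in direction \<open>m\<close> the
  preimage is again a product of discs, which yields its convexity.\<close>

lemma ramified_disc_eq: "ramified_disc = {q. \<forall>i. norm (q $ i) < (if i = m then root l r else r)}"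
proof -
  have "norm (ramify m l q $ i) < r \<longleftrightarrow> norm (q $ i) < (if i = m then root l r else r)" for q i
    by (cases "i = m") (simp_all add: ramify_nth norm_power norm_power_less_iff)
  then show ?thesis by (simp add: ramified_disc_def polydisc_def)
qed

lemma ramified_disc_convex: "convex ramified_disc"
proof (rule convexI)
  fix x y :: "complex ^ 'm" and u v :: real
  assume *: "x \<in> ramified_disc" "y \<in> ramified_disc" "0 \<le> u" "0 \<le> v" "u + v = 1"
  have "norm ((u *\<^sub>R x + v *\<^sub>R y) $ i) < (if i = m then root l r else r)" for i
  proof -
    let ?\<rho> = "if i = m then root l r else r"
    have "x $ i \<in> ball 0 ?\<rho>" "y $ i \<in> ball 0 ?\<rho>" using * by (auto simp: ramified_disc_eq)
    then have "u *\<^sub>R x $ i + v *\<^sub>R y $ i \<in> ball 0 ?\<rho>"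
      using * convex_ball[of "0::complex" ?\<rho>] by (intro convexD)
    then show ?thesis by simp
  qed
  then show "u *\<^sub>R x + v *\<^sub>R y \<in> ramified_disc" unfolding ramified_disc_eq by blast
qed

lemma ramified_disc_line_iff:
  assumes "drop_coord m v \<in> polydisc r"
  shows "drop_coord m v + t *s axis m 1 \<in> ramified_disc \<longleftrightarrow> norm t < root l r"
  unfolding ramified_disc_def mem_Collect_eq ramify_line polydisc_line_iff[OF r assms] norm_power norm_power_less_iff ..

text \<open>The limit values over the hyperplane are attained, since \<open>ramify\<close> is proper.\<close>

lemma closure_graph_ramify:
  assumes Q: "open Q" and \<Psi>: "continuous_on Q \<Psi>"
    and dense: "Q \<subseteq> closure {q\<in>Q. ramify m l q \<in> Y}"
    and y: "\<And>q. ramify m l q = y \<Longrightarrow> q \<in> Q"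
    and full: "\<And>v. v \<in> Y \<Longrightarrow> uu v = \<Psi> ` {q. ramify m l q = v}"
  shows "{w. (y, w) \<in> closure {(v, w). v \<in> Y \<and> w \<in> uu v}} = (\<Psi> :: complex ^ 'm \<Rightarrow> complex) ` {q. ramify m l q = y}"
proof (rule equalityI; rule subsetI)
  fix x assume "x \<in> \<Psi> ` {q. ramify m l q = y}"
  then obtain q where q: "ramify m l q = y" "x = \<Psi> q" by blast
  then have qQ: "q \<in> Q" by (intro y)
  have "(ramify m l q, \<Psi> q) \<in> closure {(v, w). v \<in> Y \<and> w \<in> uu v}"
    unfolding closure_iff_nhds_not_empty
  proof (intro allI impI)
    fix A V assume V: "V \<subseteq> A" "open V" "(ramify m l q, \<Psi> q) \<in> V"
    have "continuous_on Q (\<lambda>q. (ramify m l q, \<Psi> q))"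
      using \<Psi> continuous_on_ramify by (intro continuous_on_Pair)
    then have "open ((\<lambda>q. (ramify m l q, \<Psi> q)) -` V \<inter> Q)"
      using Q V(2) by (auto simp: continuous_on_open_vimage)
    moreover have "q \<in> ((\<lambda>q. (ramify m l q, \<Psi> q)) -` V \<inter> Q) \<inter> Q" using V(3) qQ by simp
    ultimately obtain q' where q': "q' \<in> ((\<lambda>q. (ramify m l q, \<Psi> q)) -` V \<inter> Q) \<inter> Q" "ramify m l q' \<in> Y"
      using dense[unfolded dense_iff] by blast
    then have "\<Psi> q' \<in> uu (ramify m l q')" using full by blast
    then show "{(v, w). v \<in> Y \<and> w \<in> uu v} \<inter> A \<noteq> {}" using q' V(1) by blast
  qed
  then show "x \<in> {w. (y, w) \<in> closure {(v, w). v \<in> Y \<and> w \<in> uu v}}" using q by simp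
next
  fix w assume "w \<in> {w. (y, w) \<in> closure {(v, w). v \<in> Y \<and> w \<in> uu v}}"
  then have w: "(y, w) \<in> closure {(v, w). v \<in> Y \<and> w \<in> uu v}" by blast
  \<comment> \<open>Compact sets over closed balls around \<open>y\<close>. For a small radius they
    lie in \<open>Q\<close>, where \<Psi> is continuous, so the graph over them is compact and
    contains its limit points.\<close>
  define fib where "fib e = ramify m l -` cball y e" for e
  have cfib: "compact (fib e)" for e
    unfolding compact_eq_bounded_closed
  proof
    show "closed (fib e)" unfolding fib_def
      using continuous_on_ramify[of UNIV m l] by (intro closed_vimage closed_cball)
    show "bounded (fib e)"
    proof (rule boundedI)
      fix q assume "q \<in> fib e"
      then have "norm (ramify m l q) \<le> norm y + e" 
        unfolding fib_def using norm_triangle_ineq2[of "ramify m l q" y] by (simp add: dist_norm norm_minus_commute)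
      then have c: "norm (ramify m l q $ i) \<le> norm y + e" for i
        by (rule order_trans[OF Finite_Cartesian_Product.norm_nth_le])
      have "norm (q $ i) \<le> max 1 (norm y + e)" for i
      proof (cases "i = m")
        case True
        show ?thesis
        proof (rule ccontr)
          assume "\<not> ?thesis"
          then have "norm (q $ m) > 1" "norm (q $ m) > norm y + e" using True by auto
          moreover have "norm (q $ m) ^ 1 \<le> norm (q $ m) ^ l" using calculation(1) l by (intro power_increasing) auto
          ultimately show False using c[of m] by (simp add: ramify_nth norm_power)
        qed
      next
        case False
        then show ?thesis using c[of i] by (simp add: ramify_nth)
      qed
      then have "(\<Sum>i\<in>UNIV. norm (q $ i)) \<le> (\<Sum>i\<in>(UNIV::'m set). max 1 (norm y + e))" by (intro sum_mono)
      moreover have "norm q \<le> (\<Sum>i\<in>UNIV. norm (q $ i))" unfolding norm_vec_def by (rule L2_set_le_sum) simp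
      ultimately show "norm q \<le> (\<Sum>i\<in>(UNIV::'m set). max 1 (norm y + e))" by simp
    qed
  qed
  have "\<exists>e>0. fib e \<subseteq> Q"
  proof -
    have cl: "closed (ramify m l ` (fib 1 - Q))"
      using compact_diff[OF cfib Q] continuous_on_ramify
      by (intro compact_imp_closed compact_continuous_image)
    have "y \<notin> ramify m l ` (fib 1 - Q)" using y by auto
    then obtain e where e: "e > 0" "ball y e \<subseteq> - ramify m l ` (fib 1 - Q)"
      using cl by (meson ComplI open_Compl open_contains_ball)
    have "fib (min 1 (e / 2)) \<subseteq> Q"
    proof
      fix q assume q: "q \<in> fib (min 1 (e / 2))"
      then have "ramify m l q \<in> ball y e" "q \<in> fib 1" using e(1) unfolding fib_def by auto
      then show "q \<in> Q" using e(2) by blast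
    qed
    then show ?thesis using e(1) by (intro exI[of _ "min 1 (e / 2)"]) simp
  qed
  then obtain e where e: "e > 0" "fib e \<subseteq> Q" by blast
  let ?G = "(\<lambda>q. (ramify m l q, \<Psi> q)) ` fib e"
  have "closed ?G"
    using cfib[of e] e(2) continuous_on_ramify \<Psi>
    by (intro compact_imp_closed compact_continuous_image continuous_on_Pair) (auto intro: continuous_on_subset)
  have "(y, w) \<in> ?G"
  proof (rule ccontr)
    assume "(y, w) \<notin> ?G"
    then have "(y, w) \<in> - ?G \<inter> (ball y e \<times> UNIV)" using e(1) by simp
    moreover have "open (- ?G \<inter> (ball y e \<times> UNIV))"
      using \<open>closed ?G\<close> by (intro open_Int open_Times) auto
    ultimately have "{(v, w). v \<in> Y \<and> w \<in> uu v} \<inter> (- ?G \<inter> (ball y e \<times> UNIV)) \<noteq> {}"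
      using w unfolding closure_iff_nhds_not_empty by (meson order_refl)
    then obtain v w' where v: "v \<in> Y" "w' \<in> uu v" "(v, w') \<notin> ?G" "v \<in> ball y e" by auto
    then obtain q where q: "ramify m l q = v" "w' = \<Psi> q" using full by auto
    then have "q \<in> fib e" using v(4) unfolding fib_def by auto
    then show False using v(3) q by auto
  qed
  then show "w \<in> \<Psi> ` {q. ramify m l q = y}" by auto
qed

end

text \<open>For a nonpositive start the separate index 0 is already in the range.\<close>

lemma puiseux_indices_nonpos: "puiseux_indices (- int k) = {- int k..}"
  by (auto simp: puiseux_indices_def)

text \<open>Every number has an \<open>l\<close>-th root, so a point where \<open>D\<close> is
  nonzero has a preimage and the pullback of \<open>D\<close> is not identically zero.\<close>

lemma dense_ramify:
  fixes m :: "'m::finite"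
  assumes l: "l > 0" and r: "r > 0" and D: "holomorphic_Cn D (polydisc r)" "\<exists>v\<in>polydisc r. D v \<noteq> 0"
  shows "ramified_disc m l r \<subseteq> closure {q\<in>ramified_disc m l r. D (ramify m l q) \<noteq> 0}"
proof -
  obtain v where v: "v \<in> polydisc r" "D v \<noteq> 0" using D(2) by blast
  obtain \<zeta> where \<zeta>: "v $ m = \<zeta> ^ l" using exists_complex_root[of l "v $ m"] l by auto
  let ?q = "drop_coord m v + \<zeta> *s axis m 1"
  have q: "ramify m l ?q = v" using \<zeta> by (simp add: ramify_eq_iff)
  show ?thesis
  proof (rule holomorphic_Cn_nonzero_dense)
    show "holomorphic_Cn (\<lambda>q. D (ramify m l q)) (ramified_disc m l r)"
      by (rule holomorphic_Cn_compose[OF D(1) holomorphic_Cn_ramify]) (auto simp: ramified_disc_def[OF l r])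
    show "?q \<in> ramified_disc m l r" "D (ramify m l ?q) \<noteq> 0" unfolding ramified_disc_def[OF l r] mem_Collect_eq q by (rule v)+
  qed (rule ramified_disc_open[OF l r] ramified_disc_convex[OF l r])+
qed

section \<open>Laurent coefficients of a quotient of holomorphic functions\<close>

context
  fixes m :: "'m::finite" and l :: nat and r :: real and g a :: "complex ^ 'm \<Rightarrow> complex" and k :: nat
    and gg aa :: "nat \<Rightarrow> complex ^ 'm \<Rightarrow> complex" and P RD H :: "(complex ^ 'm) set" and A0 :: "(complex ^ 'm, 'm) chart set"
    and c :: "nat \<Rightarrow> complex ^ 'm \<Rightarrow> complex" and B :: "int \<Rightarrow> complex ^ 'm \<Rightarrow> complex"
  assumes l: "l > 0" and r: "r > 0"
    and P: "P = polydisc r" and RD: "RD = ramified_disc m l r"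
    and g: "holomorphic_Cn g RD" and a: "holomorphic_Cn a RD"
    and gg: "gg = taylor_coeff m g" and aa: "aa = taylor_coeff m a"
    and low: "\<And>n v. n < k \<Longrightarrow> v \<in> P \<Longrightarrow> aa n v = 0" and knz: "\<exists>v\<in>P. aa k v \<noteq> 0"
    and H: "H = {v\<in>P. aa k v \<noteq> 0}" and A0: "A0 = {(UNIV, \<lambda>z. z)}"
    and c: "c = (\<lambda>n v. quot_coeff (\<lambda>i. gg i v) (\<lambda>i. aa (i + k) v) n)"
    and B: "B = (\<lambda>j. normalized A0 P (c (nat (j + int k))))"
begin

lemma open_base: "open P" unfolding P by (rule open_polydisc)

lemma convex_base: "convex P" unfolding P by (rule convex_polydisc)

lemma open_RD: "open RD" unfolding RD by (rule ramified_disc_open[OF l r])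

lemma line_RD: "v \<in> P \<Longrightarrow> drop_coord m v + t *s axis m 1 \<in> RD \<longleftrightarrow> norm t < root l r"
  unfolding RD P by (intro ramified_disc_line_iff[OF l r] drop_coord_polydisc r)

lemma root_pos: "root l r > 0" using l r by simp

lemma drop_RD: "v \<in> P \<Longrightarrow> drop_coord m v \<in> RD"
  using line_RD[of v 0] root_pos by simp

lemma drop_P: "v \<in> P \<Longrightarrow> drop_coord m v \<in> P"
  unfolding P using r by (intro drop_coord_polydisc)

lemma gg_holomorphic: "holomorphic_Cn (gg n) P"
  unfolding gg by (rule taylor_coeff_holomorphic[OF g open_RD drop_RD open_base])

lemma aa_holomorphic: "holomorphic_Cn (aa n) P"
  unfolding aa by (rule taylor_coeff_holomorphic[OF a open_RD drop_RD open_base])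

lemma gg_drop: "gg n (drop_coord m v) = gg n v" and aa_drop: "aa n (drop_coord m v) = aa n v"
  by (simp_all add: gg aa)

lemma c_drop: "c n (drop_coord m v) = c n v"
  by (simp add: c gg_drop aa_drop)

lemma open_H: "open H"
  unfolding H by (rule open_nonzero[OF holomorphic_Cn_continuous_on[OF aa_holomorphic] open_base])

lemma H_dense: "P \<subseteq> closure {v\<in>P. aa k v \<noteq> 0}"
proof -
  obtain v where "v \<in> P" "aa k v \<noteq> 0" using knz by blast
  then show ?thesis
    by (rule holomorphic_Cn_nonzero_dense[OF aa_holomorphic open_base convex_base])
qed

lemma M0: "complex_manifold A0" unfolding A0 by (rule standard_manifold)

lemma hol0: "holomorphic_mfd A0 f S \<longleftrightarrow> holomorphic_Cn f S"
  unfolding A0 by (rule holomorphic_mfd_standard)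

text \<open>The recursion divides by \<open>aa k\<close> only, and the zeros of \<open>aa k\<close>
  are thin.\<close>

lemma c_locally_quotient: "locally_quotient A0 P (c n)"
proof (induction n rule: less_induct)
  case (less n)
  have gen: "generically A0 P (\<lambda>v. aa k v \<noteq> 0)"
    unfolding generically_def hol0
    using open_base aa_holomorphic H_dense by (intro ballI exI[of _ P] exI[of _ "aa k"]) auto
  have lq: "locally_quotient A0 P (gg i)" "locally_quotient A0 P (aa i)" for i
    using gg_holomorphic aa_holomorphic open_base by (auto intro!: holomorphic_locally_quotient[OF M0] simp: hol0)
  have "locally_quotient A0 P (\<lambda>v. (gg n v + (-1) * (\<Sum>i<n. c i v * aa (n - i + k) v)) * inverse (aa k v))"
    by (intro locally_quotient_mult[OF M0] locally_quotient_add[OF M0] locally_quotient_const[OF M0 open_base]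
        locally_quotient_sum[OF M0 open_base] locally_quotient_inverse[OF M0] lq gen less.IH) auto
  moreover have "c n v = (gg n v + (-1) * (\<Sum>i<n. c i v * aa (n - i + k) v)) * inverse (aa k v)" for v
    unfolding c by (subst quot_coeff.simps) (simp add: divide_inverse)
  then have "c n = (\<lambda>v. (gg n v + (-1) * (\<Sum>i<n. c i v * aa (n - i + k) v)) * inverse (aa k v))" by blast
  ultimately show ?case by simp
qed

lemma c_holomorphic: "holomorphic_Cn (c n) H"
proof (induction n rule: less_induct)
  case (less n)
  have HP: "H \<subseteq> P" by (auto simp: H)
  have "holomorphic_Cn (\<lambda>v. (gg n v - (\<Sum>i<n. c i v * aa (n - i + k) v)) / aa k v) H"
    by (intro holomorphic_Cn_divide holomorphic_Cn_diff holomorphic_Cn_sum holomorphic_Cn_mult less.IH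
        holomorphic_Cn_subset[OF gg_holomorphic HP] holomorphic_Cn_subset[OF aa_holomorphic HP]) (auto simp: H)
  moreover have "c n v = (gg n v - (\<Sum>i<n. c i v * aa (n - i + k) v)) / aa k v" for v
    unfolding c by (subst quot_coeff.simps) simp
  then have "c n = (\<lambda>v. (gg n v - (\<Sum>i<n. c i v * aa (n - i + k) v)) / aa k v)" by blast
  ultimately show ?case by simp
qed

text \<open>The shift from \<open>v\<close> to its projection is parallel to axis \<open>m\<close>
  and leaves the unnormalised coefficients unchanged, so \<open>normalized_translate\<close>
  applies.\<close>

lemma B_drop: assumes v: "v \<in> P" shows "B j (drop_coord m v) = B j v"
proof -
  let ?s = "drop_coord m v - v"
  have s: "drop_coord m (x + ?s) = drop_coord m x" for x by (simp add: vec_eq_iff)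
  have inv: "c n (x + ?s) = c n x" for n x
    using c_drop[of n "x + ?s"] c_drop[of n x] unfolding s by simp
  have "normalized A0 P (c (nat (j + int k))) (v + ?s) = normalized A0 P (c (nat (j + int k))) v"
    using normalized_translate[OF open_base c_locally_quotient[unfolded A0] inv v, folded A0] v drop_P[OF v] by simp
  then show ?thesis by (simp add: B)
qed

lemma B_meromorphic: "meromorphic_mfd A0 (\<lambda>v. B j (drop_coord m v)) P"
  by (rule meromorphic_mfd_cong[OF normalized_meromorphic[OF M0 c_locally_quotient, of "nat (j + int k)"]])
     (use B_drop in \<open>simp add: B\<close>)

lemma B_eq_c: assumes v: "v \<in> H" shows "B j (drop_coord m v) = c (nat (j + int k)) v"
proof -
  have vP: "v \<in> P" using v by (simp add: H)
  have "local_extension A0 P (c (nat (j + int k))) v H (c (nat (j + int k)))"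
    unfolding local_extension_def[OF M0] hol0 using open_H v c_holomorphic by (auto simp: H closure_subset)
  from normalized_eq[OF M0 c_locally_quotient this] show ?thesis using B_drop[OF vP] by (simp add: B)
qed

lemma H_coefficient_domain: "H \<subseteq> coefficient_domain m B J P"
proof
  fix v assume v: "v \<in> H"
  have "holomorphic_Cn (\<lambda>v. B j (drop_coord m v)) H" for j
    by (rule holomorphic_Cn_transform[OF c_holomorphic open_H]) (simp add: B_eq_c)
  then show "v \<in> coefficient_domain m B J P"
    unfolding coefficient_domain_def using v open_H by (auto simp: H)
qed

text \<open>Hartogs: on a circle around \<open>p\<close> that avoids the zeros of \<open>aa k\<close> the coefficients grow at most
  geometrically, hence by the maximum principle they do so near \<open>p\<close>.\<close>

lemma coefficient_growth:
  assumes p: "p \<in> P" "p $ m = 0" and T: "open T" "p \<in> T" "\<And>n. holomorphic_Cn (\<lambda>v. B (int n - int k) (drop_coord m v)) T"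
  obtains \<delta> K R where "\<delta> > 0" "ball p \<delta> \<subseteq> T \<inter> P" "R > 0" "K \<ge> 0" "\<forall>v\<in>ball p \<delta>. \<forall>n. norm (B (int n - int k) (drop_coord m v)) \<le> K * R ^ n"
proof -
  obtain R0 where R0: "R0 > 0" "ball p R0 \<subseteq> T \<inter> P" using T(1,2) p(1) open_base by (meson IntI open_Int open_contains_ball)
  have pfix: "drop_coord m p = p" by (rule drop_coord_fix[OF p(2)])
  obtain q where q: "q \<in> ball p R0" "aa k q \<noteq> 0"
    using H_dense[unfolded dense_iff, rule_format, of "ball p R0"] R0(1) p(1)
    by (metis IntE IntI centre_in_ball emptyE open_ball)
  \<comment> \<open>The direction is projected to the hyperplane; as \<open>aa k\<close> does not
    depend on the coordinate \<open>m\<close>, it is still nonzero at the projection of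
    \<open>q\<close>.\<close>
  define e where "e = drop_coord m q - p"
  have em: "drop_coord m e = e" unfolding e_def drop_coord_diff pfix by simp
  let ?l = "\<lambda>z t. z + t *s e"
  have lfix: "drop_coord m (?l p t) = ?l p t" for t
  proof -
    have "e $ m = 0" by (simp add: e_def p(2))
    then show ?thesis using p(2) by (intro drop_coord_fix) simp
  qed
  define A where "A z = {t. ?l z t \<in> ball p R0}" for z
  have A: "open (A z)" "convex (A z)" for z
    unfolding A_def by (intro open_line_preimage convex_line_preimage open_ball convex_ball)+
  have l1: "?l p 1 = drop_coord m q" by (simp add: e_def)
  have "norm (drop_coord m q - p) \<le> norm (q - p)" using norm_drop_coord_le[of m "q - p"] unfolding drop_coord_diff pfix .
  then have "drop_coord m q \<in> ball p R0" using q(1) by (simp add: dist_norm norm_minus_commute)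
  then have A1: "1 \<in> A p" unfolding A_def mem_Collect_eq l1 .
  have A0': "0 \<in> A p" using R0(1) by (simp add: A_def)
  have aaB: "holomorphic_Cn (aa k) (ball p R0)" by (rule holomorphic_Cn_subset[OF aa_holomorphic]) (use R0 in blast)
  have "\<forall>\<^sub>F t in at 0. aa k (?l p t) \<noteq> 0 \<and> t \<in> A p"
  proof (rule non_zero_neighbour_alt[where \<beta>=1])
    show "(\<lambda>t. aa k (?l p t)) holomorphic_on A p" by (rule holomorphic_Cn_line[OF aaB A(1)]) (simp add: A_def)
    show "aa k (?l p 1) \<noteq> 0" unfolding l1 aa_drop by (rule q(2))
  qed (use A A0' A1 in \<open>auto intro: convex_connected\<close>)
  then obtain \<rho>0 where \<rho>0: "\<rho>0 > 0" "\<And>t. t \<noteq> 0 \<Longrightarrow> norm t < \<rho>0 \<Longrightarrow> aa k (?l p t) \<noteq> 0 \<and> t \<in> A p"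
    unfolding eventually_at by (auto simp: dist_norm)
  define \<rho> where "\<rho> = \<rho>0 / 2"
  have \<rho>: "\<rho> > 0" "\<rho> < \<rho>0" using \<rho>0 by (auto simp: \<rho>_def)
  define KS where "KS = ?l p ` sphere 0 \<rho>"
  define KC where "KC = ?l p ` cball 0 \<rho>"
  have compK: "compact KS" "compact KC"
    unfolding KS_def KC_def by (intro compact_continuous_image continuous_intros compact_sphere compact_cball)+
  have KCsub: "KC \<subseteq> ball p R0"
  proof
    fix x assume "x \<in> KC"
    then obtain t where t: "x = ?l p t" "t \<in> cball 0 \<rho>" unfolding KC_def by blast
    show "x \<in> ball p R0"
    proof (cases "t = 0")
      case False
      then have "t \<in> A p" using \<rho>0(2)[of t] t(2) \<rho> by simp
      then show ?thesis unfolding t(1) A_def by blast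
    qed (use t R0 in simp)
  qed
  have KSC: "KS \<subseteq> KC" unfolding KS_def KC_def by auto
  have KSH: "KS \<subseteq> H"
  proof
    fix x assume x: "x \<in> KS"
    then obtain t where t: "x = ?l p t" "t \<in> sphere 0 \<rho>" unfolding KS_def by blast
    then have "aa k x \<noteq> 0" using \<rho>0(2)[of t] \<rho> by auto
    moreover have "x \<in> P" using x KSC KCsub R0(2) by blast
    ultimately show "x \<in> H" by (simp add: H)
  qed
  obtain d1 where d1: "d1 > 0" "\<And>x. x \<in> KC \<Longrightarrow> ball x d1 \<subseteq> ball p R0"
    using compact_in_open_uniform[OF compK(2) open_ball KCsub] by blast
  have "holomorphic_Cn (\<lambda>v. inverse (aa k v)) H"
    by (rule holomorphic_Cn_inverse[OF holomorphic_Cn_subset[OF aa_holomorphic]]) (auto simp: H)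
  then obtain d2 M2 where d2: "d2 > 0" "M2 \<ge> 0" "\<forall>x\<in>KS. \<forall>y\<in>ball x d2. y \<in> H \<and> norm (inverse (aa k y)) \<le> M2"
    by (rule holomorphic_Cn_bounded_near[OF _ open_H compK(1) KSH])
  \<comment> \<open>A radius below \<open>root l r\<close>, on which the Cauchy estimates for the
    Taylor coefficients of \<open>g\<close> and \<open>a\<close> are made.\<close>
  define \<eta> where "\<eta> = root l r / 2"
  have \<eta>: "\<eta> > 0" "\<eta> < root l r" using root_pos by (auto simp: \<eta>_def)
  define K2 where "K2 = (\<lambda>x. fst x + snd x *s axis m 1) ` (KS \<times> sphere 0 \<eta>)"
  have compK2: "compact K2"
    unfolding K2_def by (intro compact_continuous_image continuous_intros compact_Times compK compact_sphere)
  have KSfix: "drop_coord m x = x" if "x \<in> KS" for x using that lfix unfolding KS_def by auto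
  have K2RD: "K2 \<subseteq> RD"
  proof
    fix y assume "y \<in> K2"
    then obtain x \<zeta> where x: "x \<in> KS" "norm \<zeta> = \<eta>" "y = x + \<zeta> *s axis m 1" unfolding K2_def by auto
    have "x \<in> P" using x(1) KSH by (auto simp: H)
    then show "y \<in> RD" using line_RD[of x \<zeta>] KSfix[OF x(1)] x \<eta> by simp
  qed
  obtain d3 M3 where d3: "d3 > 0" "M3 \<ge> 0" "\<forall>x\<in>K2. \<forall>y\<in>ball x d3. y \<in> RD \<and> norm (g y) \<le> M3"
    by (rule holomorphic_Cn_bounded_near[OF g open_RD compK2 K2RD])
  obtain d4 M4 where d4: "d4 > 0" "M4 \<ge> 0" "\<forall>x\<in>K2. \<forall>y\<in>ball x d4. y \<in> RD \<and> norm (a y) \<le> M4"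
    by (rule holomorphic_Cn_bounded_near[OF a open_RD compK2 K2RD])
  \<comment> \<open>Division of \<open>M4\<close> by \<open>\<eta> ^ k\<close> accounts for the
    shift by \<open>k\<close> in the coefficients of \<open>a\<close>.\<close>
  define M where "M = max M3 (M4 / \<eta> ^ k)"
  \<comment> \<open>A lower bound for \<open>aa k\<close> near the circle, where its inverse is at
    most \<open>M2\<close>; adding 1 covers \<open>M2 = 0\<close>.\<close>
  define c0 where "c0 = 1 / (M2 + 1)"
  have c0: "c0 > 0" using d2(2) by (simp add: c0_def)
  have M: "M \<ge> 0" using d3(2) by (simp add: M_def)
  define \<delta> where "\<delta> = min (min (min d1 d2) (min d3 d4)) R0"
  have \<delta>: "\<delta> > 0" "\<delta> \<le> d1" "\<delta> \<le> d2" "\<delta> \<le> d3" "\<delta> \<le> d4" "\<delta> \<le> R0" using d1 d2 d3 d4 R0 by (auto simp: \<delta>_def)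
  define K where "K = M / c0"
  define R where "R = (1 + M / c0) / \<eta>"
  have KR: "K \<ge> 0" "R > 0" using M c0 \<eta> by (auto simp: K_def R_def add_pos_nonneg)
  have circle: "?l y t \<in> H \<and> (\<forall>n. norm (c n (?l y t)) \<le> K * R ^ n)" if y: "y \<in> ball p \<delta>" and t: "norm t = \<rho>" for y t
  proof -
    let ?x = "?l p t" and ?y = "?l y t"
    have x: "?x \<in> KS" unfolding KS_def by (rule imageI) (use t in simp)
    have dist: "dist ?x ?y < \<delta>" using y by simp
    then have yH: "?y \<in> H" "norm (inverse (aa k ?y)) \<le> M2" using d2(3) x \<delta>(3) by (metis mem_ball order_less_le_trans)+
    have yP: "?y \<in> P" using yH(1) by (simp add: H)
    have aay: "aa k ?y \<noteq> 0" using yH(1) by (simp add: H)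
    have "c0 \<le> norm (aa k ?y)"
    proof -
      have "1 \<le> M2 * norm (aa k ?y)" using yH(2) aay mult_right_mono[OF yH(2), of "norm (aa k ?y)"] by (simp add: norm_inverse)
      also have "\<dots> \<le> (M2 + 1) * norm (aa k ?y)" by (intro mult_right_mono) auto
      finally show ?thesis using d2(2) by (simp add: c0_def field_simps)
    qed
    moreover have near: "drop_coord m ?y + \<zeta> *s axis m 1 \<in> ball (?x + \<zeta> *s axis m 1) \<delta>" "?x + \<zeta> *s axis m 1 \<in> K2" if "norm \<zeta> = \<eta>" for \<zeta>
    proof -
      have "norm (drop_coord m ?y - ?x) \<le> norm (?y - ?x)"
        using norm_drop_coord_le[of m "?y - ?x"] unfolding drop_coord_diff[of m ?y ?x] lfix .
      then have "dist ?x (drop_coord m ?y) < \<delta>" using dist by (simp add: dist_norm norm_minus_commute)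
      then show "drop_coord m ?y + \<zeta> *s axis m 1 \<in> ball (?x + \<zeta> *s axis m 1) \<delta>" by (simp only: mem_ball dist_add_cancel2)
      show "?x + \<zeta> *s axis m 1 \<in> K2" unfolding K2_def using x that by (intro image_eqI[of _ _ "(?x, \<zeta>)"]) auto
    qed
    moreover have gn: "norm (gg n ?y) \<le> M / \<eta> ^ n" for n
    proof -
      have "norm (gg n ?y) \<le> M3 / \<eta> ^ n"
        unfolding gg
      proof (rule taylor_coeff_bound[OF g _ \<eta>])
        show "drop_coord m ?y + t *s axis m 1 \<in> RD" if "norm t < root l r" for t using line_RD[OF yP] that by blast
        show "norm (g (drop_coord m ?y + \<zeta> *s axis m 1)) \<le> M3" if "norm \<zeta> = \<eta>" for \<zeta>
          using d3(3) near[OF that] \<delta>(4) by (meson mem_ball order_less_le_trans)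
      qed
      also have "\<dots> \<le> M / \<eta> ^ n" using \<eta> by (intro divide_right_mono) (auto simp: M_def)
      finally show ?thesis .
    qed
    moreover have an: "norm (aa (n + k) ?y) \<le> M / \<eta> ^ n" for n
    proof -
      have "norm (aa (n + k) ?y) \<le> M4 / \<eta> ^ (n + k)"
        unfolding aa
      proof (rule taylor_coeff_bound[OF a _ \<eta>])
        show "drop_coord m ?y + t *s axis m 1 \<in> RD" if "norm t < root l r" for t using line_RD[OF yP] that by blast
        show "norm (a (drop_coord m ?y + \<zeta> *s axis m 1)) \<le> M4" if "norm \<zeta> = \<eta>" for \<zeta>
          using d4(3) near[OF that] \<delta>(5) by (meson mem_ball order_less_le_trans)
      qed
      also have "\<dots> = (M4 / \<eta> ^ k) / \<eta> ^ n" by (simp add: power_add mult.commute)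
      also have "\<dots> \<le> M / \<eta> ^ n" using \<eta> by (intro divide_right_mono) (auto simp: M_def)
      finally show ?thesis .
    qed
    ultimately have "norm (c n ?y) \<le> K * R ^ n" for n
      unfolding c K_def R_def using c0 \<eta>(1) M by (intro quot_coeff_bound) auto
    then show ?thesis using yH(1) by blast
  qed
  show ?thesis
  proof (rule that[OF \<delta>(1) _ KR(2,1)])
    show sub: "ball p \<delta> \<subseteq> T \<inter> P" using R0(2) \<delta>(6) by (meson ball_subset_ball_iff subset_ball subset_trans)
    show "\<forall>v\<in>ball p \<delta>. \<forall>n. norm (B (int n - int k) (drop_coord m v)) \<le> K * R ^ n"
    proof (intro ballI allI)
      fix y n assume y: "y \<in> ball p \<delta>"
      let ?\<phi> = "\<lambda>t. B (int n - int k) (drop_coord m (?l y t))"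
      have hol: "?\<phi> holomorphic_on A y"
        by (rule holomorphic_Cn_line[OF holomorphic_Cn_subset[OF T(3)] A(1)]) (use R0(2) in \<open>auto simp: A_def\<close>)
      have cb: "cball 0 \<rho> \<subseteq> A y"
      proof
        fix t :: complex assume t: "t \<in> cball 0 \<rho>"
        have "?l p t \<in> KC" unfolding KC_def using t by (rule imageI)
        moreover have "?l y t \<in> ball (?l p t) d1" using y \<delta>(2) by simp
        ultimately show "t \<in> A y" unfolding A_def using d1(2) by blast
      qed
      \<comment> \<open>Cauchy's inequality for the derivative of order 0 is the maximum principle:
        the bound on the circle passes to its centre, where \<open>aa k\<close> may vanish.\<close>
      have "norm ((deriv ^^ 0) ?\<phi> 0) \<le> fact 0 * (K * R ^ n) / \<rho> ^ 0"
      proof (rule Cauchy_inequality)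
        show "?\<phi> holomorphic_on ball 0 \<rho>" by (rule holomorphic_on_subset[OF hol]) (use cb ball_subset_cball in blast)
        show "continuous_on (cball 0 \<rho>) ?\<phi>" by (rule holomorphic_on_imp_continuous_on[OF holomorphic_on_subset[OF hol cb]])
        show "norm (?\<phi> t) \<le> K * R ^ n" if "norm (0 - t) = \<rho>" for t
          using circle[OF y, of t] that B_eq_c[of "?l y t" "int n - int k"] by simp
      qed (rule \<rho>)
      then show "norm (B (int n - int k) (drop_coord m y)) \<le> K * R ^ n" by simp
    qed
  qed
qed

section \<open>Convergence of the series to the multi-valued function\<close>

context
  fixes D :: "complex ^ 'm \<Rightarrow> complex" and uu :: "complex ^ 'm \<Rightarrow> complex set"
  assumes D: "holomorphic_Cn D P" and D0: "\<exists>v\<in>P. D v \<noteq> 0"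
    and Dm: "\<And>v. v \<in> P \<Longrightarrow> D v \<noteq> 0 \<Longrightarrow> v $ m \<noteq> 0"
    and Da: "\<And>q. q \<in> RD \<Longrightarrow> D (ramify m l q) \<noteq> 0 \<Longrightarrow> a q \<noteq> 0"
    and uuO: "\<And>v. v \<in> P \<Longrightarrow> D v \<noteq> 0 \<Longrightarrow> uu v = (\<lambda>q. g q / a q) ` {q. ramify m l q = v}"
    and uucl: "\<And>v. v \<in> P \<Longrightarrow> uu v = {w. (v, w) \<in> closure {(v, w). (v \<in> P \<and> D v \<noteq> 0) \<and> w \<in> uu v}}"
begin

text \<open>Geometric growth of the coefficients gives convergence near \<open>p\<close>. The sum is
  compared with \<open>g / a\<close> by a Cauchy product where \<open>aa k\<close> is nonzero and by
  density elsewhere; at zeros of \<open>D\<close> the values of \<open>uu\<close> are limits of the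
  others.\<close>

lemma puiseux_near:
  assumes p: "p \<in> coefficient_domain m B {- int k..} P" "p $ m = 0"
  shows "\<exists>W. open W \<and> p \<in> W \<and> (\<forall>v\<in>P. v \<in> W \<and> v $ m \<noteq> 0 \<longrightarrow>
    (\<forall>\<zeta>. \<zeta> ^ l = v $ m \<longrightarrow> puiseux_term m B v \<zeta> summable_on {- int k..}) \<and>
    uu v = (\<lambda>\<zeta>. infsum (puiseux_term m B v \<zeta>) {- int k..}) ` {\<zeta>. \<zeta> ^ l = v $ m})"
proof -
  obtain T where T: "p \<in> P" "open T" "p \<in> T" "\<forall>j\<in>{- int k..}. holomorphic_Cn (\<lambda>v. B j (drop_coord m v)) T"
    using p(1) unfolding coefficient_domain_def by blast
  define \<beta> where "\<beta> n v = B (int n - int k) (drop_coord m v)" for n v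
  have \<beta>hol: "holomorphic_Cn (\<beta> n) T" for n using T(4) unfolding \<beta>_def by simp
  obtain \<delta> K R where \<delta>: "\<delta> > 0" "ball p \<delta> \<subseteq> T \<inter> P" "R > 0" "K \<ge> 0" "\<forall>v\<in>ball p \<delta>. \<forall>n. norm (B (int n - int k) (drop_coord m v)) \<le> K * R ^ n"
    by (rule coefficient_growth[OF T(1) p(2) T(2,3)]) (use T(4) in auto)
  have bound: "norm (\<beta> n v) \<le> K * R ^ n" if "v \<in> ball p \<delta>" for n v
    using \<delta>(5) that by (simp add: \<beta>_def)
  have \<beta>drop: "\<beta> n (drop_coord m v) = \<beta> n v" for n v by (simp add: \<beta>_def)
  \<comment> \<open>Half the radius belonging to the growth rate \<open>R\<close>, so that the terms
    are dominated by a geometric series of ratio one half.\<close>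
  define s where "s = 1 / (2 * R)"
  have s: "s > 0" using \<delta>(3) by (simp add: s_def)
  define W where "W = {v. drop_coord m v \<in> ball p \<delta> \<and> norm (v $ m) < s ^ l}"
  have openW: "open W"
  proof -
    have "open (drop_coord m -` ball p \<delta> \<inter> {v. norm (v $ m) < s ^ l})"
      by (intro open_Int open_vimage open_ball open_Collect_less continuous_intros)
    moreover have "drop_coord m -` ball p \<delta> \<inter> {v. norm (v $ m) < s ^ l} = W" by (auto simp: W_def)
    ultimately show ?thesis by simp
  qed
  have pW: "p \<in> W" using \<delta>(1) s p(2) drop_coord_fix[OF p(2)] by (simp add: W_def)
  \<comment> \<open>Coordinate \<open>m\<close> is kept nonzero because of the negative
    exponents.\<close>
  define Q where "Q = ramify m l -` (P \<inter> W \<inter> {v. v $ m \<noteq> 0})"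
  have openQ: "open Q"
  proof -
    have "open (P \<inter> W \<inter> {v. v $ m \<noteq> 0})"
      by (intro open_Int open_base openW open_Collect_neq continuous_intros)
    then show ?thesis unfolding Q_def by (rule open_vimage[OF _ continuous_on_ramify])
  qed
  have QRD: "Q \<subseteq> RD" by (auto simp: Q_def RD ramified_disc_def[OF l r] P)
  have Qd: "drop_coord m q \<in> ball p \<delta>" "norm (q $ m) < s" "q $ m \<noteq> 0" if "q \<in> Q" for q
  proof -
    have *: "drop_coord m q \<in> ball p \<delta>" "norm (q $ m) ^ l < s ^ l" "q $ m ^ l \<noteq> 0"
      using that by (auto simp: Q_def W_def ramify_nth norm_power)
    show "drop_coord m q \<in> ball p \<delta>" by (rule *(1))
    show "norm (q $ m) < s" using *(2) s by (intro power_less_imp_less_base[of _ l s]) auto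
    show "q $ m \<noteq> 0" using *(3) l by auto
  qed
  have term_le: "norm (\<beta> n q * (q $ m) ^ n) \<le> K * (1 / 2) ^ n" if "q \<in> Q" for n q
  proof -
    have "norm (\<beta> n q * (q $ m) ^ n) \<le> (K * R ^ n) * s ^ n"
      unfolding norm_mult norm_power using bound[OF Qd(1)[OF that], of n] Qd(2)[OF that] \<delta>(3,4)
      by (intro mult_mono power_mono) (auto simp: \<beta>drop)
    also have "\<dots> = K * (R * s) ^ n" by (simp add: power_mult_distrib)
    also have "R * s = 1 / 2" using \<delta>(3) by (simp add: s_def)
    finally show ?thesis .
  qed
  have geo: "summable (\<lambda>n. K * (1 / 2) ^ n)" by (intro summable_mult summable_geometric) simp
  define F where "F q = (\<Sum>n. \<beta> n q * (q $ m) ^ n)" for q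
  have summ: "summable (\<lambda>n. norm (\<beta> n q * (q $ m) ^ n))" if "q \<in> Q" for q
    by (rule summable_comparison_test'[OF geo, of 0]) (use term_le[OF that] in simp)
  have \<beta>cont: "continuous_on Q (\<beta> n)" for n
  proof -
    have "continuous_on Q (\<lambda>q. \<beta> n (drop_coord m q))"
      by (rule continuous_on_compose2[OF holomorphic_Cn_continuous_on[OF \<beta>hol] continuous_on_drop_coord[OF continuous_on_id]])
         (use Qd(1) \<delta>(2) in blast)
    then show ?thesis by (simp add: \<beta>drop)
  qed
  have Fcont: "continuous_on Q F"
  proof -
    have "uniform_limit Q (\<lambda>n q. \<Sum>i<n. \<beta> i q * (q $ m) ^ i) F sequentially"
      unfolding F_def by (rule Weierstrass_m_test[OF term_le geo])
    moreover have "\<forall>\<^sub>F n in sequentially. continuous_on Q (\<lambda>q. \<Sum>i<n. \<beta> i q * (q $ m) ^ i)"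
      by (intro always_eventually allI continuous_intros \<beta>cont)
    ultimately show ?thesis by (intro uniform_limit_theorem) auto
  qed
  have ident0: "g q * (q $ m) ^ k = a q * F q" if q: "q \<in> Q" and nz: "aa k q \<noteq> 0" for q
  proof -
    let ?\<zeta> = "q $ m" and ?y = "drop_coord m q"
    have yP: "?y \<in> P" using Qd(1)[OF q] \<delta>(2) by blast
    then have yH: "?y \<in> H" using nz by (simp add: H aa_drop)
    have line: "drop_coord m ?y + t *s axis m 1 \<in> RD" if "norm t < root l r" for t using line_RD[OF yP] that by blast
    have q_eq: "drop_coord m ?y + ?\<zeta> *s axis m 1 = q" by (simp add: drop_coord_decomp)
    have \<zeta>: "norm ?\<zeta> < root l r" using line_RD[OF yP, of ?\<zeta>] q QRD unfolding q_eq by blast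
    have gs: "(\<lambda>n. gg n ?y * ?\<zeta> ^ n) sums g q"
      using taylor_coeff_sums[OF g line \<zeta>] unfolding q_eq gg .
    have as: "(\<lambda>n. aa n ?y * t ^ n) sums a (drop_coord m ?y + t *s axis m 1)" if "norm t < root l r" for t
      using taylor_coeff_sums[OF a line that] unfolding aa .
    have "(\<lambda>n. aa (n + k) ?y * ?\<zeta> ^ (n + k)) sums (a q - (\<Sum>i<k. aa i ?y * ?\<zeta> ^ i))"
      using sums_split_initial_segment[OF as[OF \<zeta>], of k] unfolding q_eq .
    moreover have "(\<Sum>i<k. aa i ?y * ?\<zeta> ^ i) = 0" using low yP by (intro sum.neutral) auto
    ultimately have as': "(\<lambda>n. aa (n + k) ?y * ?\<zeta> ^ (n + k)) sums a q" by simp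
    have as2: "(\<lambda>n. aa (n + k) ?y * ?\<zeta> ^ n) sums (a q / ?\<zeta> ^ k)"
      using sums_divide[OF as', of "?\<zeta> ^ k"] Qd(3)[OF q] by (simp add: power_add)
    \<comment> \<open>A number of modulus between that of \<open>?\<zeta>\<close> and
      \<open>root l r\<close>: convergence there makes the series converge absolutely at
      \<open>?\<zeta>\<close>, as the Cauchy product requires.\<close>
    define x where "x = (norm ?\<zeta> + root l r) / 2"
    have "\<bar>x\<bar> = x" using root_pos norm_ge_zero[of ?\<zeta>] by (simp only: x_def abs_if) argo
    then have x: "norm (complex_of_real x) < root l r" "norm ?\<zeta> < norm (complex_of_real x)"
      unfolding norm_of_real x_def using \<zeta> by argo+
    have "summable (\<lambda>n. norm (aa n ?y * ?\<zeta> ^ n))"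
      by (rule powser_insidea[OF sums_summable[OF as[OF x(1)]] x(2)])
    then have "summable (\<lambda>n. norm (aa (n + k) ?y * ?\<zeta> ^ (n + k)))" by (rule summable_ignore_initial_segment)
    then have "summable (\<lambda>n. norm (aa (n + k) ?y * ?\<zeta> ^ (n + k)) / norm (?\<zeta> ^ k))" by (rule summable_divide)
    then have sa: "summable (\<lambda>n. norm (aa (n + k) ?y * ?\<zeta> ^ n))"
      using Qd(3)[OF q] by (simp add: norm_mult norm_power power_add)
    have c\<beta>: "\<beta> n q = c n ?y" for n
      using B_eq_c[OF yH, of "int n - int k"] by (simp add: \<beta>_def)
    have "(\<lambda>n. \<Sum>i\<le>n. (\<beta> i q * ?\<zeta> ^ i) * (aa (n - i + k) ?y * ?\<zeta> ^ (n - i))) sums (F q * (a q / ?\<zeta> ^ k))"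
      using Cauchy_product_sums[OF summ[OF q] sa] sums_unique[OF as2] by (simp add: F_def)
    moreover have "(\<Sum>i\<le>n. (\<beta> i q * ?\<zeta> ^ i) * (aa (n - i + k) ?y * ?\<zeta> ^ (n - i))) = gg n ?y * ?\<zeta> ^ n" for n
    proof -
      have "(\<Sum>i\<le>n. (\<beta> i q * ?\<zeta> ^ i) * (aa (n - i + k) ?y * ?\<zeta> ^ (n - i))) = (\<Sum>i\<le>n. c i ?y * aa (n - i + k) ?y) * ?\<zeta> ^ n"
        unfolding sum_distrib_right
      proof (rule sum.cong)
        fix i assume "i \<in> {..n}"
        then have "?\<zeta> ^ n = ?\<zeta> ^ i * ?\<zeta> ^ (n - i)" by (simp flip: power_add)
        then show "(\<beta> i q * ?\<zeta> ^ i) * (aa (n - i + k) ?y * ?\<zeta> ^ (n - i)) = c i ?y * aa (n - i + k) ?y * ?\<zeta> ^ n"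
          unfolding c\<beta> by (simp only: mult_ac)
      qed simp
      also have "(\<Sum>i\<le>n. c i ?y * aa (n - i + k) ?y) = gg n ?y"
        unfolding c using quot_coeff_convolution[of "\<lambda>i. aa (i + k) ?y" "\<lambda>i. gg i ?y" n] yH by (simp add: H)
      finally show ?thesis .
    qed
    ultimately have "g q = F q * (a q / ?\<zeta> ^ k)" using gs by (simp add: sums_unique2)
    then show ?thesis using Qd(3)[OF q] by simp
  qed
  have aadense: "RD \<subseteq> closure {q\<in>RD. aa k q \<noteq> 0}"
  proof -
    obtain v where v: "v \<in> P" "aa k v \<noteq> 0" using knz by blast
    show ?thesis
    proof (rule holomorphic_Cn_nonzero_dense)
      show "holomorphic_Cn (aa k) RD" unfolding aa
      proof (rule taylor_coeff_holomorphic[OF a open_RD _ open_RD])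
        fix q assume "q \<in> RD"
        then have "ramify m l q \<in> P" by (simp add: RD ramified_disc_def[OF l r] P)
        from drop_RD[OF this] show "drop_coord m q \<in> RD" by simp
      qed
      show "drop_coord m v \<in> RD" by (rule drop_RD[OF v(1)])
      show "aa k (drop_coord m v) \<noteq> 0" using v(2) by (simp add: aa_drop)
      show "open RD" "convex RD" unfolding RD by (rule ramified_disc_open[OF l r], rule ramified_disc_convex[OF l r])
    qed
  qed
  have ident: "g q * (q $ m) ^ k = a q * F q" if q: "q \<in> Q" for q
  proof (rule eq_on_dense[where T=Q and X="{q\<in>Q. aa k q \<noteq> 0}"])
    have "continuous_on Q g" "continuous_on Q a"
      using holomorphic_Cn_continuous_on[OF g] holomorphic_Cn_continuous_on[OF a] QRD by (auto intro: continuous_on_subset)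
    then show "continuous_on Q (\<lambda>q. g q * (q $ m) ^ k)" "continuous_on Q (\<lambda>q. a q * F q)"
      by (auto intro!: continuous_intros Fcont)
    show "Q \<subseteq> closure {q\<in>Q. aa k q \<noteq> 0}" by (rule dense_restrict[OF aadense openQ QRD])
  qed (use ident0 openQ q in auto)
  define \<Psi> where "\<Psi> q = F q / (q $ m) ^ k" for q
  have \<Psi>cont: "continuous_on Q \<Psi>" unfolding \<Psi>_def by (intro continuous_intros Fcont) (use Qd(3) in auto)
  define Y where "Y = {v\<in>P \<inter> W. D v \<noteq> 0}"
  have fibre: "q \<in> Q" if "ramify m l q = v" "v \<in> P" "v \<in> W" "v $ m \<noteq> 0" for q v
    using that by (auto simp: Q_def)
  have full: "uu v = \<Psi> ` {q. ramify m l q = v}" if v: "v \<in> Y" for v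
  proof -
    have vP: "v \<in> P" "D v \<noteq> 0" "v \<in> W" using v by (auto simp: Y_def)
    have "g q / a q = \<Psi> q" if rq: "ramify m l q = v" for q
    proof -
      have q: "q \<in> Q" using fibre[OF rq vP(1,3) Dm[OF vP(1,2)]] .
      then have "a q \<noteq> 0" using Da[of q] QRD rq vP by blast
      then show ?thesis using ident[OF q] Qd(3)[OF q] by (simp add: \<Psi>_def field_simps)
    qed
    then show ?thesis unfolding uuO[OF vP(1,2)] by (intro image_cong) auto
  qed
  have Ydense: "Q \<subseteq> closure {q\<in>Q. ramify m l q \<in> Y}"
  proof -
    have "RD \<subseteq> closure {q\<in>RD. D (ramify m l q) \<noteq> 0}"
      using dense_ramify[OF l r, of D m] D D0 unfolding P RD by blast
    from dense_restrict[OF this openQ QRD] have "Q \<subseteq> closure {q\<in>Q. D (ramify m l q) \<noteq> 0}" .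
    moreover have "{q\<in>Q. D (ramify m l q) \<noteq> 0} = {q\<in>Q. ramify m l q \<in> Y}" by (auto simp: Y_def Q_def)
    ultimately show ?thesis by simp
  qed
  have final: "(\<forall>\<zeta>. \<zeta> ^ l = v $ m \<longrightarrow> puiseux_term m B v \<zeta> summable_on {- int k..}) \<and>
    uu v = (\<lambda>\<zeta>. infsum (puiseux_term m B v \<zeta>) {- int k..}) ` {\<zeta>. \<zeta> ^ l = v $ m}"
    if v: "v \<in> P" "v \<in> W" "v $ m \<noteq> 0" for v
  proof -
    \<comment> \<open>The limit values refer to a graph over all of \<open>P\<close>, while \<Psi>
      describes only the part over \<open>W\<close>; since \<open>W\<close> is open, the closure
      over its points sees no more than this part.\<close>
    define E where "E = {(v, w). (v \<in> P \<and> D v \<noteq> 0) \<and> w \<in> uu v}"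
    have "{w. (v, w) \<in> closure E} = {w. (v, w) \<in> closure {(v, w). v \<in> Y \<and> w \<in> uu v}}"
    proof -
      have sub: "{(v, w). v \<in> Y \<and> w \<in> uu v} = (W \<times> UNIV) \<inter> E" by (auto simp: Y_def E_def)
      have "open (W \<times> (UNIV :: complex set))" by (intro open_Times openW open_UNIV)
      from open_Int_closure_subset[OF this, of E]
      have "(v, w) \<in> closure ((W \<times> UNIV) \<inter> E)" if "(v, w) \<in> closure E" for w using that v(2) by blast
      moreover have "closure ((W \<times> UNIV) \<inter> E) \<subseteq> closure E" by (rule closure_mono) blast
      ultimately show ?thesis unfolding sub by blast
    qed
    also have "\<dots> = \<Psi> ` {q. ramify m l q = v}"
      by (rule closure_graph_ramify[OF l r openQ \<Psi>cont Ydense fibre[OF _ v] full])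
    finally have uv: "uu v = \<Psi> ` {q. ramify m l q = v}" using uucl[OF v(1)] unfolding E_def by simp
    have sums: "puiseux_term m B v \<zeta> summable_on {- int k..} \<and>
        infsum (puiseux_term m B v \<zeta>) {- int k..} = \<Psi> (drop_coord m v + \<zeta> *s axis m 1)" if z: "\<zeta> ^ l = v $ m" for \<zeta>
    proof -
      let ?q = "drop_coord m v + \<zeta> *s axis m 1"
      have rq: "ramify m l ?q = v" using z by (simp add: ramify_eq_iff)
      have q: "?q \<in> Q" by (rule fibre[OF rq v])
      have qm: "?q $ m = \<zeta>" by (simp add: axis_def)
      have \<zeta>0: "\<zeta> \<noteq> 0" using Qd(3)[OF q] unfolding qm .
      define b where "b n = \<beta> n ?q * \<zeta> ^ n / \<zeta> ^ k" for n
      have sn: "summable (\<lambda>n. norm (\<beta> n ?q * \<zeta> ^ n))" using summ[OF q] unfolding qm .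
      have sb: "summable (\<lambda>n. norm (b n))"
        using summable_divide[OF sn, of "norm (\<zeta> ^ k)"] by (simp add: b_def norm_divide)
      have "suminf b = \<Psi> ?q"
        unfolding \<Psi>_def F_def qm b_def by (rule suminf_divide[OF summable_norm_cancel[OF sn]])
      moreover have "puiseux_term m B v \<zeta> j = b (nat (j + int k))" if "j \<in> {- int k..}" for j
      proof -
        have "\<beta> (nat (j + int k)) ?q = B j (drop_coord m v)" using that by (simp add: \<beta>_def)
        moreover have "\<zeta> powi j = \<zeta> ^ nat (j + int k) / \<zeta> ^ k"
          using power_int_diff[of \<zeta> "int (nat (j + int k))" "int k"] \<zeta>0 that by (simp add: power_int_def[of _ "j + int k"])
        ultimately show ?thesis by (simp add: puiseux_term_def b_def)
      qed
      note eq = this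
      show ?thesis
        using summable_int_shift[OF sb, of k] calculation
          summable_on_cong[of "{- int k..}" "puiseux_term m B v \<zeta>" "\<lambda>j. b (nat (j + int k))", OF eq]
          infsum_cong[of "{- int k..}" "puiseux_term m B v \<zeta>" "\<lambda>j. b (nat (j + int k))", OF eq]
        by simp
    qed
    have "{q. ramify m l q = v} = (\<lambda>\<zeta>. drop_coord m v + \<zeta> *s axis m 1) ` {\<zeta>. \<zeta> ^ l = v $ m}"
    proof
      show "{q. ramify m l q = v} \<subseteq> (\<lambda>\<zeta>. drop_coord m v + \<zeta> *s axis m 1) ` {\<zeta>. \<zeta> ^ l = v $ m}"
      proof
        fix q assume "q \<in> {q. ramify m l q = v}"
        then have "ramify m l q = v" by blast
        from ramify_eq_line[OF this] show "q \<in> (\<lambda>\<zeta>. drop_coord m v + \<zeta> *s axis m 1) ` {\<zeta>. \<zeta> ^ l = v $ m}" by blast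
      qed
    qed (auto simp: ramify_eq_iff)
    then have "uu v = (\<lambda>\<zeta>. \<Psi> (drop_coord m v + \<zeta> *s axis m 1)) ` {\<zeta>. \<zeta> ^ l = v $ m}"
      unfolding uv by (simp add: image_image)
    also have "\<dots> = (\<lambda>\<zeta>. infsum (puiseux_term m B v \<zeta>) {- int k..}) ` {\<zeta>. \<zeta> ^ l = v $ m}"
      using sums by (intro image_cong) auto
    finally show ?thesis using sums by blast
  qed
  show ?thesis by (intro exI[of _ W] conjI openW pW ballI impI) (use final in blast)+
qed

end

end

text \<open>The first exponent is \<open>- k\<close>, where \<open>k\<close> is the least index
  whose coefficient of \<open>a\<close> is not identically zero. Without such an index
  \<open>a\<close> would vanish along the whole line through a point where it has to be
  nonzero.\<close>

theorem puiseux_expansion_of_lift: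
  fixes m :: "'m::finite"
  assumes l: "l > 0" and r: "r > 0"
    and g: "holomorphic_Cn g (ramified_disc m l r)" and a: "holomorphic_Cn a (ramified_disc m l r)"
    and D: "holomorphic_Cn D (polydisc r)" "\<exists>v\<in>polydisc r. D v \<noteq> 0"
    and Dm: "\<And>v. v \<in> polydisc r \<Longrightarrow> D v \<noteq> 0 \<Longrightarrow> v $ m \<noteq> 0"
    and Da: "\<And>q. q \<in> ramified_disc m l r \<Longrightarrow> D (ramify m l q) \<noteq> 0 \<Longrightarrow> a q \<noteq> 0"
    and uuO: "\<And>v. v \<in> polydisc r \<Longrightarrow> D v \<noteq> 0 \<Longrightarrow> uu v = (\<lambda>q. g q / a q) ` {q. ramify m l q = v}"
    and uucl: "\<And>v. v \<in> polydisc r \<Longrightarrow> uu v = {w. (v, w) \<in> closure {(v, w). (v \<in> polydisc r \<and> D v \<noteq> 0) \<and> w \<in> uu v}}"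
    and z: "snd c ` fst c = polydisc r" and u: "\<And>x. x \<in> fst c \<Longrightarrow> u x = uu (snd c x)"
  shows "\<exists>\<tau> B. has_puiseux_expansion m l c r \<tau> B u"
proof -
  define aa where "aa = taylor_coeff m a"
  let ?P = "polydisc r :: (complex ^ 'm) set"
  have "\<exists>k. \<exists>v\<in>?P. aa k v \<noteq> 0"
  proof (rule ccontr)
    assume none: "\<not> ?thesis"
    obtain v where v: "v \<in> ?P" "D v \<noteq> 0" using D(2) by blast
    obtain \<zeta> where \<zeta>: "v $ m = \<zeta> ^ l" using exists_complex_root[of l "v $ m"] l by auto
    let ?q = "drop_coord m v + \<zeta> *s axis m 1"
    have q: "ramify m l ?q = v" using \<zeta> by (simp add: ramify_eq_iff)
    have qRD: "?q \<in> ramified_disc m l r" unfolding ramified_disc_def[OF l r] mem_Collect_eq q by (rule v)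
    note line = ramified_disc_line_iff[OF l r drop_coord_polydisc[OF v(1) r]]
    have "(\<lambda>n. taylor_coeff m a n v * \<zeta> ^ n) sums a ?q"
      by (rule taylor_coeff_sums[OF a, of "root l r"]) (use line qRD in auto)
    moreover have "(\<lambda>n. taylor_coeff m a n v * \<zeta> ^ n) = (\<lambda>n. 0)" using none v(1) by (auto simp: aa_def)
    ultimately have "a ?q = 0" using sums_unique2[OF _ sums_zero] by simp
    then show False using Da[OF qRD] q v(2) by simp
  qed
  then obtain k where k: "\<exists>v\<in>?P. aa k v \<noteq> 0" "\<And>n. n < k \<Longrightarrow> \<not> (\<exists>v\<in>?P. aa n v \<noteq> 0)"
    using exists_least_iff[of "\<lambda>k. \<exists>v\<in>?P. aa k v \<noteq> 0"] by blast
  have low: "aa n v = 0" if "n < k" "v \<in> ?P" for n v using k(2)[OF that(1)] that(2) by blast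
  let ?A0 = "{(UNIV, \<lambda>z. z)} :: (complex ^ 'm, 'm) chart set"
  let ?c = "\<lambda>n v. quot_coeff (\<lambda>i. taylor_coeff m g i v) (\<lambda>i. aa (i + k) v) n"
  define B where "B = (\<lambda>j. normalized ?A0 ?P (?c (nat (j + int k))))"
  \<comment> \<open>The context above names its objects by equations; they are discharged with
    \<open>refl\<close> and the local definitions.\<close>
  note facts = l r refl refl g a refl aa_def low k(1) refl refl refl B_def
  let ?J = "{- int k..}"
  have "has_puiseux_expansion m l c r (- int k) B u"
    unfolding has_puiseux_expansion_def Let_def puiseux_indices_nonpos
  proof (intro conjI)
    show "\<forall>j\<in>?J. meromorphic_Cn (\<lambda>v. B j (drop_coord m v)) ?P"
      using B_meromorphic[OF facts] by blast
    show "\<exists>D. holomorphic_Cn D ?P \<and> (\<exists>v\<in>?P. D v \<noteq> 0) \<and> {v\<in>?P. D v \<noteq> 0} \<subseteq> coefficient_domain m B ?J ?P"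
      using aa_holomorphic[OF facts] k(1) H_coefficient_domain[OF facts] by (intro exI[of _ "aa k"]) blast
    define good where "good W \<longleftrightarrow> (\<forall>v\<in>?P. v \<in> W \<and> v $ m \<noteq> 0 \<longrightarrow>
      (\<forall>\<zeta>. \<zeta> ^ l = v $ m \<longrightarrow> puiseux_term m B v \<zeta> summable_on ?J) \<and>
      uu v = (\<lambda>\<zeta>. infsum (puiseux_term m B v \<zeta>) ?J) ` {\<zeta>. \<zeta> ^ l = v $ m})" for W
    have near: "\<exists>W. open W \<and> p \<in> W \<and> good W" if "p \<in> coefficient_domain m B ?J ?P" "p $ m = 0" for p
      unfolding good_def by (rule puiseux_near[OF facts D Dm Da uuO uucl that])
    show "\<exists>W. open W \<and> {v \<in> coefficient_domain m B ?J ?P. v $ m = 0} \<subseteq> W \<and>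
        (\<forall>x\<in>fst c. snd c x \<in> W \<and> snd c x $ m \<noteq> 0 \<longrightarrow>
           (\<forall>\<zeta>. \<zeta> ^ l = snd c x $ m \<longrightarrow> puiseux_term m B (snd c x) \<zeta> summable_on ?J) \<and>
           u x = (\<lambda>\<zeta>. infsum (puiseux_term m B (snd c x) \<zeta>) ?J) ` {\<zeta>. \<zeta> ^ l = snd c x $ m})"
    \<comment> \<open>Each point of the hyperplane has a good neighbourhood of its own size; the
      union of all good open sets is good.\<close>
    proof (intro exI[of _ "\<Union>{W. open W \<and> good W}"] conjI)
      show "open (\<Union>{W. open W \<and> good W})" by (rule open_Union) blast
      show "{v \<in> coefficient_domain m B ?J ?P. v $ m = 0} \<subseteq> \<Union>{W. open W \<and> good W}" using near by blast
      show "\<forall>x\<in>fst c. snd c x \<in> \<Union>{W. open W \<and> good W} \<and> snd c x $ m \<noteq> 0 \<longrightarrow>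
           (\<forall>\<zeta>. \<zeta> ^ l = snd c x $ m \<longrightarrow> puiseux_term m B (snd c x) \<zeta> summable_on ?J) \<and>
           u x = (\<lambda>\<zeta>. infsum (puiseux_term m B (snd c x) \<zeta>) ?J) ` {\<zeta>. \<zeta> ^ l = snd c x $ m}"
      proof (intro ballI impI)
        fix x assume x: "x \<in> fst c" and h: "snd c x \<in> \<Union>{W. open W \<and> good W} \<and> snd c x $ m \<noteq> 0"
        then obtain W where W: "good W" "snd c x \<in> W" by blast
        have "snd c x \<in> ?P" using x z by blast
        from W(1)[unfolded good_def, rule_format, OF this] W(2) h u[OF x]
        show "(\<forall>\<zeta>. \<zeta> ^ l = snd c x $ m \<longrightarrow> puiseux_term m B (snd c x) \<zeta> summable_on ?J) \<and>
           u x = (\<lambda>\<zeta>. infsum (puiseux_term m B (snd c x) \<zeta>) ?J) ` {\<zeta>. \<zeta> ^ l = snd c x $ m}" by simp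
      qed
    qed
  qed
  then show ?thesis by blast
qed

section \<open>Uniformization by the exponential map\<close>

lemma has_sections_compose:
  assumes "has_sections Y V" "continuous_on Z g" "g ` Z \<subseteq> Y"
  shows "has_sections Z (\<lambda>z. V (g z))"
  unfolding has_sections_def
proof (intro ballI)
  fix q w assume q: "q \<in> Z" and w: "w \<in> V (g q)"
  obtain f where f: "is_section Y V f" "f (g q) = w"
    by (rule has_sectionsE[OF assms(1) _ w]) (use assms(3) q in auto)
  have "continuous_on Z (\<lambda>z. f (g z))"
    by (rule continuous_on_compose2[OF _ assms(2,3)]) (use f(1) in \<open>simp add: is_section_def\<close>)
  then have "is_section Z (\<lambda>z. V (g z)) (\<lambda>z. f (g z))"
    using f(1) assms(3) unfolding is_section_def by auto
  then show "\<exists>f. is_section Z (\<lambda>z. V (g z)) f \<and> f q = w" using f(2) by (intro exI[of _ "\<lambda>z. f (g z)"]) simp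
qed

lemma separated_on_compose:
  assumes "separated_on Y V" "continuous_on Z g" "g ` Z \<subseteq> Y"
  shows "separated_on Z (\<lambda>z. V (g z))"
proof (rule separated_onI)
  fix q assume q: "q \<in> Z"
  then have gq: "g q \<in> Y" using assms(3) by auto
  then obtain \<epsilon> \<delta> where ed: "\<epsilon> > 0" "\<delta> > 0"
    "\<forall>y w w'. y \<in> Y \<longrightarrow> dist (g q) y < \<epsilon> \<longrightarrow> w \<in> V y \<longrightarrow> w' \<in> V y \<longrightarrow> w \<noteq> w' \<longrightarrow> \<delta> \<le> dist w w'"
    by (rule separated_onE[OF assms(1)])
  obtain d where d: "d > 0" "\<forall>y\<in>Z. dist y q < d \<longrightarrow> dist (g y) (g q) < \<epsilon>"
    using assms(2) q ed(1) unfolding continuous_on_iff by blast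
  show "\<exists>\<epsilon> \<delta>. \<epsilon> > 0 \<and> \<delta> > 0 \<and>
    (\<forall>y w w'. y \<in> Z \<longrightarrow> dist q y < \<epsilon> \<longrightarrow> w \<in> V (g y) \<longrightarrow> w' \<in> V (g y) \<longrightarrow> w \<noteq> w' \<longrightarrow> \<delta> \<le> dist w w')"
  proof (rule exI[of _ d], rule exI[of _ \<delta>], intro conjI allI impI)
    fix y w w' assume y: "y \<in> Z" "dist q y < d" "w \<in> V (g y)" "w' \<in> V (g y)" "w \<noteq> w'"
    show "\<delta> \<le> dist w w'"
      using ed(3)[rule_format, of "g y" w w'] d(2)[rule_format, of y] y assms(3) by (auto simp: dist_commute)
  qed (use d(1) ed(2) in auto)
qed

lemma int_period_multiple:
  fixes a :: "int \<Rightarrow> 'b"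
  assumes "\<And>k. a (k + d) = a k"
  shows "a (k + d * n) = a k"
proof (induction n rule: int_induct[of _ 0])
  case (step1 i)
  then show ?case using assms[of "k + d * i"] by (simp add: algebra_simps)
next
  case (step2 i)
  then show ?case using assms[of "k + d * (i - 1)"] by (simp add: algebra_simps)
qed simp

text \<open>\<open>a k\<close> will be the value of a section after \<open>k\<close> turns around
  the hyperplane. By the pigeonhole principle there is a period of at most \<open>l\<close>; a
  smaller one would leave fewer than \<open>l\<close> values.\<close>

lemma int_period_card:
  fixes a :: "int \<Rightarrow> 'b"
  assumes inv: "\<And>j k n. a j = a k \<Longrightarrow> a (j + n) = a (k + n)" and card: "card (range a) = l" and l: "l > 0"
  shows "a (k + int l * n) = a k"
proof -
  have fin: "finite (range a)" using card l card_gt_0_iff by metis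
  have "\<not> inj_on a {0..int l}"
  proof
    assume "inj_on a {0..int l}"
    then have "card {0..int l} = card (a ` {0..int l})" by (simp add: card_image)
    also have "\<dots> \<le> card (range a)" by (intro card_mono fin) auto
    finally show False using card by simp
  qed
  then obtain i j where ij: "i \<in> {0..int l}" "j \<in> {0..int l}" "a i = a j" "i < j"
    unfolding inj_on_def by (metis linorder_neqE)
  define d where "d = j - i"
  have d: "0 < d" "d \<le> int l" using ij by (auto simp: d_def)
  have step: "a (k + d) = a k" for k using inv[OF ij(3), of "k - i"] by (simp add: d_def algebra_simps)
  have "range a \<subseteq> a ` {0..<d}"
  proof
    fix x assume "x \<in> range a"
    then obtain k where "x = a k" by auto
    also have "\<dots> = a (k mod d)" using int_period_multiple[of a d "k mod d" "k div d", OF step] by simp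
    finally show "x \<in> a ` {0..<d}" using d(1) by auto
  qed
  then have "card (range a) \<le> card (a ` {0..<d})" by (intro card_mono) auto
  also have "\<dots> \<le> card {0..<d}" by (rule card_image_le) simp
  finally have "d = int l" using d card by simp
  then show ?thesis using int_period_multiple[of a "int l" k n] step by simp
qed

definition exp_coord :: "'m::finite \<Rightarrow> complex ^ 'm \<Rightarrow> complex ^ 'm" where
  "exp_coord m q = (\<chi> i. if i = m then exp (q $ m) else q $ i)"

definition exp_shift :: "'m::finite \<Rightarrow> int \<Rightarrow> complex ^ 'm" where
  "exp_shift m k = (of_int (2 * k) * complex_of_real pi * \<i>) *s axis m 1"

lemma exp_shift_add: "exp_shift m (j + k) = exp_shift m j + exp_shift m k"
  by (simp add: exp_shift_def vec_eq_iff algebra_simps)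

lemma exp_shift_0 [simp]: "exp_shift m 0 = 0"
  by (simp add: exp_shift_def)

lemma exp_coord_eq_iff: "exp_coord m p = exp_coord m q \<longleftrightarrow> (\<exists>k. p = q + exp_shift m k)"
proof -
  have 1: "exp_coord m p = exp_coord m q \<longleftrightarrow> exp (p $ m) = exp (q $ m) \<and> (\<forall>i. i \<noteq> m \<longrightarrow> p $ i = q $ i)"
    by (auto simp: exp_coord_def vec_eq_iff)
  have 2: "p = q + exp_shift m k \<longleftrightarrow> p $ m = q $ m + (of_int (2 * k) * complex_of_real pi) * \<i> \<and> (\<forall>i. i \<noteq> m \<longrightarrow> p $ i = q $ i)" for k
    unfolding exp_shift_def vec_eq_iff by (auto simp: axis_def)
  show ?thesis unfolding 1 2 exp_eq by simp
qed

lemma exp_coord_shift [simp]: "exp_coord m (q + exp_shift m k) = exp_coord m q"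
  unfolding exp_coord_eq_iff by blast

lemma holomorphic_Cn_exp_coord: "holomorphic_Cn (\<lambda>q. exp_coord m q $ i) S"
proof (cases "i = m")
  case True
  have "holomorphic_Cn (\<lambda>q. exp (q $ m)) S"
    by (rule holomorphic_Cn_compose_field[OF holomorphic_Cn_coord holomorphic_on_exp open_UNIV]) auto
  then show ?thesis using True by (simp add: exp_coord_def)
qed (simp add: exp_coord_def holomorphic_Cn_coord)

lemma continuous_on_exp_coord: "continuous_on S (exp_coord m)"
  unfolding exp_coord_def
proof (rule continuous_on_vec_lambda)
  show "continuous_on S (\<lambda>q. if i = m then exp (q $ m) else q $ i)" for i
    by (cases "i = m") (auto intro!: continuous_intros)
qed

text \<open>In logarithmic coordinates the punctured disc in direction \<open>m\<close> becomes a
  half plane, and the other discs are unchanged.\<close>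

lemma exp_coord_preimage_polydisc:
  assumes "r > 0"
  shows "open {q. exp_coord m q \<in> polydisc r}" "convex {q. exp_coord m q \<in> polydisc r}"
proof -
  have "open (exp_coord m -` polydisc r)"
    by (rule open_vimage[OF open_polydisc continuous_on_exp_coord])
  then show "open {q. exp_coord m q \<in> polydisc r}" by (simp add: vimage_def)
  have eq: "{q. exp_coord m q \<in> polydisc r} = (\<Inter>i\<in>-{m}. (\<lambda>q. q $ i) -` ball 0 r) \<inter> (\<lambda>q. q $ m) -` {z. Re z < ln r}" (is "?L = ?R")
  proof (rule set_eqI)
    fix q :: "complex ^ 'a"
    have "exp (Re (q $ m)) < r \<longleftrightarrow> Re (q $ m) < ln r" using assms by (metis exp_less_cancel_iff exp_ln)
    then show "q \<in> ?L \<longleftrightarrow> q \<in> ?R" unfolding polydisc_def exp_coord_def by (auto split: if_splits)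
  qed
  show "convex {q. exp_coord m q \<in> polydisc r}"
    unfolding eq
    by (intro convex_Int convex_INT convex_linear_vimage convex_ball convex_halfspace_Re_lt bounded_linear.linear bounded_linear_vec_nth)
qed

lemma exp_coord_Ln: "v $ m \<noteq> 0 \<Longrightarrow> exp_coord m (\<chi> i. if i = m then Ln (v $ m) else v $ i) = v"
  by (simp add: exp_coord_def vec_eq_iff)

text \<open>The quotient stays within distance 1 of 1, so its principal logarithm is continuous.
  This gives a local logarithm of \<open>y $ m\<close> even if \<open>v $ m\<close> lies on the
  cut.\<close>

lemma quotient_near_one:
  fixes v y :: "complex ^ 'm::finite"
  assumes "v $ m \<noteq> 0" "dist v y < norm (v $ m)"
  shows "y $ m / v $ m \<notin> \<real>\<^sub>\<le>\<^sub>0"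
proof
  assume "y $ m / v $ m \<in> \<real>\<^sub>\<le>\<^sub>0"
  then have "Re (y $ m / v $ m) \<le> 0" by (simp add: complex_nonpos_Reals_iff)
  then have "1 \<le> Re (1 - y $ m / v $ m)" by simp
  also have "\<dots> \<le> norm (1 - y $ m / v $ m)" by (rule complex_Re_le_cmod)
  also have "\<dots> = norm ((v - y) $ m) / norm (v $ m)" using assms(1) by (simp add: norm_divide[symmetric] diff_divide_distrib)
  also have "\<dots> \<le> norm (v - y) / norm (v $ m)" using Finite_Cartesian_Product.norm_nth_le[of "v - y" m] by (intro divide_right_mono) auto
  also have "\<dots> < 1" using assms by (simp add: dist_norm)
  finally show False by simp
qed

section \<open>Lifting a multi-valued function along a root\<close>

context
  fixes m :: "'m::finite" and l :: nat and r :: real and D :: "complex ^ 'm \<Rightarrow> complex"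
    and uu :: "complex ^ 'm \<Rightarrow> complex set" and Om :: "(complex ^ 'm) set"
  assumes l: "l > 0" and r: "r > 0"
    and D: "holomorphic_Cn D (polydisc r)" "\<exists>v\<in>polydisc r. D v \<noteq> 0"
    and Dm: "\<And>v. v \<in> polydisc r \<Longrightarrow> D v \<noteq> 0 \<Longrightarrow> v $ m \<noteq> 0"
    and Om: "Om = {v\<in>polydisc r. D v \<noteq> 0}"
    and sep: "separated_on Om uu" and card: "\<And>v. v \<in> Om \<Longrightarrow> card (uu v) = l"
    and hol_sections: "\<And>v. v \<in> Om \<Longrightarrow> \<exists>\<epsilon>>0. ball v \<epsilon> \<subseteq> Om \<and> (\<forall>y\<in>ball v \<epsilon>. \<forall>w\<in>uu y.
      \<exists>b. holomorphic_Cn b (ball v \<epsilon>) \<and> b y = w \<and> (\<forall>y'\<in>ball v \<epsilon>. b y' \<in> uu y'))"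
    and splits: "\<And>y. y \<in> polydisc r \<Longrightarrow> y $ m \<noteq> 0 \<Longrightarrow> \<exists>\<epsilon>>0. ball y \<epsilon> \<subseteq> polydisc r \<and> has_sections (ball y \<epsilon> \<inter> Om) uu"
    and transitive: "\<exists>v0\<in>Om. \<forall>S. (\<forall>v\<in>Om. S v \<subseteq> uu v) \<longrightarrow> (\<forall>v\<in>Om. \<exists>\<epsilon>>0. ball v \<epsilon> \<subseteq> Om \<and> has_sections (ball v \<epsilon>) S) \<longrightarrow>
      S v0 \<noteq> {} \<longrightarrow> uu v0 \<subseteq> S v0"
begin

lemma open_Om: "open Om"
  unfolding Om by (rule open_nonzero[OF holomorphic_Cn_continuous_on[OF D(1)] open_polydisc])

lemma Om_m: "v \<in> Om \<Longrightarrow> v $ m \<noteq> 0"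
  unfolding Om using Dm by auto

lemma exp_coord_Om_connected:
  assumes Q: "open Q" "convex Q" "Q \<noteq> {}" "Q \<subseteq> {q. exp_coord m q \<in> polydisc r}"
  shows "connected (Q \<inter> {q. exp_coord m q \<in> Om}) \<and> Q \<inter> {q. exp_coord m q \<in> Om} \<noteq> {}"
proof -
  let ?E = "{q. exp_coord m q \<in> polydisc r}" and ?D = "\<lambda>q. D (exp_coord m q)"
  have hol: "holomorphic_Cn ?D ?E"
    by (rule holomorphic_Cn_compose[OF D(1) holomorphic_Cn_exp_coord]) auto
  obtain v where v: "v \<in> polydisc r" "D v \<noteq> 0" using D(2) by blast
  let ?q = "\<chi> i. if i = m then Ln (v $ m) else v $ i"
  have q: "exp_coord m ?q = v" by (rule exp_coord_Ln[OF Dm[OF v]])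
  have q': "?q \<in> ?E" "?D ?q \<noteq> 0" unfolding mem_Collect_eq q by (rule v)+
  have "?E \<subseteq> closure {q\<in>?E. ?D q \<noteq> 0}"
    by (rule holomorphic_Cn_nonzero_dense[OF hol exp_coord_preimage_polydisc[OF r] q'])
  then have ne: "\<exists>x\<in>Q \<inter> ?E. ?D x \<noteq> 0" unfolding dense_iff using Q by blast
  have eq: "Q \<inter> {q. exp_coord m q \<in> Om} = {q\<in>Q. ?D q \<noteq> 0}" using Q(4) by (auto simp: Om)
  show ?thesis
    using holomorphic_Cn_nonzero_connected[OF holomorphic_Cn_subset[OF hol Q(4)] Q(1,2)] ne unfolding eq by blast
qed

text \<open>No point of the logarithmic domain lies over the hyperplane, so the local splitting
  assumed off the hyperplane is available everywhere after pulling back.\<close>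

lemma sections_over_logarithm: "has_sections {q. exp_coord m q \<in> Om} (\<lambda>q. uu (exp_coord m q))"
proof (rule global_sections)
  let ?E = "{q. exp_coord m q \<in> polydisc r}" and ?X = "{q. exp_coord m q \<in> Om}"
  show "open ?E" "convex ?E" by (rule exp_coord_preimage_polydisc[OF r])+
  show "open ?X"
    using open_vimage[OF open_Om continuous_on_exp_coord[of UNIV m]] by (simp add: vimage_def)
  show "?X \<subseteq> ?E" by (auto simp: Om)
  show "separated_on ?X (\<lambda>q. uu (exp_coord m q))"
    by (rule separated_on_compose[OF sep continuous_on_exp_coord]) auto
  show "connected (Q \<inter> ?X) \<and> Q \<inter> ?X \<noteq> {}" if "open Q" "convex Q" "Q \<noteq> {}" "Q \<subseteq> ?E" for Q
    by (rule exp_coord_Om_connected[OF that])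
  show "\<exists>\<epsilon>>0. ball p \<epsilon> \<subseteq> ?E \<and> has_sections (ball p \<epsilon> \<inter> ?X) (\<lambda>q. uu (exp_coord m q))" if p: "p \<in> ?E" for p
  proof -
    have "exp_coord m p \<in> polydisc r" "exp_coord m p $ m \<noteq> 0" using p by (auto simp: exp_coord_def)
    from splits[OF this] obtain \<epsilon> where \<epsilon>: "\<epsilon> > 0" "ball (exp_coord m p) \<epsilon> \<subseteq> polydisc r"
      "has_sections (ball (exp_coord m p) \<epsilon> \<inter> Om) uu" by blast
    have "open (exp_coord m -` ball (exp_coord m p) \<epsilon>)"
      by (rule open_vimage[OF open_ball continuous_on_exp_coord])
    then obtain d where d: "d > 0" "ball p d \<subseteq> exp_coord m -` ball (exp_coord m p) \<epsilon>"
      using \<epsilon>(1) unfolding open_contains_ball by force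
    have "has_sections (ball p d \<inter> ?X) (\<lambda>q. uu (exp_coord m q))"
      by (rule has_sections_compose[OF \<epsilon>(3) continuous_on_exp_coord]) (use d(2) in auto)
    then show ?thesis using d \<epsilon>(2) by (intro exI[of _ d]) auto
  qed
qed

lemma Om_connected: "connected Om"
  unfolding Om by (rule holomorphic_Cn_nonzero_connected[OF D(1) open_polydisc convex_polydisc])

lemma local_sections: "v \<in> Om \<Longrightarrow> \<exists>\<epsilon>>0. ball v \<epsilon> \<subseteq> Om \<and> has_sections (ball v \<epsilon>) uu"
proof -
  assume "v \<in> Om"
  from hol_sections[OF this] obtain \<epsilon> where e: "\<epsilon> > 0" "ball v \<epsilon> \<subseteq> Om"
    and b: "\<forall>y\<in>ball v \<epsilon>. \<forall>w\<in>uu y. \<exists>b. holomorphic_Cn b (ball v \<epsilon>) \<and> b y = w \<and> (\<forall>y'\<in>ball v \<epsilon>. b y' \<in> uu y')"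
    by (elim exE conjE)
  have "has_sections (ball v \<epsilon>) uu"
    unfolding has_sections_def is_section_def
  proof (intro ballI)
    fix y w assume "y \<in> ball v \<epsilon>" "w \<in> uu y"
    from b[rule_format, OF this] obtain b where "holomorphic_Cn b (ball v \<epsilon>)" "b y = w" "\<forall>y'\<in>ball v \<epsilon>. b y' \<in> uu y'"
      by (elim exE conjE)
    then show "\<exists>f. (continuous_on (ball v \<epsilon>) f \<and> (\<forall>y\<in>ball v \<epsilon>. f y \<in> uu y)) \<and> f y = w"
      by (intro exI[of _ b]) (auto intro: holomorphic_Cn_continuous_on)
  qed
  then show ?thesis using e by blast
qed

text \<open>The values of \<open>F\<close> at all logarithms of \<open>v\<close> form a subfamily
  with local sections, namely \<open>F\<close> composed with local logarithms. Transitivity, assumed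
  in a form that avoids curves, makes it exhaust \<open>uu\<close> at the base point and hence
  everywhere.\<close>

lemma section_values_cover:
  assumes F: "is_section {q. exp_coord m q \<in> Om} (\<lambda>q. uu (exp_coord m q)) F" and v: "v \<in> Om"
  shows "uu v = F ` {q. exp_coord m q = v}"
proof -
  define S where "S v = F ` {q. exp_coord m q = v}" for v
  have Fc: "continuous_on {q. exp_coord m q \<in> Om} F" and Fu: "\<And>q. exp_coord m q \<in> Om \<Longrightarrow> F q \<in> uu (exp_coord m q)"
    using F unfolding is_section_def by auto
  have sub: "S v \<subseteq> uu v" if "v \<in> Om" for v using Fu that by (auto simp: S_def)
  have loc: "\<exists>\<epsilon>>0. ball v \<epsilon> \<subseteq> Om \<and> has_sections (ball v \<epsilon>) S" if v: "v \<in> Om" for v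
  proof -
    obtain e where e: "e > 0" "ball v e \<subseteq> Om" using open_Om v open_contains_ball by blast
    define \<epsilon> where "\<epsilon> = min e (norm (v $ m))"
    have \<epsilon>: "\<epsilon> > 0" "ball v \<epsilon> \<subseteq> Om" using e Om_m[OF v] by (auto simp: \<epsilon>_def)
    define s where "s y = Ln (y $ m / v $ m)" for y
    have s: "continuous_on (ball v \<epsilon>) s"
      unfolding s_def using quotient_near_one[OF Om_m[OF v]] Om_m[OF v]
      by (intro continuous_intros) (auto simp: \<epsilon>_def)
    have exps: "exp (s y) = y $ m / v $ m" if "y \<in> ball v \<epsilon>" for y
      unfolding s_def using Om_m[OF v] Om_m[of y] that \<epsilon>(2) by auto
    have "has_sections (ball v \<epsilon>) S"
      unfolding has_sections_def
    proof (intro ballI)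
      fix y w assume y: "y \<in> ball v \<epsilon>" and "w \<in> S y"
      then obtain q where q: "exp_coord m q = y" "w = F q" by (auto simp: S_def)
      \<comment> \<open>The local logarithm is shifted by a constant so that it passes through
        \<open>q\<close>; thus every preimage of \<open>y\<close> has a section of its own.\<close>
      define \<sigma> where "\<sigma> y' = (\<chi> i. if i = m then s y' + (q $ m - s y) else y' $ i)" for y'
      have qm: "exp (q $ m) = y $ m" and qi: "\<And>i. i \<noteq> m \<Longrightarrow> y $ i = q $ i" using q(1) by (auto simp: exp_coord_def)
      have sy: "\<sigma> y = q" by (simp add: \<sigma>_def vec_eq_iff qi)
      have es: "exp_coord m (\<sigma> y') = y'" if y': "y' \<in> ball v \<epsilon>" for y'
      proof -
        have "exp (s y' + (q $ m - s y)) = y' $ m"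
          unfolding exp_add exp_diff exps[OF y] exps[OF y'] qm
          using Om_m[OF v] Om_m[of y] y \<epsilon>(2) by (auto simp: field_simps)
        then show ?thesis by (simp add: exp_coord_def \<sigma>_def vec_eq_iff)
      qed
      have "continuous_on (ball v \<epsilon>) \<sigma>"
        unfolding \<sigma>_def
      proof (rule continuous_on_vec_lambda)
        show "continuous_on (ball v \<epsilon>) (\<lambda>y'. if i = m then s y' + (q $ m - s y) else y' $ i)" for i
          by (cases "i = m") (auto intro!: continuous_intros s)
      qed
      then have "continuous_on (ball v \<epsilon>) (\<lambda>y'. F (\<sigma> y'))"
        by (rule continuous_on_compose2[OF Fc]) (use es \<epsilon>(2) in auto)
      moreover have "F (\<sigma> y') \<in> S y'" if "y' \<in> ball v \<epsilon>" for y' using es[OF that] by (auto simp: S_def)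
      ultimately show "\<exists>f. is_section (ball v \<epsilon>) S f \<and> f y = w"
        unfolding is_section_def using sy q(2) by (intro exI[of _ "\<lambda>y'. F (\<sigma> y')"]) auto
    qed
    then show ?thesis using \<epsilon> by blast
  qed
  from transitive obtain v0 where v0: "v0 \<in> Om" and tr: "\<forall>S. (\<forall>v\<in>Om. S v \<subseteq> uu v) \<longrightarrow> (\<forall>v\<in>Om. \<exists>\<epsilon>>0. ball v \<epsilon> \<subseteq> Om \<and> has_sections (ball v \<epsilon>) S) \<longrightarrow>
      S v0 \<noteq> {} \<longrightarrow> uu v0 \<subseteq> S v0" by (rule bexE)
  have "S v0 \<noteq> {}" unfolding S_def using exp_coord_Ln[OF Om_m[OF v0]] by blast
  then have "uu v0 \<subseteq> S v0" using tr[rule_format, of S] sub loc by blast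
  from sections_exhaust[OF sep open_Om Om_connected sub order_refl loc local_sections v0 this v]
  have "uu v \<subseteq> S v" .
  then show ?thesis using sub[OF v] by (auto simp: S_def)
qed

text \<open>Translates of \<open>F\<close> by periods of the exponential are sections of the same
  family, so two of them that agree at one point agree everywhere. As there are exactly
  \<open>l\<close> values, \<open>int_period_card\<close> yields the period.\<close>

lemma section_period:
  assumes F: "is_section {q. exp_coord m q \<in> Om} (\<lambda>q. uu (exp_coord m q)) F" and q: "exp_coord m q \<in> Om"
  shows "F (q + exp_shift m (int l * n)) = F q"
proof -
  let ?X = "{q. exp_coord m q \<in> Om}"
  define a where "a k = F (q + exp_shift m k)" for k
  have sepX: "separated_on ?X (\<lambda>q. uu (exp_coord m q))"
    by (rule separated_on_compose[OF sep continuous_on_exp_coord]) auto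
  have "?X \<subseteq> {q. exp_coord m q \<in> polydisc r}" by (auto simp: Om)
  then have X: "connected ?X"
    using exp_coord_Om_connected[OF exp_coord_preimage_polydisc[OF r, of m] _ order_refl] q by (auto simp: Int_absorb1)
  have sec: "is_section ?X (\<lambda>q. uu (exp_coord m q)) (\<lambda>p. F (p + exp_shift m k))" for k
    unfolding is_section_def
  proof
    show "continuous_on ?X (\<lambda>p. F (p + exp_shift m k))"
      by (rule continuous_on_compose2[of ?X F]) (use F in \<open>auto intro!: continuous_intros simp: is_section_def\<close>)
    show "\<forall>p\<in>?X. F (p + exp_shift m k) \<in> uu (exp_coord m p)"
    proof
      fix p assume "p \<in> ?X"
      then have "p + exp_shift m k \<in> ?X" by simp
      then have "F (p + exp_shift m k) \<in> uu (exp_coord m (p + exp_shift m k))" using F unfolding is_section_def by blast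
      then show "F (p + exp_shift m k) \<in> uu (exp_coord m p)" by simp
    qed
  qed
  have inv: "a (j + n) = a (k + n)" if jk: "a j = a k" for j k n
  proof -
    have "F ((q + exp_shift m n) + exp_shift m j) = F ((q + exp_shift m n) + exp_shift m k)"
      by (rule section_unique[OF sepX X order_refl sec sec, of q]) (use q jk in \<open>auto simp: a_def\<close>)
    then show ?thesis by (simp add: a_def exp_shift_add add_ac)
  qed
  have "{p. exp_coord m p = exp_coord m q} = range (\<lambda>k. q + exp_shift m k)" by (auto simp: exp_coord_eq_iff)
  then have "range a = uu (exp_coord m q)"
    unfolding section_values_cover[OF F q] by (simp add: image_image a_def[abs_def])
  then have "card (range a) = l" using card[OF q] by simp
  from int_period_card[of a, OF inv this l, of 0 n] show ?thesis by (simp add: a_def)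
qed

text \<open>\<open>F\<close> is evaluated at \<open>l\<close> times a logarithm of the root. Another
  branch of the logarithm changes this argument by a multiple of the period of \<open>F\<close>, so
  the result is single-valued and continuous across the cut.\<close>

lemma multivalued_lift:
  obtains f where "holomorphic_Cn f {q. ramify m l q \<in> Om}" "\<And>v. v \<in> Om \<Longrightarrow> uu v = f ` {q. ramify m l q = v}"
proof -
  let ?X = "{q. exp_coord m q \<in> Om}" and ?Y = "{q. ramify m l q \<in> Om}"
  obtain v0 where v0: "v0 \<in> Om" using transitive by blast
  have "uu v0 \<noteq> {}" using card[OF v0] l by auto
  then obtain w0 where "w0 \<in> uu v0" by blast
  moreover have "exp_coord m (\<chi> i. if i = m then Ln (v0 $ m) else v0 $ i) = v0" by (rule exp_coord_Ln[OF Om_m[OF v0]])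
  ultimately obtain F where F: "is_section ?X (\<lambda>q. uu (exp_coord m q)) F"
    using has_sectionsE[OF sections_over_logarithm, of "\<chi> i. if i = m then Ln (v0 $ m) else v0 $ i" w0] v0 by auto
  have Fc: "continuous_on ?X F" using F by (simp add: is_section_def)
  define L where "L q = (\<chi> i. if i = m then of_nat l * Ln (q $ m) else q $ i)" for q :: "complex ^ 'm"
  define f where "f q = F (L q)" for q
  have Ym: "q $ m \<noteq> 0" if "ramify m l q \<in> Om" for q
    using Om_m[OF that] l by (auto simp: ramify_nth)
  have expL: "exp_coord m (L q) = ramify m l q" if "q $ m \<noteq> 0" for q
    using that unfolding vec_eq_iff by (simp add: exp_coord_def L_def ramify_nth exp_of_nat_mult)
  have FL: "F p = F p'" if "exp_coord m p \<in> Om" "p' $ m = p $ m + of_nat l * (of_int (2 * k) * complex_of_real pi * \<i>)"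
    "\<And>i. i \<noteq> m \<Longrightarrow> p' $ i = p $ i" for p p' k
  proof -
    have "p' = p + exp_shift m (int l * k)"
      unfolding vec_eq_iff exp_shift_def using that(2,3) by (auto simp: axis_def algebra_simps)
    then show ?thesis using section_period[OF F that(1)] by simp
  qed
  have openY: "open ?Y"
    using open_vimage[OF open_Om continuous_on_ramify[of UNIV m l]] by (simp add: vimage_def)
  have sepY: "separated_on ?Y (\<lambda>q. uu (ramify m l q))"
    by (rule separated_on_compose[OF sep continuous_on_ramify]) auto
  have f_mem: "f q \<in> uu (ramify m l q)" if q: "q \<in> ?Y" for q
  proof -
    have "exp_coord m (L q) = ramify m l q" using expL Ym q by blast
    then show ?thesis using F q unfolding is_section_def f_def by (metis mem_Collect_eq)
  qed
  have fc: "continuous_on ?Y f"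
  proof (rule continuous_on_local[OF openY])
    fix p assume p: "p \<in> ?Y"
    then have pm: "p $ m \<noteq> 0" using Ym by blast
    let ?T = "ball p (norm (p $ m))"
    \<comment> \<open>Near \<open>p\<close> a continuous branch replaces the principal logarithm,
      which jumps at the cut; by \<open>FL\<close> the values of \<open>F\<close> stay the
      same.\<close>
    define L1 where "L1 q = (\<chi> i. if i = m then of_nat l * (Ln (q $ m / p $ m) + Ln (p $ m)) else q $ i)" for q :: "complex ^ 'm"
    have L1c: "continuous_on (?T \<inter> ?Y) L1"
      unfolding L1_def
    proof (rule continuous_on_vec_lambda)
      show "continuous_on (?T \<inter> ?Y) (\<lambda>q. if i = m then of_nat l * (Ln (q $ m / p $ m) + Ln (p $ m)) else q $ i)" for i
        using quotient_near_one[OF pm] pm by (cases "i = m") (auto intro!: continuous_intros)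
    qed
    have L1e: "exp_coord m (L1 q) = ramify m l q" if "q \<in> ?Y" for q
      using Ym[of q] pm that unfolding vec_eq_iff
      by (simp add: exp_coord_def L1_def ramify_nth exp_of_nat_mult exp_add)
    have "continuous_on (?T \<inter> ?Y) (\<lambda>q. F (L1 q))"
      by (rule continuous_on_compose2[OF Fc L1c]) (use L1e in auto)
    moreover have "f q = F (L1 q)" if q: "q \<in> ?Y" for q
    proof -
      have "exp (Ln (q $ m / p $ m) + Ln (p $ m)) = exp (Ln (q $ m))" using Ym[of q] pm q by (simp add: exp_add)
      then obtain k where k: "Ln (q $ m / p $ m) + Ln (p $ m) = Ln (q $ m) + (of_int (2 * k) * complex_of_real pi) * \<i>"
        unfolding exp_eq of_real_mult of_real_of_int_eq by blast
      show ?thesis unfolding f_def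
      proof (rule FL[of _ _ k])
        show "exp_coord m (L q) \<in> Om" using expL[OF Ym[of q]] q by simp
      qed (simp_all add: L_def L1_def k distrib_left)
    qed
    ultimately show "\<exists>T g. open T \<and> p \<in> T \<and> continuous_on (T \<inter> ?Y) g \<and> (\<forall>y\<in>T \<inter> ?Y. f y = g y)"
      using pm by (intro exI[of _ ?T] exI[of _ "\<lambda>q. F (L1 q)"]) auto
  qed
  \<comment> \<open>A continuous section agrees with a holomorphic branch near each point by
    uniqueness of sections, so continuity is enough.\<close>
  have "holomorphic_Cn f ?Y"
  proof (rule holomorphic_Cn_local)
    fix p assume p: "p \<in> ?Y"
    then have "ramify m l p \<in> Om" by simp
    from hol_sections[OF this] obtain \<epsilon> where e: "\<epsilon> > 0" "ball (ramify m l p) \<epsilon> \<subseteq> Om"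
      and b: "\<forall>y\<in>ball (ramify m l p) \<epsilon>. \<forall>w\<in>uu y. \<exists>b. holomorphic_Cn b (ball (ramify m l p) \<epsilon>) \<and> b y = w \<and> (\<forall>y'\<in>ball (ramify m l p) \<epsilon>. b y' \<in> uu y')"
      by (elim exE conjE)
    have ctr: "ramify m l p \<in> ball (ramify m l p) \<epsilon>" using e(1) by simp
    from b[rule_format, OF ctr f_mem[OF p]] obtain b where b: "holomorphic_Cn b (ball (ramify m l p) \<epsilon>)" "b (ramify m l p) = f p"
      "\<forall>y'\<in>ball (ramify m l p) \<epsilon>. b y' \<in> uu y'"
      by (elim exE conjE)
    have "open (ramify m l -` ball (ramify m l p) \<epsilon>)" by (rule open_vimage[OF open_ball continuous_on_ramify])
    then obtain d where d: "d > 0" "ball p d \<subseteq> ramify m l -` ball (ramify m l p) \<epsilon>"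
      using e(1) unfolding open_contains_ball by force
    have dY: "ball p d \<subseteq> ?Y" using d(2) e(2) by auto
    have hb: "holomorphic_Cn (\<lambda>q. b (ramify m l q)) (ball p d)"
      by (rule holomorphic_Cn_compose[OF b(1) holomorphic_Cn_ramify]) (use d(2) in auto)
    have "b (ramify m l q) = f q" if q: "q \<in> ball p d" for q
    proof (rule section_unique[OF sepY connected_ball dY _ _ _ _ q, where q=p])
      show "is_section (ball p d) (\<lambda>q. uu (ramify m l q)) (\<lambda>q. b (ramify m l q))"
        unfolding is_section_def using holomorphic_Cn_continuous_on[OF hb] b(3) d(2) by auto
      show "is_section (ball p d) (\<lambda>q. uu (ramify m l q)) f"
        unfolding is_section_def using continuous_on_subset[OF fc dY] f_mem dY by blast
    qed (use d(1) b(2) in auto)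
    then have "holomorphic_Cn f (ball p d)" by (intro holomorphic_Cn_transform[OF hb open_ball])
    then show "\<exists>T. p \<in> T \<and> holomorphic_Cn f T" using d(1) by (intro exI[of _ "ball p d"]) simp
  qed
  moreover have "uu v = f ` {q. ramify m l q = v}" if v: "v \<in> Om" for v
  proof (rule equalityI; rule subsetI)
    fix w assume "w \<in> uu v"
    then obtain p where p: "exp_coord m p = v" "w = F p" unfolding section_values_cover[OF F v] by auto
    \<comment> \<open>Dividing the logarithm by \<open>l\<close> extracts a root, so every value of
      \<open>F\<close> over \<open>v\<close> is a value of \<open>f\<close>.\<close>
    define q where "q = (\<chi> i. if i = m then exp (p $ m / of_nat l) else p $ i)"
    have "exp (p $ m / of_nat l) ^ l = exp (p $ m)"
      using l by (simp flip: exp_of_nat_mult)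
    then have q: "ramify m l q = v" unfolding vec_eq_iff using p(1) by (auto simp: ramify_nth q_def exp_coord_def)
    have "exp (Ln (q $ m)) = exp (p $ m / of_nat l)" by (simp add: q_def)
    then obtain k where k: "Ln (q $ m) = p $ m / of_nat l + (of_int (2 * k) * complex_of_real pi) * \<i>"
      unfolding exp_eq of_real_mult of_real_of_int_eq by blast
    have "F p = f q"
      unfolding f_def
    proof (rule FL[of _ _ k])
      show "exp_coord m p \<in> Om" using p(1) v by simp
      show "L q $ m = p $ m + of_nat l * (of_int (2 * k) * complex_of_real pi * \<i>)"
        using l by (simp add: L_def k distrib_left)
      show "L q $ i = p $ i" if "i \<noteq> m" for i using that by (simp add: L_def q_def)
    qed
    then show "w \<in> f ` {q. ramify m l q = v}" using p(2) q by blast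
  next
    fix w assume "w \<in> f ` {q. ramify m l q = v}"
    then show "w \<in> uu v" using f_mem v by auto
  qed
  ultimately show thesis by (rule that)
qed

text \<open>The lift may have poles, but \<alpha> times it is locally bounded and extends across the
  zeros of \<open>D\<close>; division by \<alpha> gives the quotient demanded by
  \<open>puiseux_expansion_of_lift\<close>.\<close>

theorem puiseux_expansion_of_multivalued:
  assumes \<alpha>: "holomorphic_Cn \<alpha> (polydisc r)" "\<And>v. v \<in> Om \<Longrightarrow> \<alpha> v \<noteq> 0"
    and bd: "\<And>p. p \<in> polydisc r \<Longrightarrow> \<exists>T K. open T \<and> p \<in> T \<and> (\<forall>v\<in>T \<inter> Om. \<forall>w\<in>uu v. norm (\<alpha> v * w) \<le> K)"
    and uucl: "\<And>v. v \<in> polydisc r \<Longrightarrow> uu v = {w. (v, w) \<in> closure {(v, w). v \<in> Om \<and> w \<in> uu v}}"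
    and z: "snd c ` fst c = polydisc r" and u: "\<And>x. x \<in> fst c \<Longrightarrow> u x = uu (snd c x)"
  shows "\<exists>\<tau> B. has_puiseux_expansion m l c r \<tau> B u"
proof -
  obtain f where f: "holomorphic_Cn f {q. ramify m l q \<in> Om}" "\<And>v. v \<in> Om \<Longrightarrow> uu v = f ` {q. ramify m l q = v}"
    by (rule multivalued_lift) blast
  let ?R = "ramified_disc m l r"
  note R = ramified_disc_def[OF l r]
  have hol: "holomorphic_Cn (\<lambda>q. h (ramify m l q)) ?R" if "holomorphic_Cn h (polydisc r)" for h
    by (rule holomorphic_Cn_compose[OF that holomorphic_Cn_ramify]) (auto simp: R)
  have Y: "{q\<in>?R. D (ramify m l q) \<noteq> 0} = {q. ramify m l q \<in> Om}" by (auto simp: R Om)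
  have g0: "holomorphic_Cn (\<lambda>q. \<alpha> (ramify m l q) * f q) {q\<in>?R. D (ramify m l q) \<noteq> 0}"
    unfolding Y by (intro holomorphic_Cn_mult f(1) holomorphic_Cn_subset[OF hol[OF \<alpha>(1)]]) (auto simp: R Om)
  have bd': "\<exists>T K. open T \<and> p \<in> T \<and> (\<forall>q\<in>T \<inter> ?R. D (ramify m l q) \<noteq> 0 \<longrightarrow> norm (\<alpha> (ramify m l q) * f q) \<le> K)" if p: "p \<in> ?R" for p
  proof -
    have "ramify m l p \<in> polydisc r" using p by (simp add: R)
    from bd[OF this] obtain T K where T: "open T" "ramify m l p \<in> T" "\<forall>v\<in>T \<inter> Om. \<forall>w\<in>uu v. norm (\<alpha> v * w) \<le> K"
      by (elim exE conjE)
    have "norm (\<alpha> (ramify m l q) * f q) \<le> K" if "ramify m l q \<in> T" "ramify m l q \<in> Om" for q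
      using T(3) that f(2)[OF that(2)] by blast
    then show ?thesis
      using T(1,2) open_vimage[OF T(1) continuous_on_ramify[of UNIV m l]]
      by (intro exI[of _ "ramify m l -` T"] exI[of _ K]) (auto simp: R Om)
  qed
  obtain g where g: "holomorphic_Cn g ?R" "\<And>q. q \<in> ?R \<Longrightarrow> D (ramify m l q) \<noteq> 0 \<Longrightarrow> g q = \<alpha> (ramify m l q) * f q"
    by (rule riemann_extension[OF ramified_disc_open[OF l r] hol[OF D(1)] dense_ramify[OF l r D] g0 bd']) blast+
  show ?thesis
  proof (rule puiseux_expansion_of_lift[where uu=uu and g=g and a="\<lambda>q. \<alpha> (ramify m l q)" and D=D])
    show "holomorphic_Cn (\<lambda>q. \<alpha> (ramify m l q)) ?R" by (rule hol[OF \<alpha>(1)])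
    show "v $ m \<noteq> 0" if "v \<in> polydisc r" "D v \<noteq> 0" for v by (rule Dm[OF that])
    show "u x = uu (snd c x)" if "x \<in> fst c" for x by (rule u[OF that])
    show "\<alpha> (ramify m l q) \<noteq> 0" if "q \<in> ?R" "D (ramify m l q) \<noteq> 0" for q
      using that \<alpha>(2) by (auto simp: R Om)
    show "uu v = (\<lambda>q. g q / \<alpha> (ramify m l q)) ` {q. ramify m l q = v}" if v: "v \<in> polydisc r" "D v \<noteq> 0" for v
    proof -
      have vO: "v \<in> Om" using v by (simp add: Om)
      have "g q / \<alpha> (ramify m l q) = f q" if "ramify m l q = v" for q
        using g(2)[of q] that v \<alpha>(2)[OF vO] by (simp add: R)
      then show ?thesis unfolding f(2)[OF vO] by (intro image_cong) auto
    qed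
    show "uu v = {w. (v, w) \<in> closure {(v, w). (v \<in> polydisc r \<and> D v \<noteq> 0) \<and> w \<in> uu v}}" if "v \<in> polydisc r" for v
      using uucl[OF that] by (simp add: Om)
  qed (fact l r g(1) D z)+
qed

end

section \<open>Algebroid functions near a smooth branch set\<close>

text \<open>Cauchy's bound: for \<open>norm t > 1\<close> the lower terms are at most their
  coefficients times the power \<open>\<nu> - 1\<close> of \<open>norm t\<close>, which is then
  cancelled.\<close>

lemma norm_root_bound:
  fixes t :: complex and c :: "nat \<Rightarrow> complex"
  assumes \<nu>: "\<nu> > 0" and eq: "t ^ \<nu> + (\<Sum>k<\<nu>. c k * t ^ k) = 0"
  shows "norm t \<le> 1 + (\<Sum>k<\<nu>. norm (c k))"
proof (cases "norm t \<le> 1")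
  case True
  then show ?thesis using sum_nonneg[of "{..<\<nu>}" "\<lambda>k. norm (c k)"] by simp
next
  case False
  have "norm t * norm t ^ (\<nu> - 1) = norm (t ^ \<nu>)" using \<nu> by (simp add: norm_power flip: power_Suc)
  also have "t ^ \<nu> = - (\<Sum>k<\<nu>. c k * t ^ k)" using eq by (simp add: eq_neg_iff_add_eq_0)
  also have "norm \<dots> \<le> (\<Sum>k<\<nu>. norm (c k * t ^ k))" unfolding norm_minus_cancel by (rule norm_sum)
  also have "\<dots> \<le> (\<Sum>k<\<nu>. norm (c k) * norm t ^ (\<nu> - 1))"
    unfolding norm_mult norm_power using False \<nu> by (intro sum_mono mult_left_mono power_increasing) auto
  also have "\<dots> = (\<Sum>k<\<nu>. norm (c k)) * norm t ^ (\<nu> - 1)" by (simp add: sum_distrib_right)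
  finally have "norm t \<le> (\<Sum>k<\<nu>. norm (c k))"
    by (rule mult_right_le_imp_le) (use False in \<open>intro zero_less_power, linarith\<close>)
  then show ?thesis by simp
qed

text \<open>Multiplied by the power \<open>\<nu> - 1\<close> of its leading coefficient, the
  equation becomes monic in the product of that coefficient with the root; its new coefficients stay
  bounded near the poles of the root.\<close>

lemma leading_times_root_bound:
  assumes \<nu>: "\<nu> > 0" and w: "poly (local_poly A \<nu> i x) w = 0"
  shows "norm (A \<nu> i x * w) \<le> 1 + (\<Sum>k<\<nu>. norm (A k i x * A \<nu> i x ^ (\<nu> - 1 - k)))"
proof (rule norm_root_bound[OF \<nu>])
  let ?a = "A \<nu> i x"
  have p: "(\<Sum>k<\<nu>. A k i x * w ^ k) + ?a * w ^ \<nu> = 0"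
    using w unfolding local_poly_def poly_sum poly_monom by (simp add: lessThan_Suc_atMost[symmetric] ac_simps)
  have "(?a * w) ^ \<nu> = ?a ^ (\<nu> - 1) * (?a * w ^ \<nu>)"
    using \<nu> by (cases \<nu>) (simp_all add: power_mult_distrib ac_simps)
  moreover have "A k i x * ?a ^ (\<nu> - 1 - k) * (?a * w) ^ k = ?a ^ (\<nu> - 1) * (A k i x * w ^ k)" if "k < \<nu>" for k
  proof -
    have "?a ^ (\<nu> - 1) = ?a ^ (\<nu> - 1 - k) * ?a ^ k" using that by (simp flip: power_add)
    then show ?thesis by (simp add: power_mult_distrib ac_simps)
  qed
  then have "(\<Sum>k<\<nu>. A k i x * ?a ^ (\<nu> - 1 - k) * (?a * w) ^ k) = ?a ^ (\<nu> - 1) * (\<Sum>k<\<nu>. A k i x * w ^ k)"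
    unfolding sum_distrib_left by (intro sum.cong) auto
  ultimately have "(?a * w) ^ \<nu> + (\<Sum>k<\<nu>. A k i x * ?a ^ (\<nu> - 1 - k) * (?a * w) ^ k) =
      ?a ^ (\<nu> - 1) * ((\<Sum>k<\<nu>. A k i x * w ^ k) + ?a * w ^ \<nu>)"
    by (simp add: algebra_simps)
  then show "(?a * w) ^ \<nu> + (\<Sum>k<\<nu>. A k i x * ?a ^ (\<nu> - 1 - k) * (?a * w) ^ k) = 0" unfolding p by simp
qed

text \<open>Real orthogonality controls only the real part of the Hermitian product; since
  \<open>L\<close> is closed under multiplication by \<i>, the imaginary part vanishes as
  well.\<close>

lemma complex_hyperplane:
  fixes L :: "(complex ^ 'm::finite) set"
  assumes L: "vec.subspace L" "L \<noteq> UNIV"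
  obtains x :: "complex ^ 'm" where "x \<noteq> 0" "\<forall>y\<in>L. (\<Sum>i\<in>UNIV. cnj (x $ i) * y $ i) = 0"
proof -
  have "subspace L"
    unfolding subspace_def
  proof (intro conjI ballI allI)
    show "0 \<in> L" by (rule vec.subspace_0[OF L(1)])
    show "x + y \<in> L" if "x \<in> L" "y \<in> L" for x y by (rule vec.subspace_add[OF L(1) that])
    show "c *\<^sub>R x \<in> L" if "x \<in> L" for c x
    proof -
      have "c *\<^sub>R x = complex_of_real c *s x"
        unfolding vec_eq_iff vector_scaleR_component vector_smult_component by (simp add: scaleR_conv_of_real)
      then show ?thesis using vec.subspace_scale[OF L(1) that] by simp
    qed
  qed
  then have span: "span L = L" by (simp add: span_eq_iff)
  have "span L \<subset> span UNIV" unfolding span using L(2) by auto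
  then obtain x where x: "x \<noteq> 0" "\<And>y. y \<in> span L \<Longrightarrow> orthogonal x y"
    by (rule orthogonal_to_subspace_exists_gen) blast
  let ?\<phi> = "\<lambda>y. \<Sum>i\<in>UNIV. cnj (x $ i) * y $ i"
  have Re: "Re (?\<phi> y) = 0" if "y \<in> L" for y
  proof -
    have "x \<bullet> y = 0" using x(2)[of y] that by (simp add: span orthogonal_def)
    then show ?thesis by (simp add: inner_vec_def inner_complex_def)
  qed
  have "?\<phi> y = 0" if y: "y \<in> L" for y
  proof (rule complex_eqI)
    show "Re (?\<phi> y) = Re 0" using Re[OF y] by simp
    have "?\<phi> (\<i> *s y) = \<i> * ?\<phi> y" by (simp add: sum_distrib_left ac_simps)
    then have "Re (\<i> * ?\<phi> y) = 0" using Re[OF vec.subspace_scale[OF L(1) y, of \<i>]] by simp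
    then show "Im (?\<phi> y) = Im 0" by simp
  qed
  with x(1) show thesis by (intro that) auto
qed

text \<open>The form becomes coordinate \<open>m\<close>, the old coordinate \<open>m\<close> moves
  to a place \<open>j\<close> where the form has a nonzero coefficient, and the old coordinate
  \<open>j\<close> is recovered by solving the form for it. The case \<open>j = m\<close> is
  included.\<close>

lemma linear_coordinate_change:
  fixes x :: "complex ^ 'm::finite" and m :: 'm
  assumes x: "x \<noteq> 0"
  obtains T T' :: "complex ^ 'm \<Rightarrow> complex ^ 'm" where
    "\<forall>i. holomorphic_Cn (\<lambda>z. T z $ i) UNIV" "\<forall>i. holomorphic_Cn (\<lambda>z. T' z $ i) UNIV"
    "\<forall>z. T' (T z) = z" "\<forall>z. T (T' z) = z" "T 0 = 0" "\<forall>z. T z $ m = (\<Sum>i\<in>UNIV. cnj (x $ i) * z $ i)"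
proof -
  obtain j where j: "x $ j \<noteq> 0" using x by (auto simp: vec_eq_iff)
  let ?\<phi> = "\<lambda>y. \<Sum>i\<in>UNIV. cnj (x $ i) * y $ i"
  define T :: "complex ^ 'm \<Rightarrow> complex ^ 'm" where "T v = (\<chi> i. if i = m then ?\<phi> v else if i = j then v $ m else v $ i)" for v
  \<comment> \<open>The old coordinates other than \<open>j\<close>, read off from the new
    ones.\<close>
  define p :: "complex ^ 'm \<Rightarrow> 'm \<Rightarrow> complex" where "p w i = (if i = m then w $ j else w $ i)" for w i
  define T' :: "complex ^ 'm \<Rightarrow> complex ^ 'm" where
    "T' w = (\<chi> i. if i = j then (w $ m - (\<Sum>k\<in>-{j}. cnj (x $ k) * p w k)) / cnj (x $ j) else p w i)" for w
  have split: "?\<phi> v = cnj (x $ j) * v $ j + (\<Sum>k\<in>-{j}. cnj (x $ k) * v $ k)" for v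
    by (simp add: sum.remove[of UNIV j] Compl_eq_Diff_UNIV)
  have hp: "holomorphic_Cn (\<lambda>w. p w i) UNIV" for i
    unfolding p_def by (cases "i = m") (simp_all add: holomorphic_Cn_coord)
  have "holomorphic_Cn (\<lambda>z. T z $ i) UNIV" for i
  proof -
    have "holomorphic_Cn ?\<phi> UNIV"
      by (intro holomorphic_Cn_sum holomorphic_Cn_mult holomorphic_Cn_const holomorphic_Cn_coord)
    then show ?thesis unfolding T_def by (cases "i = m"; cases "i = j") (simp_all add: holomorphic_Cn_coord)
  qed
  moreover have "holomorphic_Cn (\<lambda>z. T' z $ i) UNIV" for i
  proof -
    have "holomorphic_Cn (\<lambda>w. (w $ m - (\<Sum>k\<in>-{j}. cnj (x $ k) * p w k)) / cnj (x $ j)) UNIV"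
      by (intro holomorphic_Cn_divide holomorphic_Cn_diff holomorphic_Cn_sum holomorphic_Cn_mult holomorphic_Cn_const
          holomorphic_Cn_coord hp) (use j in auto)
    then show ?thesis unfolding T'_def by (cases "i = j") (simp_all add: hp)
  qed
  moreover have "T' (T v) = v" for v
  proof -
    have pv: "p (T v) i = v $ i" if "i \<noteq> j" for i using that by (auto simp: p_def T_def)
    have "(\<Sum>k\<in>-{j}. cnj (x $ k) * p (T v) k) = (\<Sum>k\<in>-{j}. cnj (x $ k) * v $ k)"
      by (rule sum.cong) (auto simp: pv)
    moreover have "T v $ m = ?\<phi> v" by (simp add: T_def)
    ultimately have "T' (T v) $ j = v $ j" unfolding split T'_def using j by simp
    moreover have "T' (T v) $ i = v $ i" if "i \<noteq> j" for i using that pv by (simp add: T'_def)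
    ultimately show ?thesis unfolding vec_eq_iff by metis
  qed
  moreover have "T (T' w) = w" for w
  proof -
    have "(\<Sum>k\<in>-{j}. cnj (x $ k) * T' w $ k) = (\<Sum>k\<in>-{j}. cnj (x $ k) * p w k)"
      by (rule sum.cong) (auto simp: T'_def)
    moreover have "cnj (x $ j) * T' w $ j = w $ m - (\<Sum>k\<in>-{j}. cnj (x $ k) * p w k)"
      using j by (simp add: T'_def)
    ultimately have \<phi>: "?\<phi> (T' w) = w $ m" unfolding split by simp
    have "T (T' w) $ i = w $ i" for i
    proof (cases "i = m")
      case True
      then show ?thesis using \<phi> by (simp add: T_def)
    next
      case False
      then show ?thesis by (cases "i = j") (simp_all add: T_def T'_def p_def)
    qed
    then show ?thesis unfolding vec_eq_iff by blast
  qed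
  moreover have "T 0 = 0" by (simp add: T_def vec_eq_iff)
  moreover have "T v $ m = ?\<phi> v" for v by (simp add: T_def)
  ultimately show thesis by (intro that[of T T']) auto
qed

section \<open>Solutions near regular points in arbitrary coordinates\<close>

context
  fixes \<A> :: "('a::{t2_space,second_countable_topology}, 'm::finite) chart set"
    and U :: "'i \<Rightarrow> 'a set" and A :: "nat \<Rightarrow> 'i \<Rightarrow> 'a \<Rightarrow> complex" and \<nu> :: nat
  assumes M: "complex_manifold \<A>" and cs: "coefficient_system \<A> U A \<nu>" and \<nu>: "\<nu> > 0"
begin

lemma solutions_separated:
  assumes c: "holomorphic_coordinate \<A> c" and X: "X \<subseteq> snd c ` fst c" "\<And>v. v \<in> X \<Longrightarrow> chart_inv c v \<in> regular_points U A \<nu>"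
  shows "separated_on X (\<lambda>v. solutions U A \<nu> (chart_inv c v))"
proof (rule separated_onI)
  fix q assume q: "q \<in> X"
  note tc = holomorphic_coordinate_topological[OF c]
  have q': "snd c (chart_inv c q) = q" "chart_inv c q \<in> fst c"
    using snd_chart_inv[OF tc] chart_inv_in[OF tc] q X(1) by auto
  obtain \<epsilon> \<delta> where "\<epsilon> > 0" "\<delta> > 0" "\<forall>y\<in>ball q \<epsilon>. \<forall>w\<in>solutions U A \<nu> (chart_inv c y). \<forall>w'\<in>solutions U A \<nu> (chart_inv c y). w \<noteq> w' \<longrightarrow> \<delta> \<le> dist w w'"
    by (rule regular_local[OF M cs \<nu> c X(2)[OF q] q'(2), unfolded q'(1)])
  then show "\<exists>\<epsilon> \<delta>. \<epsilon> > 0 \<and> \<delta> > 0 \<and> (\<forall>y w w'. y \<in> X \<longrightarrow> dist q y < \<epsilon> \<longrightarrow>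
      w \<in> solutions U A \<nu> (chart_inv c y) \<longrightarrow> w' \<in> solutions U A \<nu> (chart_inv c y) \<longrightarrow> w \<noteq> w' \<longrightarrow> \<delta> \<le> dist w w')"
    by - (rule exI[of _ \<epsilon>], rule exI[of _ \<delta>], auto)
qed

lemma regular_sections:
  assumes c: "holomorphic_coordinate \<A> c" and v: "v \<in> snd c ` fst c" "chart_inv c v \<in> regular_points U A \<nu>" and O: "open O'" "v \<in> O'"
  obtains \<epsilon> where "\<epsilon> > 0" "ball v \<epsilon> \<subseteq> snd c ` fst c \<inter> O'" "\<forall>y\<in>ball v \<epsilon>. chart_inv c y \<in> regular_points U A \<nu>"
    "\<forall>y\<in>ball v \<epsilon>. \<forall>w\<in>solutions U A \<nu> (chart_inv c y). \<exists>b. holomorphic_Cn b (ball v \<epsilon>) \<and> b y = w \<and>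
      (\<forall>y'\<in>ball v \<epsilon>. b y' \<in> solutions U A \<nu> (chart_inv c y'))"
proof -
  note tc = holomorphic_coordinate_topological[OF c]
  have q': "snd c (chart_inv c v) = v" "chart_inv c v \<in> fst c"
    using snd_chart_inv[OF tc] chart_inv_in[OF tc] v(1) by auto
  obtain \<epsilon> where e: "\<epsilon> > 0" "ball v \<epsilon> \<subseteq> snd c ` fst c" "\<forall>y\<in>ball v \<epsilon>. chart_inv c y \<in> regular_points U A \<nu>"
    "\<forall>y\<in>ball v \<epsilon>. \<forall>w\<in>solutions U A \<nu> (chart_inv c y). \<exists>b. holomorphic_Cn b (ball v \<epsilon>) \<and> b y = w \<and>
      (\<forall>y'\<in>ball v \<epsilon>. b y' \<in> solutions U A \<nu> (chart_inv c y'))"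
    by (rule regular_local[OF M cs \<nu> c v(2) q'(2), unfolded q'(1)])
  obtain d where d: "d > 0" "ball v d \<subseteq> O'" using O open_contains_ball by blast
  have sub: "ball v (min \<epsilon> d) \<subseteq> ball v \<epsilon>" "ball v (min \<epsilon> d) \<subseteq> ball v d" by auto
  show thesis
  proof (rule that[of "min \<epsilon> d"])
    show "\<forall>y\<in>ball v (min \<epsilon> d). \<forall>w\<in>solutions U A \<nu> (chart_inv c y). \<exists>b. holomorphic_Cn b (ball v (min \<epsilon> d)) \<and> b y = w \<and>
      (\<forall>y'\<in>ball v (min \<epsilon> d). b y' \<in> solutions U A \<nu> (chart_inv c y'))"
    proof (intro ballI)
      fix y w assume y: "y \<in> ball v (min \<epsilon> d)" "w \<in> solutions U A \<nu> (chart_inv c y)"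
      then have "y \<in> ball v \<epsilon>" using sub by auto
      from e(4)[rule_format, OF this y(2)] obtain b where "holomorphic_Cn b (ball v \<epsilon>)" "b y = w"
        "\<forall>y'\<in>ball v \<epsilon>. b y' \<in> solutions U A \<nu> (chart_inv c y')" by (elim exE conjE)
      then show "\<exists>b. holomorphic_Cn b (ball v (min \<epsilon> d)) \<and> b y = w \<and>
        (\<forall>y'\<in>ball v (min \<epsilon> d). b y' \<in> solutions U A \<nu> (chart_inv c y'))"
        using sub by (intro exI[of _ b]) (auto intro: holomorphic_Cn_subset)
    qed
  qed (use e(1-3) d sub in auto)
qed

lemma continues_to_refl:
  assumes V: "open V" "x \<in> V" and x: "x \<in> regular_points U A \<nu>" "w \<in> solutions U A \<nu> x"
  shows "continues_to \<A> U A \<nu> V x w x w"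
proof -
  obtain c where c0: "c \<in> \<A>" "x \<in> fst c" by (rule atlas_covers[OF M])
  have c: "holomorphic_coordinate \<A> c" by (rule atlas_holomorphic_coordinate[OF M c0(1)])
  note tc = holomorphic_coordinate_topological[OF c]
  let ?v = "snd c x"
  have v: "?v \<in> snd c ` fst c" "chart_inv c ?v = x" using c0(2) chart_inv_snd[OF tc] by auto
  have O: "open (snd c ` (fst c \<inter> V))" "?v \<in> snd c ` (fst c \<inter> V)" using chart_image_open[OF tc V(1)] c0(2) V(2) by auto
  obtain \<epsilon> where e: "\<epsilon> > 0" "ball ?v \<epsilon> \<subseteq> snd c ` fst c \<inter> snd c ` (fst c \<inter> V)" "\<forall>y\<in>ball ?v \<epsilon>. chart_inv c y \<in> regular_points U A \<nu>"
    "\<forall>y\<in>ball ?v \<epsilon>. \<forall>w\<in>solutions U A \<nu> (chart_inv c y). \<exists>b. holomorphic_Cn b (ball ?v \<epsilon>) \<and> b y = w \<and>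
      (\<forall>y'\<in>ball ?v \<epsilon>. b y' \<in> solutions U A \<nu> (chart_inv c y'))"
    by (rule regular_sections[OF c v(1) _ O]) (use x(1) v(2) in auto)
  have ctr: "?v \<in> ball ?v \<epsilon>" using e(1) by simp
  have "w \<in> solutions U A \<nu> (chart_inv c ?v)" using x(2) v(2) by simp
  from e(4)[rule_format, OF ctr this] obtain b where b: "holomorphic_Cn b (ball ?v \<epsilon>)" "b ?v = w"
    "\<forall>y'\<in>ball ?v \<epsilon>. b y' \<in> solutions U A \<nu> (chart_inv c y')" by (elim exE conjE)
  have "chart_inv c y \<in> V" if "y \<in> ball ?v \<epsilon>" for y
    using e(2) that chart_inv_snd[OF tc] by auto
  then have "\<forall>y\<in>ball ?v \<epsilon>. chart_inv c y \<in> V \<inter> regular_points U A \<nu>" using e(3) by blast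
  from continues_to_local[OF M cs \<nu> c _ this b(1,3) ctr ctr] e(2) show ?thesis unfolding b(2) v(2) by blast
qed

text \<open>Over a polydisc of regular points convexity leaves no monodromy: the solutions split
  into global sections and every orbit is a single value. Since regular points are dense, the branch
  set will turn out to have no interior.\<close>

lemma regular_not_branch:
  assumes x: "x \<in> regular_points U A \<nu>" and Ux: "open Ux" "\<And>y. y \<in> Ux \<inter> regular_points U A \<nu> \<Longrightarrow> u y \<subseteq> solutions U A \<nu> y"
  shows "x \<notin> branch_set \<A> U A \<nu> Ux u"
proof
  assume bx: "x \<in> branch_set \<A> U A \<nu> Ux u"
  then have xU: "x \<in> Ux" by (simp add: branch_set_def)
  obtain c where c0: "c \<in> \<A>" "x \<in> fst c" by (rule atlas_covers[OF M])
  have c: "holomorphic_coordinate \<A> c" by (rule atlas_holomorphic_coordinate[OF M c0(1)])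
  note tc = holomorphic_coordinate_topological[OF c]
  let ?v = "snd c x"
  have v: "?v \<in> snd c ` fst c" "chart_inv c ?v = x" using c0(2) chart_inv_snd[OF tc] by auto
  obtain \<epsilon> where e: "\<epsilon> > 0" "\<forall>y\<in>ball ?v \<epsilon>. chart_inv c y \<in> regular_points U A \<nu>"
    by (rule regular_sections[OF c v(1) _ open_UNIV UNIV_I]) (use x v(2) in auto)
  define G where "G = {y\<in>fst c. snd c y \<in> ball ?v \<epsilon>}"
  have G: "open G" "x \<in> G" "\<And>y. y \<in> G \<Longrightarrow> y \<in> regular_points U A \<nu>"
    using chart_preimage_open[OF tc open_ball] e c0(2) chart_inv_snd[OF tc] by (auto simp: G_def) (metis mem_ball)
  have hT: "holomorphic_Cn (\<lambda>z. (z - ?v) $ i) UNIV" "holomorphic_Cn (\<lambda>z. (z + ?v) $ i) UNIV" for i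
    by (simp_all add: holomorphic_Cn_diff holomorphic_Cn_add holomorphic_Cn_coord holomorphic_Cn_const)
  obtain N r where N: "r > 0" "N \<subseteq> fst c \<inter> (G \<inter> Ux)" "x \<in> N" "holomorphic_coordinate \<A> (N, \<lambda>y. snd c y - ?v)"
    "(\<lambda>y. snd c y - ?v) ` N = polydisc r"
    by (rule holomorphic_coordinate_polydisc[OF M c c0(2) _ open_Int[OF G(1) Ux(1)] hT]) (use G(2) xU in auto)
  define d where "d = (N, \<lambda>y. snd c y - ?v)"
  have d: "holomorphic_coordinate \<A> d" "snd d ` fst d = polydisc r" "fst d = N" using N by (simp_all add: d_def)
  note td = holomorphic_coordinate_topological[OF d(1)]
  let ?P = "polydisc r :: (complex ^ 'm) set" and ?sol = "\<lambda>v. solutions U A \<nu> (chart_inv d v)"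
  have Nreg: "y \<in> regular_points U A \<nu>" if "y \<in> N" for y using N(2) G(3) that by blast
  have inN: "chart_inv d v \<in> N" if "v \<in> ?P" for v using chart_inv_in[OF td] that d by simp
  have sep: "separated_on ?P ?sol"
    by (rule solutions_separated[OF d(1)]) (use d(2) inN Nreg in auto)
  have loc: "\<exists>\<epsilon>>0. ball v \<epsilon> \<subseteq> ?P \<and> has_sections (ball v \<epsilon>) ?sol" if v: "v \<in> ?P" for v
  proof -
    have "v \<in> snd d ` fst d" "chart_inv d v \<in> regular_points U A \<nu>" using v d inN Nreg by auto
    then obtain \<epsilon> where e: "\<epsilon> > 0" "ball v \<epsilon> \<subseteq> snd d ` fst d \<inter> UNIV"
      "\<forall>y\<in>ball v \<epsilon>. \<forall>w\<in>?sol y. \<exists>b. holomorphic_Cn b (ball v \<epsilon>) \<and> b y = w \<and> (\<forall>y'\<in>ball v \<epsilon>. b y' \<in> ?sol y')"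
      by (rule regular_sections[OF d(1) _ _ open_UNIV UNIV_I])
    have "has_sections (ball v \<epsilon>) ?sol"
      unfolding has_sections_def is_section_def
    proof (intro ballI)
      fix y w assume "y \<in> ball v \<epsilon>" "w \<in> ?sol y"
      from e(3)[rule_format, OF this] obtain b where "holomorphic_Cn b (ball v \<epsilon>)" "b y = w" "\<forall>y'\<in>ball v \<epsilon>. b y' \<in> ?sol y'"
        by (elim exE conjE)
      then show "\<exists>f. (continuous_on (ball v \<epsilon>) f \<and> (\<forall>y\<in>ball v \<epsilon>. f y \<in> ?sol y)) \<and> f y = w"
        by (intro exI[of _ b]) (auto intro: holomorphic_Cn_continuous_on)
    qed
    then show ?thesis using e(1,2) d(2) by auto
  qed
  have sections: "has_sections ?P ?sol"
  proof (rule global_sections[OF open_polydisc convex_polydisc open_polydisc order_refl _ sep])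
    show "connected (Q \<inter> ?P) \<and> Q \<inter> ?P \<noteq> {}" if "open Q" "convex Q" "Q \<noteq> {}" "Q \<subseteq> ?P" for Q
      using that by (simp add: Int_absorb2 convex_connected)
    show "\<exists>\<epsilon>>0. ball p \<epsilon> \<subseteq> ?P \<and> has_sections (ball p \<epsilon> \<inter> ?P) ?sol" if "p \<in> ?P" for p
      using loc[OF that] by (metis Int_absorb2)
  qed
  have "orbit \<A> U A \<nu> N y w = {w}" if y: "y \<in> N \<inter> regular_points U A \<nu>" "w \<in> u y" for y w
  proof -
    have w: "w \<in> solutions U A \<nu> y" using Ux(2)[of y] y N(2) by blast
    define q where "q = snd d y"
    have q: "q \<in> ?P" "chart_inv d q = y" using d y chart_inv_snd[OF td] by (auto simp: q_def)
    obtain f where f: "is_section ?P ?sol f" "f q = w" by (rule has_sectionsE[OF sections q(1)]) (use w q(2) in auto)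
    have "w' = w" if w': "continues_to \<A> U A \<nu> N y w y w'" for w'
    proof -
      \<comment> \<open>The one-element family traced by a section is preserved by continuation, so
        the continued value cannot leave it.\<close>
      have "w' \<in> (\<lambda>v. {f v}) q"
      proof (rule continues_to_invariant[OF M cs \<nu> d(1), where V=N and X="?P"])
        show "connected (ball v \<epsilon> \<inter> ?P) \<and> ball v \<epsilon> \<inter> ?P \<noteq> {}" if "\<epsilon> > 0" "ball v \<epsilon> \<subseteq> snd d ` fst d" for v \<epsilon>
          using that d(2) by (simp add: Int_absorb2)
        show "{f v} \<subseteq> ?sol v" if "v \<in> ?P" for v using f(1) that by (simp add: is_section_def)
        show "\<exists>\<epsilon>>0. ball v \<epsilon> \<subseteq> ?P \<and> has_sections (ball v \<epsilon>) (\<lambda>v. {f v})" if v: "v \<in> ?P" for v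
        proof -
          obtain \<epsilon> where e: "\<epsilon> > 0" "ball v \<epsilon> \<subseteq> ?P" using open_polydisc v open_contains_ball by blast
          have "is_section (ball v \<epsilon>) (\<lambda>v. {f v}) f"
            using f(1) e(2) unfolding is_section_def by (auto intro: continuous_on_subset)
          then show ?thesis using e unfolding has_sections_def by auto
        qed
        show "continues_to \<A> U A \<nu> N (chart_inv d q) w (chart_inv d q) w'" using w' q(2) by simp
      qed (use d sep q(1) f(2) open_polydisc in auto)
      then show ?thesis using f(2) by simp
    qed
    moreover have "continues_to \<A> U A \<nu> N y w y w"
      by (rule continues_to_refl) (use y w chart_open(1)[OF td] d(3) in auto)
    ultimately show ?thesis unfolding orbit_def by blast
  qed
  moreover have "open N" "N \<subseteq> Ux" using chart_open(1)[OF td] d(3) N(2) by auto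
  ultimately show False using bx N(3) unfolding branch_set_def by blast
qed

end

lemma leaf_function_elementD:
  assumes "leaf_function_element \<A> U A \<nu> l Ux x0 u"
  shows "0 < l" "open Ux" "x0 \<in> Ux"
    "\<And>x. x \<in> Ux \<inter> regular_points U A \<nu> \<Longrightarrow> u x \<subseteq> solutions U A \<nu> x"
    "\<And>x. x \<in> Ux \<inter> regular_points U A \<nu> \<Longrightarrow> card (u x) = l"
    "\<And>x. x \<in> Ux \<Longrightarrow> u x = {w. (x, w) \<in> closure {(y, v). y \<in> Ux \<inter> regular_points U A \<nu> \<and> v \<in> u y}}"
    "\<And>x y w w'. continues_to \<A> U A \<nu> Ux x w y w' \<Longrightarrow> w \<in> u x \<Longrightarrow> w' \<in> u y"
    "\<And>V. open V \<Longrightarrow> x0 \<in> V \<Longrightarrow> \<exists>V'. open V' \<and> x0 \<in> V' \<and> V' \<subseteq> V \<inter> Ux \<and>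
       (\<forall>x\<in>V' \<inter> regular_points U A \<nu>. \<forall>w\<in>u x. orbit \<A> U A \<nu> V' x w = u x)"
  using assms unfolding leaf_function_element_def by (blast, blast, blast, blast, blast, blast, blast, blast)

lemma mem_closure_iff_open: "x \<in> closure S \<longleftrightarrow> (\<forall>W. open W \<longrightarrow> x \<in> W \<longrightarrow> W \<inter> S \<noteq> {})"
  unfolding closure_iff_nhds_not_empty by blast

lemma mem_closure_prod: "(x, w) \<in> closure S \<longleftrightarrow>
    (\<forall>V W. open V \<longrightarrow> x \<in> V \<longrightarrow> open W \<longrightarrow> w \<in> W \<longrightarrow> (\<exists>y v. (y, v) \<in> S \<and> y \<in> V \<and> v \<in> W))"
  unfolding mem_closure_iff_open
proof (intro iffI allI impI)
  fix V W assume *: "\<forall>W. open W \<longrightarrow> (x, w) \<in> W \<longrightarrow> W \<inter> S \<noteq> {}" "open V" "x \<in> V" "open W" "w \<in> W"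
  then have "(V \<times> W) \<inter> S \<noteq> {}" using open_Times[of V W] by simp
  then show "\<exists>y v. (y, v) \<in> S \<and> y \<in> V \<and> v \<in> W" by blast
next
  fix Z assume *: "\<forall>V W. open V \<longrightarrow> x \<in> V \<longrightarrow> open W \<longrightarrow> w \<in> W \<longrightarrow> (\<exists>y v. (y, v) \<in> S \<and> y \<in> V \<and> v \<in> W)"
    and Z: "open Z" "(x, w) \<in> Z"
  obtain V W where VW: "open V" "open W" "(x, w) \<in> V \<times> W" "V \<times> W \<subseteq> Z" by (rule open_prod_elim[OF Z])
  then obtain y v where "(y, v) \<in> S" "y \<in> V" "v \<in> W" using *[rule_format, of V W] by auto
  then show "Z \<inter> S \<noteq> {}" using VW(4) by blast
qed

section \<open>The function element in a polydisc coordinate\<close>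

context
  fixes \<A> :: "('a::{t2_space,second_countable_topology}, 'm::finite) chart set"
    and U :: "'i \<Rightarrow> 'a set" and A :: "nat \<Rightarrow> 'i \<Rightarrow> 'a \<Rightarrow> complex" and \<nu> l :: nat
    and Ux :: "'a set" and x0 :: 'a and u :: "'a \<Rightarrow> complex set" and c :: "('a, 'm) chart" and m :: 'm
    and r :: real and i0 :: 'i and h0 :: "'a \<Rightarrow> complex"
    and sol uu :: "complex ^ 'm \<Rightarrow> complex set" and \<psi> :: "complex ^ 'm \<Rightarrow> 'a" and D \<alpha> :: "complex ^ 'm \<Rightarrow> complex"
    and Om P :: "(complex ^ 'm) set" and reg :: "'a set"
  assumes M: "complex_manifold \<A>" and cs: "coefficient_system \<A> U A \<nu>" and \<nu>: "\<nu> > 0"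
    and leaf: "leaf_function_element \<A> U A \<nu> l Ux x0 u"
    and c: "holomorphic_coordinate \<A> c" "snd c ` fst c = P" and r: "r > 0" and P: "P = polydisc r"
    and x0: "x0 \<in> fst c" "snd c x0 = 0" and sub: "fst c \<subseteq> Ux" "fst c \<subseteq> U i0"
    and h0: "holomorphic_mfd \<A> h0 (fst c)" "\<exists>x\<in>fst c. h0 x \<noteq> 0" "\<And>x. x \<in> fst c \<Longrightarrow> h0 x \<noteq> 0 \<Longrightarrow> x \<in> reg"
    and lead: "\<exists>x\<in>fst c. A \<nu> i0 x \<noteq> 0"
    and branch: "\<And>x. x \<in> branch_set \<A> U A \<nu> Ux u \<Longrightarrow> x \<in> fst c \<Longrightarrow> snd c x $ m = 0"
    and reg: "reg = regular_points U A \<nu>" and \<psi>: "\<psi> = chart_inv c"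
    and sol: "sol = (\<lambda>v. solutions U A \<nu> (\<psi> v))" and uu: "uu = (\<lambda>v. u (\<psi> v))"
    and \<alpha>: "\<alpha> = (\<lambda>v. A \<nu> i0 (\<psi> v))" and D: "D = (\<lambda>v. h0 (\<psi> v) * (\<alpha> v * v $ m))"
    and Om: "Om = {v\<in>P. D v \<noteq> 0}"
begin

lemmas leafD = leaf_function_elementD[OF leaf]
lemmas tc = holomorphic_coordinate_topological[OF c(1)]

lemma \<psi>_in: "v \<in> P \<Longrightarrow> \<psi> v \<in> fst c" and \<psi>_snd: "v \<in> P \<Longrightarrow> snd c (\<psi> v) = v"
  and snd_\<psi>: "x \<in> fst c \<Longrightarrow> \<psi> (snd c x) = x"
  using chart_inv_in[OF tc] snd_chart_inv[OF tc] chart_inv_snd[OF tc] c(2) by (auto simp: \<psi>)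

lemma open_P: "open P" and convex_P: "convex P"
  unfolding P by (rule open_polydisc convex_polydisc)+

lemma \<psi>_holomorphic: assumes "holomorphic_mfd \<A> f (fst c)" shows "holomorphic_Cn (\<lambda>v. f (\<psi> v)) P"
  using holomorphic_mfd_Cn[OF M c(1) assms chart_open(1)[OF tc]] c(2) by (simp add: \<psi>)

lemma A_\<psi>_holomorphic: "k \<le> \<nu> \<Longrightarrow> holomorphic_Cn (\<lambda>v. A k i0 (\<psi> v)) P"
  by (rule \<psi>_holomorphic[OF holomorphic_mfd_subset[OF A_holomorphic[OF M cs] sub(2)]])

lemma D_holomorphic: "holomorphic_Cn D P"
  unfolding D \<alpha> by (intro holomorphic_Cn_mult \<psi>_holomorphic h0(1) A_\<psi>_holomorphic order_refl holomorphic_Cn_coord)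

lemma D_nonzero: "\<exists>v\<in>P. D v \<noteq> 0"
proof -
  have dense: "P \<subseteq> closure {v\<in>P. f v \<noteq> 0}" if "holomorphic_Cn f P" "\<exists>v\<in>P. f v \<noteq> 0" for f
    using that holomorphic_Cn_nonzero_dense[OF that(1) open_P convex_P] by blast
  have \<psi>: "\<exists>v\<in>P. f (\<psi> v) \<noteq> 0" if "\<exists>x\<in>fst c. f x \<noteq> 0" for f :: "'a \<Rightarrow> complex"
    using that snd_\<psi> c(2) by (metis imageI)
  have hol: "holomorphic_Cn (\<lambda>v. h0 (\<psi> v)) P" "holomorphic_Cn \<alpha> P"
    unfolding \<alpha> by (intro \<psi>_holomorphic h0(1) A_\<psi>_holomorphic order_refl)+
  have nz: "\<exists>v\<in>P. \<alpha> v \<noteq> 0" using \<psi>[OF lead] by (simp add: \<alpha>)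
  have "axis m (of_real (r / 2)) \<in> P" unfolding P polydisc_def using r by (simp add: axis_def)
  moreover have "axis m (of_real (r / 2)) $ m \<noteq> (0::complex)" using r by simp
  ultimately have "P \<subseteq> closure {v\<in>P. v $ m \<noteq> 0}" by (intro dense holomorphic_Cn_coord) blast
  then have "P \<subseteq> closure {v\<in>P. \<alpha> v \<noteq> 0 \<and> v $ m \<noteq> 0}"
    by (rule dense_conj[OF holomorphic_Cn_continuous_on[OF hol(2)] open_P dense[OF hol(2) nz]])
  then have "P \<subseteq> closure {v\<in>P. h0 (\<psi> v) \<noteq> 0 \<and> (\<alpha> v \<noteq> 0 \<and> v $ m \<noteq> 0)}"
    by (rule dense_conj[OF holomorphic_Cn_continuous_on[OF hol(1)] open_P dense[OF hol(1) \<psi>[OF h0(2)]]])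
  moreover have "0 \<in> P" unfolding P using r by (rule zero_in_polydisc)
  ultimately have "\<exists>x\<in>P \<inter> P. h0 (\<psi> x) \<noteq> 0 \<and> (\<alpha> x \<noteq> 0 \<and> x $ m \<noteq> 0)"
    using open_P unfolding dense_iff by blast
  then show ?thesis unfolding D by auto
qed

lemma Om_dense: "P \<subseteq> closure Om"
proof -
  obtain v where "v \<in> P" "D v \<noteq> 0" using D_nonzero by blast
  then show ?thesis unfolding Om by (rule holomorphic_Cn_nonzero_dense[OF D_holomorphic open_P convex_P])
qed

lemma Om_meets: assumes "open W" "v \<in> W" "v \<in> P" shows "\<exists>q. q \<in> Om \<and> q \<in> W"
  using Om_dense assms unfolding Om dense_iff by blast

lemma open_nonzero_locus: "open Om"
  unfolding Om by (rule open_nonzero[OF holomorphic_Cn_continuous_on[OF D_holomorphic] open_P])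

text \<open>The three factors of \<open>D\<close> ensure in turn that the point is regular, that the
  leading coefficient is nonzero and that the point is off the hyperplane.\<close>

lemma OmD: assumes "v \<in> Om" shows "v \<in> P" "\<psi> v \<in> reg" "\<psi> v \<in> Ux" "\<alpha> v \<noteq> 0" "v $ m \<noteq> 0"
  using assms \<psi>_in[of v] h0(3)[of "\<psi> v"] sub(1) unfolding Om D by auto

lemma ball_Om_connected: "\<epsilon> > 0 \<Longrightarrow> ball v \<epsilon> \<subseteq> P \<Longrightarrow> connected (ball v \<epsilon> \<inter> Om) \<and> ball v \<epsilon> \<inter> Om \<noteq> {}"
proof
  assume e: "\<epsilon> > 0" "ball v \<epsilon> \<subseteq> P"
  have "ball v \<epsilon> \<inter> Om = {x\<in>ball v \<epsilon>. D x \<noteq> 0}" using e(2) by (auto simp: Om)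
  then show "connected (ball v \<epsilon> \<inter> Om)"
    using holomorphic_Cn_nonzero_connected[OF holomorphic_Cn_subset[OF D_holomorphic e(2)] open_ball convex_ball] by simp
  show "ball v \<epsilon> \<inter> Om \<noteq> {}" 
    using Om_meets[of "ball v \<epsilon>" v] e centre_in_ball[of v \<epsilon>] by (metis IntI empty_iff open_ball subsetD)
qed

lemma uu_sol: "v \<in> P \<Longrightarrow> \<psi> v \<in> reg \<Longrightarrow> uu v \<subseteq> sol v"
  unfolding uu sol using leafD(4)[of "\<psi> v"] \<psi>_in[of v] sub(1) reg by blast

text \<open>A branch of solutions that has a value in \<open>u\<close> stays in \<open>u\<close>,
  since function elements are closed under continuation. Continuability is stated for every
  \<open>V\<close> around the ball, because orbits refer to varying neighbourhoods.\<close>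

lemma branches:
  assumes v: "v \<in> P" "\<psi> v \<in> reg" and O: "open O'" "v \<in> O'"
  obtains \<epsilon> where "\<epsilon> > 0" "ball v \<epsilon> \<subseteq> P \<inter> O'" "\<forall>y\<in>ball v \<epsilon>. \<psi> y \<in> reg"
    "\<forall>y\<in>ball v \<epsilon>. \<forall>w\<in>uu y. \<exists>b. holomorphic_Cn b (ball v \<epsilon>) \<and> b y = w \<and> (\<forall>y'\<in>ball v \<epsilon>. b y' \<in> uu y') \<and>
       (\<forall>V. (\<forall>y'\<in>ball v \<epsilon>. \<psi> y' \<in> V) \<longrightarrow> (\<forall>y'\<in>ball v \<epsilon>. \<forall>y''\<in>ball v \<epsilon>. continues_to \<A> U A \<nu> V (\<psi> y') (b y') (\<psi> y'') (b y'')))"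
proof -
  have v': "v \<in> snd c ` fst c" "chart_inv c v \<in> regular_points U A \<nu>" using v c(2) by (auto simp: \<psi> reg)
  obtain \<epsilon> where e: "\<epsilon> > 0" "ball v \<epsilon> \<subseteq> P \<inter> O'" "\<forall>y\<in>ball v \<epsilon>. \<psi> y \<in> reg"
    "\<forall>y\<in>ball v \<epsilon>. \<forall>w\<in>sol y. \<exists>b. holomorphic_Cn b (ball v \<epsilon>) \<and> b y = w \<and> (\<forall>y'\<in>ball v \<epsilon>. b y' \<in> sol y')"
    using regular_sections[OF M cs \<nu> c(1) v' O, unfolded c(2), folded \<psi> reg] unfolding sol by blast
  show thesis
  proof (rule that[OF e(1-3)], intro ballI)
    fix y w assume y: "y \<in> ball v \<epsilon>" and w: "w \<in> uu y"
    have "w \<in> sol y" using uu_sol[of y] y w e(2,3) by blast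
    from e(4)[rule_format, OF y this] obtain b where b: "holomorphic_Cn b (ball v \<epsilon>)" "b y = w" "\<forall>y'\<in>ball v \<epsilon>. b y' \<in> sol y'"
      by (elim exE conjE)
    have cont: "\<forall>y'\<in>ball v \<epsilon>. \<forall>y''\<in>ball v \<epsilon>. continues_to \<A> U A \<nu> V (\<psi> y') (b y') (\<psi> y'') (b y'')"
      if V: "\<forall>y'\<in>ball v \<epsilon>. \<psi> y' \<in> V" for V
    proof (intro ballI)
      fix y' y'' assume yy: "y' \<in> ball v \<epsilon>" "y'' \<in> ball v \<epsilon>"
      show "continues_to \<A> U A \<nu> V (\<psi> y') (b y') (\<psi> y'') (b y'')"
        unfolding \<psi>
      proof (rule continues_to_local[OF M cs \<nu> c(1) _ _ b(1) _ yy])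
        show "ball v \<epsilon> \<subseteq> snd c ` fst c" using e(2) c(2) by auto
        show "\<forall>y\<in>ball v \<epsilon>. chart_inv c y \<in> V \<inter> regular_points U A \<nu>" using V e(3) by (auto simp: \<psi> reg)
        show "\<forall>y\<in>ball v \<epsilon>. b y \<in> solutions U A \<nu> (chart_inv c y)" using b(3) by (simp add: sol \<psi>)
      qed
    qed
    have "\<forall>y'\<in>ball v \<epsilon>. \<psi> y' \<in> Ux" using e(2) \<psi>_in sub(1) by blast
    then have "b y' \<in> uu y'" if "y' \<in> ball v \<epsilon>" for y'
      unfolding uu using leafD(7)[of "\<psi> y" "b y" "\<psi> y'" "b y'"] cont[of Ux] y that b(2) w unfolding uu by blast
    then show "\<exists>b. holomorphic_Cn b (ball v \<epsilon>) \<and> b y = w \<and> (\<forall>y'\<in>ball v \<epsilon>. b y' \<in> uu y') \<and>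
       (\<forall>V. (\<forall>y'\<in>ball v \<epsilon>. \<psi> y' \<in> V) \<longrightarrow> (\<forall>y'\<in>ball v \<epsilon>. \<forall>y''\<in>ball v \<epsilon>. continues_to \<A> U A \<nu> V (\<psi> y') (b y') (\<psi> y'') (b y'')))"
      using b(1,2) cont by (intro exI[of _ b]) blast
  qed
qed

lemma sol_separated: "separated_on Om sol"
  unfolding sol \<psi> by (rule solutions_separated[OF M cs \<nu> c(1)]) (use OmD(1,2) c(2) in \<open>auto simp: reg \<psi>\<close>)

text \<open>In a neighbourhood of \<open>x0\<close> with a single orbit, continuation connects any
  two values at \<open>v0\<close>, and by \<open>continues_to_invariant\<close> it preserves
  subfamilies with local sections.\<close>

lemma transitive: "\<exists>v0\<in>Om. \<forall>S. (\<forall>v\<in>Om. S v \<subseteq> uu v) \<longrightarrow> (\<forall>v\<in>Om. \<exists>\<epsilon>>0. ball v \<epsilon> \<subseteq> Om \<and> has_sections (ball v \<epsilon>) S) \<longrightarrow>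
      S v0 \<noteq> {} \<longrightarrow> uu v0 \<subseteq> S v0"
proof -
  from leafD(8)[OF chart_open(1)[OF tc] x0(1)] obtain V where V: "open V" "x0 \<in> V" "V \<subseteq> fst c \<inter> Ux"
    "\<forall>x\<in>V \<inter> reg. \<forall>w\<in>u x. orbit \<A> U A \<nu> V x w = u x" unfolding reg by (elim exE conjE)
  have "open (snd c ` (fst c \<inter> V))" by (rule chart_image_open[OF tc V(1)])
  moreover have "0 \<in> snd c ` (fst c \<inter> V)" using x0 V(2) by (metis IntI imageI)
  moreover have "0 \<in> P" unfolding P using r by (rule zero_in_polydisc)
  ultimately obtain v0 where v0: "v0 \<in> Om" "v0 \<in> snd c ` (fst c \<inter> V)" using Om_meets by blast
  then have \<psi>V: "\<psi> v0 \<in> V" using snd_\<psi> by auto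
  show ?thesis
  proof (intro bexI[OF _ v0(1)] allI impI subsetI)
    fix S w' assume S: "\<forall>v\<in>Om. S v \<subseteq> uu v" "\<forall>v\<in>Om. \<exists>\<epsilon>>0. ball v \<epsilon> \<subseteq> Om \<and> has_sections (ball v \<epsilon>) S" "S v0 \<noteq> {}" and w': "w' \<in> uu v0"
    obtain w where w: "w \<in> S v0" using S(3) by blast
    then have "w \<in> u (\<psi> v0)" using S(1) v0(1) by (auto simp: uu)
    then have "orbit \<A> U A \<nu> V (\<psi> v0) w = u (\<psi> v0)" using V(4) \<psi>V OmD(2)[OF v0(1)] by blast
    then have cont: "continues_to \<A> U A \<nu> V (\<psi> v0) w (\<psi> v0) w'" using w' unfolding orbit_def uu by blast
    show "w' \<in> S v0"
    proof (rule continues_to_invariant[OF M cs \<nu> c(1), where V=V and X=Om])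
      show "connected (ball v \<epsilon> \<inter> Om) \<and> ball v \<epsilon> \<inter> Om \<noteq> {}" if "\<epsilon> > 0" "ball v \<epsilon> \<subseteq> snd c ` fst c" for v \<epsilon>
        using ball_Om_connected that c(2) by simp
      show "separated_on Om (\<lambda>y. solutions U A \<nu> (chart_inv c y))" using sol_separated by (simp add: sol \<psi>)
      show "S y \<subseteq> solutions U A \<nu> (chart_inv c y)" if "y \<in> Om" for y
        using S(1) uu_sol[OF OmD(1,2)[OF that]] that by (auto simp: sol \<psi>)
      show "continues_to \<A> U A \<nu> V (chart_inv c v0) w (chart_inv c v0) w'" using cont by (simp add: \<psi>)
      show "\<exists>\<epsilon>>0. ball v \<epsilon> \<subseteq> Om \<and> has_sections (ball v \<epsilon>) S" if "v \<in> Om" for v using S(2) that by blast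
    qed (use V(3) open_nonzero_locus OmD(1) c(2) v0(1) w in auto)
  qed
qed

text \<open>A point off the hyperplane is no branch point, so in some neighbourhood \<open>V\<close>
  every branch returns to itself. Continuing \<open>w\<close> from \<open>q\<close> inside
  \<open>V\<close> therefore gives a single value at each point.\<close>

lemma split_off_hyperplane:
  assumes y: "y \<in> P" "y $ m \<noteq> 0"
  shows "\<exists>\<epsilon>>0. ball y \<epsilon> \<subseteq> P \<and> has_sections (ball y \<epsilon> \<inter> Om) uu"
proof -
  have "\<psi> y \<notin> branch_set \<A> U A \<nu> Ux u" using branch[of "\<psi> y"] \<psi>_in[OF y(1)] \<psi>_snd[OF y(1)] y(2) by auto
  moreover have "\<psi> y \<in> Ux" using \<psi>_in[OF y(1)] sub(1) by blast
  ultimately obtain V where V: "open V" "\<psi> y \<in> V" "V \<subseteq> Ux" "\<And>x w. x \<in> V \<inter> reg \<Longrightarrow> w \<in> u x \<Longrightarrow> orbit \<A> U A \<nu> V x w = {w}"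
    unfolding branch_set_def reg by blast
  have "open (snd c ` (fst c \<inter> V))" by (rule chart_image_open[OF tc V(1)])
  moreover have "y \<in> snd c ` (fst c \<inter> V)" using \<psi>_in[OF y(1)] \<psi>_snd[OF y(1)] V(2) by (metis IntI imageI)
  ultimately obtain \<epsilon> where e: "\<epsilon> > 0" "ball y \<epsilon> \<subseteq> snd c ` (fst c \<inter> V)" using open_contains_ball by blast
  let ?B = "ball y \<epsilon>"
  have BP: "?B \<subseteq> P" using e(2) c(2) by auto
  have BV: "\<psi> v \<in> V" if "v \<in> ?B" for v using e(2) that snd_\<psi> by auto
  have "has_sections (?B \<inter> Om) uu"
    unfolding has_sections_def
  proof (intro ballI)
    fix q w assume q: "q \<in> ?B \<inter> Om" and w: "w \<in> uu q"
    \<comment> \<open>Going back along one continuation and out along another gives a closed curve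
      in \<open>V\<close>, so there is at most one value; connectedness of the ball minus the zeros
      of \<open>D\<close> gives at least one.\<close>
    define S where "S v = {w'. continues_to \<A> U A \<nu> V (\<psi> q) w (\<psi> v) w'}" for v
    have loc: "\<exists>\<delta>>0. ball v \<delta> \<subseteq> ?B \<inter> Om \<and> (\<forall>v'\<in>ball v \<delta>. \<forall>w'\<in>uu v'. \<exists>b. holomorphic_Cn b (ball v \<delta>) \<and> b v' = w' \<and>
        (\<forall>x\<in>ball v \<delta>. \<forall>x'\<in>ball v \<delta>. continues_to \<A> U A \<nu> V (\<psi> x) (b x) (\<psi> x') (b x')))" if v: "v \<in> ?B \<inter> Om" for v
    proof -
      have O: "open (?B \<inter> Om)" using open_nonzero_locus by auto
      have vv: "v \<in> P" "\<psi> v \<in> reg" using v OmD by auto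
      obtain \<delta> where d: "\<delta> > 0" "ball v \<delta> \<subseteq> P \<inter> (?B \<inter> Om)"
        "\<forall>y\<in>ball v \<delta>. \<forall>w\<in>uu y. \<exists>b. holomorphic_Cn b (ball v \<delta>) \<and> b y = w \<and> (\<forall>y'\<in>ball v \<delta>. b y' \<in> uu y') \<and>
       (\<forall>V. (\<forall>y'\<in>ball v \<delta>. \<psi> y' \<in> V) \<longrightarrow> (\<forall>y'\<in>ball v \<delta>. \<forall>y''\<in>ball v \<delta>. continues_to \<A> U A \<nu> V (\<psi> y') (b y') (\<psi> y'') (b y'')))"
        by (rule branches[OF vv O v])
      have dV: "\<forall>y'\<in>ball v \<delta>. \<psi> y' \<in> V" using d(2) BV by blast
      show ?thesis
      proof (intro exI[of _ \<delta>] conjI ballI d(1))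
        show "ball v \<delta> \<subseteq> ?B \<inter> Om" using d(2) by blast
        fix v' w' assume "v' \<in> ball v \<delta>" "w' \<in> uu v'"
        from d(3)[rule_format, OF this] obtain b where "holomorphic_Cn b (ball v \<delta>)" "b v' = w'"
          "\<forall>V. (\<forall>y'\<in>ball v \<delta>. \<psi> y' \<in> V) \<longrightarrow> (\<forall>y'\<in>ball v \<delta>. \<forall>y''\<in>ball v \<delta>. continues_to \<A> U A \<nu> V (\<psi> y') (b y') (\<psi> y'') (b y''))"
          by (elim exE conjE)
        then show "\<exists>b. holomorphic_Cn b (ball v \<delta>) \<and> b v' = w' \<and>
          (\<forall>x\<in>ball v \<delta>. \<forall>x'\<in>ball v \<delta>. continues_to \<A> U A \<nu> V (\<psi> x) (b x) (\<psi> x') (b x'))"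
          using dV by (intro exI[of _ b]) blast
      qed
    qed
    have S_uu: "S v \<subseteq> uu v" for v
    proof
      fix w' assume "w' \<in> S v"
      then have "continues_to \<A> U A \<nu> Ux (\<psi> q) w (\<psi> v) w'"
        unfolding S_def mem_Collect_eq by (rule continues_to_subset[OF _ V(3)])
      then have "w' \<in> u (\<psi> v)" by (rule leafD(7)) (use w in \<open>simp add: uu\<close>)
      then show "w' \<in> uu v" by (simp add: uu)
    qed
    have unique: "w1 = w2" if "w1 \<in> S v" "w2 \<in> S v" "v \<in> ?B \<inter> Om" for v w1 w2
    proof -
      have "continues_to \<A> U A \<nu> V (\<psi> v) w1 (\<psi> v) w2"
        using continues_to_trans[OF M cs \<nu> continues_to_sym] that(1,2) unfolding S_def by blast
      then have "w2 \<in> orbit \<A> U A \<nu> V (\<psi> v) w1" by (simp add: orbit_def)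
      moreover have "\<psi> v \<in> V \<inter> reg" "w1 \<in> u (\<psi> v)" using that BV OmD(2) S_uu by (auto simp: uu)
      ultimately show ?thesis using V(4)[of "\<psi> v" w1] by simp
    qed
    have extend: "\<exists>\<delta> b. \<delta> > 0 \<and> ball v \<delta> \<subseteq> ?B \<inter> Om \<and> holomorphic_Cn b (ball v \<delta>) \<and> (\<forall>x\<in>ball v \<delta>. b x \<in> S x)"
      if v: "v \<in> ?B \<inter> Om" "S v \<noteq> {}" for v
    proof -
      obtain \<delta> where d: "\<delta> > 0" "ball v \<delta> \<subseteq> ?B \<inter> Om" "\<forall>v'\<in>ball v \<delta>. \<forall>w'\<in>uu v'. \<exists>b. holomorphic_Cn b (ball v \<delta>) \<and> b v' = w' \<and>
        (\<forall>x\<in>ball v \<delta>. \<forall>x'\<in>ball v \<delta>. continues_to \<A> U A \<nu> V (\<psi> x) (b x) (\<psi> x') (b x'))"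
        using loc[OF v(1)] by (elim exE conjE)
      obtain w1 where w1: "w1 \<in> S v" using v(2) by blast
      have ctr: "v \<in> ball v \<delta>" "w1 \<in> uu v" using d(1) S_uu w1 by auto
      from d(3)[rule_format, OF ctr] obtain b where b: "holomorphic_Cn b (ball v \<delta>)" "b v = w1"
        "\<forall>x\<in>ball v \<delta>. \<forall>x'\<in>ball v \<delta>. continues_to \<A> U A \<nu> V (\<psi> x) (b x) (\<psi> x') (b x')" by (elim exE conjE)
      have "b x \<in> S x" if "x \<in> ball v \<delta>" for x
        using continues_to_trans[OF M cs \<nu>, of V "\<psi> q" w "\<psi> v" w1 "\<psi> x" "b x"] b(3) ctr(1) that w1 b(2) unfolding S_def by blast
      then show ?thesis using d(1,2) b(1) by blast
    qed
    have conn: "connected (?B \<inter> Om)" using ball_Om_connected[OF e(1) BP] by blast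
    have opS: "open (?B \<inter> Om)" using open_nonzero_locus by auto
    have base: "w \<in> S q"
      unfolding S_def using continues_to_refl[OF M cs \<nu> V(1)] q BV[of q] OmD(2)[of q] uu_sol[of q] OmD(1)[of q] w by (auto simp: reg sol)
    have ex: "S v \<noteq> {}" if v: "v \<in> ?B \<inter> Om" for v
    proof (rule connected_induction_simple[OF conn q v])
      show "S q \<noteq> {}" using base by blast
      fix a assume a: "a \<in> ?B \<inter> Om"
      obtain \<delta> where d: "\<delta> > 0" "ball a \<delta> \<subseteq> ?B \<inter> Om" "\<forall>v'\<in>ball a \<delta>. \<forall>w'\<in>uu v'. \<exists>b. holomorphic_Cn b (ball a \<delta>) \<and> b v' = w' \<and>
        (\<forall>x\<in>ball a \<delta>. \<forall>x'\<in>ball a \<delta>. continues_to \<A> U A \<nu> V (\<psi> x) (b x) (\<psi> x') (b x'))"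
        using loc[OF a] by (elim exE conjE)
      have step: "S y' \<noteq> {}" if xy: "x \<in> ball a \<delta>" "y' \<in> ball a \<delta>" "S x \<noteq> {}" for x y'
      proof -
        obtain w1 where w1: "w1 \<in> S x" using xy(3) by blast
        have "w1 \<in> uu x" using S_uu w1 by blast
        from d(3)[rule_format, OF xy(1) this] obtain b where b: "b x = w1"
          "\<forall>x\<in>ball a \<delta>. \<forall>x'\<in>ball a \<delta>. continues_to \<A> U A \<nu> V (\<psi> x) (b x) (\<psi> x') (b x')" by (elim exE conjE)
        have "b y' \<in> S y'"
          using continues_to_trans[OF M cs \<nu>, of V "\<psi> q" w "\<psi> x" w1 "\<psi> y'" "b y'"] b(2) xy(1,2) w1 b(1) unfolding S_def by blast
        then show ?thesis by blast
      qed
      have "openin (top_of_set (?B \<inter> Om)) (ball a \<delta>)" using d(2) by (simp add: openin_open_eq[OF opS])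
      moreover have "a \<in> ball a \<delta>" using d(1) by simp
      moreover have "\<forall>x\<in>ball a \<delta>. \<forall>y\<in>ball a \<delta>. S x \<noteq> {} \<longrightarrow> S y \<noteq> {}" using step by blast
      ultimately show "\<exists>T. openin (top_of_set (?B \<inter> Om)) T \<and> a \<in> T \<and> (\<forall>x\<in>T. \<forall>y\<in>T. S x \<noteq> {} \<longrightarrow> S y \<noteq> {})"
        by (intro exI[of _ "ball a \<delta>"] conjI)
    qed
    define f where "f v = (SOME w'. w' \<in> S v)" for v
    have fS: "f v \<in> S v" if "v \<in> ?B \<inter> Om" for v using ex[OF that] unfolding f_def by (simp add: some_in_eq)
    have "continuous_on (?B \<inter> Om) f"
    proof (rule continuous_on_local[OF opS])
      fix v assume v: "v \<in> ?B \<inter> Om"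
      from extend[OF v ex[OF v]] obtain \<delta> b where d: "\<delta> > 0" "ball v \<delta> \<subseteq> ?B \<inter> Om" "holomorphic_Cn b (ball v \<delta>)" "\<forall>x\<in>ball v \<delta>. b x \<in> S x"
        by (elim exE conjE)
      have "f x = b x" if "x \<in> ball v \<delta>" for x using unique[of "f x" x "b x"] fS[of x] d(2,4) that by blast
      then show "\<exists>T g. open T \<and> v \<in> T \<and> continuous_on (T \<inter> (?B \<inter> Om)) g \<and> (\<forall>y\<in>T \<inter> (?B \<inter> Om). f y = g y)"
        using d(1) holomorphic_Cn_continuous_on[OF d(3)] by (intro exI[of _ "ball v \<delta>"] exI[of _ b]) (auto intro: continuous_on_subset)
    qed
    moreover have "f q = w" using unique[OF fS[OF q] base q] .
    ultimately show "\<exists>f. is_section (?B \<inter> Om) uu f \<and> f q = w"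
      unfolding is_section_def using fS S_uu by (intro exI[of _ f]) blast
  qed
  then show ?thesis using e(1) BP by blast
qed

text \<open>The bound of \<open>leading_times_root_bound\<close> depends continuously on the
  point.\<close>

lemma values_bounded:
  assumes p: "p \<in> P"
  shows "\<exists>T K. open T \<and> p \<in> T \<and> (\<forall>v\<in>T \<inter> Om. \<forall>w\<in>uu v. norm (\<alpha> v * w) \<le> K)"
proof -
  define s where "s v = (\<Sum>k<\<nu>. norm (A k i0 (\<psi> v) * A \<nu> i0 (\<psi> v) ^ (\<nu> - 1 - k)))" for v
  have "continuous_on P s"
    unfolding s_def using A_\<psi>_holomorphic by (intro continuous_intros holomorphic_Cn_continuous_on) auto
  then have "open (P \<inter> s -` {..<s p + 1})"
    by (rule continuous_open_preimage[OF _ open_P open_lessThan])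
  moreover have "norm (\<alpha> v * w) \<le> 1 + (s p + 1)" if v: "v \<in> P \<inter> s -` {..<s p + 1}" "v \<in> Om" and w: "w \<in> uu v" for v w
  proof -
    have "w \<in> sol v" using uu_sol[OF OmD(1,2)[OF v(2)]] w by blast
    moreover have "\<psi> v \<in> U i0" using \<psi>_in OmD(1)[OF v(2)] sub(2) by blast
    ultimately have "poly (local_poly A \<nu> i0 (\<psi> v)) w = 0" by (simp add: sol solutions_def)
    from leading_times_root_bound[OF \<nu> this] show ?thesis using v(1) by (simp add: \<alpha> s_def)
  qed
  ultimately show ?thesis
    using p by (intro exI[of _ "P \<inter> s -` {..<s p + 1}"] exI[of _ "1 + (s p + 1)"]) auto
qed

text \<open>The definition of a function element takes limits over all regular points, some of which
  may be zeros of \<open>D\<close>. A branch through such a point carries its value continuously to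
  nearby points of \<open>Om\<close>, so the limits over \<open>Om\<close> are the same.\<close>

lemma values_closure:
  assumes v: "v \<in> P"
  shows "uu v = {w. (v, w) \<in> closure {(v, w). v \<in> Om \<and> w \<in> uu v}}"
proof -
  let ?G = "{(y, w). y \<in> Ux \<inter> reg \<and> w \<in> u y}" and ?H = "{(v, w). v \<in> Om \<and> w \<in> uu v}"
  have "(\<psi> v, w) \<in> closure ?G \<longleftrightarrow> (v, w) \<in> closure ?H" for w
    unfolding mem_closure_prod
  proof (intro iffI allI impI)
    fix V W assume G: "\<forall>V W. open V \<longrightarrow> \<psi> v \<in> V \<longrightarrow> open W \<longrightarrow> w \<in> W \<longrightarrow> (\<exists>y w'. (y, w') \<in> ?G \<and> y \<in> V \<and> w' \<in> W)"
      and V: "open V" "v \<in> V" and W: "open W" "w \<in> W"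
    let ?V = "{x \<in> fst c. snd c x \<in> V}"
    have "open ?V" "\<psi> v \<in> ?V" using chart_preimage_open[OF tc V(1)] \<psi>_in[OF v] \<psi>_snd[OF v] V(2) by auto
    from G[rule_format, OF this W] obtain y w' where y: "y \<in> ?V" "y \<in> reg" "w' \<in> u y" "w' \<in> W" by blast
    let ?q = "snd c y"
    have q: "?q \<in> P" "\<psi> ?q = y" "?q \<in> V" using y(1) snd_\<psi> c(2) by auto
    have qr: "\<psi> ?q \<in> reg" using q(2) y(2) by simp
    obtain \<epsilon> where e: "\<epsilon> > 0" "ball ?q \<epsilon> \<subseteq> P \<inter> V"
      "\<forall>y\<in>ball ?q \<epsilon>. \<forall>w\<in>uu y. \<exists>b. holomorphic_Cn b (ball ?q \<epsilon>) \<and> b y = w \<and> (\<forall>y'\<in>ball ?q \<epsilon>. b y' \<in> uu y') \<and>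
       (\<forall>V. (\<forall>y'\<in>ball ?q \<epsilon>. \<psi> y' \<in> V) \<longrightarrow> (\<forall>y'\<in>ball ?q \<epsilon>. \<forall>y''\<in>ball ?q \<epsilon>. continues_to \<A> U A \<nu> V (\<psi> y') (b y') (\<psi> y'') (b y'')))"
      by (rule branches[OF q(1) qr V(1) q(3)])
    have ctr: "?q \<in> ball ?q \<epsilon>" "w' \<in> uu ?q" using e(1) y(3) q(2) by (auto simp: uu)
    from e(3)[rule_format, OF ctr] obtain b where b: "holomorphic_Cn b (ball ?q \<epsilon>)" "b ?q = w'" "\<forall>y'\<in>ball ?q \<epsilon>. b y' \<in> uu y'"
      by (elim exE conjE)
    have "open (ball ?q \<epsilon> \<inter> b -` W)"
      by (rule continuous_open_preimage[OF holomorphic_Cn_continuous_on[OF b(1)] open_ball W(1)])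
    moreover have "?q \<in> ball ?q \<epsilon> \<inter> b -` W" using ctr(1) b(2) y(4) by simp
    ultimately obtain q' where "q' \<in> Om" "q' \<in> ball ?q \<epsilon> \<inter> b -` W" using Om_meets[OF _ _ q(1)] by blast
    then show "\<exists>y w'. (y, w') \<in> ?H \<and> y \<in> V \<and> w' \<in> W"
      using b(3) e(2) by (intro exI[of _ q'] exI[of _ "b q'"]) auto
  next
    fix V W assume H: "\<forall>V W. open V \<longrightarrow> v \<in> V \<longrightarrow> open W \<longrightarrow> w \<in> W \<longrightarrow> (\<exists>y w'. (y, w') \<in> ?H \<and> y \<in> V \<and> w' \<in> W)"
      and V: "open V" "\<psi> v \<in> V" and W: "open W" "w \<in> W"
    have "open (snd c ` (fst c \<inter> V))" by (rule chart_image_open[OF tc V(1)])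
    moreover have "v \<in> snd c ` (fst c \<inter> V)" using \<psi>_in[OF v] \<psi>_snd[OF v] V(2) by (metis IntI imageI)
    ultimately obtain q w' where q: "q \<in> Om" "w' \<in> uu q" "q \<in> snd c ` (fst c \<inter> V)" "w' \<in> W"
      using H[rule_format, OF _ _ W, of "snd c ` (fst c \<inter> V)"] by blast
    have "\<psi> q \<in> V" using q(3) snd_\<psi> by auto
    then show "\<exists>y w'. (y, w') \<in> ?G \<and> y \<in> V \<and> w' \<in> W"
      using OmD(2,3)[OF q(1)] q(2,4) by (intro exI[of _ "\<psi> q"] exI[of _ w']) (auto simp: uu)
  qed
  then show ?thesis
    using leafD(6)[of "\<psi> v"] \<psi>_in[OF v] sub(1) unfolding reg uu by blast
qed

lemma puiseux_in_coordinate: "\<exists>\<tau> B. has_puiseux_expansion m l c r \<tau> B u"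
proof (rule puiseux_expansion_of_multivalued[where m=m and l=l and r=r and D=D and uu=uu and Om=Om and \<alpha>=\<alpha>])
  show "Om = {v \<in> polydisc r. D v \<noteq> 0}" by (simp add: Om P)
  show "holomorphic_Cn D (polydisc r)" "\<exists>v\<in>polydisc r. D v \<noteq> 0" using D_holomorphic D_nonzero by (simp_all add: P)
  show "holomorphic_Cn \<alpha> (polydisc r)" using A_\<psi>_holomorphic[of \<nu>] by (simp add: \<alpha> P)
  show "v $ m \<noteq> 0" if "v \<in> polydisc r" "D v \<noteq> 0" for v using that by (simp add: D)
  show "separated_on Om uu"
    by (rule separated_on_subset[OF sol_separated order_refl uu_sol]) (use OmD in auto)
  show "card (uu v) = l" if "v \<in> Om" for v
    using leafD(5)[of "\<psi> v"] OmD(2,3)[OF that] by (simp add: uu reg)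
  show "\<exists>\<epsilon>>0. ball v \<epsilon> \<subseteq> Om \<and> (\<forall>y\<in>ball v \<epsilon>. \<forall>w\<in>uu y. \<exists>b. holomorphic_Cn b (ball v \<epsilon>) \<and> b y = w \<and> (\<forall>y'\<in>ball v \<epsilon>. b y' \<in> uu y'))"
    if v: "v \<in> Om" for v
  proof -
    obtain \<epsilon> where e: "\<epsilon> > 0" "ball v \<epsilon> \<subseteq> P \<inter> Om"
      "\<forall>y\<in>ball v \<epsilon>. \<forall>w\<in>uu y. \<exists>b. holomorphic_Cn b (ball v \<epsilon>) \<and> b y = w \<and> (\<forall>y'\<in>ball v \<epsilon>. b y' \<in> uu y') \<and>
       (\<forall>V. (\<forall>y'\<in>ball v \<epsilon>. \<psi> y' \<in> V) \<longrightarrow> (\<forall>y'\<in>ball v \<epsilon>. \<forall>y''\<in>ball v \<epsilon>. continues_to \<A> U A \<nu> V (\<psi> y') (b y') (\<psi> y'') (b y'')))"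
      by (rule branches[OF OmD(1,2)[OF v] open_nonzero_locus v])
    show ?thesis
    proof (intro exI[of _ \<epsilon>] conjI ballI e(1))
      show "ball v \<epsilon> \<subseteq> Om" using e(2) by blast
      fix y w assume "y \<in> ball v \<epsilon>" "w \<in> uu y"
      from e(3)[rule_format, OF this] obtain b where "holomorphic_Cn b (ball v \<epsilon>)" "b y = w" "\<forall>y'\<in>ball v \<epsilon>. b y' \<in> uu y'"
        by (elim exE conjE)
      then show "\<exists>b. holomorphic_Cn b (ball v \<epsilon>) \<and> b y = w \<and> (\<forall>y'\<in>ball v \<epsilon>. b y' \<in> uu y')"
        by (intro exI[of _ b] conjI)
    qed
  qed
  show "\<exists>\<epsilon>>0. ball y \<epsilon> \<subseteq> polydisc r \<and> has_sections (ball y \<epsilon> \<inter> Om) uu" if "y \<in> polydisc r" "y $ m \<noteq> 0" for y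
    using split_off_hyperplane[of y] that by (simp add: P)
  show "\<exists>v0\<in>Om. \<forall>S. (\<forall>v\<in>Om. S v \<subseteq> uu v) \<longrightarrow> (\<forall>v\<in>Om. \<exists>\<epsilon>>0. ball v \<epsilon> \<subseteq> Om \<and> has_sections (ball v \<epsilon>) S) \<longrightarrow>
      S v0 \<noteq> {} \<longrightarrow> uu v0 \<subseteq> S v0" by (rule transitive)
  show "\<exists>T K. open T \<and> p \<in> T \<and> (\<forall>v\<in>T \<inter> Om. \<forall>w\<in>uu v. norm (\<alpha> v * w) \<le> K)" if "p \<in> polydisc r" for p
    using values_bounded[of p] that by (simp add: P)
  show "uu v = {w. (v, w) \<in> closure {(v, w). v \<in> Om \<and> w \<in> uu v}}" if "v \<in> polydisc r" for v
    using values_closure[of v] that by (simp add: P)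
  show "snd c ` fst c = polydisc r" using c(2) P by simp
  show "u x = uu (snd c x)" if "x \<in> fst c" for x using snd_\<psi>[OF that] by (simp add: uu)
  show "\<alpha> v \<noteq> 0" if "v \<in> Om" for v by (rule OmD(4)[OF that])
qed (fact leafD(1) r)+

end

theorem theorem2p14:
  fixes \<A> :: "('a::{t2_space,second_countable_topology}, 'm::finite) chart set"
    and h :: "('a, 'm) chart \<Rightarrow> 'a \<Rightarrow> complex ^ 'm \<Rightarrow> complex ^ 'm \<Rightarrow> complex"
    and U :: "'i \<Rightarrow> 'a set"
    and A :: "nat \<Rightarrow> 'i \<Rightarrow> 'a \<Rightarrow> complex"
    and \<nu> l :: nat
    and Ux :: "'a set"
    and x0 :: 'a
    and u :: "'a \<Rightarrow> complex set"
    and m :: 'm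
  assumes "hermitian_manifold \<A> h"
    and "\<not> compact (UNIV :: 'a set)"
    and "coefficient_system \<A> U A \<nu>"
    and "\<exists>i. \<exists>x\<in>U i. A \<nu> i x \<noteq> 0"
    and "irreducible_equation \<A> U A \<nu>"
    and "leaf_function_element \<A> U A \<nu> l Ux x0 u"
    and "\<not> singular_branch_point \<A> U A \<nu> Ux u x0"
  shows "\<exists>N z r \<tau> B.
           holomorphic_coordinate \<A> (N, z) \<and> x0 \<in> N \<and> N \<subseteq> Ux \<and> z x0 = 0 \<and>
           0 < r \<and> z ` N = polydisc r \<and>
           (\<forall>x\<in>branch_set \<A> U A \<nu> Ux u \<inter> N. z x $ m = 0) \<and>
           has_puiseux_expansion m l (N, z) r \<tau> B u"
proof -
  have M: "complex_manifold \<A>" using assms(1) by (simp add: hermitian_manifold_def)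
  note cs = assms(3) and leaf = assms(6)
  note leafD = leaf_function_elementD[OF leaf]
  have \<nu>: "\<nu> > 0" using assms(5) by (simp add: irreducible_equation_def)
  let ?reg = "regular_points U A \<nu>" and ?bs = "branch_set \<A> U A \<nu> Ux u"
  obtain i0 where i0: "x0 \<in> U i0" by (rule U_cover[OF M cs])
  obtain T0 h0 where T0: "open T0" "x0 \<in> T0" "holomorphic_mfd \<A> h0 T0" "T0 \<subseteq> closure {x\<in>T0. h0 x \<noteq> 0}" "\<forall>x\<in>T0. h0 x \<noteq> 0 \<longrightarrow> x \<in> ?reg"
    by (rule generically_elim[OF regular_points_generic[OF M cs assms(4,5)] UNIV_I])
  note openU = U_open[OF M cs, of i0]
  \<comment> \<open>Both cases are brought to one form: a chart and a biholomorphic change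
    \<open>T\<close> of the model space after which the branch set near \<open>x0\<close> lies in
    the hyperplane of coordinate \<open>m\<close>.\<close>
  have "\<exists>c V T T'. holomorphic_coordinate \<A> c \<and> x0 \<in> fst c \<and> open V \<and> x0 \<in> V \<and>
      (\<forall>i. holomorphic_Cn (\<lambda>z. T z $ i) UNIV) \<and> (\<forall>i. holomorphic_Cn (\<lambda>z. T' z $ i) UNIV) \<and> (\<forall>z. T' (T z) = z) \<and> (\<forall>z. T (T' z) = z) \<and>
      T (snd c x0) = 0 \<and> (\<forall>x\<in>?bs \<inter> (fst c \<inter> V). T (snd c x) $ m = 0)"
  proof (cases "x0 \<in> ?bs")
    case True
    then have "smooth_at \<A> ?bs x0" using assms(7) by (simp add: singular_branch_point_def)
    then obtain c L where c: "holomorphic_coordinate \<A> c" "x0 \<in> fst c" "snd c x0 = 0" and L: "vec.subspace L"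
      "snd c ` (?bs \<inter> fst c) = L \<inter> snd c ` fst c" unfolding smooth_at_def by (elim exE conjE)
    note tc = holomorphic_coordinate_topological[OF c(1)]
    \<comment> \<open>Otherwise all points of the chart would be branch points, but some of them are
      regular and regular points are not.\<close>
    have "L \<noteq> UNIV"
    proof
      assume "L = UNIV"
      then have im: "snd c ` (?bs \<inter> fst c) = snd c ` fst c" using L(2) by simp
      have all: "y \<in> ?bs" if y: "y \<in> fst c" for y
      proof -
        have "snd c y \<in> snd c ` (?bs \<inter> fst c)" unfolding im using y by (rule imageI)
        then obtain y' where y': "y' \<in> ?bs" "y' \<in> fst c" "snd c y = snd c y'" by blast
        have "y = y'" using chart_inv_snd[OF tc y] chart_inv_snd[OF tc y'(2)] y'(3) by metis
        then show ?thesis using y'(1) by simp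
      qed
      have "\<exists>x\<in>fst c \<inter> T0. h0 x \<noteq> 0"
        using T0(4)[unfolded dense_iff, rule_format, OF chart_open(1)[OF tc]] T0(2) c(2) by blast
      then obtain y where "y \<in> fst c" "y \<in> ?reg" using T0(5) by blast
      then show False using all regular_not_branch[OF M cs \<nu> _ leafD(2), of y u] leafD(4) by blast
    qed
    from complex_hyperplane[OF L(1) this] obtain x where x: "x \<noteq> 0" "\<forall>y\<in>L. (\<Sum>i\<in>UNIV. cnj (x $ i) * y $ i) = 0" .
    obtain T T' where T: "\<forall>i. holomorphic_Cn (\<lambda>z. T z $ i) UNIV" "\<forall>i. holomorphic_Cn (\<lambda>z. T' z $ i) UNIV"
      "\<forall>z. T' (T z) = z" "\<forall>z. T (T' z) = z" "T 0 = 0" "\<forall>z. T z $ m = (\<Sum>i\<in>UNIV. cnj (x $ i) * z $ i)"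
      by (rule linear_coordinate_change[OF x(1), of m])
    have "T (snd c y) $ m = 0" if "y \<in> ?bs \<inter> (fst c \<inter> UNIV)" for y
    proof -
      have "snd c y \<in> L" using that L(2) by blast
      then show ?thesis using x(2) T(6) by simp
    qed
    then show ?thesis
      by - (rule exI[of _ c], rule exI[of _ UNIV], rule exI[of _ T], rule exI[of _ T'], use c T in simp)
  next
    case False
    \<comment> \<open>A neighbourhood with trivial orbits contains no branch points at all, so any
      chart centred at \<open>x0\<close> serves and the choice of \<open>m\<close> does not
      matter.\<close>
    then obtain V where V: "open V" "x0 \<in> V" "V \<subseteq> Ux" "\<forall>x\<in>V \<inter> ?reg. \<forall>w\<in>u x. orbit \<A> U A \<nu> V x w = {w}"
      using leafD(3) unfolding branch_set_def by blast
    have bs: "?bs \<inter> V = {}" using V unfolding branch_set_def by blast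
    obtain c where c0: "c \<in> \<A>" "x0 \<in> fst c" by (rule atlas_covers[OF M])
    have c: "holomorphic_coordinate \<A> c" by (rule atlas_holomorphic_coordinate[OF M c0(1)])
    have hT: "holomorphic_Cn (\<lambda>z. (z - snd c x0) $ i) UNIV" "holomorphic_Cn (\<lambda>z. (z + snd c x0) $ i) UNIV" for i
      by (simp_all add: holomorphic_Cn_diff holomorphic_Cn_add holomorphic_Cn_coord holomorphic_Cn_const)
    show ?thesis
      by (rule exI[of _ c], rule exI[of _ V], rule exI[of _ "\<lambda>z. z - snd c x0"], rule exI[of _ "\<lambda>z. z + snd c x0"],
          intro conjI allI hT c c0 V(1,2)) (use bs in auto)
  qed
  then obtain c V T T' where c: "holomorphic_coordinate \<A> c" "x0 \<in> fst c" and V: "open V" "x0 \<in> V"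
    and T: "\<forall>i. holomorphic_Cn (\<lambda>z. T z $ i) UNIV" "\<forall>i. holomorphic_Cn (\<lambda>z. T' z $ i) UNIV" "\<forall>z. T' (T z) = z" "\<forall>z. T (T' z) = z"
      "T (snd c x0) = 0" and bs: "\<forall>x\<in>?bs \<inter> (fst c \<inter> V). T (snd c x) $ m = 0"
    by (elim exE conjE)
  \<comment> \<open>In this set the branch set is under control, \<open>u\<close> is given, one
    member of the covering supplies the coefficients, and \<open>h0\<close> detects regular
    points.\<close>
  let ?S = "V \<inter> (Ux \<inter> (U i0 \<inter> T0))"
  have S: "x0 \<in> ?S" "open ?S" using V leafD(2,3) i0 openU T0(1,2) by auto
  obtain N r where N: "r > 0" "N \<subseteq> fst c \<inter> ?S" "x0 \<in> N" "holomorphic_coordinate \<A> (N, \<lambda>x. T (snd c x))"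
    "(\<lambda>x. T (snd c x)) ` N = polydisc r"
    by (rule holomorphic_coordinate_polydisc[OF M c S T[rule_format]]) blast
  have ne: "N \<inter> T0 \<noteq> {}" "N \<inter> U i0 \<noteq> {}" using N(2,3) by blast+
  have openN: "open N" using chart_open(1)[OF holomorphic_coordinate_topological[OF N(4)]] by simp
  have "\<exists>\<tau> B. has_puiseux_expansion m l (N, \<lambda>x. T (snd c x)) r \<tau> B u"
  proof (rule puiseux_in_coordinate[OF M cs \<nu> leaf N(4) _ N(1) refl, where ?i0.0=i0 and ?h0.0=h0])
    show "\<exists>x\<in>fst (N, \<lambda>x. T (snd c x)). h0 x \<noteq> 0"
      using T0(4)[unfolded dense_iff, rule_format, OF openN ne(1)] by auto
    show "\<exists>x\<in>fst (N, \<lambda>x. T (snd c x)). A \<nu> i0 x \<noteq> 0"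
      using leading_dense[OF M cs assms(4), of i0, unfolded dense_iff, rule_format, OF openN ne(2)] by auto
    show "holomorphic_mfd \<A> h0 (fst (N, \<lambda>x. T (snd c x)))"
      using N(2) by (auto intro: holomorphic_mfd_subset[OF T0(3)])
  qed (use N T0(5) T(5) bs in auto)
  then obtain \<tau> B where "has_puiseux_expansion m l (N, \<lambda>x. T (snd c x)) r \<tau> B u" by (elim exE)
  moreover have "\<forall>x\<in>?bs \<inter> N. T (snd c x) $ m = 0" using bs N(2) by blast
  ultimately show ?thesis
    using N T(5)
    by (intro exI[of _ N] exI[of _ "\<lambda>x. T (snd c x)"] exI[of _ r] exI[of _ \<tau>] exI[of _ B]) auto
qed

end
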